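(* Let $H,A,B,\mathbf U,X,X^T,T,\mathbf z^0,h$ be the data described in the context, where $h$ is a polynomial in $(t,u)$. Let $\mathbf U=\{u\in\mathbb R^m:w_1(u)\ge0,\dots,w_s(u)\ge0\}$ be a basic compact semialgebraic set with $w_1,\dots,w_s\in\mathbb R[u]$, and assume (Archimedean property) that one of the $w_j$ equals $M-\|u\|_2^2$ for some large enough integer $M$. For all $k\ge1$ let $Z_k=[\underline{z_k},\overline{z_k}]$ and $Z_k^T=[\underline{z_k}^T,\overline{z_k}^T]$ be compact intervals, so that for every $N\ge 1$, $Z_1\times\cdots\times Z_N=\{z\in\mathbb R^N:v_i(z_i)\ge0,\ i=1,\dots,N\}$ and $Z^T_1\times\cdots\times Z^T_N=\{z\in\mathbb R^N:v^T_i(z_i)\ge0,\ i=1,\dots,N\}$ with $v_i(x)=(\overline{z_i}-x)(x-\underline{z_i})$ and $v_i^T(x)=(\overline{z_i}^T-x)(x-\underline{z_i}^T)$. Then, for all positive integers $N$: (i) $\mathbf P_{N,r}\uparrow\mathbf P_N$ as $r\to\infty$ (the optimal values of the semidefinite relaxations are nondecreasing in $r$ and converge to the value of the linear program over measures). (ii) In addition, if for every $t\in[0,T]$ and every $\mathbf z\in X\cap D(A)$ the set $\{A\mathbf z+Bu:u\in\mathbf U\}$ is convex and the function $$H\ni v\mapsto g_{t,\mathbf z}(v):=\inf\{h(t,u):u\in\mathbf U,\ v=A\mathbf z+Bu\}\in\mathbb R\cup\{+\infty\}$$ is convex (with $\inf\emptyset=+\infty$), then $\mathbf P_{N,r}\uparrow\mathbf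 P_N=J_N(0,T,\mathbf z^0)\le J(0,T,\mathbf z^0)$ as $r\to\infty$.
   Context: **Riesz-spectral operator.** A sequence $(\Phi_k)_{k\ge1}$ in a Hilbert space $H$ is a Riesz basis if its closed linear span is $H$ and there are $c,C>0$ with $c\sum_{k=1}^n|\alpha_k|^2\le\|\sum_{k=1}^n\alpha_k\Phi_k\|^2\le C\sum_{k=1}^n|\alpha_k|^2$ for all $n\ge 1$ and all scalars $\alpha_1,\dots,\alpha_n$. A closed linear operator $A$ on $H$ with simple eigenvalues $(\lambda_k)_{k\ge1}$ and corresponding eigenvectors $(\Phi_k)_{k\ge1}$ forming a Riesz basis of $H$, such that the closure of $\{\lambda_k:k\ge1\}$ is disconnected, is called Riesz-spectral. Its domain is $D(A)$. Let $(\Psi_k)_{k\ge1}$ be the eigenvectors of $A^\star$ with $\langle\Phi_k,\Psi_j\rangle=\delta_{kj}$; then $A\mathbf z=\sum_{k\ge1}\lambda_k\langle\mathbf z,\Psi_k\rangle\Phi_k$ for $\mathbf z\in D(A)$. **Data.** $H$ is a real Hilbert space; $A$ is a Riesz-spectral operator on $H$ with real eigenvalues $(\lambda_k)$ which generates a strongly continuous semigroup $(S(t))_{t\ge0}$ on $H$; $m\ge 1$; $\mathbf U\subset\mathbb R^m$ is compact; $B:\mathbb R^m\to H$ is linear and bounded; $X\subseteq H$ is the state constraint set; $X^T\subseteq X\cap D(A)$ is the terminal set; $T>0$; $\mathbf z^0\in X\cap D(A)$; $h\in\mathbb R[t,u]$. **Full problem.** $\mathcal U^T$ is the set of bounded measurable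 $u:[0,T]\to\mathbf U$ such that the (mild) solution $\mathbf z(t)=S(t)\mathbf z^0+\int_0^tS(t-s)Bu(s)\,ds$ of $\dot{\mathbf z}=A\mathbf z+Bu$, $\mathbf z(0)=\mathbf z^0$, satisfies $\mathbf z(t)\in X$ for a.e. $t\in[0,T]$ and $\mathbf z(T)\in X^T$. The cost is $J(0,T,\mathbf z^0,u)=\int_0^Th(t,u(t))\,dt$, and $J(0,T,\mathbf z^0):=\inf_{u\in\mathcal U^T}J(0,T,\mathbf z^0,u)$. Throughout, $\inf\emptyset=+\infty$. **$N$-mode problem.** For $k\ge1$ put $z_k^0:=\langle\mathbf z^0,\Psi_k\rangle$, $b_k(u):=\langle Bu,\Psi_k\rangle$, $f_k(t,z_k,u):=\lambda_kz_k+b_k(u)$, $Z_k:=\{\langle\mathbf z,\Psi_k\rangle:\mathbf z\in X\}$ and $Z_k^T:=\{\langle\mathbf z,\Psi_k\rangle:\mathbf z\in X^T\}$. For $N\ge1$, $\mathcal U_N^T$ is the set of bounded measurable $u:[0,T]\to\mathbf U$ such that the absolutely continuous solution $(z_1,\dots,z_N)$ of $\dot z_k(t)=f_k(t,z_k(t),u(t))$ (a.e. $t$), $z_k(0)=z_k^0$, $k=1,\dots,N$, satisfies $(z_1(t),\dots,z_N(t))\in Z_1\times\cdots\times Z_N$ for a.e. $t\in[0,T]$ and $(z_1(T),\dots,z_N(T))\in Z_1^T\times\cdots\times Z_N^T$. Put $J_N(0,T,\mathbf z^0):=\inf_{u\in\mathcal U_N^T}J(0,T,\mathbf z^0,u)$.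 **Linear program $\mathbf P_N$.** Let $S_N:=[0,T]\times Z_1\times\cdots\times Z_N\times\mathbf U$. For $g\in\mathcal C^1(\mathbb R^{1+N})$ let $$\mathcal L_N g(t,z,u):=\frac{\partial g}{\partial t}(t,z)+\sum_{k=1}^Nf_k(t,z_k,u)\frac{\partial g}{\partial z_k}(t,z),\qquad z=(z_1,\dots,z_N).$$ $\mathbf P_N$ is the infimum of $\int_{S_N}h\,d\mu$ over finite nonnegative Borel measures $\mu$ on $S_N$ and $\nu$ on $Z_1^T\times\cdots\times Z_N^T$ such that $\int g(T,z)\,d\nu(z)-g(0,z_1^0,\dots,z_N^0)=\int_{S_N}\mathcal L_Ng\,d\mu$ for all $g\in\mathcal C^1(\mathbb R^{1+N})$. **Moment and localizing matrices.** For a real sequence $y=(y_\gamma)_{\gamma\in\mathbb N^n}$ (indexing the monomials in $n$ variables) let $\ell_y(\theta):=\sum_\gamma\theta_\gamma y_\gamma$ for a polynomial $\theta=\sum_\gamma\theta_\gamma x^\gamma$. With $\mathbb N^n_r:=\{\alpha\in\mathbb N^n:|\alpha|\le r\}$, the moment matrix $M_r(y)$ and localizing matrix $M_r(\theta y)$ are the symmetric matrices indexed by $\mathbb N^n_r$ with entries $M_r(y)_{\beta,\gamma}=y_{\beta+\gamma}$ and $M_r(\theta y)_{\beta,\gamma}=\sum_\delta\theta_\delta y_{\delta+\beta+\gamma}$. $\succeq0$ means positive semidefinite. For $y=(y_{p,\alpha,\beta})$ indexed by $(p,\alpha,\beta)\in\mathbb N\times\mathbb N^N\times\mathbb N^m$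 (monomials $t^pz^\alpha u^\beta$), its marginals are $y(t):=(y_{p,0,0})_{p\in\mathbb N}$, $y(z_i):=(y_{0,ke_i,0})_{k\in\mathbb N}$ ($e_i$ the $i$-th unit vector of $\mathbb N^N$) and $y(u):=(y_{0,0,\beta})_{\beta\in\mathbb N^m}$, regarded as sequences in the variables $t$, $z_i$, $u$ respectively. **Semidefinite relaxation $\mathbf P_{N,r}$.** Let $r_j:=\lceil\deg(w_j)/2\rceil$ and $r_{\min}:=\max\{1,r_1,\dots,r_s\}$. For $r\ge r_{\min}$, $\mathbf P_{N,r}$ is the infimum of $\ell_y(h)$ over real sequences $y=(y_\gamma)_{\gamma\in\mathbb N^{1+N+m}}$ and $y^T=(y^T_\alpha)_{\alpha\in\mathbb N^N}$ satisfying: - $M_r(y)\succeq0$, $M_r(y^T)\succeq0$, $M_{r-1}(t(T-t)\,y(t))\succeq0$; - $M_{r-1}(v_i\,y(z_i))\succeq0$ for $i=1,\dots,N$; - $M_{r-r_j}(w_j\,y(u))\succeq0$ for $j=1,\dots,s$; - $M_{r-1}(v_i^T\,y^T)\succeq0$ for $i=1,\dots,N$ (with $v_i^T$ viewed as the polynomial $v_i^T(z_i)$ in $z_1,\dots,z_N$); - for every monomial $g=t^pz_1^{\alpha_1}\cdots z_N^{\alpha_N}$ with $p+|\alpha|\le r$: $\ell_{y^T}(g_T)-\ell_y(\mathcal L_Ng)=g(0,z_1^0,\dots,z_N^0)$, where $g_T(z):=g(T,z)$. *)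

theory Defs
  imports "HOL-Analysis.Analysis" "HOL-Library.Poly_Mapping"
begin

text \<open>Sequences \<open>(x\<^sub>k)\<close> with \<open>k \<ge> 1\<close> are functions on \<^typ>\<open>nat\<close> whose value at \<open>0\<close> is never used.\<close>

section \<open>Riesz-spectral operators and semigroups\<close>

definition riesz_basis :: "(nat \<Rightarrow> 'h::{real_inner, banach}) \<Rightarrow> bool" where
  "riesz_basis \<Phi> \<longleftrightarrow>
     closure (span (\<Phi> ` {1..})) = UNIV \<and>
     (\<exists>c>0. \<exists>C>0. \<forall>n\<ge>1. \<forall>\<alpha> :: nat \<Rightarrow> real.
        c * (\<Sum>k=1..n. (\<alpha> k)\<^sup>2) \<le> (norm (\<Sum>k=1..n. \<alpha> k *\<^sub>R \<Phi> k))\<^sup>2 \<and>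
        (norm (\<Sum>k=1..n. \<alpha> k *\<^sub>R \<Phi> k))\<^sup>2 \<le> C * (\<Sum>k=1..n. (\<alpha> k)\<^sup>2))"

text \<open>An unbounded operator is a function \<open>A\<close> together with its domain \<open>D\<close>;
  the values of \<open>A\<close> outside \<open>D\<close> are irrelevant.\<close>

definition closed_operator :: "'h::{real_inner, banach} set \<Rightarrow> ('h \<Rightarrow> 'h) \<Rightarrow> bool" where
  "closed_operator D A \<longleftrightarrow>
     subspace D \<and>
     (\<forall>x\<in>D. \<forall>y\<in>D. A (x + y) = A x + A y) \<and>
     (\<forall>c. \<forall>x\<in>D. A (c *\<^sub>R x) = c *\<^sub>R A x) \<and>
     closed {(x, A x) |x. x \<in> D}"

definition riesz_spectral ::
  "'h::{real_inner, banach} set \<Rightarrow> ('h \<Rightarrow> 'h) \<Rightarrow> (nat \<Rightarrow> real) \<Rightarrow> (nat \<Rightarrow> 'h) \<Rightarrow> bool" where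
  "riesz_spectral D A lam \<Phi> \<longleftrightarrow>
     closed_operator D A \<and>
     (\<forall>k\<ge>1. \<Phi> k \<in> D \<and> \<Phi> k \<noteq> 0 \<and> A (\<Phi> k) = lam k *\<^sub>R \<Phi> k) \<and>
     inj_on lam {1..} \<and> (\<forall>k\<ge>1. {x \<in> D. A x = lam k *\<^sub>R x} = span {\<Phi> k}) \<and>
     riesz_basis \<Phi> \<and>
     \<not> connected (closure (lam ` {1..}))"

definition adjoint_graph :: "'h::{real_inner, banach} set \<Rightarrow> ('h \<Rightarrow> 'h) \<Rightarrow> ('h \<times> 'h) set" where
  "adjoint_graph D A = {(y, w). \<forall>x\<in>D. A x \<bullet> y = x \<bullet> w}"

definition dual_eigenvectors ::
  "'h::{real_inner, banach} set \<Rightarrow> ('h \<Rightarrow> 'h) \<Rightarrow> (nat \<Rightarrow> 'h) \<Rightarrow> (nat \<Rightarrow> 'h) \<Rightarrow> bool" where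
  "dual_eigenvectors D A \<Phi> \<Psi> \<longleftrightarrow>
     (\<forall>k\<ge>1. \<Psi> k \<noteq> 0 \<and> (\<exists>c. (\<Psi> k, c *\<^sub>R \<Psi> k) \<in> adjoint_graph D A)) \<and>
     (\<forall>k\<ge>1. \<forall>j\<ge>1. \<Phi> k \<bullet> \<Psi> j = (if k = j then 1 else 0))"

definition C0_semigroup :: "(real \<Rightarrow> 'h::{real_inner, banach} \<Rightarrow> 'h) \<Rightarrow> bool" where
  "C0_semigroup S \<longleftrightarrow>
     (\<forall>t\<ge>0. bounded_linear (S t)) \<and> S 0 = id \<and>
     (\<forall>s\<ge>0. \<forall>t\<ge>0. S (s + t) = S s \<circ> S t) \<and>
     (\<forall>x. ((\<lambda>t. S t x) \<longlongrightarrow> x) (at_right 0))"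

definition generates ::
  "'h::{real_inner, banach} set \<Rightarrow> ('h \<Rightarrow> 'h) \<Rightarrow> (real \<Rightarrow> 'h \<Rightarrow> 'h) \<Rightarrow> bool" where
  "generates D A S \<longleftrightarrow>
     C0_semigroup S \<and>
     (\<forall>x y. x \<in> D \<and> A x = y \<longleftrightarrow> ((\<lambda>t. (S t x - x) /\<^sub>R t) \<longlongrightarrow> y) (at_right 0))"

section \<open>Polynomials and moment sequences\<close>

text \<open>
  A real polynomial is a finitely supported family of coefficients indexed by an additive monoid
  \<open>'e\<close> of exponents; multiplication is the one of \<^theory>\<open>HOL-Library.Poly_Mapping\<close>. Exponents are
  \<^item> \<^typ>\<open>nat\<close> for one variable,
  \<^item> \<open>nat \<Rightarrow>\<^sub>0 nat\<close> for \<open>z\<^sub>1, z\<^sub>2, \<dots>\<close> (those of \<open>z\<^sub>1, \<dots>, z\<^sub>N\<close> are supported in \<open>{1..N}\<close>),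
  \<^item> \<open>'m \<Rightarrow>\<^sub>0 nat\<close> for \<open>u \<in> real^'m\<close>,
  \<^item> pairs \<open>(p, \<beta>)\<close> for \<open>t^p u^\<beta>\<close> and triples \<open>(p, \<alpha>, \<beta>)\<close> for \<open>t^p z^\<alpha> u^\<beta>\<close>.
\<close>

type_synonym 'e rpoly = "'e \<Rightarrow>\<^sub>0 real"

type_synonym zexp = "nat \<Rightarrow>\<^sub>0 nat"
type_synonym 'm uexp = "'m \<Rightarrow>\<^sub>0 nat"
type_synonym 'm tzuexp = "nat \<times> zexp \<times> 'm uexp"

definition total_deg :: "('v \<Rightarrow>\<^sub>0 nat) \<Rightarrow> nat" where
  "total_deg \<beta> = (\<Sum>i\<in>Poly_Mapping.keys \<beta>. Poly_Mapping.lookup \<beta> i)"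

text \<open>The degree of the zero polynomial is taken to be \<open>0\<close>.\<close>

definition poly_deg :: "('v \<Rightarrow>\<^sub>0 nat) rpoly \<Rightarrow> nat" where
  "poly_deg \<theta> = Max (insert 0 (total_deg ` Poly_Mapping.keys \<theta>))"

definition eval_mon :: "('m::finite) uexp \<Rightarrow> real^'m \<Rightarrow> real" where
  "eval_mon \<beta> u = (\<Prod>i\<in>UNIV. u $ i ^ Poly_Mapping.lookup \<beta> i)"

definition eval_u :: "('m::finite) uexp rpoly \<Rightarrow> real^'m \<Rightarrow> real" where
  "eval_u \<theta> u = (\<Sum>\<beta>\<in>Poly_Mapping.keys \<theta>. Poly_Mapping.lookup \<theta> \<beta> * eval_mon \<beta> u)"

definition eval_tu :: "(nat \<times> ('m::finite) uexp) rpoly \<Rightarrow> real \<Rightarrow> real^'m \<Rightarrow> real" where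
  "eval_tu \<theta> t u =
     (\<Sum>(p, \<beta>)\<in>Poly_Mapping.keys \<theta>. Poly_Mapping.lookup \<theta> (p, \<beta>) * t ^ p * eval_mon \<beta> u)"

definition const_poly :: "real \<Rightarrow> 'e::monoid_add rpoly" where
  "const_poly c = Poly_Mapping.single 0 c"

definition ell :: "('e \<Rightarrow> real) \<Rightarrow> 'e rpoly \<Rightarrow> real" where
  "ell y \<theta> = (\<Sum>\<gamma>\<in>Poly_Mapping.keys \<theta>. Poly_Mapping.lookup \<theta> \<gamma> * y \<gamma>)"

text \<open>Matrices whose rows and columns are indexed by a finite set \<open>I\<close>.\<close>

definition psd_on :: "'e set \<Rightarrow> ('e \<Rightarrow> 'e \<Rightarrow> real) \<Rightarrow> bool" where
  "psd_on I M \<longleftrightarrow>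
     (\<forall>\<beta>\<in>I. \<forall>\<gamma>\<in>I. M \<beta> \<gamma> = M \<gamma> \<beta>) \<and>
     (\<forall>x :: 'e \<Rightarrow> real. 0 \<le> (\<Sum>\<beta>\<in>I. \<Sum>\<gamma>\<in>I. x \<beta> * M \<beta> \<gamma> * x \<gamma>))"

definition moment_matrix :: "('e::comm_monoid_add \<Rightarrow> real) \<Rightarrow> 'e \<Rightarrow> 'e \<Rightarrow> real" where
  "moment_matrix y \<beta> \<gamma> = y (\<beta> + \<gamma>)"

definition localizing_matrix ::
  "'e::comm_monoid_add rpoly \<Rightarrow> ('e \<Rightarrow> real) \<Rightarrow> 'e \<Rightarrow> 'e \<Rightarrow> real" where
  "localizing_matrix \<theta> y \<beta> \<gamma> =
     (\<Sum>\<delta>\<in>Poly_Mapping.keys \<theta>. Poly_Mapping.lookup \<theta> \<delta> * y (\<delta> + \<beta> + \<gamma>))"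

definition zexps :: "nat \<Rightarrow> nat \<Rightarrow> zexp set" where
  "zexps N r = {\<alpha>. Poly_Mapping.keys \<alpha> \<subseteq> {1..N} \<and> total_deg \<alpha> \<le> r}"

definition uexps :: "nat \<Rightarrow> 'm uexp set" where
  "uexps r = {\<beta>. total_deg \<beta> \<le> r}"

definition tzuexps :: "nat \<Rightarrow> nat \<Rightarrow> 'm tzuexp set" where
  "tzuexps N r =
     {(p, \<alpha>, \<beta>). Poly_Mapping.keys \<alpha> \<subseteq> {1..N} \<and> p + total_deg \<alpha> + total_deg \<beta> \<le> r}"

definition marginal_t :: "('m tzuexp \<Rightarrow> real) \<Rightarrow> nat \<Rightarrow> real" where
  "marginal_t y p = y (p, 0, 0)"

definition marginal_z :: "nat \<Rightarrow> ('m tzuexp \<Rightarrow> real) \<Rightarrow> nat \<Rightarrow> real" where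
  "marginal_z i y k = y (0, Poly_Mapping.single i k, 0)"

definition marginal_u :: "('m tzuexp \<Rightarrow> real) \<Rightarrow> 'm uexp \<Rightarrow> real" where
  "marginal_u y \<beta> = y (0, 0, \<beta>)"

text \<open>\<open>(b - x) (x - a)\<close>, where the polynomial \<open>x\<close> is the variable constrained to \<open>[a, b]\<close>.\<close>

definition interval_poly :: "real \<Rightarrow> real \<Rightarrow> 'e::comm_monoid_add rpoly \<Rightarrow> 'e rpoly" where
  "interval_poly a b x = (const_poly b - x) * (x - const_poly a)"

section \<open>The control problems\<close>

text \<open>Bounded Lebesgue measurable controls.\<close>

definition controls :: "real \<Rightarrow> (real^'m::finite) set \<Rightarrow> (real \<Rightarrow> real^'m) set" where
  "controls T U =
     {u. u \<in> borel_measurable (lebesgue_on {0..T}) \<and> bounded (u ` {0..T}) \<and> u ` {0..T} \<subseteq> U}"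

definition cost :: "real \<Rightarrow> (nat \<times> ('m::finite) uexp) rpoly \<Rightarrow> (real \<Rightarrow> real^'m) \<Rightarrow> real" where
  "cost T h u = (LINT t|lebesgue_on {0..T}. eval_tu h t (u t))"

text \<open>The class \<open>second_countable_topology\<close>, needed for the Bochner integral, only says that the
  metric space \<open>'h\<close> is separable; this holds in every Hilbert space having a Riesz basis
  \<open>(\<Phi>\<^sub>k)\<close> with \<open>k \<ge> 1\<close>.\<close>

definition mild_solution ::
  "(real \<Rightarrow> 'h::{real_inner, banach, second_countable_topology} \<Rightarrow> 'h) \<Rightarrow> (real^'m::finite \<Rightarrow> 'h) \<Rightarrow>
   'h \<Rightarrow> (real \<Rightarrow> real^'m) \<Rightarrow> real \<Rightarrow> 'h" where
  "mild_solution S B z0 u t = S t z0 + (LINT s|lebesgue_on {0..t}. S (t - s) (B (u s)))"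

definition full_controls ::
  "(real \<Rightarrow> 'h::{real_inner, banach, second_countable_topology} \<Rightarrow> 'h) \<Rightarrow> (real^'m::finite \<Rightarrow> 'h) \<Rightarrow>
   (real^'m) set \<Rightarrow> 'h set \<Rightarrow> 'h set \<Rightarrow> real \<Rightarrow> 'h \<Rightarrow> (real \<Rightarrow> real^'m) set" where
  "full_controls S B U X XT T z0 =
     {u \<in> controls T U.
        (AE t in lebesgue_on {0..T}. mild_solution S B z0 u t \<in> X) \<and>
        mild_solution S B z0 u T \<in> XT}"

definition full_value ::
  "(real \<Rightarrow> 'h::{real_inner, banach, second_countable_topology} \<Rightarrow> 'h) \<Rightarrow> (real^'m::finite \<Rightarrow> 'h) \<Rightarrow>
   (real^'m) set \<Rightarrow> 'h set \<Rightarrow> 'h set \<Rightarrow> real \<Rightarrow> 'h \<Rightarrow> (nat \<times> 'm uexp) rpoly \<Rightarrow> ereal" where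
  "full_value S B U X XT T z0 h = (INF u\<in>full_controls S B U X XT T z0. ereal (cost T h u))"

text \<open>Modal data with respect to the dual family \<open>\<Psi>\<close>: \<open>z\<^sub>k\<close>, \<open>b\<^sub>k(u)\<close> and \<open>Z\<^sub>k\<close>.\<close>

definition coef :: "(nat \<Rightarrow> 'h::real_inner) \<Rightarrow> 'h \<Rightarrow> nat \<Rightarrow> real" where
  "coef \<Psi> z k = z \<bullet> \<Psi> k"

definition modal_input ::
  "(nat \<Rightarrow> 'h::real_inner) \<Rightarrow> (real^'m::finite \<Rightarrow> 'h) \<Rightarrow> nat \<Rightarrow> real^'m \<Rightarrow> real" where
  "modal_input \<Psi> B k u = B u \<bullet> \<Psi> k"

definition modal_set :: "(nat \<Rightarrow> 'h::real_inner) \<Rightarrow> 'h set \<Rightarrow> nat \<Rightarrow> real set" where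
  "modal_set \<Psi> X k = (\<lambda>z. coef \<Psi> z k) ` X"

definition abs_continuous_on :: "real \<Rightarrow> real \<Rightarrow> (real \<Rightarrow> real) \<Rightarrow> bool" where
  "abs_continuous_on a b f \<longleftrightarrow>
     (\<forall>\<epsilon>>0. \<exists>\<delta>>0. \<forall>n :: nat. \<forall>l r :: nat \<Rightarrow> real.
        (\<forall>i<n. a \<le> l i \<and> l i \<le> r i \<and> r i \<le> b) \<and>
        (\<forall>i<n. \<forall>j<n. i \<noteq> j \<longrightarrow> {l i<..<r i} \<inter> {l j<..<r j} = {}) \<and>
        (\<Sum>i<n. r i - l i) < \<delta> \<longrightarrow>
        (\<Sum>i<n. \<bar>f (r i) - f (l i)\<bar>) < \<epsilon>)"

text \<open>\<open>f\<^sub>k(t, x, u) = \<lambda>\<^sub>k x + b\<^sub>k(u)\<close> does not depend on \<open>t\<close>, which is dropped.\<close>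

definition modal_rhs ::
  "(nat \<Rightarrow> real) \<Rightarrow> (nat \<Rightarrow> real^'m::finite \<Rightarrow> real) \<Rightarrow> nat \<Rightarrow> real \<Rightarrow> real^'m \<Rightarrow> real" where
  "modal_rhs lam b k x u = lam k * x + b k u"

definition modal_solution ::
  "nat \<Rightarrow> (nat \<Rightarrow> real) \<Rightarrow> (nat \<Rightarrow> real^'m::finite \<Rightarrow> real) \<Rightarrow> real \<Rightarrow> (nat \<Rightarrow> real) \<Rightarrow>
   (real \<Rightarrow> real^'m) \<Rightarrow> (real \<Rightarrow> nat \<Rightarrow> real) \<Rightarrow> bool" where
  "modal_solution N lam b T \<zeta> u z \<longleftrightarrow>
     (\<forall>k\<in>{1..N}.
        abs_continuous_on 0 T (\<lambda>t. z t k) \<and> z 0 k = \<zeta> k \<and>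
        (AE t in lebesgue_on {0..T}.
           ((\<lambda>s. z s k) has_real_derivative modal_rhs lam b k (z t k) (u t)) (at t within {0..T})))"

text \<open>The solution exists for every bounded measurable control and is unique on \<open>[0, T]\<close>,
  so the existential quantifier refers to it.\<close>

definition modal_controls ::
  "nat \<Rightarrow> (nat \<Rightarrow> real) \<Rightarrow> (nat \<Rightarrow> real^'m::finite \<Rightarrow> real) \<Rightarrow> (real^'m) set \<Rightarrow>
   (nat \<Rightarrow> real set) \<Rightarrow> (nat \<Rightarrow> real set) \<Rightarrow> real \<Rightarrow> (nat \<Rightarrow> real) \<Rightarrow> (real \<Rightarrow> real^'m) set" where
  "modal_controls N lam b U Z ZT T \<zeta> =
     {u \<in> controls T U. \<exists>z.
        modal_solution N lam b T \<zeta> u z \<and>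
        (AE t in lebesgue_on {0..T}. \<forall>k\<in>{1..N}. z t k \<in> Z k) \<and>
        (\<forall>k\<in>{1..N}. z T k \<in> ZT k)}"

definition modal_value ::
  "nat \<Rightarrow> (nat \<Rightarrow> real) \<Rightarrow> (nat \<Rightarrow> real^'m::finite \<Rightarrow> real) \<Rightarrow> (real^'m) set \<Rightarrow>
   (nat \<Rightarrow> real set) \<Rightarrow> (nat \<Rightarrow> real set) \<Rightarrow> real \<Rightarrow> (nat \<Rightarrow> real) \<Rightarrow>
   (nat \<times> 'm uexp) rpoly \<Rightarrow> ereal" where
  "modal_value N lam b U Z ZT T \<zeta> h =
     (INF u\<in>modal_controls N lam b U Z ZT T \<zeta>. ereal (cost T h u))"

section \<open>The linear program over measures\<close>

text \<open>\<open>\<real>\<^sup>N\<close> is the set \<open>{1..N} \<rightarrow>\<^sub>E UNIV\<close> of extensional functions, with the topology (and Borel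
  sets) induced by the product topology of \<^typ>\<open>nat \<Rightarrow> real\<close>.\<close>

definition dt :: "(real \<times> (nat \<Rightarrow> real) \<Rightarrow> real) \<Rightarrow> real \<times> (nat \<Rightarrow> real) \<Rightarrow> real" where
  "dt g = (\<lambda>(t, z). deriv (\<lambda>s. g (s, z)) t)"

definition dz :: "nat \<Rightarrow> (real \<times> (nat \<Rightarrow> real) \<Rightarrow> real) \<Rightarrow> real \<times> (nat \<Rightarrow> real) \<Rightarrow> real" where
  "dz k g = (\<lambda>(t, z). deriv (\<lambda>x. g (t, z(k := x))) (z k))"

definition C1_functions :: "nat \<Rightarrow> (real \<times> (nat \<Rightarrow> real) \<Rightarrow> real) set" where
  "C1_functions N = {g.
     continuous_on (UNIV \<times> ({1..N} \<rightarrow>\<^sub>E UNIV)) g \<and>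
     (\<forall>t. \<forall>z\<in>{1..N} \<rightarrow>\<^sub>E UNIV.
        (\<lambda>s. g (s, z)) differentiable (at t) \<and>
        (\<forall>k\<in>{1..N}. (\<lambda>x. g (t, z(k := x))) differentiable (at (z k)))) \<and>
     continuous_on (UNIV \<times> ({1..N} \<rightarrow>\<^sub>E UNIV)) (dt g) \<and>
     (\<forall>k\<in>{1..N}. continuous_on (UNIV \<times> ({1..N} \<rightarrow>\<^sub>E UNIV)) (dz k g))}"

definition liouville ::
  "nat \<Rightarrow> (nat \<Rightarrow> real) \<Rightarrow> (nat \<Rightarrow> real^'m::finite \<Rightarrow> real) \<Rightarrow>
   (real \<times> (nat \<Rightarrow> real) \<Rightarrow> real) \<Rightarrow> real \<times> (nat \<Rightarrow> real) \<times> (real^'m) \<Rightarrow> real" where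
  "liouville N lam b g = (\<lambda>(t, z, u).
     dt g (t, z) + (\<Sum>k=1..N. modal_rhs lam b k (z k) u * dz k g (t, z)))"

definition lp_feasible ::
  "nat \<Rightarrow> (nat \<Rightarrow> real) \<Rightarrow> (nat \<Rightarrow> real^'m::finite \<Rightarrow> real) \<Rightarrow> (real^'m) set \<Rightarrow>
   (nat \<Rightarrow> real set) \<Rightarrow> (nat \<Rightarrow> real set) \<Rightarrow> real \<Rightarrow> (nat \<Rightarrow> real) \<Rightarrow>
   ((real \<times> (nat \<Rightarrow> real) \<times> (real^'m)) measure \<times> (nat \<Rightarrow> real) measure) set" where
  "lp_feasible N lam b U Z ZT T \<zeta> = {(\<mu>, \<nu>).
     finite_measure \<mu> \<and> sets \<mu> = sets (restrict_space borel ({0..T} \<times> (\<Pi>\<^sub>E k\<in>{1..N}. Z k) \<times> U)) \<and>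
     finite_measure \<nu> \<and> sets \<nu> = sets (restrict_space borel (\<Pi>\<^sub>E k\<in>{1..N}. ZT k)) \<and>
     (\<forall>g\<in>C1_functions N.
        (LINT z|\<nu>. g (T, z)) - g (0, restrict \<zeta> {1..N}) = (LINT x|\<mu>. liouville N lam b g x))}"

definition lp_value ::
  "nat \<Rightarrow> (nat \<Rightarrow> real) \<Rightarrow> (nat \<Rightarrow> real^'m::finite \<Rightarrow> real) \<Rightarrow> (real^'m) set \<Rightarrow>
   (nat \<Rightarrow> real set) \<Rightarrow> (nat \<Rightarrow> real set) \<Rightarrow> real \<Rightarrow> (nat \<Rightarrow> real) \<Rightarrow>
   (nat \<times> 'm uexp) rpoly \<Rightarrow> ereal" where
  "lp_value N lam b U Z ZT T \<zeta> h =
     (INF (\<mu>, \<nu>)\<in>lp_feasible N lam b U Z ZT T \<zeta>. ereal (LINT (t, z, u)|\<mu>. eval_tu h t u))"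

section \<open>The semidefinite relaxations\<close>

definition poly_dt :: "('m tzuexp) rpoly \<Rightarrow> ('m tzuexp) rpoly" where
  "poly_dt g = (\<Sum>(p, \<alpha>, \<beta>)\<in>Poly_Mapping.keys g.
     Poly_Mapping.single (p - 1, \<alpha>, \<beta>) (real p * Poly_Mapping.lookup g (p, \<alpha>, \<beta>)))"

definition poly_dz :: "nat \<Rightarrow> ('m tzuexp) rpoly \<Rightarrow> ('m tzuexp) rpoly" where
  "poly_dz k g = (\<Sum>(p, \<alpha>, \<beta>)\<in>Poly_Mapping.keys g.
     Poly_Mapping.single (p, \<alpha> - Poly_Mapping.single k 1, \<beta>)
       (real (Poly_Mapping.lookup \<alpha> k) * Poly_Mapping.lookup g (p, \<alpha>, \<beta>)))"

text \<open>\<open>f\<^sub>k\<close> as a polynomial, for \<open>b\<^sub>k\<close> linear: \<open>b\<^sub>k(u) = \<Sum>\<^sub>i b\<^sub>k(e\<^sub>i) u\<^sub>i\<close>.\<close>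

definition poly_rhs ::
  "(nat \<Rightarrow> real) \<Rightarrow> (nat \<Rightarrow> real^'m::finite \<Rightarrow> real) \<Rightarrow> nat \<Rightarrow> ('m tzuexp) rpoly" where
  "poly_rhs lam b k =
     Poly_Mapping.single (0, Poly_Mapping.single k 1, 0) (lam k) +
     (\<Sum>i\<in>UNIV. Poly_Mapping.single (0, 0, Poly_Mapping.single i 1) (b k (axis i 1)))"

definition poly_liouville ::
  "nat \<Rightarrow> (nat \<Rightarrow> real) \<Rightarrow> (nat \<Rightarrow> real^'m::finite \<Rightarrow> real) \<Rightarrow> ('m tzuexp) rpoly \<Rightarrow> ('m tzuexp) rpoly"
  where "poly_liouville N lam b g = poly_dt g + (\<Sum>k=1..N. poly_rhs lam b k * poly_dz k g)"

definition half_deg :: "('v \<Rightarrow>\<^sub>0 nat) rpoly \<Rightarrow> nat" where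
  "half_deg \<theta> = nat \<lceil>real (poly_deg \<theta>) / 2\<rceil>"

definition r_min :: "nat \<Rightarrow> (nat \<Rightarrow> ('m uexp) rpoly) \<Rightarrow> nat" where
  "r_min s w = Max (insert 1 ((\<lambda>j. half_deg (w j)) ` {1..s}))"

text \<open>Entries of \<open>y\<close> and \<open>y\<^sup>T\<close> whose \<open>z\<close>-exponent is not supported in \<open>{1..N}\<close> do not occur in any
  constraint or in the objective. In the last constraint, \<open>t^p z^\<alpha>\<close> at \<open>t = T\<close> is the polynomial
  \<open>T^p z^\<alpha>\<close>.\<close>

definition sdp_feasible ::
  "nat \<Rightarrow> nat \<Rightarrow> (nat \<Rightarrow> real) \<Rightarrow> (nat \<Rightarrow> real^'m::finite \<Rightarrow> real) \<Rightarrow>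
   nat \<Rightarrow> (nat \<Rightarrow> 'm uexp rpoly) \<Rightarrow> (nat \<Rightarrow> real) \<Rightarrow> (nat \<Rightarrow> real) \<Rightarrow> (nat \<Rightarrow> real) \<Rightarrow> (nat \<Rightarrow> real) \<Rightarrow>
   real \<Rightarrow> (nat \<Rightarrow> real) \<Rightarrow> (('m tzuexp \<Rightarrow> real) \<times> (zexp \<Rightarrow> real)) set" where
  "sdp_feasible N r lam b s w zlo zhi zTlo zThi T \<zeta> = {(y, yT).
     psd_on (tzuexps N r) (moment_matrix y) \<and>
     psd_on (zexps N r) (moment_matrix yT) \<and>
     psd_on {..r - 1}
       (localizing_matrix (Poly_Mapping.single 1 1 * (const_poly T - Poly_Mapping.single 1 1))
          (marginal_t y)) \<and>
     (\<forall>i\<in>{1..N}. psd_on {..r - 1}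
       (localizing_matrix (interval_poly (zlo i) (zhi i) (Poly_Mapping.single 1 1))
          (marginal_z i y))) \<and>
     (\<forall>j\<in>{1..s}. psd_on (uexps (r - half_deg (w j))) (localizing_matrix (w j) (marginal_u y))) \<and>
     (\<forall>i\<in>{1..N}. psd_on (zexps N (r - 1))
       (localizing_matrix
          (interval_poly (zTlo i) (zThi i) (Poly_Mapping.single (Poly_Mapping.single i 1) 1)) yT)) \<and>
     (\<forall>p. \<forall>\<alpha> :: zexp. Poly_Mapping.keys \<alpha> \<subseteq> {1..N} \<and> p + total_deg \<alpha> \<le> r \<longrightarrow>
        ell yT (Poly_Mapping.single \<alpha> (T ^ p)) -
        ell y (poly_liouville N lam b (Poly_Mapping.single (p, \<alpha>, 0) 1)) =
        0 ^ p * (\<Prod>k=1..N. \<zeta> k ^ Poly_Mapping.lookup \<alpha> k))}"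

definition sdp_value ::
  "nat \<Rightarrow> nat \<Rightarrow> (nat \<Rightarrow> real) \<Rightarrow> (nat \<Rightarrow> real^'m::finite \<Rightarrow> real) \<Rightarrow>
   nat \<Rightarrow> (nat \<Rightarrow> 'm uexp rpoly) \<Rightarrow> (nat \<Rightarrow> real) \<Rightarrow> (nat \<Rightarrow> real) \<Rightarrow> (nat \<Rightarrow> real) \<Rightarrow> (nat \<Rightarrow> real) \<Rightarrow>
   real \<Rightarrow> (nat \<Rightarrow> real) \<Rightarrow> (nat \<times> 'm uexp) rpoly \<Rightarrow> ereal" where
  "sdp_value N r lam b s w zlo zhi zTlo zThi T \<zeta> h =
     (INF (y, yT)\<in>sdp_feasible N r lam b s w zlo zhi zTlo zThi T \<zeta>.
        ereal (ell (\<lambda>(p, \<beta>). y (p, 0, \<beta>)) h))"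

section \<open>Remaining hypotheses\<close>

definition basic_semialgebraic :: "nat \<Rightarrow> (nat \<Rightarrow> ('m::finite) uexp rpoly) \<Rightarrow> (real^'m) set" where
  "basic_semialgebraic s w = {u. \<forall>j\<in>{1..s}. 0 \<le> eval_u (w j) u}"

definition ball_poly :: "int \<Rightarrow> ('m::finite) uexp rpoly" where
  "ball_poly M = const_poly (of_int M) -
     (\<Sum>i\<in>UNIV. Poly_Mapping.single (Poly_Mapping.single i 2) 1)"

text \<open>Convexity of a function with values in \<open>\<real> \<union> {+\<infinity>}\<close>.\<close>

definition ereal_convex :: "('a::real_vector \<Rightarrow> ereal) \<Rightarrow> bool" where
  "ereal_convex g \<longleftrightarrow>
     (\<forall>x y. \<forall>\<theta>::real. 0 < \<theta> \<and> \<theta> < 1 \<longrightarrow>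
        g ((1 - \<theta>) *\<^sub>R x + \<theta> *\<^sub>R y) \<le> ereal (1 - \<theta>) * g x + ereal \<theta> * g y)"

definition fibre_cost ::
  "('h::real_vector \<Rightarrow> 'h) \<Rightarrow> (real^'m::finite \<Rightarrow> 'h) \<Rightarrow> (real^'m) set \<Rightarrow> (nat \<times> 'm uexp) rpoly \<Rightarrow>
   real \<Rightarrow> 'h \<Rightarrow> 'h \<Rightarrow> ereal" where
  "fibre_cost A B U h t z v = (INF u\<in>{u \<in> U. v = A z + B u}. ereal (eval_tu h t u))"

end

theory Submission
  imports Defs "HOL-Probability.Probability" "HOL-Complex_Analysis.Great_Picard"
begin

text \<open>
  Every feasible pair of measures yields, through its moments, a feasible point of each relaxation.
  Conversely, the Archimedean hypothesis and the interval constraints bound the even moments of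
  points feasible for all \<open>r\<close> geometrically, so along a subsequence they converge to a linear functional
  that is nonnegative on squares, and this functional is integration over a compact set: after
  embedding the coordinates in \<open>[0, 1]\<close> it is a limit of Bernstein averages, i.e. of discrete measures,
  which are transported to the real line by a space-filling curve. The localizing constraints
  force the representing measure to live on the constraint set, and Bernstein approximation extends
  the Liouville equation from monomials to \<open>C\<^sup>1\<close> test functions.

  For (ii), the time marginal of a feasible \<open>\<mu>\<close> is Lebesgue measure, so the averages of \<open>u\<close> and of
  \<open>h\<close> over short time slices converge almost everywhere. By convexity the limit is dominated by a
  point of \<open>U\<close> with the same value of \<open>B\<close> and no larger cost, and such a point can be chosen measurably.
  The modes of the resulting control agree with the conditional means of \<open>\<mu>\<close>, because both
  satisfy the same linear equation weakly, and the interval constraints are convex.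
\<close>

section \<open>Moment functionals\<close>

text \<open>Localizing constraints act only on marginals of \<open>y\<close>. This suffices because
  the state set is a product: the full moment matrix yields one joint measure, and each marginal
  confines its own coordinates. Mixed moments are bounded through pure even powers by
  Cauchy-Schwarz, and the same growth puts \<open>R\<^sup>2 - x\<^sup>2\<close> into the set
  \<open>cone\<close> of positive multiplication operators. At a fixed order only low degrees are
  controlled, so positivity and bounds for \<open>y r\<close> are stated eventually in
  \<open>r\<close>. The curve reduces a measure on a cube to the law of one real parameter, so weak
  compactness is used on the line; the same curve later turns the choice of a control vector into
  the choice of a smallest real zero. In (ii) the convexity hypothesis concerns the possibly
  infinite-dimensional \<open>H\<close>, whereas separation by hyperplanes takes place in the
  finite-dimensional space of controls and costs: the epigraph is pulled back along
  \<open>B\<close>, and since every \<open>b k\<close> factors through \<open>B\<close>, controls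
  with the same value of \<open>B\<close> drive the modes identically.\<close>

abbreviation keys :: "('a \<Rightarrow>\<^sub>0 'b::zero) \<Rightarrow> 'a set" where "keys \<equiv> Poly_Mapping.keys"

abbreviation lookup :: "('a \<Rightarrow>\<^sub>0 'b::zero) \<Rightarrow> 'a \<Rightarrow> 'b" where "lookup \<equiv> Poly_Mapping.lookup"

abbreviation single :: "'a \<Rightarrow> 'b \<Rightarrow> 'a \<Rightarrow>\<^sub>0 'b::zero" where "single \<equiv> Poly_Mapping.single"

lemma ell_superset:
  assumes "finite K" "keys \<theta> \<subseteq> K"
  shows "ell y \<theta> = (\<Sum>\<gamma>\<in>K. lookup \<theta> \<gamma> * y \<gamma>)"
  unfolding ell_def
  by (rule sum.mono_neutral_left) (use assms in \<open>auto simp: in_keys_iff\<close>)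

lemma ell_zero [simp]: "ell y 0 = 0"
  by (simp add: ell_def)

lemma ell_single [simp]: "ell y (single \<gamma> c) = c * y \<gamma>"
  by (cases "c = 0") (simp_all add: ell_def)

lemma ell_add: "ell y (p + q) = ell y p + ell y q"
proof -
  let ?K = "keys p \<union> keys q"
  have "ell y (p + q) = (\<Sum>\<gamma>\<in>?K. lookup (p + q) \<gamma> * y \<gamma>)"
    by (rule ell_superset) (use keys_add[of p q] in auto)
  also have "\<dots> = (\<Sum>\<gamma>\<in>?K. lookup p \<gamma> * y \<gamma>) + (\<Sum>\<gamma>\<in>?K. lookup q \<gamma> * y \<gamma>)"
    by (simp add: lookup_add distrib_right sum.distrib)
  also have "\<dots> = ell y p + ell y q"
    by (subst (1 2) ell_superset[of ?K]) auto
  finally show ?thesis .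
qed

lemma ell_diff: "ell y (p - q) = ell y p - ell y q"
  using ell_add[of y "p - q" q] by simp

lemma ell_sum: "ell y (\<Sum>i\<in>I. f i) = (\<Sum>i\<in>I. ell y (f i))"
  by (induction I rule: infinite_finite_induct) (auto simp: ell_add)

lemma poly_eq_sum_single:
  "p = (\<Sum>k\<in>keys p. single k (lookup p k))"
  by (rule poly_mapping_eqI)
     (auto simp: lookup_sum lookup_single when_def in_keys_iff sum.If_cases)

lemma ell_mult:
  "ell y (p * q) = (\<Sum>\<beta>\<in>keys p. \<Sum>\<gamma>\<in>keys q.
     lookup p \<beta> * lookup q \<gamma> * y (\<beta> + \<gamma>))"
proof -
  have "p * q = (\<Sum>\<beta>\<in>keys p. \<Sum>\<gamma>\<in>keys q.
     single (\<beta> + \<gamma>) (lookup p \<beta> * lookup q \<gamma>))"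
    by (subst (1) poly_eq_sum_single[of p], subst (1) poly_eq_sum_single[of q])
       (simp add: sum_product mult_single)
  then show ?thesis by (simp add: ell_sum)
qed

lemma ell_scale: "ell y (const_poly r * p) = r * ell y p"
  unfolding const_poly_def
  by (cases "r = 0") (auto simp: ell_mult ell_def[of y p] sum_distrib_left mult.assoc)

lemma ell_mono_times: "ell y (single \<delta> c * p) = c * ell (\<lambda>\<gamma>. y (\<delta> + \<gamma>)) p"
  by (cases "c = 0") (auto simp: ell_mult ell_def[of _ p] sum_distrib_left mult.assoc)

text \<open>A family that is multiplicative in the exponent behaves like evaluation of monomials at
  a point, and evaluation respects products of polynomials. Integrands built from \<open>ev\<close>
  and \<open>evz\<close> are computed this way.\<close>

lemma ell_multiplicative:
  fixes y :: "'e::comm_monoid_add \<Rightarrow> real"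
  assumes "\<And>\<beta> \<gamma>. y (\<beta> + \<gamma>) = y \<beta> * y \<gamma>"
  shows "ell y (p * q) = ell y p * ell y q"
  unfolding ell_mult by (simp add: ell_def assms sum_product mult_ac)

lemma ell_cong: "(\<And>\<gamma>. \<gamma> \<in> keys p \<Longrightarrow> y \<gamma> = y' \<gamma>) \<Longrightarrow> ell y p = ell y' p"
  by (simp add: ell_def)

lemma const_poly_simps:
  "const_poly (a + b) = const_poly a + const_poly b"
  "const_poly (a - b) = const_poly a - const_poly b"
  "const_poly (a * b) = const_poly a * (const_poly b :: 'e::comm_monoid_add rpoly)"
  "const_poly 1 = 1" "const_poly 0 = 0"
  by (simp_all add: const_poly_def single_add single_diff mult_single)

section \<open>Positive functionals and polynomials acting as positive multiplication
  operators\<close>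

locale positive_functional =
  fixes L :: "'e::comm_monoid_add rpoly \<Rightarrow> real"
  assumes L_add: "L (p + q) = L p + L q"
    and L_scale: "L (const_poly r * p) = r * L p"
    and L_square: "0 \<le> L (p * p)"
begin

text \<open>For the semi-inner product \<open>L (p * q)\<close>, membership means that
  multiplication by \<open>a\<close> is a positive operator. Unlike a set of sums of squares, this
  set depends on \<open>L\<close>, so it can absorb analytic information such as the growth of
  moments.\<close>

definition cone :: "'e rpoly set" where
  "cone = {a. \<forall>p. 0 \<le> L (a * (p * p))}"

lemma coneD: "a \<in> cone \<Longrightarrow> 0 \<le> L (a * (p * p))"
  by (simp add: cone_def)

lemma L_zero [simp]: "L 0 = 0"
  using L_add[of 0 0] by simp

lemma L_diff: "L (p - q) = L p - L q"
  using L_add[of "p - q" q] by simp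

lemma L_sum: "L (\<Sum>i\<in>I. f i) = (\<Sum>i\<in>I. L (f i))"
  by (induction I rule: infinite_finite_induct) (auto simp: L_add)

lemma L_cauchy_schwarz: "(L (p * q))\<^sup>2 \<le> L (p * p) * L (q * q)"
proof -
  have key: "0 \<le> L (p * p) + 2 * s * L (p * q) + s\<^sup>2 * L (q * q)" for s
  proof -
    have "(p + const_poly s * q) * (p + const_poly s * q) =
       p * p + const_poly s * (p * q) + const_poly s * (p * q) + const_poly s * (const_poly s * (q * q))"
      by (simp add: algebra_simps)
    then have "L ((p + const_poly s * q) * (p + const_poly s * q)) =
       L (p * p) + s * L (p * q) + s * L (p * q) + s * (s * L (q * q))"
      by (simp only: L_add L_scale)
    with L_square[of "p + const_poly s * q"] show ?thesis
      by (simp add: power2_eq_square algebra_simps)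
  qed
  show ?thesis
  proof (cases "L (q * q) = 0")
    case True
    have "L (p * q) = 0"
    proof (rule ccontr)
      assume "L (p * q) \<noteq> 0"
      \<comment> \<open>If \<open>L (q * q) = 0\<close>, the quadratic is affine in
        \<open>s\<close>; at this \<open>s\<close> its value is \<open>-1\<close>.\<close>
      with key[of "- (L (p * p) + 1) / (2 * L (p * q))"] True show False by (simp add: field_simps)
    qed
    then show ?thesis using True by simp
  next
    case False
    then have pos: "L (q * q) > 0" using L_square[of q] by simp
    from key[of "- L (p * q) / L (q * q)"] pos show ?thesis
      by (simp add: field_simps power2_eq_square)
  qed
qed

lemma cone_add: "a \<in> cone \<Longrightarrow> b \<in> cone \<Longrightarrow> a + b \<in> cone"
  by (simp add: cone_def L_add distrib_right)

lemma cone_scale: "a \<in> cone \<Longrightarrow> 0 \<le> r \<Longrightarrow> const_poly r * a \<in> cone"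
  by (simp add: cone_def L_scale mult.assoc)

lemma cone_mult_square: "a \<in> cone \<Longrightarrow> a * (q * q) \<in> cone"
  unfolding cone_def
proof safe
  fix p assume "\<forall>p. 0 \<le> L (a * (p * p))"
  then have "0 \<le> L (a * ((q * p) * (q * p)))" by blast
  then show "0 \<le> L (a * (q * q) * (p * p))" by (simp add: mult_ac)
qed

lemma square_in_cone: "q * q \<in> cone"
  unfolding cone_def using L_square[of "q * p" for p] by (auto simp: mult_ac)

lemma one_in_cone: "1 \<in> cone"
  using square_in_cone[of 1] by simp

primrec halving :: "'e rpoly \<Rightarrow> nat \<Rightarrow> 'e rpoly" where
  "halving a 0 = a"
| "halving a (Suc n) = halving a n - halving a n * halving a n"

text \<open>The step \<open>s - s\<^sup>2\<close> preserves the operator interval between 0 and 1: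
  it equals \<open>s\<close> times the square of \<open>1 - s\<close> plus \<open>1 - s\<close>
  times the square of \<open>s\<close>, and its complement adds a square to
  \<open>1 - s\<close>.\<close>

lemma halving_in_cone:
  assumes "a \<in> cone" "1 - a \<in> cone"
  shows "halving a n \<in> cone \<and> 1 - halving a n \<in> cone"
proof (induction n)
  case (Suc n)
  let ?s = "halving a n"
  have "?s - ?s * ?s = (1 - ?s) * (?s * ?s) + ?s * ((1 - ?s) * (1 - ?s))"
    by (simp add: algebra_simps)
  moreover have "1 - (?s - ?s * ?s) = (1 - ?s) + ?s * ?s"
    by (simp add: algebra_simps)
  ultimately show ?case
    using Suc by (simp only: halving.simps) (auto intro!: cone_add cone_mult_square square_in_cone)
qed (use assms in auto)

text \<open>Writing \<open>a = \<Sum>\<^sub>k\<^sub><\<^sub>n s\<^sub>k\<^sup>2 + s\<^sub>n\<close> with \<open>s\<^sub>0 = a\<close> and \<open>s\<^sub>n\<^sub>+\<^sub>1 = s\<^sub>n - s\<^sub>n\<^sup>2\<close>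
  makes \<open>a b\<close> a sum of squares times \<open>b\<close> up to a remainder that tends to zero; this is the classical
  proof that a product of commuting positive operators is positive.\<close>

lemma cone_mult:
  assumes a: "a \<in> cone" "1 - a \<in> cone" and b: "b \<in> cone"
  shows "a * b \<in> cone"
  unfolding cone_def
proof safe
  fix p
  define s where "s = halving a"
  define e where "e n = L ((s n * p) * (s n * p))" for n
  have s0: "s 0 = a" and sS: "s (Suc n) = s n - s n * s n" for n
    by (simp_all add: s_def)
  have sc: "s n \<in> cone" for n using halving_in_cone[OF a] by (simp add: s_def)
  have tele: "a = (\<Sum>k<n. s k * s k) + s n" for n
    by (induction n) (simp_all add: s0 sS)
  have "a * (p * p) = (\<Sum>k<n. (s k * p) * (s k * p)) + s n * (p * p)" for n
    by (subst tele[of n]) (simp add: distrib_right distrib_left sum_distrib_right sum_distrib_left mult_ac)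
  then have "L (a * (p * p)) = (\<Sum>k<n. e k) + L (s n * (p * p))" for n
    by (metis (no_types, lifting) L_add L_sum e_def sum.cong)
  \<comment> \<open>Dropping the nonnegative remainder bounds the partial sums, so \<open>e\<close>
    is summable and tends to zero; \<open>e n\<close> then controls the remainder in the product
    through Cauchy-Schwarz.\<close>
  then have bound: "(\<Sum>k<n. e k) \<le> L (a * (p * p))" for n
    using coneD[OF sc[of n], of p] by (metis add_increasing2 order_refl)
  have e0: "0 \<le> e n" for n by (simp add: e_def L_square)
  have "summable e"
    by (rule summableI_nonneg_bounded[OF e0 bound])
  then have elim: "e \<longlonglongrightarrow> 0" by (rule summable_LIMSEQ_zero)
  have ge: "- sqrt (e n * L ((b * p) * (b * p))) \<le> L (a * b * (p * p))" for n
  proof -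
    have "a * b * (p * p) = (\<Sum>k<n. b * ((s k * p) * (s k * p))) + (s n * p) * (b * p)"
      by (subst tele[of n]) (simp add: distrib_right distrib_left sum_distrib_right sum_distrib_left mult_ac)
    then have "L (a * b * (p * p)) = (\<Sum>k<n. L (b * ((s k * p) * (s k * p)))) + L ((s n * p) * (b * p))"
      by (simp only: L_add L_sum)
    moreover have "0 \<le> (\<Sum>k<n. L (b * ((s k * p) * (s k * p))))"
      by (intro sum_nonneg coneD b)
    moreover have "\<bar>L ((s n * p) * (b * p))\<bar> \<le> sqrt (e n * L ((b * p) * (b * p)))"
      unfolding e_def by (intro real_le_rsqrt) (simp add: L_cauchy_schwarz)
    ultimately show ?thesis by linarith
  qed
  have "(\<lambda>n. - sqrt (e n * L ((b * p) * (b * p)))) \<longlonglongrightarrow> - sqrt (0 * L ((b * p) * (b * p)))"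
    by (intro tendsto_intros elim)
  then show "0 \<le> L (a * b * (p * p))"
    using LIMSEQ_le_const2[of _ 0 "L (a * b * (p * p))"] ge by auto
qed

text \<open>Factors are multiplied on from the left one at a time, because \<open>cone_mult\<close>
  asks for the complement of its left factor and not of the accumulated product. Up to binomial
  coefficients these products are the Bernstein weights.\<close>

lemma cone_prod:
  assumes "finite I" "\<And>i. i \<in> I \<Longrightarrow> a i \<in> cone \<and> 1 - a i \<in> cone"
  shows "(\<Prod>i\<in>I. a i ^ k i * (1 - a i) ^ l i) \<in> cone"
  using assms
proof (induction I rule: finite_induct)
  case empty
  then show ?case by (simp add: one_in_cone)
next
  case (insert i I)
  have *: "x ^ n * b \<in> cone" if "x \<in> cone" "1 - x \<in> cone" "b \<in> cone" for x b n
    using that by (induction n) (auto simp: mult.assoc intro: cone_mult)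
  show ?case using insert by (auto simp: mult.assoc intro!: *)
qed

text \<open>By the Cauchy-Schwarz inequality \<open>k \<mapsto> L (x\<^sup>2\<^sup>k p\<^sup>2)\<close> is log-convex, so a violation of
  \<open>L (x\<^sup>2 p\<^sup>2) \<le> R\<^sup>2 L (p\<^sup>2)\<close> would force growth faster than \<open>R\<^sup>2\<^sup>k\<close>.\<close>

lemma growth_imp_cone:
  assumes R: "0 < R" and growth: "\<And>k. L (x ^ (2 * k)) \<le> K * R ^ (2 * k)"
  shows "const_poly (R\<^sup>2) - x * x \<in> cone"
  unfolding cone_def
proof safe
  fix p
  define a where "a k = L (x ^ (2 * k) * (p * p))" for k
  have a0: "0 \<le> a k" for k
    using L_square[of "x ^ k * p"] by (simp add: a_def mult_ac power_mult power2_eq_square power_mult_distrib)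
  have conv: "(a (Suc k))\<^sup>2 \<le> a k * a (Suc (Suc k))" for k
    using L_cauchy_schwarz[of "x ^ k * p" "x ^ Suc (Suc k) * p"]
    by (simp add: a_def power_mult power2_eq_square power_mult_distrib mult_ac)
  have "a 1 \<le> R\<^sup>2 * a 0"
  proof (rule ccontr)
    assume contr: "\<not> a 1 \<le> R\<^sup>2 * a 0"
    then have a0pos: "a 0 > 0"
      using conv[of 0] a0[of 0] a0[of 1] by (cases "a 0 = 0") auto
    define q where "q = a 1 / a 0"
    have qR: "q > R\<^sup>2" using contr a0pos by (simp add: q_def field_simps)
    have q0: "q > 0" using qR R by (meson less_trans zero_less_power)
    have step: "a (Suc k) \<ge> q * a k \<and> a k > 0" for k
    proof (induction k)
      case 0 then show ?case using a0pos by (simp add: q_def)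
    next
      case (Suc k)
      then have p1: "a (Suc k) > 0" using q0 by (meson less_le_trans mult_pos_pos)
      have "q * a (Suc k) * a k \<le> a (Suc k) * a (Suc k)"
        using Suc p1 by (simp add: mult.commute mult.left_commute)
      also have "\<dots> \<le> a (Suc (Suc k)) * a k" using conv[of k] by (simp add: power2_eq_square mult.commute)
      finally show ?case using Suc p1 by simp
    qed
    have low: "q ^ k * a 0 \<le> a k" for k
    proof (induction k)
      case (Suc k)
      have "q ^ Suc k * a 0 \<le> q * a k" using Suc q0 by simp
      also have "\<dots> \<le> a (Suc k)" using step by blast
      finally show ?case .
    qed simp
    define C where "C = K * L ((p * p) * (p * p))"
    \<comment> \<open>Cauchy-Schwarz against \<open>p * p\<close> separates the powers of
      \<open>x\<close>, to which the growth hypothesis applies, from the arbitrary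
      \<open>p\<close>.\<close>
    have up: "(a k)\<^sup>2 \<le> C * (R\<^sup>2) ^ (2 * k)" for k
    proof -
      have "(a k)\<^sup>2 \<le> L (x ^ (2 * (2 * k))) * L ((p * p) * (p * p))"
        using L_cauchy_schwarz[of "x ^ (2 * k)" "p * p"]
        by (simp add: a_def flip: power_add)
      also have "\<dots> \<le> (K * R ^ (2 * (2 * k))) * L ((p * p) * (p * p))"
        by (intro mult_right_mono growth L_square)
      also have "R ^ (2 * (2 * k)) = (R\<^sup>2) ^ (2 * k)" by (simp only: power_mult)
      finally show ?thesis by (simp add: C_def mult_ac)
    qed
    \<comment> \<open>The lower bound \<open>low\<close> and the upper bound \<open>up\<close> keep
      all powers of \<open>\<rho>\<close> below one constant, while the assumed violation makes
      \<open>\<rho>\<close> larger than 1.\<close>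
    define \<rho> where "\<rho> = (q / R\<^sup>2)\<^sup>2"
    have rho: "\<rho> > 1" using qR R by (simp add: \<rho>_def)
    have "\<rho> ^ k * (a 0)\<^sup>2 \<le> C" for k
    proof -
      have "(q ^ k * a 0)\<^sup>2 \<le> (a k)\<^sup>2" using low[of k] q0 a0pos by (intro power_mono) auto
      also note up[of k]
      finally have 1: "(q ^ k * a 0)\<^sup>2 \<le> C * (R\<^sup>2) ^ (2 * k)" .
      have 2: "\<rho> ^ k = (q ^ k)\<^sup>2 / (R\<^sup>2) ^ (2 * k)"
      proof -
        have "(q\<^sup>2) ^ k = (q ^ k)\<^sup>2" by (metis power_mult mult.commute)
        moreover have "((R\<^sup>2)\<^sup>2) ^ k = (R\<^sup>2) ^ (2 * k)" by (simp only: power_mult)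
        ultimately show ?thesis by (simp only: \<rho>_def power_divide)
      qed
      have 3: "0 < (R\<^sup>2) ^ (2 * k)" using R by simp
      have "(q ^ k)\<^sup>2 / (R\<^sup>2) ^ (2 * k) * (a 0)\<^sup>2 = (q ^ k * a 0)\<^sup>2 / (R\<^sup>2) ^ (2 * k)"
        by (simp add: power_mult_distrib)
      also have "\<dots> \<le> C" using 1 3 by (simp only: pos_divide_le_eq)
      finally show ?thesis by (simp only: 2)
    qed
    then have "\<rho> ^ k \<le> C / (a 0)\<^sup>2" for k using a0pos by (simp add: pos_le_divide_eq)
    moreover obtain n where "\<rho> ^ n > C / (a 0)\<^sup>2" using real_arch_pow[OF rho] by blast
    ultimately show False by (meson not_le)
  qed
  moreover have "(const_poly (R\<^sup>2) - x * x) * (p * p) = const_poly (R\<^sup>2) * (p * p) - x ^ (2 * 1) * (p * p)"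
    by (simp add: algebra_simps power2_eq_square)
  ultimately show "0 \<le> L ((const_poly (R\<^sup>2) - x * x) * (p * p))"
    by (simp only: L_diff L_scale a_def) simp
qed

text \<open>The affine map of \<open>[-R, R]\<close> onto \<open>[0, 1]\<close>. Completing the
  square gives \<open>1/2 + r x = (1/2 + r x)\<^sup>2 + r\<^sup>2 (R\<^sup>2 - x\<^sup>2)\<close>
  whenever \<open>r\<^sup>2 = 1 / (4 R\<^sup>2)\<close>; the two signs of \<open>r\<close> yield
  \<open>a\<close> and \<open>1 - a\<close>.\<close>

lemma affine_in_cone:
  assumes R: "0 < R" and c: "const_poly (R\<^sup>2) - x * x \<in> cone"
  defines "a \<equiv> const_poly (1 / 2) + const_poly (1 / (2 * R)) * x"
  shows "a \<in> cone" "1 - a \<in> cone"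
proof -
  have *: "const_poly (1 / 2) + const_poly r * x \<in> cone" if r: "r\<^sup>2 = 1 / (4 * R\<^sup>2)" for r
  proof -
    have c1: "const_poly (1/2) * const_poly (1/2) + const_poly (r * r) * const_poly (R\<^sup>2) = (const_poly (1/2) :: 'e rpoly)"
      using r R unfolding const_poly_simps(1,3)[symmetric] by (simp add: power2_eq_square field_simps)
    have c2: "const_poly (1/2) * const_poly r + const_poly (1/2) * const_poly r = (const_poly r :: 'e rpoly)"
      unfolding const_poly_simps(1,3)[symmetric] by simp
    have "const_poly (1 / 2) + const_poly r * x
       = (const_poly (1/2) + const_poly r * x) * (const_poly (1/2) + const_poly r * x)
         + const_poly (r * r) * (const_poly (R\<^sup>2) - x * x)"
    proof -
      have "(const_poly (1/2) + const_poly r * x) * (const_poly (1/2) + const_poly r * x)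
         + const_poly (r * r) * (const_poly (R\<^sup>2) - x * x)
         = (const_poly (1/2) * const_poly (1/2) + const_poly (r * r) * const_poly (R\<^sup>2))
           + (const_poly (1/2) * const_poly r + const_poly (1/2) * const_poly r) * x"
        by (simp add: algebra_simps const_poly_simps)
      then show ?thesis unfolding c1 c2 by simp
    qed
    also have "\<dots> \<in> cone"
      by (intro cone_add square_in_cone cone_scale c) auto
    finally show ?thesis .
  qed
  show "a \<in> cone" unfolding a_def by (rule *) (simp add: power2_eq_square)
  have "1 - a = const_poly (1/2) + const_poly (- (1 / (2 * R))) * x"
  proof -
    have "1 = const_poly (1/2) + (const_poly (1/2) :: 'e rpoly)"
      unfolding const_poly_simps(1)[symmetric] by (simp add: const_poly_simps)
    moreover have "const_poly (- (1 / (2 * R))) = - (const_poly (1 / (2 * R)) :: 'e rpoly)"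
      by (simp add: const_poly_def single_uminus)
    ultimately show ?thesis by (simp add: a_def algebra_simps)
  qed
  also have "\<dots> \<in> cone" by (rule *) (simp add: power2_eq_square)
  finally show "1 - a \<in> cone" .
qed

end

lemma positive_functional_ell:
  assumes "\<And>p. 0 \<le> ell y (p * p)"
  shows "positive_functional (ell y)"
  by unfold_locales (auto simp: ell_add ell_scale assms)

section \<open>A space-filling curve\<close>

text \<open>A continuous function of period 2 that is 0 on \<open>[0, 1/3]\<close> and 1 on
  \<open>[2/3, 1]\<close>, so that it recognises a leading ternary digit 0 or 2. The truncated
  cosine makes continuity and periodicity immediate.\<close>

definition plateau :: "real \<Rightarrow> real" where
  "plateau x = max 0 (min 1 (1 / 2 - cos (pi * x)))"

text \<open>The \<open>i\<close>-th coordinate of Schoenberg's curve in dimension \<open>n\<close>: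
  for \<open>s\<close> with ternary digits 0 and 2, the digits in positions \<open>n * k + i\<close>
  serve as the binary digits of the coordinate.\<close>

definition space_filling :: "nat \<Rightarrow> nat \<Rightarrow> real \<Rightarrow> real" where
  "space_filling n i s = suminf (\<lambda>k. plateau (3 ^ (n * k + i) * s) * (1 / 2) ^ Suc k)"

lemma plateau_bounds: "0 \<le> plateau x" "plateau x \<le> 1"
  by (auto simp: plateau_def)

lemma plateau_periodic: "plateau (x + 2 * real m) = plateau x"
proof -
  have "cos (pi * (x + 2 * real m)) = cos (pi * x + 2 * pi * of_int (int m))"
    by (simp add: algebra_simps)
  also have "\<dots> = cos (pi * x)"
    by (simp only: cos_add cos_int_2pin sin_int_2pin)
  finally show ?thesis by (simp add: plateau_def)
qed

lemma plateau_eq_0: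
  assumes "0 \<le> x" "x \<le> 1 / 3"
  shows "plateau x = 0"
proof -
  have "cos (pi / 3) \<le> cos (pi * x)"
    using assms by (intro cos_monotone_0_pi_le) (auto simp: field_simps)
  then show ?thesis by (simp add: plateau_def cos_60)
qed

lemma plateau_eq_1:
  assumes "2 / 3 \<le> x" "x \<le> 1"
  shows "plateau x = 1"
proof -
  have "cos (pi / 3) \<le> cos (pi * (1 - x))"
    using assms by (intro cos_monotone_0_pi_le) (auto simp: field_simps)
  also have "pi * (1 - x) = pi - pi * x" by (simp add: algebra_simps)
  finally show ?thesis by (simp add: plateau_def cos_60)
qed

lemma geometric_half_sums: "(\<lambda>k. (1 / 2 :: real) ^ Suc k) sums 1"
  using sums_mult[OF geometric_sums[of "1/2::real"], of "1/2"] by simp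

lemma summable_half: "summable (\<lambda>k. (1 / 2 :: real) ^ Suc k)"
  using geometric_half_sums by (rule sums_summable)

lemma summable_space_filling: "summable (\<lambda>k. plateau (3 ^ (n * k + i) * s) * (1 / 2) ^ Suc k)"
  by (rule summable_comparison_test'[OF summable_half])
     (use plateau_bounds in \<open>auto simp: abs_mult mult_le_one intro!: mult_right_le_one_le\<close>)

lemma space_filling_bounds: "0 \<le> space_filling n i s" "space_filling n i s \<le> 1"
proof -
  show "0 \<le> space_filling n i s"
    unfolding space_filling_def
    by (rule suminf_nonneg[OF summable_space_filling]) (simp add: plateau_bounds)
  have "space_filling n i s \<le> suminf (\<lambda>k. (1 / 2) ^ Suc k)"
    unfolding space_filling_def
    by (rule suminf_le[OF _ summable_space_filling summable_half])
       (simp add: plateau_bounds mult_left_le_one_le)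
  also have "\<dots> = 1" using geometric_half_sums by (rule sums_unique[symmetric])
  finally show "space_filling n i s \<le> 1" .
qed

lemma continuous_space_filling: "continuous_on UNIV (space_filling n i)"
proof -
  have "uniform_limit UNIV (\<lambda>m x. \<Sum>k<m. plateau (3 ^ (n * k + i) * x) * (1 / 2) ^ Suc k)
          (\<lambda>x. suminf (\<lambda>k. plateau (3 ^ (n * k + i) * x) * (1 / 2) ^ Suc k)) sequentially"
    by (rule Weierstrass_m_test[OF _ summable_half])
       (use plateau_bounds in \<open>auto simp: abs_mult intro!: mult_left_le_one_le\<close>)
  then show ?thesis
    unfolding space_filling_def[abs_def]
    by (rule uniform_limit_theorem[rotated])
       (auto intro!: always_eventually continuous_intros simp: plateau_def)
qed

lemma binary_expansion:
  assumes "0 \<le> q" "q \<le> (1::real)"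
  obtains a :: "nat \<Rightarrow> nat" where "\<And>k. a k \<le> 1" "(\<lambda>k. real (a k) * (1 / 2) ^ Suc k) sums q"
proof -
  \<comment> \<open>Remainders of the greedy binary expansion, rescaled to \<open>[0, 1]\<close>;
    the endpoint \<open>q = 1\<close> gets the constant digit 1.\<close>
  define r where "r = rec_nat q (\<lambda>_ r. 2 * r - (if r \<ge> 1 / 2 then 1 else 0))"
  define a :: "nat \<Rightarrow> nat" where "a k = (if r k \<ge> 1 / 2 then 1 else 0)" for k
  have r0: "r 0 = q" and rS: "r (Suc k) = 2 * r k - real (a k)" for k
    by (simp_all add: r_def a_def)
  have rb: "0 \<le> r k \<and> r k \<le> 1" for k
    by (induction k) (use assms in \<open>auto simp: r0 rS, auto simp: a_def\<close>)
  have tele: "q = (\<Sum>k<m. real (a k) * (1 / 2) ^ Suc k) + r m * (1 / 2) ^ m" for m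
  proof (induction m)
    case (Suc m)
    have "r m * (1 / 2) ^ m = real (a m) * (1 / 2) ^ Suc m + r (Suc m) * (1 / 2) ^ Suc m"
      by (simp add: rS field_simps)
    then show ?case using Suc by simp
  qed (simp add: r0)
  have "(\<lambda>m. r m * (1 / 2) ^ m) \<longlonglongrightarrow> 0"
  proof (rule Lim_null_comparison)
    show "\<forall>\<^sub>F m in sequentially. norm (r m * (1 / 2) ^ m) \<le> (1 / 2) ^ m"
      using rb by (intro always_eventually allI) (auto simp: abs_mult intro!: mult_left_le_one_le)
  qed (rule LIMSEQ_power_zero, simp)
  then have "(\<lambda>m. q - r m * (1 / 2) ^ m) \<longlonglongrightarrow> q - 0" by (intro tendsto_intros)
  moreover have "q - r m * (1 / 2) ^ m = (\<Sum>k<m. real (a k) * (1 / 2) ^ Suc k)" for m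
    using tele[of m] by linarith
  ultimately have "(\<lambda>k. real (a k) * (1 / 2) ^ Suc k) sums q" by (simp add: sums_def)
  then show ?thesis by (rule that[rotated]) (simp add: a_def)
qed

text \<open>Take the Cantor point with ternary digits \<open>2 * d j\<close>. Multiplication by
  \<open>3 ^ m\<close> shifts the digits; what is moved in front of the point is an even integer,
  lost in the period of \<open>plateau\<close>, and the leading digit places the rest in
  \<open>[0, 1/3]\<close> or \<open>[2/3, 1]\<close>.\<close>

lemma ternary_digits:
  fixes d :: "nat \<Rightarrow> nat"
  assumes "\<And>j. d j \<le> 1"
  obtains s where "0 \<le> s" "s \<le> 1" "\<And>m. plateau (3 ^ m * s) = real (d m)"
proof -
  define f where "f m j = 2 * real (d (m + j)) * (1 / 3) ^ Suc j" for m j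
  define t where "t m = suminf (\<lambda>j. f m j)" for m
  have g: "(\<lambda>j. 2 * (1 / 3 :: real) ^ Suc j) sums 1"
    using sums_mult[OF geometric_sums[of "1/3::real"], of "2/3"] by simp
  have le: "f m j \<le> 2 * (1 / 3) ^ Suc j" "0 \<le> f m j" for m j
    using assms[of "m + j"] by (auto simp: f_def)
  have sm: "summable (f m)" for m
    by (rule summable_comparison_test'[OF sums_summable[OF g]]) (use le[of m] in auto)
  have t0: "0 \<le> t m" for m unfolding t_def by (rule suminf_nonneg[OF sm le(2)])
  have t1: "t m \<le> 1" for m
    using suminf_le[OF le(1) sm sums_summable[OF g]] sums_unique[OF g] by (simp add: t_def)
  have rec: "t m = 2 * real (d m) / 3 + t (Suc m) / 3" for m
  proof -
    have "t m = f m 0 + suminf (\<lambda>j. f m (Suc j))" unfolding t_def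
      using suminf_split_head[OF sm[of m]] by simp
    also have "(\<lambda>j. f m (Suc j)) = (\<lambda>j. f (Suc m) j / 3)" by (simp add: f_def)
    also have "suminf (\<lambda>j. f (Suc m) j / 3) = t (Suc m) / 3"
      unfolding t_def by (rule suminf_divide[OF sm])
    finally show ?thesis by (simp add: f_def)
  qed
  have "\<exists>N. 3 ^ m * t 0 = t m + 2 * real N" for m
  proof (induction m)
    case 0 show ?case by (rule exI[of _ 0]) simp
  next
    case (Suc m)
    then obtain N where N: "3 ^ m * t 0 = t m + 2 * real N" by blast
    have "3 ^ Suc m * t 0 = 3 * (3 ^ m * t 0)" by simp
    also have "\<dots> = t (Suc m) + 2 * real (d m + 3 * N)" unfolding N using rec[of m] by simp
    finally show ?case by blast
  qed
  then have "plateau (3 ^ m * t 0) = plateau (t m)" for m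
    by (metis plateau_periodic)
  moreover have "plateau (t m) = real (d m)" for m
  proof (cases "d m = 0")
    case True
    then show ?thesis using rec[of m] t0[of m] t1[of "Suc m"] by (simp add: plateau_eq_0)
  next
    case False
    then have "d m = 1" using assms[of m] by simp
    then show ?thesis using rec[of m] t0[of "Suc m"] t1[of m] by (simp add: plateau_eq_1)
  qed
  ultimately show ?thesis using that[of "t 0"] t0 t1 by simp
qed

text \<open>Interleaving: binary digit \<open>k\<close> of coordinate \<open>i\<close> is stored at
  position \<open>n * k + i\<close> and recovered by \<open>mod\<close> and
  \<open>div\<close>.\<close>

lemma space_filling_surj:
  assumes q: "\<And>i. i < n \<Longrightarrow> 0 \<le> q i \<and> q i \<le> 1"
  obtains s where "0 \<le> s" "s \<le> 1" "\<And>i. i < n \<Longrightarrow> space_filling n i s = q i"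
proof -
  have "\<exists>a :: nat \<Rightarrow> nat. (\<forall>k. a k \<le> 1) \<and> (i < n \<longrightarrow> (\<lambda>k. real (a k) * (1 / 2) ^ Suc k) sums q i)" for i
  proof (cases "i < n")
    case True
    then show ?thesis using binary_expansion[of "q i"] q by metis
  qed (auto intro: exI[of _ "\<lambda>_. 0"])
  then obtain a :: "nat \<Rightarrow> nat \<Rightarrow> nat" where a: "\<And>i k. a i k \<le> 1"
    "\<And>i. i < n \<Longrightarrow> (\<lambda>k. real (a i k) * (1 / 2) ^ Suc k) sums q i"
    by metis
  define d where "d j = a (j mod n) (j div n)" for j
  obtain s where s: "0 \<le> s" "s \<le> 1" "\<And>m. plateau (3 ^ m * s) = real (d m)"
    using ternary_digits[of d] a(1) by (auto simp: d_def)
  have "space_filling n i s = q i" if "i < n" for i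
    using sums_unique[OF a(2)[OF that]] that by (simp add: space_filling_def s(3) d_def)
  then show ?thesis using that s by blast
qed

section \<open>The moment problem on a cube as a limit of Bernstein averages\<close>

lemma weak_limit_of_discrete:
  fixes J :: "nat \<Rightarrow> 'j set" and w s :: "nat \<Rightarrow> 'j \<Rightarrow> real"
  assumes fin: "\<And>n. finite (J n)" and w: "\<And>n j. j \<in> J n \<Longrightarrow> 0 \<le> w n j" "\<And>n. (\<Sum>j\<in>J n. w n j) = 1"
    and s: "\<And>n j. j \<in> J n \<Longrightarrow> 0 \<le> s n j \<and> s n j \<le> 1"
  obtains r \<rho> where "strict_mono r" "real_distribution \<rho>"
    "\<And>(f :: real \<Rightarrow> real) K. continuous_on UNIV f \<Longrightarrow> (\<And>x. \<bar>f x\<bar> \<le> K) \<Longrightarrow>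
       (\<lambda>n. \<Sum>j\<in>J (r n). w (r n) j * f (s (r n) j)) \<longlonglongrightarrow> (LINT x|\<rho>. f x)"
proof -
  define P where "P n = point_measure (J n) (\<lambda>j. ennreal (w n j))" for n
  define M where "M n = distr (P n) borel (s n)" for n
  have meas: "s n \<in> measurable (P n) borel" for n by (simp add: P_def measurable_point_measure_eq1)
  have emP: "emeasure (P n) (J n) = 1" for n
    using w(1)[of _ n] w(2)[of n] by (simp add: P_def emeasure_point_measure_finite[OF fin] sum_ennreal)
  interpret P: prob_space "P n" for n
    by standard (use emP in \<open>simp add: P_def space_point_measure\<close>)
  have rd: "real_distribution (M n)" for n
    unfolding M_def by (rule P.real_distribution_distr[OF meas])
  interpret M: real_distribution "M n" for n by (rule rd)
  have int: "(LINT x|M n. f x) = (\<Sum>j\<in>J n. w n j * f (s n j))" if "f \<in> borel_measurable borel" for f :: "real \<Rightarrow> real" and n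
    unfolding M_def
    by (subst integral_distr[OF meas that]) (simp add: P_def w lebesgue_integral_point_measure_finite[OF fin])
  \<comment> \<open>Tightness is tested on half-open intervals; this one contains every atom, since
    atoms lie in \<open>[0, 1]\<close>, so no mass can escape along the sequence.\<close>
  have full: "measure (M n) {-1<..1} = 1" for n
  proof -
    have "measure (M n) {-1<..1} = measure (P n) (s n -` {-1<..1} \<inter> space (P n))"
      unfolding M_def by (rule measure_distr[OF meas]) simp
    also have "s n -` {-1<..1} \<inter> space (P n) = space (P n)"
      using s[of _ n] by (force simp: P_def space_point_measure)
    finally show ?thesis by (simp add: P.prob_space)
  qed
  have "tight M"
    unfolding tight_def
  proof (intro conjI allI impI)
    show "\<exists>a b::real. a < b \<and> (\<forall>n. 1 - \<epsilon> < measure (M n) {a<..b})" if "0 < \<epsilon>" for \<epsilon> :: real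
      by (rule exI[of _ "-1"], rule exI[of _ 1]) (simp add: full that)
  qed (rule rd)
  from tight_imp_convergent_subsubsequence[OF this strict_mono_id]
  obtain r \<rho> where r: "strict_mono r" and \<rho>: "real_distribution \<rho>" and conv: "weak_conv_m (M \<circ> id \<circ> r) \<rho>"
    by blast
  show ?thesis
  proof (rule that[OF r \<rho>])
    fix f :: "real \<Rightarrow> real" and K
    assume f: "continuous_on UNIV f" "\<And>x. \<bar>f x\<bar> \<le> K"
    have "(\<lambda>n. integral\<^sup>L ((M \<circ> id \<circ> r) n) f) \<longlonglongrightarrow> integral\<^sup>L \<rho> f"
    proof (rule weak_conv_imp_integral_bdd_continuous_conv)
      show "\<And>n. real_distribution ((M \<circ> id \<circ> r) n)" using rd by simp
      show "isCont f x" for x using f(1) by (simp add: continuous_on_eq_continuous_at)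
    qed (use \<rho> conv f in \<open>auto simp: o_def\<close>)
    then show "(\<lambda>n. \<Sum>j\<in>J (r n). w (r n) j * f (s (r n) j)) \<longlonglongrightarrow> (LINT x|\<rho>. f x)"
      using f(1) by (simp add: int borel_measurable_continuous_onI)
  qed
qed

text \<open>The ratio compares falling factorials, as in sampling without replacement, with plain
  powers. Factor by factor the difference is at most \<open>j / (M - j)\<close>;
  \<open>2 * j \<le> M\<close> keeps every factor at most 1 in modulus, also those with
  \<open>k < l\<close>, so the differences may be added.\<close>

lemma binomial_ratio_bound:
  assumes "k \<le> M" "2 * j \<le> M" "0 < M"
  shows "\<bar>real (k choose j) / real (M choose j) - (real k / real M) ^ j\<bar> \<le> real j * real j / real (M - j)"
proof -
  have e: "real (n choose j) = (\<Prod>l<j. real n - real l) / fact j" for n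
    by (simp add: binomial_gbinomial gbinomial_prod_rev atLeast0LessThan)
  have "real (k choose j) / real (M choose j) = (\<Prod>l<j. (real k - real l) / (real M - real l))"
    by (simp add: e prod_dividef)
  moreover have "(real k / real M) ^ j = (\<Prod>l<j. real k / real M)" by simp
  ultimately have "\<bar>real (k choose j) / real (M choose j) - (real k / real M) ^ j\<bar>
      = norm ((\<Prod>l<j. (real k - real l) / (real M - real l)) - (\<Prod>l<j. real k / real M))"
    by simp
  also have "\<dots> \<le> (\<Sum>l<j. norm ((real k - real l) / (real M - real l) - real k / real M))"
  proof (rule norm_prod_diff)
    show "norm ((real k - real l) / (real M - real l)) \<le> 1" if "l \<in> {..<j}" for l
      using that assms by (auto simp: abs_if field_simps)
  qed (use assms in auto)
  also have "\<dots> \<le> (\<Sum>l<j. real j / real (M - j))"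
  proof (rule sum_mono)
    fix l assume l: "l \<in> {..<j}"
    have pos: "0 < real M" "0 < real M - real l" "0 < real M - real j" using l assms by auto
    have "(real k - real l) / (real M - real l) - real k / real M = - (real l * (real M - real k) / (real M * (real M - real l)))"
      using pos by (simp add: field_simps)
    also have "norm \<dots> = real l * ((real M - real k) / real M) / (real M - real l)"
      using pos assms by (simp add: abs_mult)
    also have "\<dots> \<le> real j * 1 / (real M - real j)"
      using pos l assms by (intro frac_le mult_mono) auto
    finally show "norm ((real k - real l) / (real M - real l) - real k / real M) \<le> real j / real (M - j)"
      using assms by (simp add: of_nat_diff)
  qed
  finally show ?thesis by simp
qed

definition bernstein :: "nat \<Rightarrow> nat \<Rightarrow> 'e::comm_monoid_add rpoly \<Rightarrow> 'e rpoly" where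
  "bernstein M k x = const_poly (real (M choose k)) * (x ^ k * (1 - x) ^ (M - k))"

lemma const_poly_of_nat: "const_poly (real n) = (of_nat n :: 'e::comm_monoid_add rpoly)"
  by (simp add: const_poly_def)

text \<open>Degree elevation: with binomial ratios as coefficients the identity is exact, whereas
  the values \<open>(k / M) ^ j\<close> would give an approximation only. Exactness is essential
  because \<open>L\<close> is applied to polynomials on which no norm is available.\<close>

lemma sum_bernstein:
  fixes x :: "'e::comm_monoid_add rpoly"
  assumes "j \<le> M"
  shows "(\<Sum>k\<le>M. const_poly (real (k choose j) / real (M choose j)) * bernstein M k x) = x ^ j"
proof -
  have "(\<Sum>k\<le>M. const_poly (real (k choose j) / real (M choose j)) * bernstein M k x)
      = (\<Sum>k\<in>{j..M}. const_poly (real (k choose j) / real (M choose j)) * bernstein M k x)"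
    by (rule sum.mono_neutral_right) (auto simp: const_poly_def binomial_eq_0)
  also have "\<dots> = (\<Sum>k\<in>{j..M}. x ^ j * (of_nat ((M - j) choose (k - j)) * x ^ (k - j) * (1 - x) ^ (M - k)))"
  proof (rule sum.cong)
    fix k assume k: "k \<in> {j..M}"
    have "real (M choose k) * real (k choose j) = real (M choose j) * real ((M - j) choose (k - j))"
      using k choose_mult[of j k M] by (metis atLeastAtMost_iff of_nat_mult)
    moreover have "real (M choose j) \<noteq> 0" using assms by simp
    ultimately have "real (k choose j) / real (M choose j) * real (M choose k) = real ((M - j) choose (k - j))"
      by (simp add: field_simps)
    then have e1: "const_poly (real (k choose j) / real (M choose j)) * const_poly (real (M choose k))
        = (of_nat ((M - j) choose (k - j)) :: 'e rpoly)"
      by (metis const_poly_of_nat const_poly_simps(3))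
    have e2: "x ^ k = x ^ j * x ^ (k - j)" using k by (simp flip: power_add)
    have "const_poly (real (k choose j) / real (M choose j)) * bernstein M k x
        = (const_poly (real (k choose j) / real (M choose j)) * const_poly (real (M choose k)))
           * (x ^ k * (1 - x) ^ (M - k))"
      by (simp only: bernstein_def mult.assoc)
    then show "const_poly (real (k choose j) / real (M choose j)) * bernstein M k x =
        x ^ j * (of_nat ((M - j) choose (k - j)) * x ^ (k - j) * (1 - x) ^ (M - k))"
      unfolding e1 e2 by (simp only: mult_ac)
  qed simp
  also have "\<dots> = x ^ j * (\<Sum>l\<le>M - j. of_nat ((M - j) choose l) * x ^ l * (1 - x) ^ (M - j - l))"
    unfolding sum_distrib_left
    by (rule sum.reindex_bij_witness[of _ "\<lambda>l. l + j" "\<lambda>k. k - j"])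
       (use assms in auto)
  also have "\<dots> = x ^ j"
    using binomial_ring[of x "1 - x" "M - j"] by (simp del: diff_diff_left)
  finally show ?thesis .
qed

lemma prod_power_upd:
  fixes b :: "'i \<Rightarrow> 'z::comm_monoid_mult"
  assumes "finite I" "i \<in> I"
  shows "(\<Prod>l\<in>I. b l ^ (j(i := Suc (j i))) l) = b i * (\<Prod>l\<in>I. b l ^ j l)"
  using assms by (simp add: prod.remove[of I i] mult_ac)

context positive_functional
begin

lemma const_poly_prod: "(\<Prod>i\<in>I. const_poly (c i)) = (const_poly (\<Prod>i\<in>I. c i) :: 'e rpoly)"
  by (induction I rule: infinite_finite_induct) (auto simp: const_poly_simps)

text \<open>All variables are expanded at once. A moment becomes an average over a grid whose
  weights do not depend on \<open>j\<close>, so one discrete measure serves all moments with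
  exponents up to \<open>M\<close>.\<close>

lemma bernstein_sampling:
  assumes I: "finite I" and j: "\<And>i. i \<in> I \<Longrightarrow> j i \<le> M"
  shows "L (\<Prod>i\<in>I. a i ^ j i) = (\<Sum>g\<in>PiE I (\<lambda>_. {..M}).
           L (\<Prod>i\<in>I. bernstein M (g i) (a i)) * (\<Prod>i\<in>I. real (g i choose j i) / real (M choose j i)))"
proof -
  have "(\<Prod>i\<in>I. a i ^ j i) = (\<Prod>i\<in>I. \<Sum>k\<le>M. const_poly (real (k choose j i) / real (M choose j i)) * bernstein M k (a i))"
    using j by (intro prod.cong) (auto simp: sum_bernstein)
  also have "\<dots> = (\<Sum>g\<in>PiE I (\<lambda>_. {..M}). const_poly (\<Prod>i\<in>I. real (g i choose j i) / real (M choose j i)) * (\<Prod>i\<in>I. bernstein M (g i) (a i)))"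
    by (subst prod_sum_PiE) (auto simp: I prod.distrib const_poly_prod)
  finally have e: "(\<Prod>i\<in>I. a i ^ j i) = \<dots>" .
  show ?thesis unfolding e L_sum L_scale by (intro sum.cong refl mult.commute)
qed

lemma bernstein_weight_nonneg:
  assumes I: "finite I" and a: "\<And>i. i \<in> I \<Longrightarrow> a i \<in> cone \<and> 1 - a i \<in> cone"
  shows "0 \<le> L (\<Prod>i\<in>I. bernstein M (g i) (a i))"
proof -
  let ?q = "\<Prod>i\<in>I. a i ^ g i * (1 - a i) ^ (M - g i)"
  have e: "(\<Prod>i\<in>I. bernstein M (g i) (a i)) = const_poly (\<Prod>i\<in>I. real (M choose g i)) * ?q"
    unfolding bernstein_def prod.distrib const_poly_prod ..
  have "?q \<in> cone" by (rule cone_prod[OF I a])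
  then have "0 \<le> L ?q" using coneD[of ?q 1] by simp
  then show ?thesis unfolding e L_scale by (simp add: prod_nonneg)
qed

text \<open>The Bernstein weights are nonnegative with total 1, hence a discrete probability on the
  grid. Every grid point is reached by the curve at some parameter, and a weak limit is taken for
  the laws of this parameter; the coordinates of the curve are continuous, so the integrals
  converge.\<close>

lemma hausdorff_moment:
  fixes a :: "'i \<Rightarrow> 'e rpoly"
  assumes I: "finite I" and a: "\<And>i. i \<in> I \<Longrightarrow> a i \<in> cone \<and> 1 - a i \<in> cone" and L1: "L 1 = 1"
  obtains \<rho> X where "real_distribution \<rho>" "\<And>i. continuous_on UNIV (X i)"
    "\<And>i s. 0 \<le> X i s \<and> X i s \<le> (1::real)"
    "\<And>j. L (\<Prod>i\<in>I. a i ^ j i) = (LINT s|\<rho>. (\<Prod>i\<in>I. X i s ^ j i))"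
proof -
  define n where "n = card I"
  obtain idx where idx: "bij_betw idx I {..<n}"
    using ex_bij_betw_finite_nat[OF I] by (auto simp: n_def atLeast0LessThan)
  define X where "X i = space_filling n (idx i)" for i
  \<comment> \<open>\<open>Suc M\<close> subdivisions, so that the grid spacing makes sense for
    every \<open>M\<close>.\<close>
  define J where "J M = PiE I (\<lambda>_. {..Suc M})" for M
  define w where "w M g = L (\<Prod>i\<in>I. bernstein (Suc M) (g i) (a i))" for M and g :: "'i \<Rightarrow> nat"
  define s where "s M g = (SOME s. 0 \<le> s \<and> s \<le> 1 \<and> (\<forall>i\<in>I. X i s = real (g i) / real (Suc M)))"
    for M and g :: "'i \<Rightarrow> nat"
  have s: "0 \<le> s M g \<and> s M g \<le> 1 \<and> (\<forall>i\<in>I. X i (s M g) = real (g i) / real (Suc M))"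
    if True: "g \<in> J M" for M g
  proof -
    let ?q = "\<lambda>l. real (g (inv_into I idx l)) / real (Suc M)"
    have "0 \<le> ?q l \<and> ?q l \<le> 1" if "l < n" for l
    proof -
      have "inv_into I idx l \<in> I" using that idx by (metis bij_betw_def inv_into_into lessThan_iff)
      then have "g (inv_into I idx l) \<le> Suc M" using True by (auto simp: J_def)
      then show ?thesis by (simp add: field_simps)
    qed
    then obtain s where s: "0 \<le> s" "s \<le> 1" "\<And>l. l < n \<Longrightarrow> space_filling n l s = ?q l"
      by (rule space_filling_surj[of n ?q]) auto
    have "X i s = real (g i) / real (Suc M)" if "i \<in> I" for i
      using s(3)[of "idx i"] that idx unfolding X_def
      by (metis bij_betw_apply bij_betw_inv_into_left lessThan_iff)
    then show ?thesis unfolding s_def using s by - (rule someI_ex, blast)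
  qed
  have finJ: "finite (J M)" for M by (simp add: J_def I finite_PiE)
  have w0: "0 \<le> w M g" for M g unfolding w_def by (rule bernstein_weight_nonneg[OF I a])
  have sampling: "L (\<Prod>i\<in>I. a i ^ j i) =
      (\<Sum>g\<in>J M. w M g * (\<Prod>i\<in>I. real (g i choose j i) / real (Suc M choose j i)))"
    if "\<And>i. i \<in> I \<Longrightarrow> j i \<le> Suc M" for j M
    unfolding J_def w_def by (rule bernstein_sampling[OF I that])
  have w1: "(\<Sum>g\<in>J M. w M g) = 1" for M
    using sampling[of "\<lambda>_. 0" M] L1 by simp
  have sb: "0 \<le> s M g \<and> s M g \<le> 1" if "g \<in> J M" for M g using s[OF that] by blast
  obtain r \<rho> where r: "strict_mono r" and \<rho>: "real_distribution \<rho>" and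
    conv: "\<And>(f :: real \<Rightarrow> real) K. continuous_on UNIV f \<Longrightarrow> (\<And>x. \<bar>f x\<bar> \<le> K) \<Longrightarrow>
       (\<lambda>n. \<Sum>g\<in>J (r n). w (r n) g * f (s (r n) g)) \<longlonglongrightarrow> (LINT x|\<rho>. f x)"
  proof (rule weak_limit_of_discrete[of J w s, OF finJ w0 w1 sb])
    fix r \<rho>
    assume "strict_mono r" "real_distribution \<rho>"
      "\<And>(f :: real \<Rightarrow> real) K. continuous_on UNIV f \<Longrightarrow> (\<And>x. \<bar>f x\<bar> \<le> K) \<Longrightarrow>
       (\<lambda>n. \<Sum>g\<in>J (r n). w (r n) g * f (s (r n) g)) \<longlonglongrightarrow> (LINT x|\<rho>. f x)"
    then show thesis by (rule that)
  qed
  have Xb: "0 \<le> X i s \<and> X i s \<le> 1" for i s by (simp add: X_def space_filling_bounds)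
  have Xc: "continuous_on UNIV (X i)" for i unfolding X_def by (rule continuous_space_filling)
  have "L (\<Prod>i\<in>I. a i ^ j i) = (LINT s|\<rho>. (\<Prod>i\<in>I. X i s ^ j i))" for j
  proof -
    let ?f = "\<lambda>s. \<Prod>i\<in>I. X i s ^ j i"
    let ?b = "\<lambda>M. \<Sum>i\<in>I. real (j i) * real (j i) / real (Suc M - j i)"
    have c1: "(\<lambda>n. \<Sum>g\<in>J (r n). w (r n) g * ?f (s (r n) g)) \<longlonglongrightarrow> (LINT x|\<rho>. ?f x)"
    proof (rule conv)
      show "continuous_on UNIV ?f" by (intro continuous_intros Xc)
      show "\<bar>?f x\<bar> \<le> 1" for x
        unfolding abs_prod by (intro prod_le_1) (use Xb in \<open>auto intro: power_le_one\<close>)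
    qed
    \<comment> \<open>The exact coefficients are binomial ratios, the integrand takes powers of
      \<open>g i / Suc M\<close>; their difference is bounded uniformly over the grid by a quantity
      that vanishes as the grid is refined.\<close>
    have err: "\<bar>L (\<Prod>i\<in>I. a i ^ j i) - (\<Sum>g\<in>J M. w M g * ?f (s M g))\<bar> \<le> ?b M"
      if M: "\<And>i. i \<in> I \<Longrightarrow> 2 * j i \<le> Suc M" for M
    proof -
      let ?h = "\<lambda>g. \<Prod>i\<in>I. real (g i choose j i) / real (Suc M choose j i)"
      have pw: "\<bar>?h g - ?f (s M g)\<bar> \<le> ?b M" if g: "g \<in> J M" for g
      proof -
        have gi: "g i \<le> Suc M" if "i \<in> I" for i using g that by (auto simp: J_def)
        have "norm (?h g - (\<Prod>i\<in>I. X i (s M g) ^ j i)) \<le>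
           (\<Sum>i\<in>I. norm (real (g i choose j i) / real (Suc M choose j i) - X i (s M g) ^ j i))"
        proof (rule norm_prod_diff)
          show "norm (real (g i choose j i) / real (Suc M choose j i)) \<le> 1" if "i \<in> I" for i
            using gi[OF that] by (cases "real (Suc M choose j i) = 0") (auto simp: divide_le_eq_1 intro: binomial_right_mono)
          show "norm (X i (s M g) ^ j i) \<le> 1" if "i \<in> I" for i
            using Xb[of i] by (simp add: power_le_one)
        qed
        also have "\<dots> \<le> ?b M"
        proof (rule sum_mono)
          fix i assume i: "i \<in> I"
          have "X i (s M g) = real (g i) / real (Suc M)" using s[OF g] i by blast
          then show "norm (real (g i choose j i) / real (Suc M choose j i) - X i (s M g) ^ j i)
              \<le> real (j i) * real (j i) / real (Suc M - j i)"
            using binomial_ratio_bound[OF gi[OF i] M[OF i]] by simp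
        qed
        finally show ?thesis by simp
      qed
      have "L (\<Prod>i\<in>I. a i ^ j i) = (\<Sum>g\<in>J M. w M g * ?h g)"
        using M by (intro sampling) fastforce
      then have "L (\<Prod>i\<in>I. a i ^ j i) - (\<Sum>g\<in>J M. w M g * ?f (s M g)) = (\<Sum>g\<in>J M. w M g * (?h g - ?f (s M g)))"
        by (simp add: right_diff_distrib sum_subtractf)
      also have "\<bar>\<dots>\<bar> \<le> (\<Sum>g\<in>J M. w M g * ?b M)"
        by (rule order_trans[OF sum_abs]) (use pw w0 in \<open>auto simp: abs_mult intro!: sum_mono mult_left_mono\<close>)
      also have "\<dots> = ?b M" by (simp add: w1 flip: sum_distrib_right)
      finally show ?thesis .
    qed
    have "?b \<longlonglongrightarrow> (\<Sum>i\<in>I. 0)"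
    proof (rule tendsto_sum)
      show "(\<lambda>M. real (j i) * real (j i) / real (Suc M - j i)) \<longlonglongrightarrow> 0" for i
        by real_asymp
    qed
    then have l0: "(\<lambda>n. ?b (r n)) \<longlonglongrightarrow> 0"
      using LIMSEQ_subseq_LIMSEQ[OF _ r] by (auto simp: o_def)
    have l1: "\<forall>\<^sub>F n in sequentially. norm (L (\<Prod>i\<in>I. a i ^ j i) - (\<Sum>g\<in>J (r n). w (r n) g * ?f (s (r n) g))) \<le> ?b (r n)"
      using eventually_ge_at_top[of "\<Sum>i\<in>I. 2 * j i"]
    proof eventually_elim
      case (elim n)
      have "2 * j i \<le> Suc (r n)" if "i \<in> I" for i
        using member_le_sum[OF that _ I, of "\<lambda>i. 2 * j i"] elim seq_suble[OF r, of n] by simp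
      from err[OF this] show ?case by (simp only: real_norm_def)
    qed
    have l2: "(\<lambda>n. L (\<Prod>i\<in>I. a i ^ j i) - (\<Sum>g\<in>J (r n). w (r n) g * ?f (s (r n) g))) \<longlonglongrightarrow> 0"
      by (rule Lim_null_comparison[OF l1 l0])
    from tendsto_diff[OF tendsto_const[of "L (\<Prod>i\<in>I. a i ^ j i)"] l2]
    have "(\<lambda>n. \<Sum>g\<in>J (r n). w (r n) g * ?f (s (r n) g)) \<longlonglongrightarrow> L (\<Prod>i\<in>I. a i ^ j i)" by simp
    from LIMSEQ_unique[OF this c1] show ?thesis .
  qed
  with \<rho> Xc Xb show ?thesis by (rule that)
qed

text \<open>Applies the result for \<open>[0, 1]\<close> to the rescaled variables. Since
  \<open>x i\<close> is affine in \<open>a i\<close>, moments in \<open>x\<close> follow from those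
  in \<open>a\<close> one factor at a time.\<close>

lemma bounded_moment:
  fixes x :: "'i \<Rightarrow> 'e rpoly"
  assumes I: "finite I" and R: "0 < R" and x: "\<And>i. i \<in> I \<Longrightarrow> const_poly (R\<^sup>2) - x i * x i \<in> cone" and L1: "L 1 = 1"
  obtains \<rho> X where "real_distribution \<rho>" "\<And>i. continuous_on UNIV (X i)"
    "\<And>i s. \<bar>X i s\<bar> \<le> R"
    "\<And>j. L (\<Prod>i\<in>I. x i ^ j i) = (LINT s|\<rho>. (\<Prod>i\<in>I. X i s ^ j i))"
proof -
  define a where "a i = const_poly (1 / 2) + const_poly (1 / (2 * R)) * x i" for i
  have "a i \<in> cone \<and> 1 - a i \<in> cone" if "i \<in> I" for i
    using affine_in_cone[OF R x[OF that]] by (simp add: a_def)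
  then obtain \<rho> Y where \<rho>: "real_distribution \<rho>" and Yc: "\<And>i. continuous_on UNIV (Y i)"
    and Yb: "\<And>i s. 0 \<le> Y i s \<and> Y i s \<le> (1::real)"
    and Ym: "\<And>j. L (\<Prod>i\<in>I. a i ^ j i) = (LINT s|\<rho>. (\<Prod>i\<in>I. Y i s ^ j i))"
  proof (rule hausdorff_moment[OF I _ L1, of a])
    fix \<rho> Y
    assume "real_distribution \<rho>" "\<And>i. continuous_on UNIV (Y i)" "\<And>i s. 0 \<le> Y i s \<and> Y i s \<le> (1::real)"
      "\<And>j. L (\<Prod>i\<in>I. a i ^ j i) = (LINT s|\<rho>. (\<Prod>i\<in>I. Y i s ^ j i))"
    then show thesis by (rule that)
  qed
  interpret \<rho>: real_distribution \<rho> by (rule \<rho>)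
  define X where "X i s = R * (2 * Y i s - 1)" for i s
  have Xc: "continuous_on UNIV (X i)" for i unfolding X_def by (intro continuous_intros Yc)
  have Xb: "\<bar>X i s\<bar> \<le> R" for i s
    using Yb[of i s] R by (auto simp: X_def abs_mult abs_le_iff intro: mult_left_le)
  have xa: "x i = const_poly (2 * R) * a i - const_poly R" for i
  proof -
    have "const_poly (2 * R) * a i - const_poly R
       = (const_poly (2 * R) * const_poly (1 / 2) - const_poly R) + (const_poly (2 * R) * const_poly (1 / (2 * R))) * x i"
      by (simp add: a_def algebra_simps)
    also have "const_poly (2 * R) * const_poly (1 / 2) - const_poly R = (0 :: 'e rpoly)"
      unfolding const_poly_simps(3)[symmetric] by simp
    also have "const_poly (2 * R) * const_poly (1 / (2 * R)) = (1 :: 'e rpoly)"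
      unfolding const_poly_simps(3)[symmetric] using R by (simp add: const_poly_simps)
    finally show ?thesis by simp
  qed
  \<comment> \<open>\<open>rel p f\<close> says that \<open>f\<close> represents \<open>p\<close>
    against all monomials in \<open>a\<close>. Quantifying over these monomials makes the relation
    stable under multiplication by \<open>x i\<close>, which mixes two of them.\<close>
  define rel where "rel p f \<longleftrightarrow> continuous_on UNIV f \<and> (\<exists>K. \<forall>s. \<bar>f s\<bar> \<le> K) \<and>
     (\<forall>j. L (p * (\<Prod>i\<in>I. a i ^ j i)) = (LINT s|\<rho>. f s * (\<Prod>i\<in>I. Y i s ^ j i)))"
    for p and f :: "real \<Rightarrow> real"
  have rel1: "rel 1 (\<lambda>_. 1)" unfolding rel_def using Ym by auto
  have step: "rel (x i * p) (\<lambda>s. X i s * f s)" if i: "i \<in> I" and rel: "rel p f" for i p f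
  proof -
    from rel obtain K where f: "continuous_on UNIV f" "\<And>s. \<bar>f s\<bar> \<le> K"
      and fm: "\<And>j. L (p * (\<Prod>i\<in>I. a i ^ j i)) = (LINT s|\<rho>. f s * (\<Prod>i\<in>I. Y i s ^ j i))"
      by (auto simp: rel_def)
    have int: "integrable \<rho> (\<lambda>s. f s * (\<Prod>i\<in>I. Y i s ^ j i))" for j
    proof (rule \<rho>.integrable_const_bound[of _ K])
      have "norm (f s * (\<Prod>i\<in>I. Y i s ^ j i)) \<le> K * 1" for s
        unfolding norm_mult using f(2)[of s] Yb
        by (intro mult_mono) (auto simp: abs_prod intro!: prod_le_1 power_le_one prod_nonneg)
      then show "AE s in \<rho>. norm (f s * (\<Prod>i\<in>I. Y i s ^ j i)) \<le> K" by simp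
      show "(\<lambda>s. f s * (\<Prod>i\<in>I. Y i s ^ j i)) \<in> borel_measurable \<rho>"
        by (simp add: borel_measurable_continuous_onI continuous_intros f(1) Yc)
    qed
    note prodS = prod_power_upd[OF I i]
    have "L (x i * p * (\<Prod>i\<in>I. a i ^ j i)) = (LINT s|\<rho>. X i s * f s * (\<Prod>i\<in>I. Y i s ^ j i))" for j
    proof -
      let ?j = "j(i := Suc (j i))"
      have "x i * p * (\<Prod>i\<in>I. a i ^ j i) =
          const_poly (2 * R) * (p * (\<Prod>l\<in>I. a l ^ ?j l)) - const_poly R * (p * (\<Prod>i\<in>I. a i ^ j i))"
        by (simp only: prodS xa) (simp add: algebra_simps)
      then have "L (x i * p * (\<Prod>i\<in>I. a i ^ j i)) =
          2 * R * (LINT s|\<rho>. f s * (\<Prod>i\<in>I. Y i s ^ ?j i)) - R * (LINT s|\<rho>. f s * (\<Prod>i\<in>I. Y i s ^ j i))"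
        by (simp only: L_diff L_scale fm)
      also have "\<dots> = (LINT s|\<rho>. 2 * R * (f s * (\<Prod>i\<in>I. Y i s ^ ?j i)) - R * (f s * (\<Prod>i\<in>I. Y i s ^ j i)))"
        using int[of ?j] int[of j] by simp
      also have "\<dots> = (LINT s|\<rho>. X i s * f s * (\<Prod>i\<in>I. Y i s ^ j i))"
      proof -
        have pY: "(\<Prod>l\<in>I. Y l s ^ ?j l) = Y i s * (\<Prod>l\<in>I. Y l s ^ j l)" for s
          by (rule prodS)
        show ?thesis unfolding pY X_def by (simp add: algebra_simps)
      qed
      finally show ?thesis .
    qed
    moreover have "\<bar>X i s * f s\<bar> \<le> R * K" for s
      unfolding abs_mult using Xb f(2) R by (intro mult_mono) auto
    ultimately show ?thesis unfolding rel_def using f(1) Xc by (auto intro!: continuous_intros)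
  qed
  have power: "rel (x i ^ n * p) (\<lambda>s. X i s ^ n * f s)" if "i \<in> I" "rel p f" for i p f n
  proof (induction n)
    case (Suc n)
    from step[OF that(1) Suc] show ?case by (simp add: mult.assoc)
  qed (use that in simp)
  have "rel (\<Prod>i\<in>K. x i ^ j i) (\<lambda>s. \<Prod>i\<in>K. X i s ^ j i)" if "K \<subseteq> I" for K j
    using finite_subset[OF that I] that
  proof (induction K rule: finite_induct)
    case (insert i K)
    then show ?case using power[of i "\<Prod>i\<in>K. x i ^ j i" "\<lambda>s. \<Prod>i\<in>K. X i s ^ j i"] by simp
  qed (simp add: rel1)
  from this[OF order_refl] have relI: "rel (\<Prod>i\<in>I. x i ^ j i) (\<lambda>s. \<Prod>i\<in>I. X i s ^ j i)" for j .
  have relD: "L p = (LINT s|\<rho>. f s)" if "rel p f" for p f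
  proof -
    from that have "\<forall>j. L (p * (\<Prod>i\<in>I. a i ^ j i)) = (LINT s|\<rho>. f s * (\<Prod>i\<in>I. Y i s ^ j i))"
      unfolding rel_def by (elim conjE)
    from this[THEN spec, of "\<lambda>_. 0"] show ?thesis by simp
  qed
  from \<rho> Xc Xb relD[OF relI] show ?thesis by (rule that)
qed

end

section \<open>Absolutely continuous functions\<close>

lemma abs_continuousE:
  assumes "abs_continuous_on a b f" "0 < e"
  obtains \<delta> where "\<delta> > 0" "\<And>(n :: nat) (l :: nat \<Rightarrow> real) r.
        (\<forall>i<n. a \<le> l i \<and> l i \<le> r i \<and> r i \<le> b) \<and>
        (\<forall>i<n. \<forall>j<n. i \<noteq> j \<longrightarrow> {l i<..<r i} \<inter> {l j<..<r j} = {}) \<and>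
        (\<Sum>i<n. r i - l i) < \<delta> \<Longrightarrow> (\<Sum>i<n. \<bar>f (r i) - f (l i)\<bar>) < e"
proof -
  from assms(1)[unfolded abs_continuous_on_def, THEN spec, THEN mp, OF assms(2)]
  show ?thesis
  proof (elim exE conjE)
    fix \<delta> assume "\<delta> > 0" and H: "\<forall>n :: nat. \<forall>l r :: nat \<Rightarrow> real.
        (\<forall>i<n. a \<le> l i \<and> l i \<le> r i \<and> r i \<le> b) \<and>
        (\<forall>i<n. \<forall>j<n. i \<noteq> j \<longrightarrow> {l i<..<r i} \<inter> {l j<..<r j} = {}) \<and>
        (\<Sum>i<n. r i - l i) < \<delta> \<longrightarrow> (\<Sum>i<n. \<bar>f (r i) - f (l i)\<bar>) < e"
    show ?thesis by (rule that[OF \<open>\<delta> > 0\<close> H[rule_format]])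
  qed
qed

text \<open>A direct gauge argument. Intervals tagged where the derivative exists are estimated by
  differentiability; those tagged in the null set \<open>N\<close> lie in an open set of small
  measure, where absolute continuity bounds the increments of \<open>f\<close>.\<close>

lemma fundamental_theorem_abs_continuous:
  assumes ab: "a \<le> b" and ac: "abs_continuous_on a b f"
    and der: "AE t in lebesgue_on {a..b}. (f has_real_derivative \<phi> t) (at t within {a..b})"
  shows "(\<phi> has_integral (f b - f a)) {a..b}"
proof -
  define N where "N = {t\<in>{a..b}. \<not> (f has_real_derivative \<phi> t) (at t within {a..b})}"
  obtain M where M: "M \<in> null_sets (lebesgue_on {a..b})" "N \<subseteq> M"
    using der by (auto simp: eventually_ae_filter N_def space_restrict_space)
  then have "M \<in> null_sets lebesgue"
    by (simp add: null_sets_restrict_space)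
  then have negN: "negligible N" using M(2) by (meson negligible_iff_null_sets negligible_subset)
  \<comment> \<open>Changing the integrand on a null set does not affect the integral; with value
    zero there, intervals tagged in \<open>N\<close> contribute increments of \<open>f\<close>
    only.\<close>
  define \<psi> where "\<psi> t = (if t \<in> N then 0 else \<phi> t)" for t
  have "(\<psi> has_integral (f b - f a)) (cbox a b)"
    unfolding has_integral
  proof (intro allI impI)
    fix e :: real assume e: "0 < e"
    obtain \<delta> where \<delta>: "\<delta> > 0" and ac': "\<And>(n :: nat) (l :: nat \<Rightarrow> real) r.
        (\<forall>i<n. a \<le> l i \<and> l i \<le> r i \<and> r i \<le> b) \<and>
        (\<forall>i<n. \<forall>j<n. i \<noteq> j \<longrightarrow> {l i<..<r i} \<inter> {l j<..<r j} = {}) \<and>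
        (\<Sum>i<n. r i - l i) < \<delta> \<Longrightarrow> (\<Sum>i<n. \<bar>f (r i) - f (l i)\<bar>) < e / 2"
      by (rule abs_continuousE[OF ac half_gt_zero[OF e]]) blast
    obtain G where G: "open G" "N \<subseteq> G" "G \<in> lmeasurable" "measure lebesgue G < \<delta>"
    proof -
      have "N \<in> sets lebesgue" using negN by (simp add: negligible_imp_sets)
      then obtain G where G: "open G" "N \<subseteq> G" "G - N \<in> lmeasurable" "emeasure lebesgue (G - N) < ennreal \<delta>"
        using sets_lebesgue_outer_open \<delta> by blast
      have Nm: "N \<in> lmeasurable" "measure lebesgue N = 0"
        using negN by (auto simp: negligible_iff_measure)
      have "G = (G - N) \<union> N" using G by auto
      then have "G \<in> lmeasurable" using G(3) Nm by (metis fmeasurable.Un)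
      moreover have "measure lebesgue G \<le> measure lebesgue (G - N) + measure lebesgue N"
        using measure_Un_le[of "G - N" lebesgue N] G(3) Nm \<open>G = (G - N) \<union> N\<close> by (metis fmeasurableD)
      moreover have "measure lebesgue (G - N) < \<delta>"
        using G(3,4) \<delta> by (simp add: emeasure_eq_measure2 ennreal_less_iff)
      ultimately show ?thesis using that G Nm by auto
    qed
    \<comment> \<open>Chosen so that the error \<open>\<epsilon> * (b - a)\<close> is at most
      \<open>e / 2\<close>; the added 1 covers the case \<open>a = b\<close>.\<close>
    define \<epsilon> where "\<epsilon> = e / (2 * (b - a + 1))"
    have \<epsilon>: "\<epsilon> > 0" using e ab by (simp add: \<epsilon>_def)
    have "\<exists>d>0. x \<in> {a..b} - N \<longrightarrow>
         (\<forall>y\<in>{a..b}. norm (y-x) < d \<longrightarrow> norm (f y - f x - (y-x) *\<^sub>R \<phi> x) \<le> \<epsilon> * norm (y-x))" for x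
    proof (cases "x \<in> {a..b} - N")
      case True
      then have "(f has_vector_derivative \<phi> x) (at x within {a..b})"
        by (simp add: N_def has_real_derivative_iff_has_vector_derivative)
      then show ?thesis
        unfolding has_vector_derivative_def has_derivative_within_alt using \<epsilon> by blast
    qed (auto intro: exI[of _ 1])
    then obtain d where d: "\<And>x. 0 < d x"
        "\<And>x y. x \<in> {a..b} - N \<Longrightarrow> y \<in> {a..b} \<Longrightarrow> norm (y-x) < d x
                        \<Longrightarrow> norm (f y - f x - (y-x) *\<^sub>R \<phi> x) \<le> \<epsilon> * norm (y-x)"
      by metis
    define \<gamma> where "\<gamma> x = (if x \<in> N then G else ball x (d x))" for x
    have gauge: "gauge \<gamma>" using G(1,2) d(1) by (auto simp: gauge_def \<gamma>_def)
    show "\<exists>\<gamma>. gauge \<gamma> \<and> (\<forall>\<D>. \<D> tagged_division_of cbox a b \<and> \<gamma> fine \<D> \<longrightarrow>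
        norm ((\<Sum>(x, k)\<in>\<D>. measure lborel k *\<^sub>R \<psi> x) - (f b - f a)) < e)"
    proof (intro exI[of _ \<gamma>] conjI gauge allI impI; elim conjE)
      fix p assume p: "p tagged_division_of cbox a b" "\<gamma> fine p"
      have fin: "finite p" using p(1) by blast
      define D where "D x K = measure lborel K *\<^sub>R \<psi> x - (f (Sup K) - f (Inf K))" for x K
      have K: "\<exists>u v. K = {u..v} \<and> u \<le> v \<and> x \<in> {u..v} \<and> a \<le> u \<and> v \<le> b \<and> x \<in> {a..b} \<and> {u..v} \<subseteq> \<gamma> x
          \<and> Sup K = v \<and> Inf K = u \<and> measure lborel K = v - u" if xKp: "(x, K) \<in> p" for x K
      proof -
        have xK: "x \<in> K" "K \<subseteq> cbox a b" using p(1) xKp by blast+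
        then obtain u v where k: "K = cbox u v" using tagged_division_ofD(4)[OF p(1) xKp] by blast
        have uv: "u \<le> v" using xK k by auto
        have "K \<subseteq> \<gamma> x" using p(2) xKp by (auto simp: fine_def)
        moreover have "a \<le> u" "v \<le> b" using xK uv by (auto simp: k)
        ultimately show ?thesis using xK uv k by (intro exI[of _ u] exI[of _ v]) auto
      qed
      have ba: "b - a = (\<Sum>(x,K)\<in>p. Sup K - Inf K)" "f b - f a = (\<Sum>(x,K)\<in>p. f (Sup K) - f (Inf K))"
        using additive_tagged_division_1[where f= "\<lambda>x. x"] additive_tagged_division_1[where f= f] ab p(1) by auto
      define p1 where "p1 = {(x, K) \<in> p. x \<notin> N}"
      define p2 where "p2 = {(x, K) \<in> p. x \<in> N}"
      have p12: "p = p1 \<union> p2" "p1 \<inter> p2 = {}" "p1 \<subseteq> p" "p2 \<subseteq> p" by (auto simp: p1_def p2_def)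
      have fin12: "finite p1" "finite p2" using fin p12 finite_subset by blast+
      have "(\<Sum>(x, K)\<in>p. measure lborel K *\<^sub>R \<psi> x) - (f b - f a) = (\<Sum>(x, K)\<in>p. D x K)"
        by (simp add: ba(2) D_def split_def sum_subtractf)
      also have "\<dots> = (\<Sum>(x, K)\<in>p1. D x K) + (\<Sum>(x, K)\<in>p2. D x K)"
        using p12 fin12 by (metis sum.union_disjoint)
      also have "norm \<dots> \<le> \<epsilon> * (b - a) + (\<Sum>(x, K)\<in>p2. \<bar>f (Sup K) - f (Inf K)\<bar>)"
      proof (rule order_trans[OF norm_triangle_ineq add_mono])
        have "norm (\<Sum>(x, K)\<in>p1. D x K) \<le> (\<Sum>(x, K)\<in>p1. \<epsilon> * (Sup K - Inf K))"
          unfolding split_def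
        proof (rule sum_norm_le)
          fix q assume q: "q \<in> p1"
          obtain x K' where xk: "q = (x, K')" by (cases q)
          then have xp: "(x, K') \<in> p" "x \<notin> N" using q by (auto simp: p1_def)
          obtain u v where uv: "K' = {u..v}" "u \<le> v" "x \<in> {u..v}" "a \<le> u" "v \<le> b" "x \<in> {a..b}"
             "{u..v} \<subseteq> \<gamma> x" "Sup K' = v" "Inf K' = u" "measure lborel K' = v - u" using K[OF xp(1)] by blast
          have near: "norm (u - x) < d x" "norm (v - x) < d x"
          proof -
            have "u \<in> \<gamma> x" "v \<in> \<gamma> x" using uv(2,7) by auto
            then show "norm (u - x) < d x" "norm (v - x) < d x"
              using xp(2) by (simp_all add: \<gamma>_def dist_norm norm_minus_commute)
          qed
          \<comment> \<open>Straddle estimate: the increment over the interval is split at the tag,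
            and each half is compared with the derivative there.\<close>
          have "norm (D x K') = norm (f u - f x - (u - x) *\<^sub>R \<phi> x - (f v - f x - (v - x) *\<^sub>R \<phi> x))"
            using uv xp by (simp add: D_def \<psi>_def algebra_simps)
          also have "\<dots> \<le> norm (f u - f x - (u - x) *\<^sub>R \<phi> x) + norm (f v - f x - (v - x) *\<^sub>R \<phi> x)"
            by (rule norm_triangle_ineq4)
          also have "\<dots> \<le> \<epsilon> * norm (u - x) + \<epsilon> * norm (v - x)"
            using uv xp near by (intro add_mono d(2)) auto
          also have "\<dots> = \<epsilon> * (v - u)" using uv by (simp add: algebra_simps)
          finally show "norm (D (fst q) (snd q)) \<le> \<epsilon> * (Sup (snd q) - Inf (snd q))" using uv xk by simp
        qed
        also have "\<dots> \<le> (\<Sum>(x, K)\<in>p. \<epsilon> * (Sup K - Inf K))"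
          by (rule sum_mono2[OF fin p12(3)]) (use K \<epsilon> in \<open>fastforce simp: p1_def\<close>)
        also have "\<dots> = \<epsilon> * (b - a)" by (simp add: ba(1) sum_distrib_left split_def)
        finally show "norm (\<Sum>(x, K)\<in>p1. D x K) \<le> \<epsilon> * (b - a)" .
        have "(\<Sum>(x, K)\<in>p2. D x K) = (\<Sum>(x, K)\<in>p2. - (f (Sup K) - f (Inf K)))"
          by (rule sum.cong) (auto simp: D_def \<psi>_def p2_def)
        then show "norm (\<Sum>(x, K)\<in>p2. D x K) \<le> (\<Sum>(x, K)\<in>p2. \<bar>f (Sup K) - f (Inf K)\<bar>)"
          by (simp only:) (rule order_trans[OF norm_sum], simp add: split_def abs_minus_commute)
      qed
      also have "\<dots> < e / 2 + e / 2"
      proof (rule add_le_less_mono)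
        have "\<epsilon> * (b - a) \<le> \<epsilon> * (b - a + 1)" using \<epsilon> by simp
        also have "\<dots> = e / 2" using ab by (simp add: \<epsilon>_def divide_simps)
        finally show "\<epsilon> * (b - a) \<le> e / 2" .
        \<comment> \<open>The definition of absolute continuity speaks of indexed families, so the
          finite set of tagged intervals is enumerated.\<close>
        obtain h where h: "bij_betw h {0..<card p2} p2" using ex_bij_betw_nat_finite[OF fin12(2)] by blast
        define n where "n = card p2"
        have h': "bij_betw h {..<n} p2" using h by (simp add: n_def atLeast0LessThan)
        define l r where "l i = Inf (snd (h i))" and "r i = Sup (snd (h i))" for i
        have hp: "h i \<in> p2" if "i < n" for i using h' that by (meson bij_betwE lessThan_iff)
        have ri: "\<exists>x. h i = (x, {l i..r i}) \<and> l i \<le> r i \<and> a \<le> l i \<and> r i \<le> b \<and> x \<in> N \<and> {l i..r i} \<subseteq> G" if "i < n" for i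
        proof -
          obtain x K' where xk: "h i = (x, K')" by (cases "h i")
          then have xp: "(x, K') \<in> p" "x \<in> N" using hp[OF that] by (auto simp: p2_def)
          then show ?thesis using K[OF xp(1)] xk by (auto simp: l_def r_def \<gamma>_def)
        qed
        have disj: "{l i<..<r i} \<inter> {l j<..<r j} = {}" if ij: "i < n" "j < n" "i \<noteq> j" for i j
        proof -
          obtain x y where xy: "h i = (x, {l i..r i})" "h j = (y, {l j..r j})" using ri[OF ij(1)] ri[OF ij(2)] by blast
          have "h i \<noteq> h j" using h' ij unfolding bij_betw_def inj_on_def by blast
          moreover have "h i \<in> p" "h j \<in> p" using hp ij p12 by blast+
          ultimately have "interior {l i..r i} \<inter> interior {l j..r j} = {}"
            using p(1) xy by (metis tagged_division_ofD(5))
          then show ?thesis by (simp add: interior_atLeastAtMost_real)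
        qed
        \<comment> \<open>The total length becomes the measure of a union, to be compared with
          \<open>G\<close>. Open intervals are used because closed ones of a division may share
          endpoints.\<close>
        have "(\<Sum>i<n. r i - l i) = (\<Sum>i<n. measure lebesgue {l i<..<r i})"
        proof (rule sum.cong)
          fix i assume "i \<in> {..<n}"
          then have "l i \<le> r i" using ri by blast
          then show "r i - l i = measure lebesgue {l i<..<r i}" by (simp add: measure_completion)
        qed simp
        also have "\<dots> = measure lebesgue (\<Union>i<n. {l i<..<r i})"
        proof (rule measure_finite_Union[symmetric])
          have "emeasure lborel {u<..<v} \<noteq> top" for u v :: real
            by (cases "u \<le> v") auto
          then show "\<And>i. i \<in> {..<n} \<Longrightarrow> emeasure lebesgue {l i<..<r i} \<noteq> \<infinity>" by simp
        qed (use disj in \<open>auto simp: disjoint_family_on_def\<close>)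
        also have "\<dots> \<le> measure lebesgue G"
          by (rule measure_mono_fmeasurable) (use ri G(3) in force)+
        also note G(4)
        finally have "(\<Sum>i<n. r i - l i) < \<delta>" .
        then have "(\<Sum>i<n. \<bar>f (r i) - f (l i)\<bar>) < e / 2"
          using ri disj by (intro ac' conjI allI impI) blast+
        moreover have "(\<Sum>(x, K)\<in>p2. \<bar>f (Sup K) - f (Inf K)\<bar>) = (\<Sum>i<n. \<bar>f (r i) - f (l i)\<bar>)"
          using sum.reindex_bij_betw[OF h', of "\<lambda>q. \<bar>f (Sup (snd q)) - f (Inf (snd q))\<bar>"]
          by (simp add: split_def l_def r_def)
        ultimately show "(\<Sum>(x, K)\<in>p2. \<bar>f (Sup K) - f (Inf K)\<bar>) < e / 2" by simp
      qed
      finally show "norm ((\<Sum>(x, K)\<in>p. measure lborel K *\<^sub>R \<psi> x) - (f b - f a)) < e" by simp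
    qed
  qed
  then show ?thesis
    using has_integral_spike[OF negN, of "cbox a b" \<phi> \<psi>] by (auto simp: \<psi>_def)
qed

lemma abs_continuous_cong:
  assumes f: "abs_continuous_on a b f" and eq: "\<And>t. t \<in> {a..b} \<Longrightarrow> g t = f t"
  shows "abs_continuous_on a b g"
  unfolding abs_continuous_on_def
proof (intro allI impI)
  fix e :: real assume e: "0 < e"
  obtain d where d: "d > 0" and f': "\<And>(n :: nat) (l :: nat \<Rightarrow> real) r.
        (\<forall>i<n. a \<le> l i \<and> l i \<le> r i \<and> r i \<le> b) \<and>
        (\<forall>i<n. \<forall>j<n. i \<noteq> j \<longrightarrow> {l i<..<r i} \<inter> {l j<..<r j} = {}) \<and>
        (\<Sum>i<n. r i - l i) < d \<Longrightarrow> (\<Sum>i<n. \<bar>f (r i) - f (l i)\<bar>) < e"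
    by (rule abs_continuousE[OF f e]) blast
  show "\<exists>\<delta>>0. \<forall>n :: nat. \<forall>l r :: nat \<Rightarrow> real.
        (\<forall>i<n. a \<le> l i \<and> l i \<le> r i \<and> r i \<le> b) \<and>
        (\<forall>i<n. \<forall>j<n. i \<noteq> j \<longrightarrow> {l i<..<r i} \<inter> {l j<..<r j} = {}) \<and>
        (\<Sum>i<n. r i - l i) < \<delta> \<longrightarrow>
        (\<Sum>i<n. \<bar>g (r i) - g (l i)\<bar>) < e"
  proof (intro exI[of _ d] conjI allI impI d)
    fix n :: nat and l r :: "nat \<Rightarrow> real"
    assume H: "(\<forall>i<n. a \<le> l i \<and> l i \<le> r i \<and> r i \<le> b) \<and>
        (\<forall>i<n. \<forall>j<n. i \<noteq> j \<longrightarrow> {l i<..<r i} \<inter> {l j<..<r j} = {}) \<and> (\<Sum>i<n. r i - l i) < d"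
    have "g (r i) = f (r i)" "g (l i) = f (l i)" if "i < n" for i
      using H that by (auto intro!: eq intro: order_trans)
    then have "(\<Sum>i<n. \<bar>g (r i) - g (l i)\<bar>) = (\<Sum>i<n. \<bar>f (r i) - f (l i)\<bar>)" by simp
    then show "(\<Sum>i<n. \<bar>g (r i) - g (l i)\<bar>) < e" using f'[OF H] by simp
  qed
qed

lemma abs_continuous_imp_continuous:
  assumes "abs_continuous_on a b f"
  shows "continuous_on {a..b} f"
  unfolding continuous_on_iff
proof (intro ballI allI impI)
  fix x e :: real assume x: "x \<in> {a..b}" and e: "0 < e"
  obtain \<delta> where \<delta>: "\<delta> > 0" and ac: "\<And>(n :: nat) (l :: nat \<Rightarrow> real) r.
        (\<forall>i<n. a \<le> l i \<and> l i \<le> r i \<and> r i \<le> b) \<and>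
        (\<forall>i<n. \<forall>j<n. i \<noteq> j \<longrightarrow> {l i<..<r i} \<inter> {l j<..<r j} = {}) \<and>
        (\<Sum>i<n. r i - l i) < \<delta> \<Longrightarrow> (\<Sum>i<n. \<bar>f (r i) - f (l i)\<bar>) < e"
    by (rule abs_continuousE[OF assms e]) blast
  have "dist (f y) (f x) < e" if y: "y \<in> {a..b}" "dist y x < \<delta>" for y
    using ac[of 1 "\<lambda>_. x" "\<lambda>_. y"] ac[of 1 "\<lambda>_. y" "\<lambda>_. x"] x y
    by (cases "x \<le> y") (auto simp: dist_real_def abs_minus_commute)
  then show "\<exists>d>0. \<forall>x'\<in>{a..b}. dist x' x < d \<longrightarrow> dist (f x') (f x) < e" using \<delta> by blast
qed

lemma abs_continuous_bounded:
  assumes "abs_continuous_on a b f"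
  obtains K where "K > 0" "\<And>x. a \<le> x \<Longrightarrow> x \<le> b \<Longrightarrow> \<bar>f x\<bar> \<le> K"
proof -
  have "compact (f ` {a..b})"
    by (intro compact_continuous_image abs_continuous_imp_continuous assms compact_Icc)
  then obtain K where "K > 0" "\<forall>y\<in>f ` {a..b}. norm y \<le> K"
    using compact_imp_bounded bounded_pos by blast
  then show ?thesis using that by auto
qed

lemma abs_continuous_mult:
  assumes f: "abs_continuous_on a b f" and g: "abs_continuous_on a b g"
  shows "abs_continuous_on a b (\<lambda>x. f x * g x)"
  unfolding abs_continuous_on_def
proof (intro allI impI)
  fix e :: real assume e: "0 < e"
  obtain K where K: "K > 0" "\<And>x. a \<le> x \<Longrightarrow> x \<le> b \<Longrightarrow> \<bar>f x\<bar> \<le> K" using abs_continuous_bounded[OF f] by blast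
  obtain L where L: "L > 0" "\<And>x. a \<le> x \<Longrightarrow> x \<le> b \<Longrightarrow> \<bar>g x\<bar> \<le> L" using abs_continuous_bounded[OF g] by blast
  obtain d1 where d1: "d1 > 0" and f': "\<And>(n :: nat) (l :: nat \<Rightarrow> real) r.
        (\<forall>i<n. a \<le> l i \<and> l i \<le> r i \<and> r i \<le> b) \<and>
        (\<forall>i<n. \<forall>j<n. i \<noteq> j \<longrightarrow> {l i<..<r i} \<inter> {l j<..<r j} = {}) \<and>
        (\<Sum>i<n. r i - l i) < d1 \<Longrightarrow> (\<Sum>i<n. \<bar>f (r i) - f (l i)\<bar>) < e / (2 * L)"
    by (rule abs_continuousE[OF f, of "e / (2 * L)"]) (use e L in \<open>simp, blast\<close>)
  obtain d2 where d2: "d2 > 0" and g': "\<And>(n :: nat) (l :: nat \<Rightarrow> real) r.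
        (\<forall>i<n. a \<le> l i \<and> l i \<le> r i \<and> r i \<le> b) \<and>
        (\<forall>i<n. \<forall>j<n. i \<noteq> j \<longrightarrow> {l i<..<r i} \<inter> {l j<..<r j} = {}) \<and>
        (\<Sum>i<n. r i - l i) < d2 \<Longrightarrow> (\<Sum>i<n. \<bar>g (r i) - g (l i)\<bar>) < e / (2 * K)"
    by (rule abs_continuousE[OF g, of "e / (2 * K)"]) (use e K in \<open>simp, blast\<close>)
  show "\<exists>\<delta>>0. \<forall>n :: nat. \<forall>l r :: nat \<Rightarrow> real.
        (\<forall>i<n. a \<le> l i \<and> l i \<le> r i \<and> r i \<le> b) \<and>
        (\<forall>i<n. \<forall>j<n. i \<noteq> j \<longrightarrow> {l i<..<r i} \<inter> {l j<..<r j} = {}) \<and>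
        (\<Sum>i<n. r i - l i) < \<delta> \<longrightarrow>
        (\<Sum>i<n. \<bar>f (r i) * g (r i) - f (l i) * g (l i)\<bar>) < e"
  proof (intro exI[of _ "min d1 d2"] conjI allI impI)
    fix n :: nat and l r :: "nat \<Rightarrow> real"
    assume H: "(\<forall>i<n. a \<le> l i \<and> l i \<le> r i \<and> r i \<le> b) \<and>
        (\<forall>i<n. \<forall>j<n. i \<noteq> j \<longrightarrow> {l i<..<r i} \<inter> {l j<..<r j} = {}) \<and> (\<Sum>i<n. r i - l i) < min d1 d2"
    have "(\<Sum>i<n. \<bar>f (r i) * g (r i) - f (l i) * g (l i)\<bar>)
        \<le> (\<Sum>i<n. L * \<bar>f (r i) - f (l i)\<bar> + K * \<bar>g (r i) - g (l i)\<bar>)"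
    proof (rule sum_mono)
      fix i assume "i \<in> {..<n}"
      then have i: "a \<le> l i" "l i \<le> r i" "r i \<le> b" using H by auto
      have "f (r i) * g (r i) - f (l i) * g (l i) = g (r i) * (f (r i) - f (l i)) + f (l i) * (g (r i) - g (l i))"
        by (simp add: algebra_simps)
      also have "\<bar>\<dots>\<bar> \<le> \<bar>g (r i)\<bar> * \<bar>f (r i) - f (l i)\<bar> + \<bar>f (l i)\<bar> * \<bar>g (r i) - g (l i)\<bar>"
        by (rule order_trans[OF abs_triangle_ineq]) (simp add: abs_mult)
      also have "\<dots> \<le> L * \<bar>f (r i) - f (l i)\<bar> + K * \<bar>g (r i) - g (l i)\<bar>"
        using i K L by (intro add_mono mult_right_mono) auto
      finally show "\<bar>f (r i) * g (r i) - f (l i) * g (l i)\<bar> \<le> L * \<bar>f (r i) - f (l i)\<bar> + K * \<bar>g (r i) - g (l i)\<bar>" .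
    qed
    also have "\<dots> = L * (\<Sum>i<n. \<bar>f (r i) - f (l i)\<bar>) + K * (\<Sum>i<n. \<bar>g (r i) - g (l i)\<bar>)"
      by (simp add: sum.distrib sum_distrib_left)
    also have "\<dots> < L * (e / (2 * L)) + K * (e / (2 * K))"
      using H K L by (intro add_strict_mono mult_strict_left_mono f' g') auto
    also have "\<dots> = e" using K L by simp
    finally show "(\<Sum>i<n. \<bar>f (r i) * g (r i) - f (l i) * g (l i)\<bar>) < e" .
  qed (use d1 d2 in auto)
qed

lemma abs_continuous_lipschitz:
  assumes "\<And>x y. a \<le> x \<Longrightarrow> x \<le> y \<Longrightarrow> y \<le> b \<Longrightarrow> \<bar>f y - f x\<bar> \<le> K * (y - x)"
  shows "abs_continuous_on a b f"
  unfolding abs_continuous_on_def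
proof (intro allI impI)
  fix e :: real assume e: "0 < e"
  let ?K = "\<bar>K\<bar> + 1"
  show "\<exists>\<delta>>0. \<forall>n :: nat. \<forall>l r :: nat \<Rightarrow> real.
        (\<forall>i<n. a \<le> l i \<and> l i \<le> r i \<and> r i \<le> b) \<and>
        (\<forall>i<n. \<forall>j<n. i \<noteq> j \<longrightarrow> {l i<..<r i} \<inter> {l j<..<r j} = {}) \<and>
        (\<Sum>i<n. r i - l i) < \<delta> \<longrightarrow>
        (\<Sum>i<n. \<bar>f (r i) - f (l i)\<bar>) < e"
  proof (intro exI[of _ "e / ?K"] conjI allI impI)
    fix n :: nat and l r :: "nat \<Rightarrow> real"
    assume H: "(\<forall>i<n. a \<le> l i \<and> l i \<le> r i \<and> r i \<le> b) \<and>
        (\<forall>i<n. \<forall>j<n. i \<noteq> j \<longrightarrow> {l i<..<r i} \<inter> {l j<..<r j} = {}) \<and> (\<Sum>i<n. r i - l i) < e / ?K"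
    have "(\<Sum>i<n. \<bar>f (r i) - f (l i)\<bar>) \<le> (\<Sum>i<n. ?K * (r i - l i))"
    proof (rule sum_mono)
      fix i assume "i \<in> {..<n}"
      then have "a \<le> l i" "l i \<le> r i" "r i \<le> b" using H by auto
      then have "\<bar>f (r i) - f (l i)\<bar> \<le> K * (r i - l i)" "K * (r i - l i) \<le> ?K * (r i - l i)"
        using assms by (auto intro!: mult_right_mono)
      then show "\<bar>f (r i) - f (l i)\<bar> \<le> ?K * (r i - l i)" by linarith
    qed
    also have "\<dots> = ?K * (\<Sum>i<n. r i - l i)" by (simp only: sum_distrib_left)
    also have "\<dots> < ?K * (e / ?K)" using H by (intro mult_strict_left_mono) auto
    also have "\<dots> = e" by (simp add: add_pos_nonneg less_imp_neq[symmetric])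
    finally show "(\<Sum>i<n. \<bar>f (r i) - f (l i)\<bar>) < e" .
  qed (use e in auto)
qed

section \<open>Lebesgue differentiation and the variation of constants formula\<close>

lemma AE_lebesgue_on_negligible:
  assumes "negligible N" "S \<in> sets lebesgue" "\<And>t. t \<in> S - N \<Longrightarrow> P t"
  shows "AE t in lebesgue_on S. P t"
proof -
  have "AE t in lebesgue. t \<notin> N"
    using assms(1) by (simp add: negligible_iff_null_sets AE_not_in)
  then have "AE t in lebesgue. t \<in> S \<longrightarrow> P t"
    by eventually_elim (use assms(3) in blast)
  then show ?thesis using assms(2) by (simp add: AE_restrict_space_iff)
qed

lemma AE_lebesgue_on_imp_negligible:
  assumes "S \<in> sets lebesgue" "AE t in lebesgue_on S. P t"
  obtains N where "negligible N" "\<And>t. t \<in> S - N \<Longrightarrow> P t"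
proof -
  have "AE t in lebesgue. t \<in> S \<longrightarrow> P t" using assms by (simp add: AE_restrict_space_iff)
  then obtain N where "N \<in> null_sets lebesgue" "{t. \<not> (t \<in> S \<longrightarrow> P t)} \<subseteq> N"
    by (auto simp: eventually_ae_filter)
  then show ?thesis using that[of N] by (auto simp: negligible_iff_null_sets)
qed

lemma integrable_lebesgue_on_bounded:
  fixes f :: "real \<Rightarrow> 'a::{banach, second_countable_topology}"
  assumes "f \<in> borel_measurable (lebesgue_on {a..b})" "\<And>t. a \<le> t \<Longrightarrow> t \<le> b \<Longrightarrow> norm (f t) \<le> K"
  shows "integrable (lebesgue_on {a..b}) f"
proof -
  interpret finite_measure "lebesgue_on {a..b}" by (rule finite_measure_lebesgue_on) simp
  show ?thesis by (rule integrable_const_bound[of _ K]) (use assms in auto)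
qed

lemma integral_eq_lebesgue_on:
  fixes f :: "real \<Rightarrow> real"
  assumes "integrable (lebesgue_on {a..b}) f"
  shows "f integrable_on {a..b}" "integral {a..b} f = (LINT t|lebesgue_on {a..b}. f t)"
  using assms by (auto simp: integrable_on_lebesgue_on lebesgue_integral_eq_integral)

lemma lebesgue_differentiation_right:
  fixes f :: "real \<Rightarrow> real"
  assumes "\<And>a b. f integrable_on {a..b}"
  obtains N where "negligible N"
    "\<And>x e. x \<notin> N \<Longrightarrow> 0 < e \<Longrightarrow> \<exists>d>0. \<forall>h. 0 < h \<and> h < d \<longrightarrow> \<bar>integral {x..x + h} f / h - f x\<bar> < e"
proof -
  have "\<And>a b. f integrable_on cbox a b" using assms by simp
  then obtain N where N: "negligible N"
       "\<And>x e. \<lbrakk>x \<notin> N; 0 < e\<rbrakk> \<Longrightarrow>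
               \<exists>d>0. \<forall>h. 0 < h \<and> h < d \<longrightarrow>
                         norm(integral (cbox x (x + h *\<^sub>R One)) f /\<^sub>R h ^ DIM(real) - f x) < e"
    by (rule integrable_ccontinuous_explicit) blast
  show ?thesis by (rule that[OF N(1)]) (use N(2) in \<open>simp add: divide_inverse mult.commute\<close>)
qed

lemma lebesgue_differentiation_sequence:
  fixes f :: "real \<Rightarrow> real"
  assumes "\<And>a b. f integrable_on {a..b}"
  obtains N where "negligible N"
    "\<And>x. x \<notin> N \<Longrightarrow> (\<lambda>n. integral {x..x + 1 / real (Suc n)} f * real (Suc n)) \<longlonglongrightarrow> f x"
proof -
  obtain N where N: "negligible N"
    "\<And>x e. x \<notin> N \<Longrightarrow> 0 < e \<Longrightarrow> \<exists>d>0. \<forall>h. 0 < h \<and> h < d \<longrightarrow> \<bar>integral {x..x + h} f / h - f x\<bar> < e"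
    using lebesgue_differentiation_right[OF assms] by blast
  have "(\<lambda>n. integral {x..x + 1 / real (Suc n)} f * real (Suc n)) \<longlonglongrightarrow> f x" if x: "x \<notin> N" for x
  proof (rule LIMSEQ_I)
    fix e :: real assume "0 < e"
    from N(2)[OF x this] obtain d where d: "d > 0"
      "\<And>h. 0 < h \<and> h < d \<Longrightarrow> \<bar>integral {x..x + h} f / h - f x\<bar> < e" by blast
    obtain n0 where n0: "1 / real (Suc n0) < d" using d(1) nat_approx_posE by (metis inverse_eq_divide)
    have "norm (integral {x..x + 1 / real (Suc n)} f * real (Suc n) - f x) < e" if "n \<ge> n0" for n
    proof -
      have "1 / real (Suc n) \<le> 1 / real (Suc n0)" using that by (simp add: frac_le)
      then show ?thesis using d(2)[of "1 / real (Suc n)"] n0 by simp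
    qed
    then show "\<exists>no. \<forall>n\<ge>no. norm (integral {x..x + 1 / real (Suc n)} f * real (Suc n) - f x) < e" by blast
  qed
  then show ?thesis using that N(1) by blast
qed

text \<open>Right difference quotients are averages over intervals to the right of \<open>x\<close>.
  Left ones are right averages of the reflected function, whose exceptional set is reflected back
  and stays negligible.\<close>

lemma lebesgue_differentiation:
  fixes f :: "real \<Rightarrow> real"
  assumes int: "\<And>a b. f integrable_on {a..b}"
  obtains N where "negligible N"
    "\<And>x. x \<in> {a..b} - N \<Longrightarrow> ((\<lambda>t. integral {a..t} f) has_real_derivative f x) (at x within {a..b})"
proof -
  obtain N1 where N1: "negligible N1"
    "\<And>x e. x \<notin> N1 \<Longrightarrow> 0 < e \<Longrightarrow> \<exists>d>0. \<forall>h. 0 < h \<and> h < d \<longrightarrow> \<bar>integral {x..x + h} f / h - f x\<bar> < e"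
    using lebesgue_differentiation_right[OF int] by blast
  have refl: "(\<lambda>x. f (- x)) integrable_on {a..b}" for a b
    using Henstock_Kurzweil_Integration.integrable_reflect_real[where f = f and a = "- b" and b = "- a"] int[of "- b" "- a"] by simp
  obtain N2 where N2: "negligible N2"
    "\<And>x e. x \<notin> N2 \<Longrightarrow> 0 < e \<Longrightarrow> \<exists>d>0. \<forall>h. 0 < h \<and> h < d \<longrightarrow> \<bar>integral {x..x + h} (\<lambda>x. f (- x)) / h - f (- x)\<bar> < e"
    using lebesgue_differentiation_right[OF refl] by blast
  let ?N = "N1 \<union> uminus ` N2"
  have "negligible ?N"
  proof (intro negligible_Un N1(1) negligible_locally_Lipschitz_image N2(1))
    fix x assume "x \<in> N2"
    show "\<exists>T B. open T \<and> x \<in> T \<and> (\<forall>y\<in>N2 \<inter> T. norm (- y - - x) \<le> B * norm (y - x))"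
      by (rule exI[of _ UNIV], rule exI[of _ 1]) (auto simp: norm_minus_commute)
  qed simp
  moreover have "((\<lambda>t. integral {a..t} f) has_real_derivative f x) (at x within {a..b})" if x: "x \<in> {a..b} - ?N" for x
    unfolding has_field_derivative_iff Lim_within
  proof (intro allI impI)
    fix e :: real assume e: "0 < e"
    have xn: "x \<notin> N1" "- x \<notin> N2" using x by (auto simp: image_iff)
    from N1(2)[OF xn(1) e] obtain d1 where d1: "d1 > 0"
      "\<And>h. 0 < h \<and> h < d1 \<Longrightarrow> \<bar>integral {x..x + h} f / h - f x\<bar> < e" by blast
    from N2(2)[OF xn(2) e] obtain d2 where d2: "d2 > 0"
      "\<And>h. 0 < h \<and> h < d2 \<Longrightarrow> \<bar>integral {- x..- x + h} (\<lambda>x. f (- x)) / h - f x\<bar> < e" by auto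
    have "dist ((integral {a..y} f - integral {a..x} f) / (y - x)) (f x) < e"
      if y: "y \<in> {a..b}" "0 < dist y x" "dist y x < min d1 d2" for y
    proof (cases "x < y")
      case True
      have "integral {a..x} f + integral {x..y} f = integral {a..y} f"
        using True x y by (intro Henstock_Kurzweil_Integration.integral_combine int) auto
      then have "integral {a..y} f - integral {a..x} f = integral {x..y} f" by simp
      then show ?thesis using d1(2)[of "y - x"] y True by (simp only: dist_real_def) simp
    next
      case False
      then have xy: "y < x" using y by (auto simp: dist_real_def)
      have "integral {a..y} f + integral {y..x} f = integral {a..x} f"
        using xy x y by (intro Henstock_Kurzweil_Integration.integral_combine int) auto
      moreover have "integral {- x..- y} (\<lambda>x. f (- x)) = integral {y..x} f"
        by (rule Henstock_Kurzweil_Integration.integral_reflect_real)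
      ultimately have "(integral {a..y} f - integral {a..x} f) / (y - x)
          = integral {- x..- x + (x - y)} (\<lambda>x. f (- x)) / (x - y)"
      proof -
        assume "integral {a..y} f + integral {y..x} f = integral {a..x} f"
          and "integral {- x..- y} (\<lambda>x. f (- x)) = integral {y..x} f"
        then have "integral {a..y} f - integral {a..x} f = - integral {- x..- x + (x - y)} (\<lambda>x. f (- x))"
          by simp
        then show ?thesis
          using minus_divide_divide[of "integral {- x..- x + (x - y)} (\<lambda>x. f (- x))" "x - y"] by simp
      qed
      moreover have "x - y < d2" using y xy by (simp add: dist_real_def)
      ultimately show ?thesis using d2(2)[of "x - y"] xy by (simp only: dist_real_def) simp
    qed
    then show "\<exists>d>0. \<forall>y\<in>{a..b}. 0 < dist y x \<and> dist y x < d \<longrightarrow>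
        dist ((integral {a..y} f - integral {a..x} f) / (y - x)) (f x) < e"
      using d1(1) d2(1) by (intro exI[of _ "min d1 d2"]) auto
  qed
  ultimately show ?thesis using that by blast
qed

text \<open>The integrating factor reduces the equation to an indefinite integral \<open>F\<close>,
  which is Lipschitz and differentiable almost everywhere; multiplying by the exponential preserves
  absolute continuity.\<close>

lemma duhamel:
  fixes \<beta> :: "real \<Rightarrow> real" and l \<zeta> :: real
  assumes T: "0 \<le> T" and meas: "\<beta> \<in> borel_measurable (lebesgue_on {0..T})" and bd: "\<And>t. 0 \<le> t \<Longrightarrow> t \<le> T \<Longrightarrow> \<bar>\<beta> t\<bar> \<le> K"
  defines "z \<equiv> \<lambda>t. exp (l * t) * (\<zeta> + (LINT s|lebesgue_on {0..t}. exp (- l * s) * \<beta> s))"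
  shows "abs_continuous_on 0 T z" "z 0 = \<zeta>"
    "AE t in lebesgue_on {0..T}. (z has_real_derivative l * z t + \<beta> t) (at t within {0..T})"
proof -
  \<comment> \<open>Extended by zero outside \<open>[0, T]\<close>, so that it is integrable over
    every interval as the differentiation theorem requires.\<close>
  define f where "f s = (if s \<in> {0..T} then exp (- l * s) * \<beta> s else 0)" for s
  define E where "E = exp (\<bar>l\<bar> * T)"
  have El: "exp (c * s) \<le> E" if "0 \<le> s" "s \<le> T" "\<bar>c\<bar> \<le> \<bar>l\<bar>" for s c
  proof -
    have "c * s \<le> \<bar>c\<bar> * s" using that by (intro mult_right_mono) auto
    also have "\<dots> \<le> \<bar>l\<bar> * T" using that by (intro mult_mono) auto
    finally show ?thesis by (simp add: E_def)
  qed
  have E0: "0 < E" by (simp add: E_def)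
  have m1: "(\<lambda>s. exp (- l * s) * \<beta> s) \<in> borel_measurable (lebesgue_on {0..T})"
    by (intro borel_measurable_times meas continuous_imp_measurable_on_sets_lebesgue continuous_intros) simp
  have mf: "f \<in> borel_measurable lebesgue"
    using m1 unfolding f_def by (subst borel_measurable_if) auto
  have fb: "\<bar>f s\<bar> \<le> E * \<bar>K\<bar>" for s
  proof (cases "s \<in> {0..T}")
    case True
    then have "\<bar>\<beta> s\<bar> \<le> \<bar>K\<bar>" using bd[of s] by auto
    then show ?thesis using True El[of s "- l"] E0 by (auto simp: f_def abs_mult intro!: mult_mono)
  qed (use E0 in \<open>auto simp: f_def\<close>)
  have fi: "integrable (lebesgue_on {a..b}) f" for a b
    by (rule integrable_lebesgue_on_bounded[of _ _ _ "E * \<bar>K\<bar>"]) (use fb mf in \<open>auto intro: measurable_restrict_space1\<close>)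
  note fint = integral_eq_lebesgue_on[OF fi]
  define F where "F t = integral {0..t} f" for t
  have zF: "z t = exp (l * t) * (\<zeta> + F t)" if "t \<in> {0..T}" for t
  proof -
    have "F t = (LINT s|lebesgue_on {0..t}. f s)" unfolding F_def by (rule fint(2))
    also have "\<dots> = (LINT s|lebesgue_on {0..t}. exp (- l * s) * \<beta> s)"
      using that by (intro Bochner_Integration.integral_cong) (auto simp: f_def)
    finally show ?thesis by (simp add: z_def)
  qed
  have Flip: "\<bar>F y - F x\<bar> \<le> (E * \<bar>K\<bar>) * (y - x)" if "0 \<le> x" "x \<le> y" "y \<le> T" for x y
  proof -
    have "integral {0..x} f + integral {x..y} f = integral {0..y} f"
      using that by (intro Henstock_Kurzweil_Integration.integral_combine fint(1)) auto
    then have "F y - F x = integral {x..y} f" by (simp add: F_def)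
    also have "norm \<dots> \<le> E * \<bar>K\<bar> * (y - x)"
    proof -
      have "norm (integral {x..y} f) \<le> integral {x..y} (\<lambda>_. E * \<bar>K\<bar>)"
        by (rule integral_norm_bound_integral[OF fint(1)]) (use fb in auto)
      then show ?thesis using that by (simp add: mult_ac)
    qed
    finally show ?thesis by simp
  qed
  have acF: "abs_continuous_on 0 T (\<lambda>t. \<zeta> + F t)"
    by (rule abs_continuous_lipschitz[of _ _ _ "E * \<bar>K\<bar>"]) (use Flip in simp)
  have acE: "abs_continuous_on 0 T (\<lambda>t. exp (l * t))"
  proof (rule abs_continuous_lipschitz[of _ _ _ "\<bar>l\<bar> * E"])
    fix x y assume xy: "0 \<le> x" "x \<le> y" "y \<le> T"
    have "norm (exp (l * y) - exp (l * x)) \<le> (\<bar>l\<bar> * E) * norm (y - x)"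
    proof (rule field_differentiable_bound[of "{0..T}" "\<lambda>t. exp (l * t)" "\<lambda>t. l * exp (l * t)"])
      show "((\<lambda>t. exp (l * t)) has_field_derivative l * exp (l * t)) (at t within {0..T})" for t
        by (auto intro!: derivative_eq_intros)
      show "norm (l * exp (l * t)) \<le> \<bar>l\<bar> * E" if "t \<in> {0..T}" for t
        using El[of t l] that by (simp add: abs_mult mult_left_mono)
    qed (use xy in auto)
    then show "\<bar>exp (l * y) - exp (l * x)\<bar> \<le> \<bar>l\<bar> * E * (y - x)" using xy by simp
  qed
  show "abs_continuous_on 0 T z"
    by (rule abs_continuous_cong[OF abs_continuous_mult[OF acE acF]]) (rule zF)
  show "z 0 = \<zeta>" using zF[of 0] T by (simp add: F_def)
  obtain N where N: "negligible N"
    "\<And>x. x \<in> {0..T} - N \<Longrightarrow> (F has_real_derivative f x) (at x within {0..T})"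
    using lebesgue_differentiation[OF fint(1), of 0 T] unfolding F_def by blast
  show "AE t in lebesgue_on {0..T}. (z has_real_derivative l * z t + \<beta> t) (at t within {0..T})"
  proof (rule AE_lebesgue_on_negligible[OF N(1)])
    fix t assume t: "t \<in> {0..T} - N"
    have "((\<lambda>t. exp (l * t) * (\<zeta> + F t)) has_real_derivative
        (exp (l * t) * l) * (\<zeta> + F t) + f t * exp (l * t)) (at t within {0..T})"
      by (rule DERIV_mult) (auto intro!: derivative_eq_intros N(2) t)
    moreover have "(exp (l * t) * l) * (\<zeta> + F t) + f t * exp (l * t) = l * z t + \<beta> t"
      using t zF[of t] by (simp add: f_def exp_minus field_simps)
    ultimately have "((\<lambda>t. exp (l * t) * (\<zeta> + F t)) has_real_derivative l * z t + \<beta> t) (at t within {0..T})" by simp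
    then show "(z has_real_derivative l * z t + \<beta> t) (at t within {0..T})"
      by (rule has_field_derivative_transform_within[of _ _ _ _ 1]) (use t zF in auto)
  qed simp
qed

section \<open>Approximation by Bernstein polynomials\<close>

text \<open>The case distinction compensates the truncation of \<open>k - 1\<close> at
  \<open>k = 0\<close>, where the first term is absent; at \<open>k = Suc m\<close> the second term
  vanishes by itself.\<close>

lemma DERIV_Bernstein:
  "(Bernstein (Suc m) k has_real_derivative
     real (Suc m) * ((if k = 0 then 0 else Bernstein m (k - 1) s) - Bernstein m k s)) (at s)"
proof -
  have e1: "real (Suc m choose k) * real k = real (Suc m) * (if k = 0 then 0 else real (m choose (k - 1)))"
  proof (cases k)
    case (Suc k')
    have "real (Suc m choose Suc k') * real (Suc k') = real (Suc m) * real (m choose k')"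
      by (simp only: of_nat_mult[symmetric] Suc_times_binomial_eq)
    then show ?thesis using Suc by simp
  qed simp
  have e2: "real (Suc m choose k) * real (Suc m - k) = real (Suc m) * real (m choose k)"
    using binomial_absorb_comp[of "Suc m" k]
    by (simp only: of_nat_mult[symmetric] mult.commute[of "Suc m choose k"] diff_Suc_1)
  have e3: "s ^ k * (1 - s) ^ (m - k) * real (m choose k) = s ^ k * (1 - s) ^ (Suc m - k - 1) * real (m choose k)"
    by (cases "k \<le> m") (auto simp: binomial_eq_0)
  have "(Bernstein (Suc m) k has_real_derivative
      real (Suc m choose k) * (real k * s ^ (k - 1) * (1 - s) ^ (Suc m - k) - s ^ k * (real (Suc m - k) * (1 - s) ^ (Suc m - k - 1)))) (at s)"
    unfolding Bernstein_def[abs_def] by (auto intro!: derivative_eq_intros simp: algebra_simps)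
  also have "real (Suc m choose k) * (real k * s ^ (k - 1) * (1 - s) ^ (Suc m - k) - s ^ k * (real (Suc m - k) * (1 - s) ^ (Suc m - k - 1)))
     = (real (Suc m choose k) * real k) * (s ^ (k - 1) * (1 - s) ^ (Suc m - k))
       - (real (Suc m choose k) * real (Suc m - k)) * (s ^ k * (1 - s) ^ (Suc m - k - 1))"
    by (simp add: algebra_simps)
  also have "\<dots> = real (Suc m) * ((if k = 0 then 0 else Bernstein m (k - 1) s) - Bernstein m k s)"
    unfolding e1 e2 using e3 by (auto simp: Bernstein_def algebra_simps)
  finally show ?thesis .
qed

text \<open>The derivative of the Bernstein polynomial of degree \<open>Suc m\<close>, after
  summation by parts: a Bernstein sum of degree \<open>m\<close> whose coefficients are difference
  quotients of \<open>f\<close>.\<close>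

definition bernstein_deriv :: "nat \<Rightarrow> (real \<Rightarrow> real) \<Rightarrow> real \<Rightarrow> real" where
  "bernstein_deriv m f s =
     (\<Sum>k\<le>m. real (Suc m) * (f (real (Suc k) / real (Suc m)) - f (real k / real (Suc m))) * Bernstein m k s)"

lemma DERIV_bernstein_sum:
  "((\<lambda>s. \<Sum>k\<le>Suc m. f (real k / real (Suc m)) * Bernstein (Suc m) k s) has_real_derivative
     bernstein_deriv m f s) (at s)"
proof -
  let ?f = "\<lambda>k. f (real k / real (Suc m))"
  have "((\<lambda>s. \<Sum>k\<le>Suc m. ?f k * Bernstein (Suc m) k s) has_real_derivative
     (\<Sum>k\<le>Suc m. ?f k * (real (Suc m) * ((if k = 0 then 0 else Bernstein m (k - 1) s) - Bernstein m k s)))) (at s)"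
    by (intro DERIV_sum DERIV_cmult DERIV_Bernstein)
  also have "(\<Sum>k\<le>Suc m. ?f k * (real (Suc m) * ((if k = 0 then 0 else Bernstein m (k - 1) s) - Bernstein m k s)))
     = (\<Sum>k\<le>Suc m. ?f k * real (Suc m) * (if k = 0 then 0 else Bernstein m (k - 1) s))
       - (\<Sum>k\<le>Suc m. ?f k * real (Suc m) * Bernstein m k s)"
    by (simp only: sum_subtractf[symmetric]) (simp only: algebra_simps)
  also have "(\<Sum>k\<le>Suc m. ?f k * real (Suc m) * (if k = 0 then 0 else Bernstein m (k - 1) s))
     = (\<Sum>k\<le>m. ?f (Suc k) * real (Suc m) * Bernstein m k s)"
    by (subst sum.atMost_Suc_shift) simp
  also have "(\<Sum>k\<le>Suc m. ?f k * real (Suc m) * Bernstein m k s) = (\<Sum>k\<le>m. ?f k * real (Suc m) * Bernstein m k s)"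
    by (simp add: Bernstein_def binomial_eq_0)
  also have "(\<Sum>k\<le>m. ?f (Suc k) * real (Suc m) * Bernstein m k s) - (\<Sum>k\<le>m. ?f k * real (Suc m) * Bernstein m k s)
     = bernstein_deriv m f s"
    unfolding bernstein_deriv_def by (simp only: sum_subtractf[symmetric]) (simp only: algebra_simps)
  finally show ?thesis .
qed

lemma bernstein_sum_bound:
  assumes "s \<in> {0..1}" "\<And>k. k \<le> n \<Longrightarrow> \<bar>c k\<bar> \<le> K"
  shows "\<bar>\<Sum>k\<le>n. c k * Bernstein n k s\<bar> \<le> K"
proof -
  have "\<bar>\<Sum>k\<le>n. c k * Bernstein n k s\<bar> \<le> (\<Sum>k\<le>n. K * Bernstein n k s)"
    by (rule order_trans[OF sum_abs sum_mono])
       (use assms in \<open>auto simp: abs_mult Bernstein_nonneg mult_right_mono\<close>)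
  also have "\<dots> = K" by (simp flip: sum_distrib_left)
  finally show ?thesis .
qed

lemma bernstein_tendsto:
  fixes f :: "real \<Rightarrow> real"
  assumes "continuous_on {0..1} f" "s \<in> {0..1}"
  shows "(\<lambda>n. \<Sum>k\<le>n. f (real k / real n) * Bernstein n k s) \<longlonglongrightarrow> f s"
proof (rule LIMSEQ_I)
  fix e :: real assume "0 < e"
  from Bernstein_Weierstrass[OF assms(1) this] assms(2)
  show "\<exists>no. \<forall>n\<ge>no. norm ((\<Sum>k\<le>n. f (real k / real n) * Bernstein n k s) - f s) < e"
    by (auto simp: abs_minus_commute)
qed

context
  fixes f f' :: "real \<Rightarrow> real"
  assumes der: "\<And>x. x \<in> {0..1} \<Longrightarrow> (f has_real_derivative f' x) (at x)"
    and cont: "continuous_on {0..1} f'"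
begin

text \<open>By the mean value theorem the coefficients of \<open>bernstein_deriv\<close> are values
  of \<open>f'\<close>; both its bound and its limit are deduced from this.\<close>

lemma difference_quotient:
  assumes "k \<le> m"
  obtains \<xi> where "\<xi> \<in> {0..1}" "real k / real (Suc m) < \<xi>" "\<xi> < real (Suc k) / real (Suc m)"
    "real (Suc m) * (f (real (Suc k) / real (Suc m)) - f (real k / real (Suc m))) = f' \<xi>"
proof -
  let ?a = "real k / real (Suc m)" and ?b = "real (Suc k) / real (Suc m)"
  have ab: "?a < ?b" by (simp add: divide_strict_right_mono)
  have b1: "0 \<le> ?a" "?b \<le> 1" using assms by auto
  obtain \<xi> where \<xi>: "?a < \<xi>" "\<xi> < ?b" "f ?b - f ?a = (?b - ?a) * f' \<xi>"
    using MVT2[OF ab, of f f'] der b1 by (metis atLeastAtMost_iff order_trans)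
  moreover have "?b - ?a = 1 / real (Suc m)" by (simp add: field_simps)
  ultimately show ?thesis using that[of \<xi>] b1 by (auto simp: field_simps)
qed

lemma bernstein_deriv_bound:
  assumes "s \<in> {0..1}" "\<And>x. x \<in> {0..1} \<Longrightarrow> \<bar>f' x\<bar> \<le> K"
  shows "\<bar>bernstein_deriv m f s\<bar> \<le> K"
  unfolding bernstein_deriv_def
proof (rule bernstein_sum_bound[OF assms(1)])
  fix k assume "k \<le> m"
  then show "\<bar>real (Suc m) * (f (real (Suc k) / real (Suc m)) - f (real k / real (Suc m)))\<bar> \<le> K"
    using difference_quotient[of k m] assms(2) by metis
qed

lemma bernstein_deriv_tendsto:
  assumes s: "s \<in> {0..1}"
  shows "(\<lambda>m. bernstein_deriv m f s) \<longlonglongrightarrow> f' s"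
proof -
  have "(\<lambda>m. bernstein_deriv m f s - (\<Sum>k\<le>m. f' (real k / real m) * Bernstein m k s)) \<longlonglongrightarrow> 0"
  proof (rule LIMSEQ_I)
    fix e :: real assume e: "0 < e"
    have "uniformly_continuous_on {0..1} f'"
      by (rule compact_uniformly_continuous[OF cont]) simp
    then obtain d where d: "d > 0" "\<And>x y. x \<in> {0..1} \<Longrightarrow> y \<in> {0..1} \<Longrightarrow> dist y x < d \<Longrightarrow> dist (f' y) (f' x) < e / 2"
      unfolding uniformly_continuous_on_def using e by (metis half_gt_zero)
    obtain n0 where n0: "1 / real (Suc n0) < d" using d(1) nat_approx_posE by (metis inverse_eq_divide)
    have "norm (bernstein_deriv m f s - (\<Sum>k\<le>m. f' (real k / real m) * Bernstein m k s) - 0) < e"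
      if m: "m \<ge> Suc n0" for m
    proof -
      have "bernstein_deriv m f s - (\<Sum>k\<le>m. f' (real k / real m) * Bernstein m k s)
         = (\<Sum>k\<le>m. (real (Suc m) * (f (real (Suc k) / real (Suc m)) - f (real k / real (Suc m))) - f' (real k / real m)) * Bernstein m k s)"
        by (simp add: bernstein_deriv_def left_diff_distrib sum_subtractf)
      also have "\<bar>\<dots>\<bar> \<le> e / 2"
      proof (rule bernstein_sum_bound[OF s])
        fix k assume k: "k \<le> m"
        obtain \<xi> where \<xi>: "\<xi> \<in> {0..1}" "real k / real (Suc m) < \<xi>" "\<xi> < real (Suc k) / real (Suc m)"
          "real (Suc m) * (f (real (Suc k) / real (Suc m)) - f (real k / real (Suc m))) = f' \<xi>"
          using difference_quotient[OF k] by blast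
        have m0: "0 < real m" using m by simp
        \<comment> \<open>The node \<open>k / m\<close> lies between the same two points as
          \<open>\<xi>\<close>, so the two arguments of \<open>f'\<close> differ by at most
          \<open>1 / Suc m\<close>.\<close>
        have b: "real k / real (Suc m) \<le> real k / real m" "real k / real m \<le> real (Suc k) / real (Suc m)"
          using m0 k by (auto simp: field_simps)
        have "\<bar>\<xi> - real k / real m\<bar> \<le> real (Suc k) / real (Suc m) - real k / real (Suc m)"
          using \<xi> b by linarith
        also have "\<dots> = 1 / real (Suc m)" by (simp add: field_simps)
        also have "\<dots> \<le> 1 / real (Suc n0)" using m by (simp add: frac_le)
        finally have "dist \<xi> (real k / real m) < d" using n0 by (simp add: dist_real_def)
        then have "dist (f' \<xi>) (f' (real k / real m)) < e / 2"
          using \<xi> k m0 by (intro d(2)) auto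
        then show "\<bar>real (Suc m) * (f (real (Suc k) / real (Suc m)) - f (real k / real (Suc m))) - f' (real k / real m)\<bar> \<le> e / 2"
          unfolding \<xi>(4) by (simp add: dist_real_def)
      qed
      finally show ?thesis using e by simp
    qed
    then show "\<exists>no. \<forall>m\<ge>no. norm (bernstein_deriv m f s - (\<Sum>k\<le>m. f' (real k / real m) * Bernstein m k s) - 0) < e" by blast
  qed
  from tendsto_add[OF this bernstein_tendsto[OF cont s]] show ?thesis by simp
qed

end

section \<open>Functions that are continuously differentiable in finitely many coordinates\<close>

definition partial :: "nat \<Rightarrow> ((nat \<Rightarrow> real) \<Rightarrow> real) \<Rightarrow> (nat \<Rightarrow> real) \<Rightarrow> real" where
  "partial j G \<xi> = deriv (\<lambda>x. G (\<xi>(j := x))) (\<xi> j)"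

text \<open>The domain is the space of all sequences, where coordinate 0 will carry time and
  \<open>1..N\<close> the states. Updating a coordinate never leaves this space, and boxes are
  compact in its product topology.\<close>

definition c1 :: "nat \<Rightarrow> ((nat \<Rightarrow> real) \<Rightarrow> real) \<Rightarrow> bool" where
  "c1 N G \<longleftrightarrow> continuous_on UNIV G \<and>
     (\<forall>j\<le>N. (\<forall>\<xi>. (\<lambda>x. G (\<xi>(j := x))) differentiable (at (\<xi> j))) \<and> continuous_on UNIV (partial j G))"

lemma c1_continuous: "c1 N G \<Longrightarrow> continuous_on UNIV G"
  and c1_continuous_partial: "c1 N G \<Longrightarrow> j \<le> N \<Longrightarrow> continuous_on UNIV (partial j G)"
  by (auto simp: c1_def)

lemma c1_DERIV:
  assumes "c1 N G" "j \<le> N"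
  shows "((\<lambda>x. G (\<xi>(j := x))) has_real_derivative partial j G (\<xi>(j := x))) (at x)"
proof -
  have "(\<lambda>y. G ((\<xi>(j := x))(j := y))) differentiable (at ((\<xi>(j := x)) j))"
    using assms unfolding c1_def by blast
  then have "(\<lambda>y. G (\<xi>(j := y))) differentiable (at x)" by simp
  then show ?thesis by (simp add: partial_def DERIV_deriv_iff_real_differentiable)
qed

lemma c1I:
  assumes "continuous_on UNIV G"
    "\<And>j \<xi>. j \<le> N \<Longrightarrow> ((\<lambda>x. G (\<xi>(j := x))) has_real_derivative G' j \<xi>) (at (\<xi> j))"
    "\<And>j. j \<le> N \<Longrightarrow> continuous_on UNIV (G' j)"
  shows "c1 N G" "\<And>j \<xi>. j \<le> N \<Longrightarrow> partial j G \<xi> = G' j \<xi>"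
proof -
  show p: "partial j G \<xi> = G' j \<xi>" if "j \<le> N" for j \<xi>
    unfolding partial_def by (rule DERIV_imp_deriv) (rule assms(2)[OF that])
  have "partial j G = G' j" if "j \<le> N" for j using p[OF that] by blast
  then show "c1 N G" unfolding c1_def using assms
    by (auto simp: real_differentiable_def)
qed

lemma c1_DERIV_at: "c1 N G \<Longrightarrow> j \<le> N \<Longrightarrow> ((\<lambda>x. G (\<xi>(j := x))) has_real_derivative partial j G \<xi>) (at (\<xi> j))"
  using c1_DERIV[of N G j \<xi> "\<xi> j"] by simp

lemma continuous_on_fun_upd:
  assumes "continuous_on S (g :: 'a::topological_space \<Rightarrow> nat \<Rightarrow> real)" "continuous_on S h"
  shows "continuous_on S (\<lambda>x. (g x)(j := h x))"
proof (rule continuous_on_coordinatewise_then_product)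
  show "continuous_on S (\<lambda>x. ((g x)(j := h x)) i)" for i
    using assms(2) continuous_on_product_then_coordinatewise[OF assms(1), of i] by (cases "i = j") simp_all
qed

lemma c1_const: "c1 N (\<lambda>_. c)" "j \<le> N \<Longrightarrow> partial j (\<lambda>_. c) \<xi> = 0"
proof -
  have d: "((\<lambda>x. c) has_real_derivative 0) (at x)" for x :: real by simp
  show "c1 N (\<lambda>_. c)" by (rule c1I(1)[where G' = "\<lambda>_ _. 0"]) (simp_all add: d)
  show "j \<le> N \<Longrightarrow> partial j (\<lambda>_. c) \<xi> = 0" by (simp add: partial_def)
qed

lemma c1_add:
  assumes "c1 N G" "c1 N H"
  shows "c1 N (\<lambda>\<xi>. G \<xi> + H \<xi>)" "j \<le> N \<Longrightarrow> partial j (\<lambda>\<xi>. G \<xi> + H \<xi>) \<xi> = partial j G \<xi> + partial j H \<xi>"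
proof -
  let ?G = "\<lambda>j \<xi>. partial j G \<xi> + partial j H \<xi>"
  have c: "continuous_on UNIV (\<lambda>\<xi>. G \<xi> + H \<xi>)"
    by (intro continuous_intros c1_continuous[OF assms(1)] c1_continuous[OF assms(2)])
  have d: "((\<lambda>x. G (\<xi>(j := x)) + H (\<xi>(j := x))) has_real_derivative ?G j \<xi>) (at (\<xi> j))" if "j \<le> N" for j \<xi>
    by (rule DERIV_add[OF c1_DERIV_at[OF assms(1) that] c1_DERIV_at[OF assms(2) that]])
  have p: "continuous_on UNIV (?G j)" if "j \<le> N" for j
    by (intro continuous_intros c1_continuous_partial[OF assms(1) that] c1_continuous_partial[OF assms(2) that])
  show "c1 N (\<lambda>\<xi>. G \<xi> + H \<xi>)" by (rule c1I(1)[where G' = ?G, OF c d p])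
  show "partial j (\<lambda>\<xi>. G \<xi> + H \<xi>) \<xi> = ?G j \<xi>" if "j \<le> N"
    by (rule c1I(2)[where N = N and G' = ?G, OF c d p that])
qed

lemma c1_mult:
  assumes "c1 N G" "c1 N H"
  shows "c1 N (\<lambda>\<xi>. G \<xi> * H \<xi>)"
    "j \<le> N \<Longrightarrow> partial j (\<lambda>\<xi>. G \<xi> * H \<xi>) \<xi> = partial j G \<xi> * H \<xi> + partial j H \<xi> * G \<xi>"
proof -
  let ?G = "\<lambda>j \<xi>. partial j G \<xi> * H \<xi> + partial j H \<xi> * G \<xi>"
  have c: "continuous_on UNIV (\<lambda>\<xi>. G \<xi> * H \<xi>)"
    by (intro continuous_intros c1_continuous[OF assms(1)] c1_continuous[OF assms(2)])
  have d: "((\<lambda>x. G (\<xi>(j := x)) * H (\<xi>(j := x))) has_real_derivative ?G j \<xi>) (at (\<xi> j))" if "j \<le> N" for j \<xi>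
    using DERIV_mult[OF c1_DERIV_at[OF assms(1) that, of \<xi>] c1_DERIV_at[OF assms(2) that, of \<xi>]] by simp
  have p: "continuous_on UNIV (?G j)" if "j \<le> N" for j
    by (intro continuous_intros c1_continuous_partial[OF assms(1) that] c1_continuous_partial[OF assms(2) that]
        c1_continuous[OF assms(1)] c1_continuous[OF assms(2)])
  show "c1 N (\<lambda>\<xi>. G \<xi> * H \<xi>)" by (rule c1I(1)[where G' = ?G, OF c d p])
  show "partial j (\<lambda>\<xi>. G \<xi> * H \<xi>) \<xi> = ?G j \<xi>" if "j \<le> N"
    by (rule c1I(2)[where N = N and G' = ?G, OF c d p that])
qed

lemma c1_cmult:
  assumes "c1 N G"
  shows "c1 N (\<lambda>\<xi>. r * G \<xi>)" "j \<le> N \<Longrightarrow> partial j (\<lambda>\<xi>. r * G \<xi>) \<xi> = r * partial j G \<xi>"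
  using c1_mult[OF c1_const(1)[of N r] assms] by (auto simp: c1_const)

lemma c1_sum:
  assumes "\<And>k. k \<in> K \<Longrightarrow> c1 N (G k)"
  shows "c1 N (\<lambda>\<xi>. \<Sum>k\<in>K. G k \<xi>)"
    "j \<le> N \<Longrightarrow> partial j (\<lambda>\<xi>. \<Sum>k\<in>K. G k \<xi>) \<xi> = (\<Sum>k\<in>K. partial j (G k) \<xi>)"
proof -
  have "c1 N (\<lambda>\<xi>. \<Sum>k\<in>K. G k \<xi>) \<and> (\<forall>j\<le>N. \<forall>\<xi>. partial j (\<lambda>\<xi>. \<Sum>k\<in>K. G k \<xi>) \<xi> = (\<Sum>k\<in>K. partial j (G k) \<xi>))"
    using assms
  proof (induction K rule: infinite_finite_induct)
    case (insert k K)
    then show ?case using c1_add[of N "G k" "\<lambda>\<xi>. \<Sum>k\<in>K. G k \<xi>"] by simp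
  qed (auto simp: c1_const)
  then show "c1 N (\<lambda>\<xi>. \<Sum>k\<in>K. G k \<xi>)"
    "j \<le> N \<Longrightarrow> partial j (\<lambda>\<xi>. \<Sum>k\<in>K. G k \<xi>) \<xi> = (\<Sum>k\<in>K. partial j (G k) \<xi>)" by auto
qed

lemma c1_one_variable:
  assumes "\<And>x. (p has_real_derivative p' x) (at x)" "continuous_on UNIV p'"
  shows "c1 N (\<lambda>\<xi>. p (\<xi> i))"
    "j \<le> N \<Longrightarrow> partial j (\<lambda>\<xi>. p (\<xi> i)) \<xi> = (if j = i then p' (\<xi> i) else 0)"
proof -
  have c: "continuous_on UNIV (\<lambda>\<xi>. q (\<xi> i))" if "continuous_on UNIV q" for q :: "real \<Rightarrow> real"
    by (rule continuous_on_compose2[OF that continuous_on_product_coordinates]) simp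
  have cp: "continuous_on UNIV p" using assms(1) by (meson DERIV_isCont continuous_at_imp_continuous_on)
  let ?G = "\<lambda>j \<xi>. if j = i then p' (\<xi> i) else 0"
  have d: "((\<lambda>x. p ((\<xi>(j := x)) i)) has_real_derivative ?G j \<xi>) (at (\<xi> j))" for j \<xi>
    using assms(1) by (cases "j = i") auto
  have p: "continuous_on UNIV (?G j)" for j
    using c[OF assms(2)] by (cases "j = i") auto
  show "c1 N (\<lambda>\<xi>. p (\<xi> i))" by (rule c1I(1)[where G' = ?G, OF c[OF cp] d p])
  show "partial j (\<lambda>\<xi>. p (\<xi> i)) \<xi> = ?G j \<xi>" if "j \<le> N"
    by (rule c1I(2)[where N = N and G' = ?G, OF c[OF cp] d p that])
qed

section \<open>Monomials as test functions for the Liouville equation\<close>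

locale liouville_functional =
  fixes N :: nat and \<mu> :: "'x measure" and \<nu> :: "'y measure" and b :: "'x \<Rightarrow> nat \<Rightarrow> real" and a :: "'y \<Rightarrow> nat \<Rightarrow> real"
    and c :: "nat \<Rightarrow> 'x \<Rightarrow> real" and \<zeta> :: "nat \<Rightarrow> real" and R C :: real
  assumes fin: "finite_measure \<mu>" "finite_measure \<nu>"
    and b: "b \<in> measurable \<mu> borel" "\<And>x i. x \<in> space \<mu> \<Longrightarrow> \<bar>b x i\<bar> \<le> R"
    and a: "a \<in> measurable \<nu> borel" "\<And>y i. y \<in> space \<nu> \<Longrightarrow> \<bar>a y i\<bar> \<le> R"
    and \<zeta>: "\<And>i. \<bar>\<zeta> i\<bar> \<le> R"
    and c: "\<And>j. j \<le> N \<Longrightarrow> c j \<in> borel_measurable \<mu>" "\<And>j x. j \<le> N \<Longrightarrow> x \<in> space \<mu> \<Longrightarrow> \<bar>c j x\<bar> \<le> C"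
    and R: "0 < R"
begin

text \<open>The defect of the Liouville equation for the test function \<open>G\<close>:
  \<open>b\<close> and \<open>a\<close> place the points of the two measures in sequence space, and
  \<open>c j\<close> is the velocity of coordinate \<open>j\<close>.\<close>

definition F :: "((nat \<Rightarrow> real) \<Rightarrow> real) \<Rightarrow> real" where
  "F G = (LINT y|\<nu>. G (a y)) - G \<zeta> - (LINT x|\<mu>. (\<Sum>j\<le>N. c j x * partial j G (b x)))"

definition box :: "(nat \<Rightarrow> real) set" where
  "box = {\<xi>. \<forall>i. \<bar>\<xi> i\<bar> \<le> R}"

lemma compact_box: "compact box"
proof -
  have "\<bar>x\<bar> \<le> R \<longleftrightarrow> x \<in> {- R..R}" for x :: real by auto
  then have "box = PiE UNIV (\<lambda>_. {- R..R})"
    by (simp add: box_def PiE_UNIV_domain Pi_def)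
  moreover have "compactin (product_topology (\<lambda>_. euclidean) UNIV) (PiE UNIV (\<lambda>_ :: nat. {- R..R}))"
    by (subst compactin_PiE) auto
  ultimately show ?thesis by (simp add: euclidean_product_topology)
qed

lemma bounded_on_box:
  assumes "continuous_on UNIV G"
  obtains K :: real where "\<And>\<xi>. \<xi> \<in> box \<Longrightarrow> \<bar>G \<xi>\<bar> \<le> K"
proof -
  have "compact (G ` box)"
    by (rule compact_continuous_image[OF _ compact_box]) (rule continuous_on_subset[OF assms], simp)
  then obtain K where "\<forall>y\<in>G ` box. norm y \<le> K"
    using compact_imp_bounded bounded_iff by blast
  then show ?thesis using that by auto
qed

lemma a_box: "y \<in> space \<nu> \<Longrightarrow> a y \<in> box" and b_box: "x \<in> space \<mu> \<Longrightarrow> b x \<in> box" and \<zeta>_box: "\<zeta> \<in> box"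
  using a b \<zeta> by (auto simp: box_def)

lemma meas_a: "continuous_on UNIV (G :: _ \<Rightarrow> real) \<Longrightarrow> (\<lambda>y. G (a y)) \<in> borel_measurable \<nu>"
  by (rule measurable_compose[OF a(1) borel_measurable_continuous_onI])

lemma meas_b: "continuous_on UNIV (G :: _ \<Rightarrow> real) \<Longrightarrow> (\<lambda>x. G (b x)) \<in> borel_measurable \<mu>"
  by (rule measurable_compose[OF b(1) borel_measurable_continuous_onI])

lemma meas_sum: "c1 N G \<Longrightarrow> (\<lambda>x. \<Sum>j\<le>N. c j x * partial j G (b x)) \<in> borel_measurable \<mu>"
  by (intro borel_measurable_sum borel_measurable_times c meas_b c1_continuous_partial) auto

lemma C_nonneg: "space \<mu> \<noteq> {} \<Longrightarrow> 0 \<le> C"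
  using c(2)[of 0] by force

lemma sum_bound:
  assumes "x \<in> space \<mu>" "\<And>j. j \<le> N \<Longrightarrow> \<bar>d j\<bar> \<le> K"
  shows "\<bar>\<Sum>j\<le>N. c j x * d j\<bar> \<le> real (Suc N) * (C * K)"
proof -
  have "\<bar>\<Sum>j\<le>N. c j x * d j\<bar> \<le> (\<Sum>j\<le>N. C * K)"
    by (rule order_trans[OF sum_abs sum_mono])
       (use assms c(2) C_nonneg in \<open>auto simp: abs_mult intro!: mult_mono\<close>)
  then show ?thesis by simp
qed

lemma integrable_a:
  assumes "c1 N G" shows "integrable \<nu> (\<lambda>y. G (a y))"
proof -
  obtain K where "\<And>\<xi>. \<xi> \<in> box \<Longrightarrow> \<bar>G \<xi>\<bar> \<le> K" using bounded_on_box[OF c1_continuous[OF assms]] by blast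
  then show ?thesis
    by (intro finite_measure.integrable_const_bound[OF fin(2), of _ K] meas_a c1_continuous[OF assms])
       (auto intro!: AE_I2 a_box)
qed

lemma partials_bounded_on_box:
  assumes "c1 N G"
  obtains K where "\<And>j \<xi>. j \<le> N \<Longrightarrow> \<xi> \<in> box \<Longrightarrow> \<bar>partial j G \<xi>\<bar> \<le> K"
proof -
  have "\<exists>K. j \<le> N \<longrightarrow> (\<forall>\<xi>\<in>box. \<bar>partial j G \<xi>\<bar> \<le> K)" for j
    using bounded_on_box[OF c1_continuous_partial[OF assms]] by metis
  then obtain K where K: "\<And>j. j \<le> N \<Longrightarrow> (\<forall>\<xi>\<in>box. \<bar>partial j G \<xi>\<bar> \<le> K j)" by metis
  have "K j \<le> Max (K ` {..N})" if "j \<le> N" for j using that by (intro Max_ge) auto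
  then show ?thesis using that[of "Max (K ` {..N})"] K by (meson order_trans)
qed

lemma integrable_b:
  assumes "c1 N G" shows "integrable \<mu> (\<lambda>x. \<Sum>j\<le>N. c j x * partial j G (b x))"
proof -
  obtain K where K: "\<And>j \<xi>. j \<le> N \<Longrightarrow> \<xi> \<in> box \<Longrightarrow> \<bar>partial j G \<xi>\<bar> \<le> K"
    using partials_bounded_on_box[OF assms] by blast
  have "norm (\<Sum>j\<le>N. c j x * partial j G (b x)) \<le> real (Suc N) * (C * K)" if "x \<in> space \<mu>" for x
    using sum_bound[OF that, of "\<lambda>j. partial j G (b x)" K] K b_box[OF that] by auto
  then show ?thesis
    by (intro finite_measure.integrable_const_bound[OF fin(1), of _ "real (Suc N) * (C * K)"] meas_sum assms)
       (auto intro!: AE_I2)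
qed

lemma F_add:
  assumes "c1 N G" "c1 N H"
  shows "F (\<lambda>\<xi>. G \<xi> + H \<xi>) = F G + F H"
proof -
  have "(\<Sum>j\<le>N. c j x * partial j (\<lambda>\<xi>. G \<xi> + H \<xi>) (b x))
      = (\<Sum>j\<le>N. c j x * partial j G (b x)) + (\<Sum>j\<le>N. c j x * partial j H (b x))" for x
    by (simp add: c1_add[OF assms] distrib_left sum.distrib)
  then show ?thesis
    unfolding F_def using assms by (simp add: integrable_a integrable_b)
qed

lemma F_cmult:
  assumes "c1 N G"
  shows "F (\<lambda>\<xi>. r * G \<xi>) = r * F G"
proof -
  have "(\<Sum>j\<le>N. c j x * partial j (\<lambda>\<xi>. r * G \<xi>) (b x)) = r * (\<Sum>j\<le>N. c j x * partial j G (b x))" for x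
    by (simp add: c1_cmult[OF assms] sum_distrib_left mult_ac)
  then show ?thesis
    unfolding F_def using assms by (simp add: right_diff_distrib)
qed

lemma F_sum:
  assumes "\<And>k. k \<in> K \<Longrightarrow> c1 N (G k)"
  shows "F (\<lambda>\<xi>. \<Sum>k\<in>K. G k \<xi>) = (\<Sum>k\<in>K. F (G k))"
  using assms
proof (induction K rule: infinite_finite_induct)
  case (insert k K)
  then show ?case using F_add[of "G k" "\<lambda>\<xi>. \<Sum>k\<in>K. G k \<xi>"] c1_sum(1)[of K N G] by simp
qed (use F_cmult[OF c1_const(1), of 0 0] in simp_all)

text \<open>Dominated convergence: the velocities are bounded and the measures finite. Bounded
  pointwise convergence of the function and of its partial derivatives on \<open>box\<close> is what
  Bernstein approximation in one coordinate provides.\<close>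

lemma F_tendsto:
  assumes G: "\<And>n. c1 N (G n)" and H: "c1 N H"
    and bd: "\<And>n \<xi>. \<xi> \<in> box \<Longrightarrow> \<bar>G n \<xi>\<bar> \<le> K" "\<And>n j \<xi>. j \<le> N \<Longrightarrow> \<xi> \<in> box \<Longrightarrow> \<bar>partial j (G n) \<xi>\<bar> \<le> K"
    and lim: "\<And>\<xi>. \<xi> \<in> box \<Longrightarrow> (\<lambda>n. G n \<xi>) \<longlonglongrightarrow> H \<xi>"
      "\<And>j \<xi>. j \<le> N \<Longrightarrow> \<xi> \<in> box \<Longrightarrow> (\<lambda>n. partial j (G n) \<xi>) \<longlonglongrightarrow> partial j H \<xi>"
  shows "(\<lambda>n. F (G n)) \<longlonglongrightarrow> F H"
  unfolding F_def
proof (intro tendsto_diff)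
  show "(\<lambda>n. LINT y|\<nu>. G n (a y)) \<longlonglongrightarrow> (LINT y|\<nu>. H (a y))"
  proof (rule integral_dominated_convergence[where w = "\<lambda>_. K"])
    show "integrable \<nu> (\<lambda>_. K)" using finite_measure.integrable_const[OF fin(2)] .
    show "AE y in \<nu>. (\<lambda>n. G n (a y)) \<longlonglongrightarrow> H (a y)" using lim(1) a_box by (auto intro!: AE_I2)
    show "AE y in \<nu>. norm (G n (a y)) \<le> K" for n using bd(1) a_box by (auto intro!: AE_I2)
  qed (auto intro!: meas_a c1_continuous G H)
  show "(\<lambda>n. G n \<zeta>) \<longlonglongrightarrow> H \<zeta>" by (rule lim(1)[OF \<zeta>_box])
  show "(\<lambda>n. LINT x|\<mu>. (\<Sum>j\<le>N. c j x * partial j (G n) (b x))) \<longlonglongrightarrow> (LINT x|\<mu>. (\<Sum>j\<le>N. c j x * partial j H (b x)))"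
  proof (rule integral_dominated_convergence[where w = "\<lambda>_. real (Suc N) * (C * K)"])
    show "integrable \<mu> (\<lambda>_. real (Suc N) * (C * K))" using finite_measure.integrable_const[OF fin(1)] .
    show "AE x in \<mu>. (\<lambda>n. \<Sum>j\<le>N. c j x * partial j (G n) (b x)) \<longlonglongrightarrow> (\<Sum>j\<le>N. c j x * partial j H (b x))"
      using lim(2) b_box by (auto intro!: AE_I2 tendsto_intros)
    show "AE x in \<mu>. norm (\<Sum>j\<le>N. c j x * partial j (G n) (b x)) \<le> real (Suc N) * (C * K)" for n
    proof (rule AE_I2)
      fix x assume x: "x \<in> space \<mu>"
      show "norm (\<Sum>j\<le>N. c j x * partial j (G n) (b x)) \<le> real (Suc N) * (C * K)"
        using sum_bound[OF x, of "\<lambda>j. partial j (G n) (b x)" K] bd(2) b_box[OF x] by auto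
    qed
  qed (auto intro!: meas_sum G H)
qed

text \<open>Coordinates in \<open>J\<close> stay free, all others are frozen at \<open>q\<close>;
  the density argument is an induction on \<open>J\<close>.\<close>

definition merge :: "nat set \<Rightarrow> (nat \<Rightarrow> real) \<Rightarrow> (nat \<Rightarrow> real) \<Rightarrow> nat \<Rightarrow> real" where
  "merge J q \<xi> = (\<lambda>i. if i \<in> J then \<xi> i else q i)"

lemma continuous_merge: "continuous_on UNIV (merge J q)"
proof (rule continuous_on_coordinatewise_then_product)
  show "continuous_on UNIV (\<lambda>\<xi>. merge J q \<xi> i)" for i
    by (cases "i \<in> J") (simp_all add: merge_def)
qed

lemma c1_merge:
  assumes "c1 N G"
  shows "c1 N (\<lambda>\<xi>. G (merge J q \<xi>))"
    "j \<le> N \<Longrightarrow> partial j (\<lambda>\<xi>. G (merge J q \<xi>)) \<xi> = (if j \<in> J then partial j G (merge J q \<xi>) else 0)"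
proof -
  let ?G = "\<lambda>j \<xi>. if j \<in> J then partial j G (merge J q \<xi>) else 0"
  have comp: "continuous_on UNIV (\<lambda>\<xi>. f (merge J q \<xi>))" if "continuous_on UNIV f" for f :: "_ \<Rightarrow> real"
    by (rule continuous_on_compose2[OF that continuous_merge]) simp
  have d: "((\<lambda>x. G (merge J q (\<xi>(j := x)))) has_real_derivative ?G j \<xi>) (at (\<xi> j))" if "j \<le> N" for j \<xi>
  proof (cases "j \<in> J")
    case True
    then have e: "merge J q (\<xi>(j := x)) = (merge J q \<xi>)(j := x)" for x by (auto simp: merge_def)
    have "merge J q \<xi> j = \<xi> j" using True by (simp add: merge_def)
    then show ?thesis using True c1_DERIV_at[OF assms that, of "merge J q \<xi>"] by (simp add: e)
  next
    case False
    then have "merge J q (\<xi>(j := x)) = merge J q \<xi>" for x by (auto simp: merge_def)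
    then show ?thesis using False by simp
  qed
  have p: "continuous_on UNIV (?G j)" if "j \<le> N" for j
    using comp[OF c1_continuous_partial[OF assms that]] by (cases "j \<in> J") auto
  show "c1 N (\<lambda>\<xi>. G (merge J q \<xi>))" by (rule c1I(1)[where G' = ?G, OF comp[OF c1_continuous[OF assms]] d p])
  show "partial j (\<lambda>\<xi>. G (merge J q \<xi>)) \<xi> = ?G j \<xi>" if "j \<le> N"
    by (rule c1I(2)[where N = N and G' = ?G, OF comp[OF c1_continuous[OF assms]] d p that])
qed

definition cmonom :: "(nat \<Rightarrow> nat) \<Rightarrow> (nat \<Rightarrow> real) \<Rightarrow> real" where
  "cmonom e \<xi> = (\<Prod>i\<le>N. \<xi> i ^ e i)"

lemma c1_power: "c1 N (\<lambda>\<xi>. \<xi> i ^ n)"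
  by (rule c1_one_variable(1)[where p' = "\<lambda>x. real n * x ^ (n - 1)"])
     (auto intro!: derivative_eq_intros continuous_intros)

lemma c1_cmonom: "c1 N (cmonom e)"
proof -
  have "c1 N (\<lambda>\<xi>. \<Prod>i\<in>I. \<xi> i ^ e i)" if "finite I" for I
    using that by (induction I rule: finite_induct) (auto intro: c1_const(1) c1_mult(1) c1_power)
  then show ?thesis unfolding cmonom_def[abs_def] by simp
qed

lemma cmonom_times_power:
  assumes "j \<le> N"
  shows "\<xi> j ^ l * cmonom e \<xi> = cmonom (e(j := e j + l)) \<xi>"
proof -
  have "cmonom f \<xi> = \<xi> j ^ f j * (\<Prod>i\<in>{..N} - {j}. \<xi> i ^ f i)" for f
    unfolding cmonom_def using assms by (subst prod.remove[of _ j]) auto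
  moreover have "(\<Prod>i\<in>{..N} - {j}. \<xi> i ^ (e(j := e j + l)) i) = (\<Prod>i\<in>{..N} - {j}. \<xi> i ^ e i)"
    by (rule prod.cong) auto
  ultimately show ?thesis by (simp add: power_add)
qed

lemma F_cong: assumes "\<And>\<xi>. G \<xi> = H \<xi>" shows "F G = F H"
  using assms by (metis ext)

text \<open>Approximate in coordinate \<open>j\<close> by Bernstein polynomials. Their coefficients
  freeze this coordinate at a node, and their basis polynomials are absorbed into the monomial
  factor, so the induction hypothesis makes \<open>F\<close> vanish on each approximant. The factor
  \<open>cmonom e\<close> with arbitrary \<open>e\<close> is carried along for this purpose.\<close>

lemma density_step:
  assumes G: "c1 N G" and j: "j \<le> N" "j \<notin> J" and q: "q \<in> box"
    and IH: "\<And>q e. q \<in> box \<Longrightarrow> F (\<lambda>\<xi>. G (merge J q \<xi>) * cmonom e \<xi>) = 0"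
  shows "F (\<lambda>\<xi>. G (merge (insert j J) q \<xi>) * cmonom e \<xi>) = 0"
proof -
  define H where "H \<xi> = G (merge (insert j J) q \<xi>)" for \<xi>
  \<comment> \<open>\<open>s\<close> maps \<open>[-R, R]\<close> affinely onto
    \<open>[0, 1]\<close>, and \<open>\<tau> n k\<close> is the preimage of the node
    \<open>k / n\<close>.\<close>
  define s where "s x = (x + R) / (2 * R)" for x
  define \<tau> where "\<tau> n k = 2 * R * (real k / real n) - R" for n k :: nat
  define B where "B n \<xi> = (\<Sum>k\<le>n. H (\<xi>(j := \<tau> n k)) * Bernstein n k (s (\<xi> j)))" for n \<xi>
  define g where "g \<xi> x = H (\<xi>(j := 2 * R * x - R))" for \<xi> x
  have Hc1: "c1 N H" unfolding H_def by (rule c1_merge(1)[OF G])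
  have \<tau>: "\<bar>\<tau> n k\<bar> \<le> R" if "k \<le> n" for n k
  proof -
    have "0 \<le> real k / real n" "real k / real n \<le> 1" using that by (auto simp: divide_le_eq_1)
    then have "0 \<le> 2 * R * (real k / real n)" "2 * R * (real k / real n) \<le> 2 * R * 1"
      using R by (simp, intro mult_left_mono) auto
    then show ?thesis by (simp add: \<tau>_def abs_le_iff)
  qed
  have s01: "s (\<xi> j) \<in> {0..1}" if "\<xi> \<in> box" for \<xi>
  proof -
    have "\<bar>\<xi> j\<bar> \<le> R" using that by (simp add: box_def)
    then have "0 \<le> \<xi> j + R" "\<xi> j + R \<le> 2 * R" by linarith+
    then show ?thesis using R by (simp add: s_def)
  qed
  have sinv: "2 * R * s x - R = x" for x using R by (simp add: s_def field_simps)
  have upd_box: "\<xi>(j := x) \<in> box" if "\<xi> \<in> box" "\<bar>x\<bar> \<le> R" for \<xi> x using that by (auto simp: box_def)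
  have g_der: "(g \<xi> has_real_derivative 2 * R * partial j H (\<xi>(j := 2 * R * x - R))) (at x)" for \<xi> x
  proof -
    have "((\<lambda>y. H (\<xi>(j := y))) \<circ> (\<lambda>x. 2 * R * x - R) has_real_derivative partial j H (\<xi>(j := 2 * R * x - R)) * (2 * R)) (at x)"
      by (rule DERIV_chain[OF c1_DERIV[OF Hc1 j(1)]]) (auto intro!: derivative_eq_intros)
    then show ?thesis by (simp add: g_def[abs_def] o_def mult.commute)
  qed
  have updc: "continuous_on UNIV (\<lambda>x. \<xi>(j := 2 * R * x - R))" for \<xi> :: "nat \<Rightarrow> real"
    by (intro continuous_on_fun_upd continuous_intros)
  have gcont: "continuous_on UNIV (\<lambda>x. f (\<xi>(j := 2 * R * x - R)))" if "continuous_on UNIV f" for f :: "_ \<Rightarrow> real" and \<xi>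
    by (rule continuous_on_compose2[OF that updc]) simp
  have B_tendsto: "(\<lambda>n. \<Sum>k\<le>n. f (\<xi>(j := \<tau> n k)) * Bernstein n k (s (\<xi> j))) \<longlonglongrightarrow> f \<xi>"
    if "continuous_on UNIV f" "\<xi> \<in> box" for f :: "_ \<Rightarrow> real" and \<xi>
    using bernstein_tendsto[OF continuous_on_subset[OF gcont[OF that(1), of \<xi>]] s01[OF that(2)]]
    by (simp add: \<tau>_def sinv)
  have B_bound: "\<bar>\<Sum>k\<le>n. f (\<xi>(j := \<tau> n k)) * Bernstein n k (s (\<xi> j))\<bar> \<le> K"
    if "\<And>\<xi>. \<xi> \<in> box \<Longrightarrow> \<bar>f \<xi>\<bar> \<le> K" "\<xi> \<in> box" for f :: "_ \<Rightarrow> real" and \<xi> n K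
    by (rule bernstein_sum_bound[OF s01[OF that(2)]]) (use that \<tau> upd_box in auto)
  \<comment> \<open>the summands have the form covered by the induction hypothesis, since the \<open>j\<close>-th coordinate is frozen\<close>
  have frozen: "H (\<xi>(j := x)) = G (merge J (q(j := x)) \<xi>)" for \<xi> x
  proof -
    have "merge (insert j J) q (\<xi>(j := x)) = merge J (q(j := x)) \<xi>"
      using j(2) by (auto simp: merge_def)
    then show ?thesis by (simp add: H_def)
  qed
  have summand_c1: "c1 N (\<lambda>\<xi>. H (\<xi>(j := x)))" for x unfolding frozen by (rule c1_merge(1)[OF G])
  have summand_partial: "partial i (\<lambda>\<xi>. H (\<xi>(j := x))) \<xi> = (if i = j then 0 else partial i H (\<xi>(j := x)))"
    if "i \<le> N" for i x \<xi>
  proof (cases "i = j")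
    case False
    have "(\<xi>(i := y))(j := x) = (\<xi>(j := x))(i := y)" for y using False by (simp add: fun_upd_twist)
    then show ?thesis using False by (simp add: partial_def)
  next
    case True
    then show ?thesis by (simp add: partial_def)
  qed
  define D where "D m k y = real (Suc m) * ((if k = 0 then 0 else Bernstein m (k - 1) y) - Bernstein m k y)" for m k y
  have s_der: "(s has_real_derivative 1 / (2 * R)) (at x)" for x
    unfolding s_def[abs_def] using R by (auto intro!: derivative_eq_intros)
  have s_cont: "continuous_on UNIV s" unfolding s_def[abs_def] using R by (intro continuous_intros) auto
  have Bern_der: "((\<lambda>x. Bernstein (Suc m) k (s x)) has_real_derivative D m k (s x) * (1 / (2 * R))) (at x)" for m k x
    using DERIV_chain[OF DERIV_Bernstein s_der, of m k x] by (simp add: o_def D_def)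
  have Bern_cont: "continuous_on UNIV (\<lambda>x. D m k (s x) * (1 / (2 * R)))" for m k
    unfolding D_def Bernstein_def using R by (cases "k = 0") (auto intro!: continuous_intros s_cont)
  note Bern_c1 = c1_one_variable[OF Bern_der Bern_cont]
  have B_c1: "c1 N (B (Suc m))" for m
    unfolding B_def by (intro c1_sum(1) c1_mult(1) summand_c1 Bern_c1(1))
  \<comment> \<open>In the other coordinates the partial derivative of the approximant is the
    Bernstein sum of a continuous function; only in coordinate \<open>j\<close> do derivatives of
    Bernstein polynomials have to converge.\<close>
  have partial_other: "partial i (B (Suc m)) \<xi> = (\<Sum>k\<le>Suc m. partial i H (\<xi>(j := \<tau> (Suc m) k)) * Bernstein (Suc m) k (s (\<xi> j)))"
    if i: "i \<le> N" "i \<noteq> j" for i m \<xi>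
    unfolding B_def
    by (subst c1_sum(2)[OF c1_mult(1)[OF summand_c1 Bern_c1(1)] i(1)], rule sum.cong[OF refl])
       (subst c1_mult(2)[OF summand_c1 Bern_c1(1) i(1)], simp add: summand_partial Bern_c1(2)[OF i(1)] i)
  have partial_j: "partial j (B (Suc m)) \<xi> = bernstein_deriv m (g \<xi>) (s (\<xi> j)) * (1 / (2 * R))" for m \<xi>
  proof -
    have e: "B (Suc m) (\<xi>(j := x)) = (\<Sum>k\<le>Suc m. g \<xi> (real k / real (Suc m)) * Bernstein (Suc m) k (s x))" for x
      by (simp add: B_def g_def \<tau>_def)
    have "((\<lambda>x. B (Suc m) (\<xi>(j := x))) has_real_derivative bernstein_deriv m (g \<xi>) (s (\<xi> j)) * (1 / (2 * R))) (at (\<xi> j))"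
      unfolding e using DERIV_chain[OF DERIV_bernstein_sum[of "g \<xi>" m "s (\<xi> j)"] s_der[of "\<xi> j"]] by (simp only: o_def)
    then show ?thesis unfolding partial_def by (rule DERIV_imp_deriv)
  qed
  have g_cont: "continuous_on {0..1} (\<lambda>x. 2 * R * partial j H (\<xi>(j := 2 * R * x - R)))" for \<xi>
    by (intro continuous_intros continuous_on_subset[OF gcont[OF c1_continuous_partial[OF Hc1 j(1)]]]) simp
  obtain KH where KH: "\<And>\<xi>. \<xi> \<in> box \<Longrightarrow> \<bar>H \<xi>\<bar> \<le> KH"
    using bounded_on_box[OF c1_continuous[OF Hc1]] by blast
  obtain KP where KP: "\<And>j \<xi>. j \<le> N \<Longrightarrow> \<xi> \<in> box \<Longrightarrow> \<bar>partial j H \<xi>\<bar> \<le> KP"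
    using partials_bounded_on_box[OF Hc1] by blast
  obtain M where M: "\<And>\<xi>. \<xi> \<in> box \<Longrightarrow> \<bar>cmonom e \<xi>\<bar> \<le> M"
    using bounded_on_box[OF c1_continuous[OF c1_cmonom]] by blast
  obtain MP where MP: "\<And>j \<xi>. j \<le> N \<Longrightarrow> \<xi> \<in> box \<Longrightarrow> \<bar>partial j (cmonom e) \<xi>\<bar> \<le> MP"
    using partials_bounded_on_box[OF c1_cmonom] by blast
  have Bb: "\<bar>B n \<xi>\<bar> \<le> KH" if "\<xi> \<in> box" for n \<xi>
    unfolding B_def by (rule B_bound[OF _ that]) (rule KH)
  have Bt: "(\<lambda>m. B (Suc m) \<xi>) \<longlonglongrightarrow> H \<xi>" if "\<xi> \<in> box" for \<xi>
    unfolding B_def by (rule LIMSEQ_Suc[OF B_tendsto[OF c1_continuous[OF Hc1] that]])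
  have Pb: "\<bar>partial i (B (Suc m)) \<xi>\<bar> \<le> KP" and Pt: "(\<lambda>m. partial i (B (Suc m)) \<xi>) \<longlonglongrightarrow> partial i H \<xi>"
    if i: "i \<le> N" and \<xi>: "\<xi> \<in> box" for i \<xi> m
  proof -
    have "\<bar>partial i (B (Suc m)) \<xi>\<bar> \<le> KP \<and> (\<lambda>m. partial i (B (Suc m)) \<xi>) \<longlonglongrightarrow> partial i H \<xi>"
    proof (cases "i = j")
      case False
      show ?thesis unfolding partial_other[OF i False]
        by (intro conjI B_bound[OF _ \<xi>] LIMSEQ_Suc[OF B_tendsto[OF c1_continuous_partial[OF Hc1 i] \<xi>]] KP[OF i])
    next
      case True
      have "\<bar>bernstein_deriv m (g \<xi>) (s (\<xi> j))\<bar> \<le> 2 * R * KP"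
      proof (rule bernstein_deriv_bound[OF g_der g_cont s01[OF \<xi>]])
        fix x :: real assume x: "x \<in> {0..1}"
        have "0 \<le> R * x" "R * x \<le> R" using x R by (auto intro: mult_left_le)
        then have "\<bar>2 * R * x - R\<bar> \<le> R" by (simp add: abs_le_iff)
        then show "\<bar>2 * R * partial j H (\<xi>(j := 2 * R * x - R))\<bar> \<le> 2 * R * KP"
          using KP[OF j(1) upd_box[OF \<xi>]] R by (simp add: abs_mult)
      qed
      moreover have "(\<lambda>m. bernstein_deriv m (g \<xi>) (s (\<xi> j)) * (1 / (2 * R)))
          \<longlonglongrightarrow> 2 * R * partial j H (\<xi>(j := 2 * R * s (\<xi> j) - R)) * (1 / (2 * R))"
        by (intro tendsto_mult_right bernstein_deriv_tendsto[OF g_der g_cont s01[OF \<xi>]])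
      ultimately show ?thesis
        unfolding True partial_j sinv using R by (simp add: abs_mult pos_divide_le_eq mult_ac)
    qed
    then show "\<bar>partial i (B (Suc m)) \<xi>\<bar> \<le> KP" "(\<lambda>m. partial i (B (Suc m)) \<xi>) \<longlonglongrightarrow> partial i H \<xi>" by auto
  qed
  have "(\<lambda>m. F (\<lambda>\<xi>. B (Suc m) \<xi> * cmonom e \<xi>)) \<longlonglongrightarrow> F (\<lambda>\<xi>. H \<xi> * cmonom e \<xi>)"
  proof (rule F_tendsto[where K = "\<bar>KH\<bar> * \<bar>M\<bar> + (\<bar>KP\<bar> * \<bar>M\<bar> + \<bar>MP\<bar> * \<bar>KH\<bar>)"])
    fix \<xi> assume \<xi>: "\<xi> \<in> box"
    show "\<bar>B (Suc n) \<xi> * cmonom e \<xi>\<bar> \<le> \<bar>KH\<bar> * \<bar>M\<bar> + (\<bar>KP\<bar> * \<bar>M\<bar> + \<bar>MP\<bar> * \<bar>KH\<bar>)" for n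
    proof -
      have "\<bar>B (Suc n) \<xi> * cmonom e \<xi>\<bar> \<le> \<bar>KH\<bar> * \<bar>M\<bar>"
        unfolding abs_mult using Bb[OF \<xi>, of "Suc n"] M[OF \<xi>] by (intro mult_mono) auto
      moreover have "0 \<le> \<bar>KP\<bar> * \<bar>M\<bar> + \<bar>MP\<bar> * \<bar>KH\<bar>" by simp
      ultimately show ?thesis by linarith
    qed
    show "(\<lambda>n. B (Suc n) \<xi> * cmonom e \<xi>) \<longlonglongrightarrow> H \<xi> * cmonom e \<xi>"
      by (intro tendsto_intros Bt \<xi>)
    fix i assume i: "i \<le> N"
    note pm = c1_mult(2)[OF B_c1 c1_cmonom i, of _ e \<xi>] c1_mult(2)[OF Hc1 c1_cmonom i, of e \<xi>]
    show "\<bar>partial i (\<lambda>\<xi>. B (Suc n) \<xi> * cmonom e \<xi>) \<xi>\<bar> \<le> \<bar>KH\<bar> * \<bar>M\<bar> + (\<bar>KP\<bar> * \<bar>M\<bar> + \<bar>MP\<bar> * \<bar>KH\<bar>)" for n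
    proof -
      have "\<bar>partial i (B (Suc n)) \<xi> * cmonom e \<xi>\<bar> \<le> \<bar>KP\<bar> * \<bar>M\<bar>"
        unfolding abs_mult using Pb[OF i \<xi>, of n] M[OF \<xi>] by (intro mult_mono) auto
      moreover have "\<bar>partial i (cmonom e) \<xi> * B (Suc n) \<xi>\<bar> \<le> \<bar>MP\<bar> * \<bar>KH\<bar>"
        unfolding abs_mult using MP[OF i \<xi>] Bb[OF \<xi>, of "Suc n"] by (intro mult_mono) auto
      moreover have "0 \<le> \<bar>KH\<bar> * \<bar>M\<bar>" by simp
      ultimately show ?thesis unfolding pm by linarith
    qed
    show "(\<lambda>n. partial i (\<lambda>\<xi>. B (Suc n) \<xi> * cmonom e \<xi>) \<xi>) \<longlonglongrightarrow> partial i (\<lambda>\<xi>. H \<xi> * cmonom e \<xi>) \<xi>"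
      unfolding pm by (intro tendsto_intros Bt Pt i \<xi>)
  qed (intro c1_mult(1) B_c1 Hc1 c1_cmonom)+
  moreover have "F (\<lambda>\<xi>. B (Suc m) \<xi> * cmonom e \<xi>) = 0" for m
  proof -
    \<comment> \<open>Expanding the basis polynomials in powers of \<open>\<xi> j\<close> turns the
      approximant into a combination of the functions covered by the induction hypothesis.\<close>
    have "real_polynomial_function (\<lambda>x. Bernstein (Suc m) k (s x))" for k
      unfolding Bernstein_def s_def
      by (intro real_polynomial_function_power real_polynomial_function_diff real_polynomial_function_divide
          real_polynomial_function.intros) auto
    then have "\<exists>p :: (nat \<Rightarrow> real) \<times> nat. \<forall>x. Bernstein (Suc m) k (s x) = (\<Sum>l\<le>snd p. fst p l * x ^ l)" for k
    proof -
      assume "\<And>k. real_polynomial_function (\<lambda>x. Bernstein (Suc m) k (s x))"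
      then obtain d L where "(\<lambda>x. Bernstein (Suc m) k (s x)) = (\<lambda>x. \<Sum>l\<le>L. d l * x ^ l)"
        unfolding real_polynomial_function_iff_sum by blast
      then have "\<forall>x. Bernstein (Suc m) k (s x) = (\<Sum>l\<le>snd (d, L). fst (d, L) l * x ^ l)"
        by (auto dest: fun_cong)
      then show ?thesis by (rule exI)
    qed
    then have "\<forall>k. \<exists>p :: (nat \<Rightarrow> real) \<times> nat. \<forall>x. Bernstein (Suc m) k (s x) = (\<Sum>l\<le>snd p. fst p l * x ^ l)" ..
    from choice[OF this] obtain p :: "nat \<Rightarrow> (nat \<Rightarrow> real) \<times> nat"
      where p: "\<forall>k. \<forall>x. Bernstein (Suc m) k (s x) = (\<Sum>l\<le>snd (p k). fst (p k) l * x ^ l)" by (elim exE)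
    define d where "d k = fst (p k)" for k
    define L where "L k = snd (p k)" for k
    have dL: "Bernstein (Suc m) k (s x) = (\<Sum>l\<le>L k. d k l * x ^ l)" for k x
      using p by (simp add: d_def L_def)
    let ?t = "\<lambda>k l \<xi>. G (merge J (q(j := \<tau> (Suc m) k)) \<xi>) * cmonom (e(j := e j + l)) \<xi>"
    have c: "c1 N (?t k l)" for k l by (rule c1_mult(1)[OF c1_merge(1)[OF G] c1_cmonom])
    have "B (Suc m) \<xi> * cmonom e \<xi> = (\<Sum>k\<le>Suc m. \<Sum>l\<le>L k. d k l * ?t k l \<xi>)" for \<xi>
      unfolding B_def dL frozen
      by (simp only: sum_distrib_left sum_distrib_right cmonom_times_power[OF j(1), symmetric] mult_ac)
    then have "F (\<lambda>\<xi>. B (Suc m) \<xi> * cmonom e \<xi>) = F (\<lambda>\<xi>. \<Sum>k\<le>Suc m. \<Sum>l\<le>L k. d k l * ?t k l \<xi>)"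
      by (rule F_cong)
    also have "\<dots> = (\<Sum>k\<le>Suc m. \<Sum>l\<le>L k. d k l * F (?t k l))"
      by (subst F_sum, intro c1_sum(1) c1_cmult(1) c, rule sum.cong[OF refl], subst F_sum, intro c1_cmult(1) c)
         (simp only: F_cmult[OF c])
    also have "\<dots> = 0"
    proof (intro sum.neutral ballI)
      fix k l assume "k \<in> {..Suc m}"
      then show "d k l * F (?t k l) = 0" using IH[OF upd_box[OF q \<tau>]] by simp
    qed
    finally show ?thesis .
  qed
  ultimately have "(\<lambda>m. 0 :: real) \<longlonglongrightarrow> F (\<lambda>\<xi>. H \<xi> * cmonom e \<xi>)" by simp
  then show ?thesis unfolding H_def using LIMSEQ_unique[OF tendsto_const] by fastforce
qed

text \<open>Approximating one coordinate at a time by Bernstein polynomials keeps the partial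
  derivatives under control, so monomials suffice as test functions.\<close>

lemma vanishes_on_c1:
  assumes mon: "\<And>e. F (cmonom e) = 0" and G: "c1 N G" and dep: "\<And>\<xi> \<xi>'. (\<And>i. i \<le> N \<Longrightarrow> \<xi> i = \<xi>' i) \<Longrightarrow> G \<xi> = G \<xi>'"
  shows "F G = 0"
proof -
  have "F (\<lambda>\<xi>. G (merge J q \<xi>) * cmonom e \<xi>) = 0" if "finite J" "J \<subseteq> {..N}" "q \<in> box" for J q e
    using that
  proof (induction J arbitrary: q e rule: finite_induct)
    case empty
    have "F (\<lambda>\<xi>. G q * cmonom e \<xi>) = G q * F (cmonom e)" by (rule F_cmult[OF c1_cmonom])
    then show ?case by (simp add: merge_def mon)
  next
    case (insert j J)
    then show ?case by (intro density_step[OF G]) auto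
  qed
  \<comment> \<open>All coordinates up to \<open>N\<close> are free and the monomial is 1;
    \<open>\<zeta>\<close> merely fills the coordinates on which \<open>G\<close> does not
    depend.\<close>
  from this[of "{..N}" \<zeta> "\<lambda>_. 0"] have "F (\<lambda>\<xi>. G (merge {..N} \<zeta> \<xi>) * cmonom (\<lambda>_. 0) \<xi>) = 0"
    using \<zeta>_box by simp
  moreover have "G (merge {..N} \<zeta> \<xi>) * cmonom (\<lambda>_. 0) \<xi> = G \<xi>" for \<xi>
    using dep[of "merge {..N} \<zeta> \<xi>" \<xi>] by (simp add: merge_def cmonom_def)
  ultimately show ?thesis by simp
qed

end

section \<open>Occupation measures\<close>

lemma AE_lebesgue_on_negligible_ex:
  assumes "S \<in> sets lebesgue" "AE t in lebesgue_on S. P t"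
  shows "\<exists>N. negligible N \<and> (\<forall>t\<in>S - N. P t)"
  by (rule AE_lebesgue_on_imp_negligible[OF assms]) auto

lemma measurable_restrict_borel:
  assumes "sets M = sets (restrict_space borel S)" "f \<in> borel_measurable borel"
  shows "f \<in> borel_measurable M"
  using measurable_restrict_space1[OF assms(2), of S] assms(1) by (simp cong: measurable_cong_sets)

lemma space_restrict_borel:
  "sets M = sets (restrict_space borel S) \<Longrightarrow> space M = S"
  by (metis sets_eq_imp_space_eq Int_UNIV_right space_borel space_restrict_space)

definition zmon :: "nat \<Rightarrow> nat \<Rightarrow> (nat \<Rightarrow> nat) \<Rightarrow> real \<times> (nat \<Rightarrow> real) \<Rightarrow> real" where
  "zmon N p e = (\<lambda>(t, z). t ^ p * (\<Prod>k\<in>{1..N}. z k ^ e k))"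

lemma zmon_upd:
  assumes "k \<in> {1..N}"
  shows "zmon N p e (t, z(k := x)) = x ^ e k * (t ^ p * (\<Prod>l\<in>{1..N} - {k}. z l ^ e l))"
proof -
  have "(\<Prod>l\<in>{1..N} - {k}. (z(k := x)) l ^ e l) = (\<Prod>l\<in>{1..N} - {k}. z l ^ e l)"
    by (rule prod.cong) auto
  moreover have "(\<Prod>l\<in>{1..N}. (z(k := x)) l ^ e l) = (z(k := x)) k ^ e k * (\<Prod>l\<in>{1..N} - {k}. (z(k := x)) l ^ e l)"
    by (rule prod.remove) (use assms in auto)
  ultimately show ?thesis by (simp only: zmon_def prod.case fun_upd_same mult_ac)
qed

lemma dt_zmon: "dt (zmon N p e) (t, z) = real p * zmon N (p - 1) e (t, z)"
proof -
  have "((\<lambda>s. s ^ p * (\<Prod>k\<in>{1..N}. z k ^ e k)) has_real_derivative real p * t ^ (p - 1) * (\<Prod>k\<in>{1..N}. z k ^ e k)) (at t)"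
    by (auto intro!: derivative_eq_intros)
  then show ?thesis by (simp add: dt_def zmon_def DERIV_imp_deriv)
qed

lemma dz_zmon:
  assumes "k \<in> {1..N}"
  shows "dz k (zmon N p e) (t, z) = real (e k) * zmon N p (e(k := e k - 1)) (t, z)"
proof -
  let ?c = "t ^ p * (\<Prod>l\<in>{1..N} - {k}. z l ^ e l)"
  have "((\<lambda>x. x ^ e k * ?c) has_real_derivative real (e k) * z k ^ (e k - 1) * ?c) (at (z k))"
    by (auto intro!: derivative_eq_intros)
  then have "dz k (zmon N p e) (t, z) = real (e k) * z k ^ (e k - 1) * ?c"
    by (simp only: dz_def zmon_upd[OF assms] prod.case) (rule DERIV_imp_deriv)
  moreover have "(\<Prod>l\<in>{1..N} - {k}. z l ^ (e(k := e k - 1)) l) = (\<Prod>l\<in>{1..N} - {k}. z l ^ e l)"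
    by (rule prod.cong) auto
  ultimately show ?thesis
    using zmon_upd[OF assms, of p "e(k := e k - 1)" t z "z k"] by simp
qed

text \<open>Passes from extensional states, which are \<open>undefined\<close> off
  \<open>1..N\<close>, to sequences with time in front. The value 0 above \<open>N\<close> keeps the
  point inside the box.\<close>

definition emb :: "nat \<Rightarrow> real \<Rightarrow> (nat \<Rightarrow> real) \<Rightarrow> nat \<Rightarrow> real" where
  "emb N t z = (\<lambda>i. if i = 0 then t else if i \<le> N then z i else 0)"

definition lift :: "nat \<Rightarrow> (real \<times> (nat \<Rightarrow> real) \<Rightarrow> real) \<Rightarrow> (nat \<Rightarrow> real) \<Rightarrow> real" where
  "lift N g \<xi> = g (\<xi> 0, restrict \<xi> {1..N})"

lemma restrict_emb: "z \<in> {1..N} \<rightarrow>\<^sub>E UNIV \<Longrightarrow> restrict (emb N t z) {1..N} = z"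
  by (auto simp: emb_def fun_eq_iff PiE_def extensional_def)

lemma lift_emb: "z \<in> {1..N} \<rightarrow>\<^sub>E UNIV \<Longrightarrow> lift N g (emb N t z) = g (t, z)"
  unfolding lift_def by (subst restrict_emb) (auto simp: emb_def)

lemma lift_emb_restrict: "lift N g (emb N t z) = g (t, restrict z {1..N})"
proof -
  have "restrict (emb N t z) {1..N} = restrict z {1..N}" by (auto simp: emb_def restrict_def)
  then show ?thesis by (simp add: lift_def) (simp add: emb_def)
qed

lemma partial_0_lift: "partial 0 (lift N g) \<xi> = dt g (\<xi> 0, restrict \<xi> {1..N})"
proof -
  have "restrict (\<xi>(0 := x)) {1..N} = restrict \<xi> {1..N}" for x by (auto simp: restrict_def)
  then show ?thesis by (simp add: partial_def dt_def lift_def)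
qed

lemma partial_k_lift:
  assumes "k \<in> {1..N}"
  shows "partial k (lift N g) \<xi> = dz k g (\<xi> 0, restrict \<xi> {1..N})"
proof -
  have "restrict (\<xi>(k := x)) {1..N} = (restrict \<xi> {1..N})(k := x)" for x using assms by (auto simp: restrict_def)
  then show ?thesis using assms by (simp add: partial_def dz_def lift_def)
qed

lemma c1_lift:
  assumes g: "g \<in> C1_functions N"
  shows "c1 N (lift N g)"
proof -
  let ?r = "\<lambda>\<xi> :: nat \<Rightarrow> real. (\<xi> 0, restrict \<xi> {1..N})"
  have rc: "continuous_on UNIV ?r"
  proof (intro continuous_on_Pair continuous_on_product_coordinates continuous_on_coordinatewise_then_product)
    show "continuous_on UNIV (\<lambda>\<xi> :: nat \<Rightarrow> real. restrict \<xi> {1..N} i)" for i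
    proof (cases "i \<in> {1..N}")
      case False
      then have eq: "(\<lambda>\<xi> :: nat \<Rightarrow> real. restrict \<xi> {1..N} i) = (\<lambda>_. undefined)" by (simp only: restrict_def if_False)
      show ?thesis by (rule ssubst[OF eq, of "continuous_on UNIV"]) simp
    qed (simp add: restrict_def)
  qed
  have comp: "continuous_on UNIV (\<lambda>\<xi>. f (?r \<xi>))" if "continuous_on (UNIV \<times> ({1..N} \<rightarrow>\<^sub>E UNIV)) f"
    for f :: "real \<times> (nat \<Rightarrow> real) \<Rightarrow> real"
    by (rule continuous_on_compose2[OF that rc]) auto
  show ?thesis unfolding c1_def
  proof (intro conjI allI impI)
    show "continuous_on UNIV (lift N g)" unfolding lift_def using g by (intro comp) (simp add: C1_functions_def)
    fix j assume j: "j \<le> N"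
    show "continuous_on UNIV (partial j (lift N g))"
    proof (cases "j = 0")
      case True
      have "partial j (lift N g) = (\<lambda>\<xi>. dt g (?r \<xi>))" unfolding True by (rule ext) (rule partial_0_lift)
      then show ?thesis using g by (simp only:) (rule comp, simp add: C1_functions_def)
    next
      case False
      then have k: "j \<in> {1..N}" using j by auto
      have "partial j (lift N g) = (\<lambda>\<xi>. dz j g (?r \<xi>))" by (rule ext) (rule partial_k_lift[OF k])
      then show ?thesis using g k by (simp only:) (rule comp, simp add: C1_functions_def)
    qed
    fix \<xi> :: "nat \<Rightarrow> real"
    have r: "restrict \<xi> {1..N} \<in> {1..N} \<rightarrow>\<^sub>E UNIV" by auto
    show "(\<lambda>x. lift N g (\<xi>(j := x))) differentiable at (\<xi> j)"
    proof (cases "j = 0")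
      case True
      have "restrict (\<xi>(0 := x)) {1..N} = restrict \<xi> {1..N}" for x by (auto simp: restrict_def)
      then show ?thesis using g r by (simp add: True lift_def C1_functions_def)
    next
      case False
      then have k: "j \<in> {1..N}" using j by auto
      then have "restrict (\<xi>(j := x)) {1..N} = (restrict \<xi> {1..N})(j := x)" for x by (auto simp: restrict_def)
      moreover have "(\<lambda>x. g (\<xi> 0, (restrict \<xi> {1..N})(j := x))) differentiable at (restrict \<xi> {1..N} j)"
        using g r k unfolding C1_functions_def by blast
      ultimately show ?thesis using False k by (simp add: lift_def)
    qed
  qed
qed

text \<open>Time is treated as one more coordinate, moving with velocity 1; this is the shape
  expected by \<open>liouville_functional\<close>.\<close>

lemma liouville_eq_partials:
  assumes "z \<in> {1..N} \<rightarrow>\<^sub>E UNIV"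
  shows "liouville N lam b g (t, z, u) =
    (\<Sum>j\<le>N. (if j = 0 then 1 else modal_rhs lam b j (z j) u) * partial j (lift N g) (emb N t z))"
proof -
  have 0: "partial 0 (lift N g) (emb N t z) = dt g (t, z)"
    by (simp only: partial_0_lift restrict_emb[OF assms]) (simp add: emb_def)
  have k: "partial k (lift N g) (emb N t z) = dz k g (t, z)" if "k \<in> {1..N}" for k
    by (simp only: partial_k_lift[OF that] restrict_emb[OF assms]) (simp add: emb_def)
  have "{..N} = insert 0 {1..N}" by auto
  then show ?thesis by (simp add: liouville_def 0 k)
qed

lemma cmonom_eq_lift_zmon:
  "(\<Prod>i\<le>N. \<xi> i ^ e i) = lift N (zmon N (e 0) e) \<xi>"
proof -
  have "{..N} = insert 0 {1..N}" by auto
  then show ?thesis by (simp add: lift_def zmon_def)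
qed

text \<open>Reduces the equation from all \<open>C\<^sup>1\<close> test functions to monomials.
  Occupation measures and limits of moment sequences both enter the linear program through this
  rule.\<close>

lemma lp_feasibleI:
  fixes b :: "nat \<Rightarrow> real^'m::finite \<Rightarrow> real"
  assumes fin: "finite_measure \<mu>" "finite_measure \<nu>"
    and sets: "sets \<mu> = sets (restrict_space borel ({0..T} \<times> (\<Pi>\<^sub>E k\<in>{1..N}. Z k) \<times> U))"
      "sets \<nu> = sets (restrict_space borel (\<Pi>\<^sub>E k\<in>{1..N}. ZT k))"
    and U: "compact U" and b: "\<And>k. continuous_on UNIV (b k)" and T: "0 \<le> T"
    and Z: "\<And>k. k \<in> {1..N} \<Longrightarrow> bounded (Z k) \<and> bounded (ZT k)"
    and mon: "\<And>p e. (LINT z|\<nu>. zmon N p e (T, z)) - zmon N p e (0, restrict \<zeta> {1..N})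
                = (LINT x|\<mu>. liouville N lam b (zmon N p e) x)"
  shows "(\<mu>, \<nu>) \<in> lp_feasible N lam b U Z ZT T \<zeta>"
proof -
  have sp: "space \<mu> = {0..T} \<times> (\<Pi>\<^sub>E k\<in>{1..N}. Z k) \<times> U" "space \<nu> = (\<Pi>\<^sub>E k\<in>{1..N}. ZT k)"
    by (rule space_restrict_borel[OF sets(1)], rule space_restrict_borel[OF sets(2)])
  have "\<exists>r. \<forall>k\<in>{1..N}. \<forall>x\<in>Z k \<union> ZT k \<union> {\<zeta> k}. \<bar>x\<bar> \<le> r"
  proof -
    have "\<forall>k\<in>{1..N}. \<exists>r. \<forall>x\<in>Z k \<union> ZT k \<union> {\<zeta> k}. \<bar>x\<bar> \<le> r"
    proof
      fix k assume "k \<in> {1..N}"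
      then have "bounded (Z k \<union> ZT k \<union> {\<zeta> k})" using Z by auto
      then show "\<exists>r. \<forall>x\<in>Z k \<union> ZT k \<union> {\<zeta> k}. \<bar>x\<bar> \<le> r" by (simp add: bounded_iff)
    qed
    from bchoice[OF this] obtain r where r: "\<forall>k\<in>{1..N}. \<forall>x\<in>Z k \<union> ZT k \<union> {\<zeta> k}. \<bar>x\<bar> \<le> r k" by blast
    have "r k \<le> Max (insert 0 (r ` {1..N}))" if "k \<in> {1..N}" for k using that by (intro Max_ge) auto
    then show ?thesis using r by (meson order_trans)
  qed
  then obtain r where r: "\<And>k x. k \<in> {1..N} \<Longrightarrow> x \<in> Z k \<union> ZT k \<union> {\<zeta> k} \<Longrightarrow> \<bar>x\<bar> \<le> r" by blast
  \<comment> \<open>Must be positive and dominate times, states, terminal states and initial values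
    simultaneously.\<close>
  define R where "R = max (max 1 T) (max 1 r)"
  have R: "0 < R" "T \<le> R" "r \<le> R" by (auto simp: R_def)
  have "\<exists>K. \<forall>k\<in>{1..N}. \<forall>u\<in>U. \<bar>b k u\<bar> \<le> K"
  proof -
    have "\<forall>k\<in>{1..N}. \<exists>K. \<forall>u\<in>U. \<bar>b k u\<bar> \<le> K"
    proof
      fix k
      have "compact (b k ` U)" by (rule compact_continuous_image[OF continuous_on_subset[OF b] U]) simp
      then show "\<exists>K. \<forall>u\<in>U. \<bar>b k u\<bar> \<le> K" using compact_imp_bounded bounded_iff by (metis image_eqI real_norm_def)
    qed
    from bchoice[OF this] obtain K where K: "\<forall>k\<in>{1..N}. \<forall>u\<in>U. \<bar>b k u\<bar> \<le> K k" by blast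
    have "K k \<le> Max (insert 0 (K ` {1..N}))" if "k \<in> {1..N}" for k using that by (intro Max_ge) auto
    then show ?thesis using K by (meson order_trans)
  qed
  then obtain K where K: "\<And>k u. k \<in> {1..N} \<Longrightarrow> u \<in> U \<Longrightarrow> \<bar>b k u\<bar> \<le> K" by blast
  define Lm where "Lm = Max (insert 0 ((\<lambda>k. \<bar>lam k\<bar>) ` {1..N}))"
  have Lm: "\<bar>lam k\<bar> \<le> Lm" if "k \<in> {1..N}" for k unfolding Lm_def using that by (intro Max_ge) auto
  define c where "c j x = (if j = 0 then 1 else modal_rhs lam b j (fst (snd x) j) (snd (snd x)))"
    for j and x :: "real \<times> (nat \<Rightarrow> real) \<times> (real^'m)"
  have emb_meas: "(\<lambda>x. emb N (f x) (g x)) \<in> borel_measurable M"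
    if "f \<in> borel_measurable M" "g \<in> borel_measurable M" for f g and M :: "'z measure"
  proof (rule measurable_coordinatewise_then_product)
    show "(\<lambda>x. emb N (f x) (g x) i) \<in> borel_measurable M" for i
      using that(1) measurable_product_then_coordinatewise[OF that(2), of i] by (cases "i = 0"; cases "i \<le> N") (simp_all add: emb_def)
  qed
  have proj: "fst \<in> borel_measurable \<mu>" "(\<lambda>x. fst (snd x)) \<in> borel_measurable \<mu>" "(\<lambda>x. snd (snd x)) \<in> borel_measurable \<mu>"
    by (rule measurable_restrict_borel[OF sets(1)], rule borel_measurable_continuous_onI, intro continuous_intros)+
  have embR: "\<bar>emb N t z i\<bar> \<le> R" if "t \<in> {0..T}" "\<And>k. k \<in> {1..N} \<Longrightarrow> \<bar>z k\<bar> \<le> r" for t z i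
    using that(1) that(2)[of i] R by (auto simp: emb_def)
  interpret liouville_functional N \<mu> \<nu> "\<lambda>x. emb N (fst x) (fst (snd x))" "\<lambda>z. emb N T z" c "emb N 0 \<zeta>" R "1 + Lm * \<bar>r\<bar> + \<bar>K\<bar>"
  proof (rule liouville_functional.intro)
    show "finite_measure \<mu>" "finite_measure \<nu>" by fact+
    show "(\<lambda>x. emb N (fst x) (fst (snd x))) \<in> borel_measurable \<mu>" by (intro emb_meas proj)
    show "(\<lambda>z. emb N T z) \<in> borel_measurable \<nu>"
      by (intro emb_meas measurable_restrict_borel[OF sets(2)]) auto
    show "\<bar>emb N (fst x) (fst (snd x)) i\<bar> \<le> R" if "x \<in> space \<mu>" for x i
    proof (rule embR)
      show "fst x \<in> {0..T}" using that by (auto simp: sp)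
      show "\<bar>fst (snd x) k\<bar> \<le> r" if k: "k \<in> {1..N}" for k
      proof (rule r[OF k])
        have "fst (snd x) \<in> (\<Pi>\<^sub>E k\<in>{1..N}. Z k)" using \<open>x \<in> space \<mu>\<close> by (auto simp: sp)
        then show "fst (snd x) k \<in> Z k \<union> ZT k \<union> {\<zeta> k}" using PiE_mem[OF _ k] by blast
      qed
    qed
    show "\<bar>emb N T y i\<bar> \<le> R" if "y \<in> space \<nu>" for y i
    proof (rule embR)
      show "T \<in> {0..T}" using T by simp
      show "\<bar>y k\<bar> \<le> r" if k: "k \<in> {1..N}" for k
        by (rule r[OF k]) (use PiE_mem[OF _ k, of y ZT] \<open>y \<in> space \<nu>\<close> sp in blast)
    qed
    show "\<bar>emb N 0 \<zeta> i\<bar> \<le> R" for i using T r by (intro embR) auto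
    show "0 < R" by fact
    fix j assume j: "j \<le> N"
    show "c j \<in> borel_measurable \<mu>"
    proof (cases "j = 0")
      case False
      have "(\<lambda>x. b j (snd (snd x))) \<in> borel_measurable \<mu>"
        by (rule measurable_compose[OF proj(3) borel_measurable_continuous_onI[OF b]])
      then show ?thesis using False measurable_product_then_coordinatewise[OF proj(2), of j]
        by (simp add: c_def[abs_def] modal_rhs_def)
    qed (simp add: c_def[abs_def])
    fix x assume x: "x \<in> space \<mu>"
    have U0: "snd (snd x) \<in> U" and Z0: "\<And>k. k \<in> {1..N} \<Longrightarrow> \<bar>fst (snd x) k\<bar> \<le> r"
    proof -
      show "snd (snd x) \<in> U" using x by (auto simp: sp)
      show "\<bar>fst (snd x) k\<bar> \<le> r" if k: "k \<in> {1..N}" for k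
      proof (rule r[OF k])
        have "fst (snd x) \<in> (\<Pi>\<^sub>E k\<in>{1..N}. Z k)" using x by (auto simp: sp)
        then show "fst (snd x) k \<in> Z k \<union> ZT k \<union> {\<zeta> k}" using PiE_mem[OF _ k] by blast
      qed
    qed
    have nn: "0 \<le> Lm" by (simp add: Lm_def)
    show "\<bar>c j x\<bar> \<le> 1 + Lm * \<bar>r\<bar> + \<bar>K\<bar>"
    proof (cases "j = 0")
      case True
      then show ?thesis using nn by (simp add: c_def)
    next
      case False
      then have k: "j \<in> {1..N}" using j by auto
      have "\<bar>lam j * fst (snd x) j\<bar> \<le> Lm * \<bar>r\<bar>"
        unfolding abs_mult using Lm[OF k] Z0[OF k] nn by (intro mult_mono) auto
      moreover have "\<bar>b j (snd (snd x))\<bar> \<le> \<bar>K\<bar>" using K[OF k U0] by linarith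
      ultimately show ?thesis using False by (simp add: c_def modal_rhs_def)
    qed
  qed
  have Feq: "F (lift N g) = (LINT z|\<nu>. g (T, z)) - g (0, restrict \<zeta> {1..N}) - (LINT x|\<mu>. liouville N lam b g x)" for g
  proof -
    have "(LINT y|\<nu>. lift N g (emb N T y)) = (LINT z|\<nu>. g (T, z))"
      by (rule Bochner_Integration.integral_cong) (auto simp: sp intro!: lift_emb)
    moreover have "(LINT x|\<mu>. (\<Sum>j\<le>N. c j x * partial j (lift N g) (emb N (fst x) (fst (snd x))))) = (LINT x|\<mu>. liouville N lam b g x)"
    proof (rule Bochner_Integration.integral_cong)
      fix x assume x: "x \<in> space \<mu>"
      obtain t z u where xt: "x = (t, z, u)" by (cases x)
      have zE: "z \<in> {1..N} \<rightarrow>\<^sub>E UNIV" using x xt by (auto simp: sp)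
      show "(\<Sum>j\<le>N. c j x * partial j (lift N g) (emb N (fst x) (fst (snd x)))) = liouville N lam b g x"
        by (simp only: xt c_def fst_conv snd_conv liouville_eq_partials[OF zE])
    qed simp
    ultimately show ?thesis unfolding F_def by (simp only: lift_emb_restrict)
  qed
  have "F (lift N g) = 0" if g: "g \<in> C1_functions N" for g
  proof (rule vanishes_on_c1)
    show "F (cmonom e) = 0" for e
    proof -
      have "cmonom e = lift N (zmon N (e 0) e)" by (rule ext) (simp add: cmonom_def cmonom_eq_lift_zmon)
      then show ?thesis using mon by (simp add: Feq)
    qed
    show "c1 N (lift N g)" by (rule c1_lift[OF g])
    show "lift N g \<xi> = lift N g \<xi>'" if "\<And>i. i \<le> N \<Longrightarrow> \<xi> i = \<xi>' i" for \<xi> \<xi>'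
    proof -
      have "restrict \<xi> {1..N} = restrict \<xi>' {1..N}" using that by (auto simp: restrict_def)
      then show ?thesis using that by (simp add: lift_def)
    qed
  qed
  then show ?thesis
    unfolding lp_feasible_def using fin sets Feq by auto
qed

lemma eval_tu_continuous: "continuous_on UNIV (\<lambda>x :: real \<times> (real^'m::finite). eval_tu h (fst x) (snd x))"
  unfolding eval_tu_def eval_mon_def by (auto simp: split_def intro!: continuous_intros)

text \<open>The witnesses are the image of Lebesgue measure under
  \<open>t \<mapsto> (t, z t, u t)\<close> and the Dirac measure at the terminal state. Feasibility
  is the fundamental theorem of calculus for each monomial along the trajectory.\<close>

lemma occupation_measure:
  fixes b :: "nat \<Rightarrow> real^'m::finite \<Rightarrow> real"
  assumes u: "u \<in> modal_controls N lam b U Z ZT T \<zeta>"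
    and U: "compact U" and b: "\<And>k. continuous_on UNIV (b k)" and T: "0 < T"
    and Z: "\<And>k. k \<in> {1..N} \<Longrightarrow> lo k \<le> hi k \<and> Z k = {lo k..hi k} \<and> bounded (ZT k)"
  shows "\<exists>(\<mu>, \<nu>)\<in>lp_feasible N lam b U Z ZT T \<zeta>. (LINT (t, z, u)|\<mu>. eval_tu h t u) = cost T h u"
proof -
  let ?L = "lebesgue_on {0..T}"
  let ?S = "{0..T} \<times> (\<Pi>\<^sub>E k\<in>{1..N}. Z k) \<times> U"
  let ?ST = "\<Pi>\<^sub>E k\<in>{1..N}. ZT k"
  obtain z where sol: "modal_solution N lam b T \<zeta> u z"
    and zZ: "AE t in ?L. \<forall>k\<in>{1..N}. z t k \<in> Z k" and zT: "\<And>k. k \<in> {1..N} \<Longrightarrow> z T k \<in> ZT k"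
    and uc: "u \<in> controls T U"
    using u unfolding modal_controls_def by blast
  have ac: "abs_continuous_on 0 T (\<lambda>t. z t k)" and z0: "z 0 k = \<zeta> k"
    and der: "AE t in ?L. ((\<lambda>s. z s k) has_real_derivative modal_rhs lam b k (z t k) (u t)) (at t within {0..T})"
    if "k \<in> {1..N}" for k
    using sol that by (auto simp: modal_solution_def)
  have um: "u \<in> borel_measurable ?L" and uU: "\<And>t. t \<in> {0..T} \<Longrightarrow> u t \<in> U"
    using uc by (auto simp: controls_def)
  \<comment> \<open>The trajectory is in the state set only almost everywhere, while the image
    measure has to live on that set; clamping repairs the exceptional times and leaves the integrals
    unchanged.\<close>
  define m where "m t = (t, \<lambda>k\<in>{1..N}. max (lo k) (min (hi k) (z t k)), u t)" for t
  have fl: "finite_measure ?L" by (rule finite_measure_lebesgue_on) simp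
  have zm: "(\<lambda>t. z t k) \<in> borel_measurable ?L" if "k \<in> {1..N}" for k
    by (rule continuous_imp_measurable_on_sets_lebesgue[OF abs_continuous_imp_continuous[OF ac[OF that]]]) simp
  have idm: "(\<lambda>t. t) \<in> borel_measurable ?L"
    by (rule continuous_imp_measurable_on_sets_lebesgue) (auto intro: continuous_intros)
  have mb: "m \<in> borel_measurable ?L"
    unfolding m_def
  proof (intro borel_measurable_Pair um idm measurable_coordinatewise_then_product)
    show "(\<lambda>t. (\<lambda>k\<in>{1..N}. max (lo k) (min (hi k) (z t k))) i) \<in> borel_measurable ?L" for i
    proof (cases "i \<in> {1..N}")
      case False
      then have eq: "(\<lambda>t. (\<lambda>k\<in>{1..N}. max (lo k) (min (hi k) (z t k))) i) = (\<lambda>_. undefined)" by (simp only: restrict_def if_False)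
      show ?thesis by (rule ssubst[OF eq, of "\<lambda>f. f \<in> borel_measurable ?L"]) simp
    next
      case True
      then have eq: "(\<lambda>t. (\<lambda>k\<in>{1..N}. max (lo k) (min (hi k) (z t k))) i) = (\<lambda>t. max (lo i) (min (hi i) (z t i)))" by (simp only: restrict_def if_True)
      show ?thesis by (rule ssubst[OF eq, of "\<lambda>f. f \<in> borel_measurable ?L"]) (intro borel_measurable_max borel_measurable_min borel_measurable_const zm[OF True])
    qed
  qed
  have mS: "m t \<in> ?S" if "t \<in> {0..T}" for t
    using that uU Z by (auto simp: m_def)
  have mm: "m \<in> measurable ?L (restrict_space borel ?S)"
    by (rule measurable_restrict_space2[OF _ mb]) (use mS in auto)
  define \<mu> where "\<mu> = distr ?L (restrict_space borel ?S) m"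
  define \<nu> where "\<nu> = return (restrict_space borel ?ST) (restrict (z T) {1..N})"
  have rT: "restrict (z T) {1..N} \<in> space (restrict_space borel ?ST)"
    using zT by (auto simp: space_restrict_space)
  have int\<mu>: "(LINT x|\<mu>. f x) = (LINT t|?L. f (m t))" if "f \<in> borel_measurable borel" for f :: "_ \<Rightarrow> real"
    unfolding \<mu>_def by (rule integral_distr[OF mm measurable_restrict_space1[OF that]])
  have int\<nu>: "(LINT x|\<nu>. f x) = f (restrict (z T) {1..N})" if "f \<in> borel_measurable borel" for f :: "_ \<Rightarrow> real"
    unfolding \<nu>_def by (rule integral_return[OF rT measurable_restrict_space1[OF that]])
  have zmon_cont: "continuous_on UNIV (zmon N p e)" for p e
    unfolding zmon_def split_def
    by (intro continuous_intros continuous_on_product_then_coordinatewise)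
  have zmon_meas: "zmon N p e \<in> borel_measurable borel" for p e
    by (rule borel_measurable_continuous_onI[OF zmon_cont])
  have mon: "(LINT x|\<nu>. zmon N p e (T, x)) - zmon N p e (0, restrict \<zeta> {1..N}) = (LINT x|\<mu>. liouville N lam b (zmon N p e) x)" for p e
  proof -
    let ?w = "\<lambda>t. zmon N p e (t, z t)"
    have restr: "zmon N p e (t, restrict y {1..N}) = zmon N p e (t, y)" for p e t y by (simp add: zmon_def)
    have liou: "liouville N lam b (zmon N p e) = (\<lambda>x. real p * zmon N (p - 1) e (fst x, fst (snd x)) +
       (\<Sum>k=1..N. (lam k * fst (snd x) k + b k (snd (snd x))) * (real (e k) * zmon N p (e(k := e k - 1)) (fst x, fst (snd x)))))"
      by (rule ext) (auto simp: liouville_def dt_zmon dz_zmon modal_rhs_def split_def)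
    have bc: "continuous_on UNIV (\<lambda>x :: real \<times> (nat \<Rightarrow> real) \<times> (real^'m). b k (snd (snd x)))" for k
      by (rule continuous_on_compose2[OF b]) (auto intro!: continuous_intros)
    have zc: "continuous_on UNIV (\<lambda>x :: real \<times> (nat \<Rightarrow> real) \<times> (real^'m). zmon N p e (fst x, fst (snd x)))" for p e
      by (rule continuous_on_compose2[OF zmon_cont])
         (auto intro!: continuous_on_Pair continuous_on_fst continuous_on_snd continuous_on_id)
    have cc: "continuous_on UNIV (\<lambda>x :: real \<times> (nat \<Rightarrow> real) \<times> (real^'m). fst (snd x) k)" for k
      by (rule continuous_on_product_then_coordinatewise)
         (intro continuous_on_fst continuous_on_snd continuous_on_id)
    have lm: "liouville N lam b (zmon N p e) \<in> borel_measurable borel"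
      unfolding liou by (intro borel_measurable_continuous_onI continuous_intros bc zc cc)
    have acw: "abs_continuous_on 0 T ?w"
    proof -
      have idac: "abs_continuous_on 0 T (\<lambda>t. t)" by (rule abs_continuous_lipschitz[of _ _ _ 1]) auto
      have cac: "abs_continuous_on 0 T (\<lambda>t. c)" for c by (rule abs_continuous_lipschitz[of _ _ _ 0]) auto
      have pac: "abs_continuous_on 0 T (\<lambda>t. f t ^ n)" if "abs_continuous_on 0 T f" for f n
        by (induction n) (auto intro: cac abs_continuous_mult that)
      have "abs_continuous_on 0 T (\<lambda>t. \<Prod>k\<in>K. z t k ^ e k)" if "finite K" "K \<subseteq> {1..N}" for K
        using that by (induction K rule: finite_induct) (auto intro!: cac abs_continuous_mult pac ac)
      then show ?thesis unfolding zmon_def by (auto intro!: abs_continuous_mult pac idac)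
    qed
    have "\<exists>M. negligible M \<and> (\<forall>t\<in>{0..T} - M. ((\<lambda>s. z s k) has_real_derivative modal_rhs lam b k (z t k) (u t)) (at t within {0..T}) \<and> z t k \<in> Z k)"
      if "k \<in> {1..N}" for k
    proof -
      have "AE t in ?L. ((\<lambda>s. z s k) has_real_derivative modal_rhs lam b k (z t k) (u t)) (at t within {0..T}) \<and> z t k \<in> Z k"
        using der[OF that] zZ by eventually_elim (use that in auto)
      from AE_lebesgue_on_negligible_ex[OF _ this] show ?thesis by simp
    qed
    then have "\<forall>k\<in>{1..N}. \<exists>M. negligible M \<and> (\<forall>t\<in>{0..T} - M. ((\<lambda>s. z s k) has_real_derivative modal_rhs lam b k (z t k) (u t)) (at t within {0..T}) \<and> z t k \<in> Z k)"
      by blast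
    from bchoice[OF this] obtain M where M: "\<And>k. k \<in> {1..N} \<Longrightarrow> negligible (M k)"
      "\<And>k t. k \<in> {1..N} \<Longrightarrow> t \<in> {0..T} - M k \<Longrightarrow> ((\<lambda>s. z s k) has_real_derivative modal_rhs lam b k (z t k) (u t)) (at t within {0..T}) \<and> z t k \<in> Z k"
      by (elim exE) blast
    \<comment> \<open>Removing the endpoints turns derivatives within \<open>[0, T]\<close> into
      ordinary ones.\<close>
    define NN where "NN = (\<Union>k\<in>{1..N}. M k) \<union> {0, T}"
    have NN: "negligible NN" unfolding NN_def by (intro negligible_Un negligible_Union) (auto intro: M(1))
    have derw: "(?w has_real_derivative liouville N lam b (zmon N p e) (m t)) (at t within {0..T})" if t: "t \<in> {0..T} - NN" for t
    proof -
      have t0: "0 < t" "t < T" using t by (auto simp: NN_def)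
      have at: "at t within {0..T} = at t" using t0 by (intro at_within_interior) (simp add: interior_atLeastAtMost_real)
      have zd: "((\<lambda>s. z s k) has_real_derivative modal_rhs lam b k (z t k) (u t)) (at t)" and zz: "z t k \<in> Z k"
        if "k \<in> {1..N}" for k
        using M(2)[OF that, of t] t that by (auto simp: NN_def at)
      have mt: "m t = (t, restrict (z t) {1..N}, u t)"
        using zz Z by (fastforce simp: m_def restrict_def)
      have pw: "((\<lambda>s. z s k ^ e k) has_real_derivative modal_rhs lam b k (z t k) (u t) * (real (e k) * z t k ^ (e k - 1))) (at t)"
        if "k \<in> {1..N}" for k
        using DERIV_power[OF zd[OF that], of "e k"] by (simp add: mult_ac)
      have "(?w has_real_derivative real p * t ^ (p - 1) * (\<Prod>k\<in>{1..N}. z t k ^ e k) +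
         (\<Sum>k\<in>{1..N}. modal_rhs lam b k (z t k) (u t) * (real (e k) * z t k ^ (e k - 1)) * (\<Prod>l\<in>{1..N} - {k}. z t l ^ e l)) * t ^ p) (at t)"
        unfolding zmon_def prod.case
        by (rule DERIV_mult[OF _ has_field_derivative_prod[OF pw]]) (auto intro!: derivative_eq_intros)
      also have "real p * t ^ (p - 1) * (\<Prod>k\<in>{1..N}. z t k ^ e k) +
         (\<Sum>k\<in>{1..N}. modal_rhs lam b k (z t k) (u t) * (real (e k) * z t k ^ (e k - 1)) * (\<Prod>l\<in>{1..N} - {k}. z t l ^ e l)) * t ^ p
         = liouville N lam b (zmon N p e) (m t)"
      proof -
        have zk: "zmon N p (e(k := e k - 1)) (t, z t) = z t k ^ (e k - 1) * (t ^ p * (\<Prod>l\<in>{1..N} - {k}. z t l ^ e l))" if "k \<in> {1..N}" for k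
        proof -
          have e1: "(\<Prod>l\<in>{1..N} - {k}. z t l ^ (e(k := e k - 1)) l) = (\<Prod>l\<in>{1..N} - {k}. z t l ^ e l)" by (rule prod.cong) auto
          show ?thesis using zmon_upd[OF that, of p "e(k := e k - 1)" t "z t" "z t k"]
            by (simp only: e1 fun_upd_same fun_upd_triv)
        qed
        have "liouville N lam b (zmon N p e) (m t) = real p * zmon N (p - 1) e (t, z t) +
          (\<Sum>k\<in>{1..N}. modal_rhs lam b k (z t k) (u t) * (real (e k) * zmon N p (e(k := e k - 1)) (t, z t)))"
          unfolding liou mt fst_conv snd_conv restr
          by (intro arg_cong2[where f = "(+)"] refl sum.cong) (simp add: modal_rhs_def)
        also have "(\<Sum>k\<in>{1..N}. modal_rhs lam b k (z t k) (u t) * (real (e k) * zmon N p (e(k := e k - 1)) (t, z t)))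
          = (\<Sum>k\<in>{1..N}. modal_rhs lam b k (z t k) (u t) * (real (e k) * z t k ^ (e k - 1)) * (\<Prod>l\<in>{1..N} - {k}. z t l ^ e l)) * t ^ p"
          unfolding sum_distrib_right by (rule sum.cong[OF refl]) (simp only: zk mult_ac)
        also have "real p * zmon N (p - 1) e (t, z t) = real p * t ^ (p - 1) * (\<Prod>k\<in>{1..N}. z t k ^ e k)"
          by (simp add: zmon_def)
        finally show ?thesis by simp
      qed
      finally show ?thesis by (simp add: at)
    qed
    have "((\<lambda>t. liouville N lam b (zmon N p e) (m t)) has_integral ?w T - ?w 0) {0..T}"
      by (rule fundamental_theorem_abs_continuous[OF _ acw AE_lebesgue_on_negligible[OF NN]]) (use T derw in auto)
    moreover have "integrable ?L (\<lambda>t. liouville N lam b (zmon N p e) (m t))"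
    proof -
      have "compact ((\<Pi>\<^sub>E k\<in>{1..N}. Z k) :: (nat \<Rightarrow> real) set)"
      proof -
        have "(\<Pi>\<^sub>E k\<in>{1..N}. Z k) = PiE UNIV (\<lambda>k. if k \<in> {1..N} then Z k else {undefined})"
          by (auto simp: PiE_def Pi_def extensional_def split: if_splits)
        moreover have "compactin (product_topology (\<lambda>_. euclidean) UNIV) (PiE UNIV (\<lambda>k :: nat. if k \<in> {1..N} then Z k else {undefined}))"
          by (subst compactin_PiE) (use Z in auto)
        ultimately show ?thesis by (simp add: euclidean_product_topology)
      qed
      then have "compact ?S" by (intro compact_Times U) auto
      moreover have "continuous_on UNIV (liouville N lam b (zmon N p e))"
        unfolding liou by (intro continuous_intros bc zc cc)
      ultimately have "compact (liouville N lam b (zmon N p e) ` ?S)"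
        by (intro compact_continuous_image) (auto intro: continuous_on_subset)
      then obtain K where K: "\<forall>y\<in>liouville N lam b (zmon N p e) ` ?S. norm y \<le> K"
        using compact_imp_bounded bounded_iff by blast
      have "norm (liouville N lam b (zmon N p e) (m t)) \<le> K" if "0 \<le> t" "t \<le> T" for t
        using K mS[of t] that by (meson atLeastAtMost_iff image_eqI)
      then show ?thesis
        by (rule integrable_lebesgue_on_bounded[where K = K, OF measurable_compose[OF mb lm]])
    qed
    ultimately have "(LINT t|?L. liouville N lam b (zmon N p e) (m t)) = ?w T - ?w 0"
      using integral_eq_lebesgue_on(2)[of 0 T "\<lambda>t. liouville N lam b (zmon N p e) (m t)"] by (simp add: integral_unique)
    moreover have "?w 0 = zmon N p e (0, restrict \<zeta> {1..N})"
      using z0 by (simp add: zmon_def)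
    moreover have "(\<lambda>x. zmon N p e (T, x)) \<in> borel_measurable borel"
      by (rule measurable_compose[OF _ zmon_meas]) (intro borel_measurable_Pair; simp)
    ultimately show ?thesis
      by (simp only: int\<mu>[OF lm] int\<nu> restr)
  qed
  have "(\<mu>, \<nu>) \<in> lp_feasible N lam b U Z ZT T \<zeta>"
  proof (rule lp_feasibleI[OF _ _ _ _ U b _ _ mon])
    show "finite_measure \<mu>" unfolding \<mu>_def by (rule finite_measure.finite_measure_distr[OF fl mm])
    show "finite_measure \<nu>" unfolding \<nu>_def by (intro prob_space.finite_measure prob_space_return rT)
  qed (use T Z in \<open>auto simp: \<mu>_def \<nu>_def\<close>)
  moreover have "(LINT (t, z, u)|\<mu>. eval_tu h t u) = cost T h u"
  proof -
    have "continuous_on UNIV (\<lambda>x :: real \<times> (nat \<Rightarrow> real) \<times> (real^'m). eval_tu h (fst (fst x, snd (snd x))) (snd (fst x, snd (snd x))))"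
      by (rule continuous_on_compose2[OF eval_tu_continuous]) (auto intro!: continuous_intros)
    then have "(\<lambda>x. case x of (t, z, u) \<Rightarrow> eval_tu h t u) \<in> borel_measurable (borel :: (real \<times> (nat \<Rightarrow> real) \<times> (real^'m)) measure)"
      by (intro borel_measurable_continuous_onI) (simp add: split_def)
    from int\<mu>[OF this] show ?thesis by (simp add: m_def cost_def)
  qed
  ultimately show ?thesis by blast
qed

section \<open>The semigroup in modal coordinates\<close>

text \<open>In \<open>c t = c (t / n) ^ n\<close> logarithms identify \<open>ln (c t) / t\<close>
  with the difference quotient of \<open>ln (c h)\<close> at \<open>h = t / n\<close>, which tends
  to \<open>l\<close>. Positivity near 0 comes from right continuity and passes to
  \<open>c t\<close> through the power.\<close>

lemma exponential_from_right_derivative: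
  fixes c :: "real \<Rightarrow> real"
  assumes mult: "\<And>s t. 0 \<le> s \<Longrightarrow> 0 \<le> t \<Longrightarrow> c (s + t) = c s * c t" and c0: "c 0 = 1"
    and der: "((\<lambda>h. (c h - 1) / h) \<longlongrightarrow> l) (at_right 0)" and t: "0 \<le> t"
  shows "c t = exp (l * t)"
proof (cases "t = 0")
  case False
  then have t0: "t > 0" using t by simp
  have iter: "c (real n * s) = c s ^ n" if "0 \<le> s" for n s
  proof (induction n)
    case (Suc n)
    have "c (real (Suc n) * s) = c (s + real n * s)" by (simp add: distrib_right)
    also have "\<dots> = c s * c (real n * s)" using that by (intro mult) auto
    finally show ?case using Suc by simp
  qed (simp add: c0)
  have dc: "(c has_real_derivative l) (at 0 within {0<..})"
    unfolding has_field_derivative_iff using der by (simp add: c0)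
  have dl: "((\<lambda>h. ln (c h)) has_real_derivative 1 * l) (at 0 within {0<..})"
    by (rule DERIV_chain2[OF _ dc]) (auto simp: c0 intro!: derivative_eq_intros)
  then have lim: "((\<lambda>h. ln (c h) / h) \<longlongrightarrow> l) (at_right 0)"
    unfolding has_field_derivative_iff by (simp add: c0)
  have fl: "filterlim (\<lambda>n. t / real (Suc n)) (at_right 0) sequentially"
    unfolding filterlim_at using t0 by (auto intro!: always_eventually) real_asymp
  have "continuous (at 0 within {0<..}) c" using dc by (rule DERIV_continuous)
  then have "(c \<longlongrightarrow> 1) (at_right 0)" by (simp add: continuous_within c0)
  then have "((\<lambda>n. c (t / real (Suc n))) \<longlongrightarrow> 1) sequentially" by (rule filterlim_compose[OF _ fl])
  then have "\<forall>\<^sub>F n in sequentially. c (t / real (Suc n)) > 0" by (rule order_tendstoD) simp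
  then have ev: "\<forall>\<^sub>F n in sequentially. c t > 0 \<and> ln (c (t / real (Suc n))) / (t / real (Suc n)) = ln (c t) / t"
  proof eventually_elim
    case (elim n)
    have e: "c t = c (t / real (Suc n)) ^ Suc n" using iter[of "t / real (Suc n)" "Suc n"] t0 by simp
    then have "c t > 0" using elim by simp
    moreover have "ln (c t) = real (Suc n) * ln (c (t / real (Suc n)))"
      unfolding e using elim by (simp only: ln_realpow)
    ultimately show ?case using t0 by simp
  qed
  have "((\<lambda>n. ln (c (t / real (Suc n))) / (t / real (Suc n))) \<longlongrightarrow> l) sequentially"
    by (rule filterlim_compose[OF lim fl])
  moreover have "((\<lambda>n. ln (c (t / real (Suc n))) / (t / real (Suc n))) \<longlongrightarrow> ln (c t) / t) sequentially"
    by (rule tendsto_eventually) (rule eventually_mono[OF ev], simp)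
  ultimately have "l = ln (c t) / t" using LIMSEQ_unique by blast
  moreover have "c t > 0" using eventually_happens[OF ev] by auto
  ultimately show ?thesis using t0 by simp
qed (simp add: c0)

locale modal_semigroup =
  fixes D :: "'h::{real_inner, banach, second_countable_topology} set" and A :: "'h \<Rightarrow> 'h" and lam :: "nat \<Rightarrow> real"
    and \<Phi> \<Psi> :: "nat \<Rightarrow> 'h" and S :: "real \<Rightarrow> 'h \<Rightarrow> 'h"
  assumes rs: "riesz_spectral D A lam \<Phi>" and dual: "dual_eigenvectors D A \<Phi> \<Psi>" and gen: "generates D A S"
begin

lemma S_bl: "0 \<le> t \<Longrightarrow> bounded_linear (S t)" and S_0: "S 0 = id"
  and S_add: "0 \<le> s \<Longrightarrow> 0 \<le> t \<Longrightarrow> S (s + t) x = S s (S t x)"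
  using gen by (auto simp: generates_def C0_semigroup_def)

lemma biorthogonal: "1 \<le> k \<Longrightarrow> 1 \<le> j \<Longrightarrow> \<Phi> k \<bullet> \<Psi> j = (if k = j then 1 else 0)"
  using dual by (simp add: dual_eigenvectors_def)

lemma span_dense: "closure (span (\<Phi> ` {1..})) = UNIV"
  using rs by (simp add: riesz_spectral_def riesz_basis_def)

text \<open>\<open>S t\<close> commutes with the difference quotients that define \<open>A\<close>,
  so it maps the eigenspace into itself; simplicity makes it act there as a scalar, and the
  semigroup law makes this scalar exponential in \<open>t\<close>.\<close>

lemma S_eigenvector:
  assumes k: "1 \<le> k" and t: "0 \<le> t"
  shows "S t (\<Phi> k) = exp (lam k * t) *\<^sub>R \<Phi> k"
proof -
  have gen': "x \<in> D \<and> A x = y \<longleftrightarrow> ((\<lambda>t. (S t x - x) /\<^sub>R t) \<longlongrightarrow> y) (at_right 0)" for x y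
    using gen by (simp add: generates_def)
  have \<Phi>: "\<Phi> k \<in> D" "A (\<Phi> k) = lam k *\<^sub>R \<Phi> k" and simple: "{x \<in> D. A x = lam k *\<^sub>R x} = span {\<Phi> k}"
    using rs k by (auto simp: riesz_spectral_def)
  have lim: "((\<lambda>t. (S t (\<Phi> k) - \<Phi> k) /\<^sub>R t) \<longlongrightarrow> lam k *\<^sub>R \<Phi> k) (at_right 0)"
    using \<Phi> gen' by blast
  define c where "c t = S t (\<Phi> k) \<bullet> \<Psi> k" for t
  have Sc: "S t (\<Phi> k) = c t *\<^sub>R \<Phi> k" if t: "0 \<le> t" for t
  proof -
    interpret bounded_linear "S t" by (rule S_bl[OF t])
    have "((\<lambda>h. S t ((S h (\<Phi> k) - \<Phi> k) /\<^sub>R h)) \<longlongrightarrow> S t (lam k *\<^sub>R \<Phi> k)) (at_right 0)"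
      by (rule tendsto[OF lim])
    moreover have "\<forall>\<^sub>F h in at_right 0. S t ((S h (\<Phi> k) - \<Phi> k) /\<^sub>R h) = (S h (S t (\<Phi> k)) - S t (\<Phi> k)) /\<^sub>R h"
      unfolding eventually_at_right_field
    proof (intro exI[of _ 1] conjI allI impI)
      fix h :: real assume "0 < h"
      then show "S t ((S h (\<Phi> k) - \<Phi> k) /\<^sub>R h) = (S h (S t (\<Phi> k)) - S t (\<Phi> k)) /\<^sub>R h"
        using S_add[of h t "\<Phi> k"] S_add[of t h "\<Phi> k"] t by (simp add: scaleR diff add.commute)
    qed simp
    ultimately have "((\<lambda>h. (S h (S t (\<Phi> k)) - S t (\<Phi> k)) /\<^sub>R h) \<longlongrightarrow> S t (lam k *\<^sub>R \<Phi> k)) (at_right 0)"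
      by (rule Lim_transform_eventually)
    then have "S t (\<Phi> k) \<in> D \<and> A (S t (\<Phi> k)) = S t (lam k *\<^sub>R \<Phi> k)" using gen' by blast
    then have "S t (\<Phi> k) \<in> span {\<Phi> k}" using simple by (auto simp: scaleR)
    then obtain r where r: "S t (\<Phi> k) = r *\<^sub>R \<Phi> k" by (auto simp: span_singleton)
    then have "c t = r" using biorthogonal[OF k k] by (simp add: c_def)
    then show ?thesis using r by simp
  qed
  have "c t = exp (lam k * t)"
  proof (rule exponential_from_right_derivative[OF _ _ _ t])
    show "c 0 = 1" using biorthogonal[OF k k] by (simp add: c_def S_0)
    show "c (s + t) = c s * c t" if "0 \<le> s" "0 \<le> t" for s t
    proof -
      interpret bounded_linear "S s" by (rule S_bl) fact
      have "S (s + t) (\<Phi> k) = S s (S t (\<Phi> k))" using that by (intro S_add) auto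
      also have "\<dots> = c t *\<^sub>R S s (\<Phi> k)" by (simp only: Sc[OF that(2)] scaleR)
      also have "\<dots> = (c t * c s) *\<^sub>R \<Phi> k" by (subst Sc[OF that(1)]) simp
      finally have "S (s + t) (\<Phi> k) = (c t * c s) *\<^sub>R \<Phi> k" .
      then show ?thesis using biorthogonal[OF k k] by (simp add: c_def[of "s + t"] mult.commute)
    qed
    have "((\<lambda>t. ((S t (\<Phi> k) - \<Phi> k) /\<^sub>R t) \<bullet> \<Psi> k) \<longlongrightarrow> (lam k *\<^sub>R \<Phi> k) \<bullet> \<Psi> k) (at_right 0)"
      by (intro tendsto_intros lim)
    then show "((\<lambda>h. (c h - 1) / h) \<longlongrightarrow> lam k) (at_right 0)"
      using biorthogonal[OF k k] by (simp add: c_def inner_diff_left divide_inverse mult.commute)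
  qed
  then show ?thesis using Sc[OF t] by simp
qed

text \<open>Both sides are continuous and linear in \<open>x\<close>, agree on the eigenvectors by
  biorthogonality, and the eigenvectors have dense span.\<close>

lemma coef_S:
  assumes k: "1 \<le> k" and t: "0 \<le> t"
  shows "S t x \<bullet> \<Psi> k = exp (lam k * t) * (x \<bullet> \<Psi> k)"
proof -
  interpret bounded_linear "S t" by (rule S_bl[OF t])
  let ?E = "{x. S t x \<bullet> \<Psi> k = exp (lam k * t) * (x \<bullet> \<Psi> k)}"
  have "subspace ?E"
    by (auto simp: subspace_def zero add scaleR inner_add_left distrib_left)
  moreover have "\<Phi> ` {1..} \<subseteq> ?E"
    using t k by (auto simp: S_eigenvector biorthogonal)
  ultimately have "span (\<Phi> ` {1..}) \<subseteq> ?E" by (rule span_minimal[rotated])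
  moreover have "closed ?E"
    by (intro closed_Collect_eq continuous_intros continuous_on)
  ultimately have "closure (span (\<Phi> ` {1..})) \<subseteq> ?E" by (rule closure_minimal)
  then show ?thesis using span_dense by blast
qed

lemma span_finite_sum:
  assumes "x \<in> span (\<Phi> ` {1..})"
  obtains \<alpha> n where "1 \<le> n" "x = (\<Sum>k=1..n. \<alpha> k *\<^sub>R \<Phi> k)"
proof -
  \<comment> \<open>The vanishing tail of \<open>\<alpha>\<close> lets two sums of different length
    be padded to a common upper index.\<close>
  have "\<exists>\<alpha> n. 1 \<le> n \<and> (\<forall>k>n. \<alpha> k = 0) \<and> x = (\<Sum>k=1..n. \<alpha> k *\<^sub>R \<Phi> k)"
    using assms
  proof (induction rule: span_induct_alt)
    case base
    show ?case by (rule exI[of _ "\<lambda>_. 0"], rule exI[of _ 1]) simp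
  next
    case (step c x y)
    then obtain j \<alpha> n where j: "1 \<le> j" "x = \<Phi> j" and n: "1 \<le> n" "\<forall>k>n. \<alpha> k = 0" "y = (\<Sum>k=1..n. \<alpha> k *\<^sub>R \<Phi> k)"
      by auto
    define m where "m = max n j"
    have y: "y = (\<Sum>k=1..m. \<alpha> k *\<^sub>R \<Phi> k)"
      unfolding n(3) by (rule sum.mono_neutral_left) (use n(2) in \<open>auto simp: m_def\<close>)
    have "(\<Sum>k=1..m. (if k = j then c else 0) *\<^sub>R \<Phi> k) = (\<Sum>k\<in>{1..m}. if k = j then c *\<^sub>R \<Phi> k else 0)"
      by (rule sum.cong) auto
    also have "\<dots> = c *\<^sub>R x" using j by (simp add: m_def)
    finally have "c *\<^sub>R x + y = (\<Sum>k=1..m. ((if k = j then c else 0) + \<alpha> k) *\<^sub>R \<Phi> k)"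
      by (simp add: y scaleR_add_left sum.distrib)
    then show ?case using n j
      by (intro exI[of _ "\<lambda>k. (if k = j then c else 0) + \<alpha> k"] exI[of _ m]) (auto simp: m_def)
  qed
  then show ?thesis using that by blast
qed

lemma S_sum:
  assumes "0 \<le> t"
  shows "S t (\<Sum>k=1..n. \<alpha> k *\<^sub>R \<Phi> k) = (\<Sum>k=1..n. (exp (lam k * t) * \<alpha> k) *\<^sub>R \<Phi> k)"
proof -
  interpret bounded_linear "S t" by (rule S_bl[OF assms])
  show ?thesis using assms by (auto simp: sum scaleR S_eigenvector mult.commute intro!: sum.cong)
qed

text \<open>Boundedness of \<open>S 1\<close> on the eigenvectors bounds all \<open>lam k\<close>
  from above. The Riesz inequalities then control \<open>S t\<close> on finite sums, uniformly for
  \<open>t\<close> in \<open>[0, T]\<close>, and density extends the bound.\<close>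

lemma S_bounded:
  obtains M where "M > 0" "\<And>t x. 0 \<le> t \<Longrightarrow> t \<le> T \<Longrightarrow> norm (S t x) \<le> M * norm x"
proof -
  have "bounded_linear (S 1)" by (rule S_bl) simp
  then obtain K1 where K1: "K1 > 0" "\<And>x. norm (S 1 x) \<le> norm x * K1"
    using bounded_linear.pos_bounded by blast
  have le: "lam k \<le> ln K1" if k: "1 \<le> k" for k
  proof -
    have "\<Phi> k \<noteq> 0" using rs k by (simp add: riesz_spectral_def)
    moreover have "norm (exp (lam k) *\<^sub>R \<Phi> k) \<le> norm (\<Phi> k) * K1" using K1(2)[of "\<Phi> k"] S_eigenvector[OF k, of 1] by simp
    ultimately have "exp (lam k) \<le> K1" by simp
    then show ?thesis using K1(1) by (simp add: ln_ge_iff)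
  qed
  obtain c C where cC: "c > 0" "C > 0" and
    rb: "\<And>n \<alpha>. 1 \<le> n \<Longrightarrow> c * (\<Sum>k=1..n. (\<alpha> k)\<^sup>2) \<le> (norm (\<Sum>k=1..n. \<alpha> k *\<^sub>R \<Phi> k))\<^sup>2 \<and>
        (norm (\<Sum>k=1..n. \<alpha> k *\<^sub>R \<Phi> k))\<^sup>2 \<le> C * (\<Sum>k=1..n. (\<alpha> k)\<^sup>2)"
    using rs unfolding riesz_spectral_def riesz_basis_def by blast
  define E where "E = exp (\<bar>ln K1\<bar> * \<bar>T\<bar>)"
  \<comment> \<open>\<open>sqrt (C / c)\<close> is the price of passing from the norm to the
    coefficients and back; \<open>E\<close> bounds the exponentials.\<close>
  define M where "M = sqrt (C / c) * E"
  have M: "M > 0" using cC by (simp add: M_def E_def)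
  have bd: "norm (S t x) \<le> M * norm x" if t: "0 \<le> t" "t \<le> T" for t x
  proof -
    interpret bounded_linear "S t" by (rule S_bl[OF t(1)])
    let ?E = "{x. norm (S t x) \<le> M * norm x}"
    have "span (\<Phi> ` {1..}) \<subseteq> ?E"
    proof
      fix x assume "x \<in> span (\<Phi> ` {1..})"
      then obtain \<alpha> n where n: "1 \<le> n" and x: "x = (\<Sum>k=1..n. \<alpha> k *\<^sub>R \<Phi> k)" by (rule span_finite_sum)
      have ek: "exp (lam k * t) \<le> E" if "1 \<le> k" for k
      proof -
        have "lam k * t \<le> \<bar>ln K1\<bar> * t" using le[OF that] t by (intro mult_right_mono) auto
        also have "\<dots> \<le> \<bar>ln K1\<bar> * \<bar>T\<bar>" using t by (intro mult_left_mono) auto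
        finally show ?thesis by (simp add: E_def)
      qed
      have "(norm (S t x))\<^sup>2 \<le> C * (\<Sum>k=1..n. (exp (lam k * t) * \<alpha> k)\<^sup>2)"
        unfolding x S_sum[OF t(1)] using rb[OF n, of "\<lambda>k. exp (lam k * t) * \<alpha> k"] by blast
      also have "\<dots> \<le> C * (\<Sum>k=1..n. E\<^sup>2 * (\<alpha> k)\<^sup>2)"
        using cC ek by (intro mult_left_mono sum_mono) (auto simp: power_mult_distrib intro!: mult_right_mono power_mono)
      also have "\<dots> = (C / c) * E\<^sup>2 * (c * (\<Sum>k=1..n. (\<alpha> k)\<^sup>2))"
        using cC by (simp add: sum_distrib_left)
      also have "\<dots> \<le> (C / c) * E\<^sup>2 * (norm x)\<^sup>2"
        using rb[OF n, of \<alpha>] cC unfolding x by (intro mult_left_mono) auto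
      also have "\<dots> = (M * norm x)\<^sup>2" using cC by (simp add: M_def power_mult_distrib)
      finally have "norm (S t x) \<le> M * norm x" using M by (intro power2_le_imp_le[of "norm (S t x)"]) auto
      then show "x \<in> ?E" by simp
    qed
    moreover have "closed ?E" by (intro closed_Collect_le continuous_intros continuous_on)
    ultimately have "closure (span (\<Phi> ` {1..})) \<subseteq> ?E" by (rule closure_minimal)
    then show ?thesis using span_dense by blast
  qed
  show ?thesis by (rule that[OF M bd])
qed

text \<open>On finite sums of eigenvectors the orbit is explicit; the bound of
  \<open>S_bounded\<close> makes the approximation by such sums uniform in \<open>t\<close>.\<close>

lemma S_continuous: "continuous_on {0..T} (\<lambda>t. S t x)"
proof -
  obtain M where M: "M > 0" "\<And>t x. 0 \<le> t \<Longrightarrow> t \<le> T \<Longrightarrow> norm (S t x) \<le> M * norm x" using S_bounded by blast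
  have "x \<in> closure (span (\<Phi> ` {1..}))" using span_dense by blast
  then obtain y where y: "\<And>n. y n \<in> span (\<Phi> ` {1..})" "y \<longlonglongrightarrow> x"
    unfolding closure_sequential by blast
  have yc: "continuous_on {0..T} (\<lambda>t. S t (y n))" for n
  proof -
    obtain \<alpha> m where m: "1 \<le> m" "y n = (\<Sum>k=1..m. \<alpha> k *\<^sub>R \<Phi> k)" using y(1)[of n] by (rule span_finite_sum)
    have "continuous_on {0..T} (\<lambda>t. \<Sum>k=1..m. (exp (lam k * t) * \<alpha> k) *\<^sub>R \<Phi> k)"
      by (intro continuous_intros)
    then show ?thesis unfolding m(2) by (rule continuous_on_eq) (simp only: S_sum atLeastAtMost_iff)
  qed
  have "uniform_limit {0..T} (\<lambda>n t. S t (y n)) (\<lambda>t. S t x) sequentially"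
    unfolding uniform_limit_iff
  proof (intro allI impI)
    fix e :: real assume "0 < e"
    then have "\<forall>\<^sub>F n in sequentially. dist (y n) x < e / M" using tendstoD[OF y(2), of "e / M"] M(1) by simp
    then show "\<forall>\<^sub>F n in sequentially. \<forall>t\<in>{0..T}. dist (S t (y n)) (S t x) < e"
    proof eventually_elim
      case (elim n)
      show ?case
      proof
        fix t assume t: "t \<in> {0..T}"
        then interpret bounded_linear "S t" by (intro S_bl) auto
        have "dist (S t (y n)) (S t x) \<le> M * norm (y n - x)"
          using M(2)[of t "y n - x"] t by (simp add: dist_norm diff)
        also have "\<dots> < e" using elim M(1) by (simp add: dist_norm pos_less_divide_eq mult.commute)
        finally show "dist (S t (y n)) (S t x) < e" .
      qed
    qed
  qed
  then show ?thesis by (rule uniform_limit_theorem[rotated]) (auto intro: always_eventually yc)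
qed

text \<open>Pairing with \<open>\<Psi> k\<close> passes under the integral, where
  \<open>coef_S\<close> replaces the semigroup by an exponential; the mode is thus given by the
  formula of \<open>duhamel\<close>.\<close>

lemma coef_mild_solution:
  fixes B :: "real^'m::finite \<Rightarrow> 'h"
  assumes B: "bounded_linear B" and u: "u \<in> controls T U" and t: "0 \<le> t" "t \<le> T" and k: "1 \<le> k"
  shows "coef \<Psi> (mild_solution S B z0 u t) k =
    exp (lam k * t) * (coef \<Psi> z0 k + (LINT s|lebesgue_on {0..t}. exp (- lam k * s) * modal_input \<Psi> B k (u s)))"
proof -
  interpret B: bounded_linear B by (rule B)
  let ?L = "lebesgue_on {0..t}"
  let ?f = "\<lambda>s. S (t - s) (B (u s))"
  have "u \<in> borel_measurable (lebesgue_on {0..T})" using u by (simp add: controls_def)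
  then have um: "u \<in> borel_measurable ?L" by (rule measurable_restrict_mono) (use t in auto)
  obtain K where K: "\<And>s. s \<in> {0..T} \<Longrightarrow> norm (u s) \<le> K"
  proof -
    have "bounded (u ` {0..T})" using u by (simp add: controls_def)
    then show ?thesis using that by (force simp: bounded_iff)
  qed
  obtain M where M: "M > 0" "\<And>t x. 0 \<le> t \<Longrightarrow> t \<le> T \<Longrightarrow> norm (S t x) \<le> M * norm x" using S_bounded by blast
  obtain KB where KB: "KB > 0" "\<And>x. norm (B x) \<le> norm x * KB" using B.pos_bounded by blast
  \<comment> \<open>In the standard basis the integrand is a finite combination of continuous orbits
    with measurable coefficients, which settles its measurability.\<close>
  have expand: "?f s = (\<Sum>i\<in>UNIV. (u s $ i) *\<^sub>R S (t - s) (B (axis i 1)))" if "s \<in> {0..t}" for s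
  proof -
    interpret St: bounded_linear "S (t - s)" by (rule S_bl) (use that in auto)
    have "u s = (\<Sum>i\<in>UNIV. (u s $ i) *\<^sub>R axis i 1)"
      using basis_expansion[of "u s"] by (simp add: scalar_mult_eq_scaleR)
    then have "?f s = S (t - s) (B (\<Sum>i\<in>UNIV. (u s $ i) *\<^sub>R axis i 1))" by simp
    then show ?thesis by (simp only: B.sum B.scaleR St.sum St.scaleR)
  qed
  have Sm: "(\<lambda>s. S (t - s) x) \<in> borel_measurable ?L" for x
  proof (rule continuous_imp_measurable_on_sets_lebesgue)
    show "continuous_on {0..t} (\<lambda>s. S (t - s) x)"
      by (rule continuous_on_compose2[OF S_continuous[of t]]) (auto intro!: continuous_intros)
  qed simp
  have "(\<lambda>s. \<Sum>i\<in>UNIV. (u s $ i) *\<^sub>R S (t - s) (B (axis i 1))) \<in> borel_measurable ?L"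
    by (intro borel_measurable_sum borel_measurable_scaleR Sm measurable_compose[OF um] borel_measurable_continuous_onI continuous_intros)
  then have fm: "?f \<in> borel_measurable ?L"
    by (rule measurable_cong[THEN iffD1, rotated]) (simp add: expand)
  have fi: "integrable ?L ?f"
  proof (rule integrable_lebesgue_on_bounded[OF fm, of "M * (K * KB)"])
    fix s assume s: "0 \<le> s" "s \<le> t"
    have "norm (?f s) \<le> M * norm (B (u s))" using s t by (intro M) auto
    also have "\<dots> \<le> M * (norm (u s) * KB)" using KB M by (intro mult_left_mono) auto
    also have "\<dots> \<le> M * (K * KB)" using KB M K s t by (intro mult_left_mono mult_right_mono) auto
    finally show "norm (?f s) \<le> M * (K * KB)" .
  qed
  have "(LINT s|?L. ?f s) \<bullet> \<Psi> k = (LINT s|?L. ?f s \<bullet> \<Psi> k)"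
    by (rule integral_inner_left[symmetric]) (use fi in simp)
  also have "\<dots> = (LINT s|?L. exp (lam k * t) * (exp (- lam k * s) * modal_input \<Psi> B k (u s)))"
  proof (rule Bochner_Integration.integral_cong)
    fix s assume "s \<in> space ?L"
    then have "?f s \<bullet> \<Psi> k = exp (lam k * (t - s)) * (B (u s) \<bullet> \<Psi> k)" by (intro coef_S k) auto
    also have "exp (lam k * (t - s)) = exp (lam k * t) * exp (- lam k * s)"
      by (simp add: algebra_simps flip: exp_add)
    finally show "?f s \<bullet> \<Psi> k = exp (lam k * t) * (exp (- lam k * s) * modal_input \<Psi> B k (u s))"
      by (simp add: modal_input_def)
  qed simp
  also have "\<dots> = exp (lam k * t) * (LINT s|?L. exp (- lam k * s) * modal_input \<Psi> B k (u s))" by simp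
  finally show ?thesis
    using coef_S[OF k t(1), of z0]
    by (simp add: coef_def mild_solution_def inner_add_left distrib_left)
qed

lemma modal_input_bounded_measurable:
  fixes B :: "real^'m::finite \<Rightarrow> 'h"
  assumes B: "bounded_linear B" and u: "u \<in> controls T U"
  shows "(\<lambda>s. modal_input \<Psi> B k (u s)) \<in> borel_measurable (lebesgue_on {0..T})"
    "\<exists>K. \<forall>s. 0 \<le> s \<and> s \<le> T \<longrightarrow> \<bar>modal_input \<Psi> B k (u s)\<bar> \<le> K"
proof -
  interpret B: bounded_linear B by (rule B)
  have um: "u \<in> borel_measurable (lebesgue_on {0..T})" using u by (simp add: controls_def)
  have "continuous_on UNIV (modal_input \<Psi> B k)"
    unfolding modal_input_def[abs_def] by (intro continuous_intros B.continuous_on)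
  then show "(\<lambda>s. modal_input \<Psi> B k (u s)) \<in> borel_measurable (lebesgue_on {0..T})"
    by (intro measurable_compose[OF um] borel_measurable_continuous_onI)
  obtain K where K: "\<And>s. s \<in> {0..T} \<Longrightarrow> norm (u s) \<le> K"
  proof -
    have "bounded (u ` {0..T})" using u by (simp add: controls_def)
    then show ?thesis using that by (force simp: bounded_iff)
  qed
  obtain KB where KB: "KB > 0" "\<And>x. norm (B x) \<le> norm x * KB" using B.pos_bounded by blast
  have "\<bar>modal_input \<Psi> B k (u s)\<bar> \<le> (K * KB) * norm (\<Psi> k)" if "0 \<le> s" "s \<le> T" for s
  proof -
    have "\<bar>modal_input \<Psi> B k (u s)\<bar> \<le> norm (B (u s)) * norm (\<Psi> k)" unfolding modal_input_def by (rule Cauchy_Schwarz_ineq2)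
    also have "\<dots> \<le> (norm (u s) * KB) * norm (\<Psi> k)" by (intro mult_right_mono KB) auto
    also have "\<dots> \<le> (K * KB) * norm (\<Psi> k)" using K[of s] that KB by (intro mult_right_mono) auto
    finally show ?thesis .
  qed
  then show "\<exists>K. \<forall>s. 0 \<le> s \<and> s \<le> T \<longrightarrow> \<bar>modal_input \<Psi> B k (u s)\<bar> \<le> K" by blast
qed

text \<open>The coordinates of the mild solution solve the modal equations, and membership in
  \<open>X\<close> or \<open>XT\<close> passes to each coordinate. The larger set of controls gives
  the smaller infimum.\<close>

lemma full_controls_subset_modal_controls:
  fixes B :: "real^'m::finite \<Rightarrow> 'h"
  assumes B: "bounded_linear B" and T: "0 < T"
  shows "full_controls S B U X XT T z0 \<subseteq>
    modal_controls N lam (modal_input \<Psi> B) U (modal_set \<Psi> X) (modal_set \<Psi> XT) T (coef \<Psi> z0)"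
proof
  fix u assume "u \<in> full_controls S B U X XT T z0"
  then have u: "u \<in> controls T U" and X: "AE t in lebesgue_on {0..T}. mild_solution S B z0 u t \<in> X"
    and XT: "mild_solution S B z0 u T \<in> XT" by (auto simp: full_controls_def)
  define z where "z t k = exp (lam k * t) * (coef \<Psi> z0 k + (LINT s|lebesgue_on {0..t}. exp (- lam k * s) * modal_input \<Psi> B k (u s)))"
    for t k
  have zc: "z t k = coef \<Psi> (mild_solution S B z0 u t) k" if "1 \<le> k" "t \<in> {0..T}" for t k
    using coef_mild_solution[OF B u _ _ that(1), of t z0] that by (simp add: z_def)
  have "modal_solution N lam (modal_input \<Psi> B) T (coef \<Psi> z0) u z"
    unfolding modal_solution_def
  proof
    fix k
    obtain K where K: "\<And>s. 0 \<le> s \<Longrightarrow> s \<le> T \<Longrightarrow> \<bar>modal_input \<Psi> B k (u s)\<bar> \<le> K"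
      using modal_input_bounded_measurable(2)[OF B u] by blast
    from duhamel[OF less_imp_le[OF T] modal_input_bounded_measurable(1)[OF B u] K, of "lam k" "coef \<Psi> z0 k"]
    show "abs_continuous_on 0 T (\<lambda>t. z t k) \<and> z 0 k = coef \<Psi> z0 k \<and>
        (AE t in lebesgue_on {0..T}. ((\<lambda>s. z s k) has_real_derivative modal_rhs lam (modal_input \<Psi> B) k (z t k) (u t)) (at t within {0..T}))"
      unfolding z_def modal_rhs_def by blast
  qed
  moreover have "AE t in lebesgue_on {0..T}. \<forall>k\<in>{1..N}. z t k \<in> modal_set \<Psi> X k"
    using X AE_space
  proof eventually_elim
    case (elim t)
    then show ?case using zc[of _ t] by (auto simp: modal_set_def)
  qed
  moreover have "\<forall>k\<in>{1..N}. z T k \<in> modal_set \<Psi> XT k"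
    using XT zc[of _ T] T by (auto simp: modal_set_def)
  ultimately show "u \<in> modal_controls N lam (modal_input \<Psi> B) U (modal_set \<Psi> X) (modal_set \<Psi> XT) T (coef \<Psi> z0)"
    using u unfolding modal_controls_def by blast
qed

end

section \<open>Measures give feasible moment sequences\<close>

text \<open>A test vector on \<open>I\<close> is extended by zero to \<open>J\<close>.\<close>

lemma psd_on_subset:
  assumes "psd_on J M" "I \<subseteq> J" "finite J"
  shows "psd_on I M"
  unfolding psd_on_def
proof (intro conjI ballI allI)
  show "M \<beta> \<gamma> = M \<gamma> \<beta>" if "\<beta> \<in> I" "\<gamma> \<in> I" for \<beta> \<gamma> using assms that by (auto simp: psd_on_def)
  fix x :: "'a \<Rightarrow> real"
  let ?x = "\<lambda>\<beta>. if \<beta> \<in> I then x \<beta> else 0"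
  have "0 \<le> (\<Sum>\<beta>\<in>J. \<Sum>\<gamma>\<in>J. ?x \<beta> * M \<beta> \<gamma> * ?x \<gamma>)" using assms(1)[unfolded psd_on_def, THEN conjunct2, THEN spec, of ?x] .
  also have "\<dots> = (\<Sum>\<beta>\<in>I. \<Sum>\<gamma>\<in>J. ?x \<beta> * M \<beta> \<gamma> * ?x \<gamma>)"
    by (rule sum.mono_neutral_right) (use assms in auto)
  also have "\<dots> = (\<Sum>\<beta>\<in>I. \<Sum>\<gamma>\<in>I. ?x \<beta> * M \<beta> \<gamma> * ?x \<gamma>)"
    by (intro sum.cong[OF refl] sum.mono_neutral_right) (use assms in auto)
  also have "\<dots> = (\<Sum>\<beta>\<in>I. \<Sum>\<gamma>\<in>I. x \<beta> * M \<beta> \<gamma> * x \<gamma>)" by (intro sum.cong) auto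
  finally show "0 \<le> (\<Sum>\<beta>\<in>I. \<Sum>\<gamma>\<in>I. x \<beta> * M \<beta> \<gamma> * x \<gamma>)" .
qed

lemma localizing_matrix_ell: "localizing_matrix \<theta> y \<beta> \<gamma> = ell (\<lambda>\<delta>. y (\<delta> + \<beta> + \<gamma>)) \<theta>"
  by (simp add: localizing_matrix_def ell_def)

lemma moment_matrix_localizing: "moment_matrix y = localizing_matrix 1 y"
proof (rule ext, rule ext)
  show "moment_matrix y \<beta> \<gamma> = localizing_matrix 1 y \<beta> \<gamma>" for \<beta> \<gamma>
    by (simp add: moment_matrix_def localizing_matrix_ell single_one[symmetric] del: single_one)
qed

text \<open>The coefficients of \<open>q\<close> serve as the test vector: the quadratic form of the
  localizing matrix at this vector is the displayed value.\<close>

lemma localizing_nonneg: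
  assumes psd: "psd_on I (localizing_matrix \<theta> y)" and I: "finite I" "keys q \<subseteq> I"
  shows "0 \<le> ell y (\<theta> * (q * q))"
proof -
  let ?q = "lookup q" and ?K = "keys q"
  have "ell y (\<theta> * (q * q)) = (\<Sum>\<delta>\<in>keys \<theta>. lookup \<theta> \<delta> * ell (\<lambda>\<gamma>. y (\<delta> + \<gamma>)) (q * q))"
    by (subst poly_eq_sum_single[of \<theta>]) (simp add: sum_distrib_right ell_sum ell_mono_times)
  also have "\<dots> = (\<Sum>\<delta>\<in>keys \<theta>. \<Sum>\<beta>\<in>?K. \<Sum>\<gamma>\<in>?K. lookup \<theta> \<delta> * (?q \<beta> * ?q \<gamma> * y (\<delta> + (\<beta> + \<gamma>))))"
    by (simp add: ell_mult sum_distrib_left)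
  also have "\<dots> = (\<Sum>\<beta>\<in>?K. \<Sum>\<gamma>\<in>?K. \<Sum>\<delta>\<in>keys \<theta>. lookup \<theta> \<delta> * (?q \<beta> * ?q \<gamma> * y (\<delta> + (\<beta> + \<gamma>))))"
    by (subst sum.swap, rule sum.cong[OF refl], subst sum.swap, rule refl)
  also have "\<dots> = (\<Sum>\<beta>\<in>?K. \<Sum>\<gamma>\<in>?K. ?q \<beta> * localizing_matrix \<theta> y \<beta> \<gamma> * ?q \<gamma>)"
    by (intro sum.cong refl) (simp add: localizing_matrix_def sum_distrib_left sum_distrib_right mult_ac add.assoc)
  also have "\<dots> \<ge> 0"
    using psd_on_subset[OF psd I(2,1)] by (simp add: psd_on_def)
  finally show ?thesis .
qed

lemma lookup_le_total_deg: "lookup \<beta> i \<le> total_deg \<beta>"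
proof (cases "i \<in> keys \<beta>")
  case True
  then show ?thesis unfolding total_deg_def by (rule member_le_sum) auto
qed (simp add: in_keys_iff)

lemma finite_bounded_exps:
  assumes "finite V"
  shows "finite {\<beta> :: 'v \<Rightarrow>\<^sub>0 nat. keys \<beta> \<subseteq> V \<and> total_deg \<beta> \<le> r}" (is "finite ?S")
proof (rule finite_imageD[of lookup])
  have "lookup ` ?S \<subseteq> {f. \<forall>x. (x \<in> V \<longrightarrow> f x \<in> {..r}) \<and> (x \<notin> V \<longrightarrow> f x = 0)}"
  proof
    fix f assume "f \<in> lookup ` ?S"
    then obtain \<beta> where \<beta>: "f = lookup \<beta>" "keys \<beta> \<subseteq> V" "total_deg \<beta> \<le> r" by auto
    have "f x \<in> {..r}" for x using lookup_le_total_deg[of \<beta> x] \<beta> by simp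
    moreover have "f x = 0" if "x \<notin> V" for x using that \<beta> by (auto simp: in_keys_iff)
    ultimately show "f \<in> {f. \<forall>x. (x \<in> V \<longrightarrow> f x \<in> {..r}) \<and> (x \<notin> V \<longrightarrow> f x = 0)}" by blast
  qed
  moreover have "finite {f. \<forall>x. (x \<in> V \<longrightarrow> f x \<in> {..r}) \<and> (x \<notin> V \<longrightarrow> f x = (0::nat))}"
    by (rule finite_set_of_finite_funs[OF assms]) simp
  ultimately show "finite (lookup ` ?S)" by (rule finite_subset)
  show "inj_on lookup ?S" by (rule inj_onI) (rule poly_mapping_eqI, simp)
qed

lemma finite_zexps: "finite (zexps N r)"
  unfolding zexps_def by (rule finite_bounded_exps) simp

lemma finite_uexps: "finite (uexps r :: ('m::finite) uexp set)"
  using finite_bounded_exps[of "UNIV :: 'm set" r] by (simp add: uexps_def)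

lemma finite_tzuexps: "finite (tzuexps N r :: ('m::finite) tzuexp set)"
proof (rule finite_subset)
  show "tzuexps N r \<subseteq> {..r} \<times> zexps N r \<times> uexps r" by (auto simp: tzuexps_def zexps_def uexps_def)
  show "finite ({..r} \<times> zexps N r \<times> (uexps r :: 'm uexp set))" by (intro finite_cartesian_product finite_zexps finite_uexps) simp
qed

text \<open>Every matrix of order \<open>r\<close> is a principal submatrix of the one of order
  \<open>r'\<close>, since truncated subtraction is monotone in the order, and the equations of
  order \<open>r\<close> are among those of order \<open>r'\<close>.\<close>

lemma sdp_feasible_antimono:
  fixes b :: "nat \<Rightarrow> real^'m::finite \<Rightarrow> real"
  assumes "r \<le> r'"
  shows "sdp_feasible N r' lam b s w zlo zhi zTlo zThi T \<zeta> \<subseteq> sdp_feasible N r lam b s w zlo zhi zTlo zThi T \<zeta>"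
proof
  fix Y assume Y: "Y \<in> sdp_feasible N r' lam b s w zlo zhi zTlo zThi T \<zeta>"
  obtain y yT where Yy: "Y = (y, yT)" by (cases Y)
  have sub: "tzuexps N r \<subseteq> tzuexps N r'" "zexps N r \<subseteq> zexps N r'" "{..r - 1} \<subseteq> {..r' - 1}"
    "zexps N (r - 1) \<subseteq> zexps N (r' - 1)" "\<And>d. uexps (r - d) \<subseteq> uexps (r' - d)"
    using assms by (auto simp: tzuexps_def zexps_def uexps_def)
  note Y' = Y[unfolded Yy sdp_feasible_def mem_Collect_eq prod.case]
  show "Y \<in> sdp_feasible N r lam b s w zlo zhi zTlo zThi T \<zeta>"
    unfolding Yy sdp_feasible_def mem_Collect_eq prod.case
  proof (intro conjI ballI allI impI)
    show "psd_on (tzuexps N r) (moment_matrix y)"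
      by (rule psd_on_subset[OF _ sub(1) finite_tzuexps]) (use Y' in blast)
    show "psd_on (zexps N r) (moment_matrix yT)"
      by (rule psd_on_subset[OF _ sub(2) finite_zexps]) (use Y' in blast)
    show "psd_on {..r - 1} (localizing_matrix (single 1 1 * (const_poly T - single 1 1)) (marginal_t y))"
      by (rule psd_on_subset[OF _ sub(3)]) (use Y' in blast, simp)
    show "psd_on {..r - 1} (localizing_matrix (interval_poly (zlo i) (zhi i) (single 1 1)) (marginal_z i y))"
      if "i \<in> {1..N}" for i
      by (rule psd_on_subset[OF _ sub(3)]) (use Y' that in blast, simp)
    show "psd_on (uexps (r - half_deg (w j))) (localizing_matrix (w j) (marginal_u y))" if "j \<in> {1..s}" for j
      by (rule psd_on_subset[OF _ sub(5) finite_uexps]) (use Y' that in blast)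
    show "psd_on (zexps N (r - 1)) (localizing_matrix (interval_poly (zTlo i) (zThi i) (single (single i 1) 1)) yT)"
      if "i \<in> {1..N}" for i
      by (rule psd_on_subset[OF _ sub(4) finite_zexps]) (use Y' that in blast)
    fix p and \<alpha> :: zexp
    assume "keys \<alpha> \<subseteq> {1..N} \<and> p + total_deg \<alpha> \<le> r"
    then have "keys \<alpha> \<subseteq> {1..N} \<and> p + total_deg \<alpha> \<le> r'" using assms by linarith
    then show "ell yT (single \<alpha> (T ^ p)) - ell y (poly_liouville N lam b (single (p, \<alpha>, 0) 1)) =
        0 ^ p * (\<Prod>k=1..N. \<zeta> k ^ lookup \<alpha> k)"
      using Y' by blast
  qed
qed

lemma sdp_value_mono:
  assumes "r \<le> r'"
  shows "sdp_value N r lam b s w zlo zhi zTlo zThi T \<zeta> h \<le> sdp_value N r' lam (b :: nat \<Rightarrow> real^'m::finite \<Rightarrow> real) s w zlo zhi zTlo zThi T \<zeta> h"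
  unfolding sdp_value_def by (rule INF_superset_mono[OF sdp_feasible_antimono[OF assms] order_refl])

section \<open>Monomials as point evaluations, and moments of feasible measures\<close>

definition evz :: "nat \<Rightarrow> (nat \<Rightarrow> real) \<Rightarrow> zexp \<Rightarrow> real" where
  "evz N z \<alpha> = (\<Prod>k\<in>{1..N}. z k ^ lookup \<alpha> k)"

definition ev :: "nat \<Rightarrow> real \<times> (nat \<Rightarrow> real) \<times> (real^'m::finite) \<Rightarrow> 'm tzuexp \<Rightarrow> real" where
  "ev N = (\<lambda>(t, z, u) (p, \<alpha>, \<beta>). t ^ p * evz N z \<alpha> * eval_mon \<beta> u)"

lemma evz_add: "evz N z (\<alpha> + \<beta>) = evz N z \<alpha> * evz N z \<beta>"
  by (simp add: evz_def lookup_add power_add prod.distrib)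

lemma eval_mon_add: "eval_mon (\<alpha> + \<beta>) u = eval_mon \<alpha> u * eval_mon \<beta> u"
  by (simp add: eval_mon_def lookup_add power_add prod.distrib)

lemma evz_0 [simp]: "evz N z 0 = 1" and eval_mon_0 [simp]: "eval_mon 0 u = 1"
  by (simp_all add: evz_def eval_mon_def)

lemma ev_add: "ev N x (\<gamma> + \<delta>) = ev N x \<gamma> * ev N x \<delta>"
  by (cases x; cases \<gamma>; cases \<delta>) (simp add: ev_def evz_add eval_mon_add power_add)

lemma evz_single: "k \<in> {1..N} \<Longrightarrow> evz N z (single k n) = z k ^ n"
proof -
  assume k: "k \<in> {1..N}"
  have "evz N z (single k n) = (\<Prod>l\<in>{1..N}. if l = k then z k ^ n else 1)"
    unfolding evz_def by (rule prod.cong) (auto simp: lookup_single when_def)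
  then show ?thesis using k by simp
qed

lemma eval_mon_single: "eval_mon (single j n) u = u $ j ^ n"
proof -
  have "eval_mon (single j n) u = (\<Prod>l\<in>UNIV. if l = j then u $ j ^ n else 1)"
    unfolding eval_mon_def by (rule prod.cong) (auto simp: lookup_single when_def)
  then show ?thesis by simp
qed

text \<open>Links the symbolic operator of the relaxations with the differential operator of the
  linear program at each point. Linearity of \<open>b k\<close> enters through its expansion in the
  standard basis.\<close>

lemma ell_poly_liouville:
  fixes b :: "nat \<Rightarrow> real^'m::finite \<Rightarrow> real"
  assumes b: "\<And>k. linear (b k)"
  shows "ell (ev N (t, z, u)) (poly_liouville N lam b (single (p, \<alpha>, 0) 1)) =
    liouville N lam b (zmon N p (lookup \<alpha>)) (t, z, u)"
proof -
  have dt: "poly_dt (single (p, \<alpha>, 0) 1) = single (p - 1, \<alpha>, 0 :: 'm uexp) (real p)"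
    by (simp add: poly_dt_def)
  have dz: "poly_dz k (single (p, \<alpha>, 0) 1) = single (p, \<alpha> - single k 1, 0 :: 'm uexp) (real (lookup \<alpha> k))" for k
    by (simp add: poly_dz_def)
  have mon: "ev N (t, z, u) (p, \<alpha>, 0) = zmon N p (lookup \<alpha>) (t, z)" for p \<alpha>
    by (simp add: ev_def zmon_def evz_def)
  have rhs: "ell (ev N (t, z, u)) (poly_rhs lam b k) = modal_rhs lam b k (z k) u" if "k \<in> {1..N}" for k
  proof -
    have "u = (\<Sum>i\<in>UNIV. (u $ i) *\<^sub>R axis i 1)"
      using basis_expansion[of u] by (simp add: scalar_mult_eq_scaleR)
    then have "b k u = b k (\<Sum>i\<in>UNIV. (u $ i) *\<^sub>R axis i 1)" by simp
    then have "b k u = (\<Sum>i\<in>UNIV. u $ i * b k (axis i 1))"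
      by (simp add: linear_sum[OF b] linear_cmul[OF b])
    then show ?thesis
      using evz_single[OF that, of z 1]
      by (simp add: poly_rhs_def ell_add ell_sum ev_def eval_mon_single modal_rhs_def mult.commute)
  qed
  \<comment> \<open>Subtraction of exponents is truncated in each coordinate, matching
    \<open>lookup \<alpha> k - 1\<close>; when this truncates, the coefficient
    \<open>lookup \<alpha> k\<close> is zero and removes the term.\<close>
  have "\<alpha> - single k 1 = \<alpha>' \<Longrightarrow> lookup \<alpha>' = (lookup \<alpha>)(k := lookup \<alpha> k - 1)" for k \<alpha>'
    by (auto simp: lookup_minus lookup_single when_def)
  then have lk: "lookup (\<alpha> - single k 1) = (lookup \<alpha>)(k := lookup \<alpha> k - 1)" for k
    by blast
  have "ell (ev N (t, z, u)) (poly_liouville N lam b (single (p, \<alpha>, 0) 1))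
     = real p * zmon N (p - 1) (lookup \<alpha>) (t, z) +
       (\<Sum>k=1..N. ell (ev N (t, z, u)) (poly_rhs lam b k) * (real (lookup \<alpha> k) * ev N (t, z, u) (p, \<alpha> - single k 1, 0)))"
    unfolding poly_liouville_def dt dz ell_add ell_sum ell_multiplicative[OF ev_add] ell_single mon ..
  also have "\<dots> = real p * zmon N (p - 1) (lookup \<alpha>) (t, z) +
       (\<Sum>k=1..N. modal_rhs lam b k (z k) u * dz k (zmon N p (lookup \<alpha>)) (t, z))"
    by (intro arg_cong2[where f = "(+)"] refl sum.cong) (simp only: rhs mon dz_zmon lk)
  finally show ?thesis by (simp add: liouville_def dt_zmon)
qed

lemma ell_integral:
  assumes "\<And>\<gamma>. integrable M (\<lambda>x. f x \<gamma>)"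
  shows "ell (\<lambda>\<gamma>. LINT x|M. f x \<gamma>) P = (LINT x|M. ell (f x) P)" "integrable M (\<lambda>x. ell (f x) P)"
  unfolding ell_def using assms by simp_all

lemma ev_continuous: "continuous_on UNIV (\<lambda>x :: real \<times> (nat \<Rightarrow> real) \<times> (real^'m::finite). ev N x \<gamma>)"
proof -
  obtain p \<alpha> \<beta> where g: "\<gamma> = (p, \<alpha>, \<beta>)" by (cases \<gamma>)
  have "continuous_on UNIV (\<lambda>x :: real \<times> (nat \<Rightarrow> real) \<times> (real^'m). fst (snd x) k)" for k
    by (rule continuous_on_product_then_coordinatewise) (intro continuous_on_fst continuous_on_snd continuous_on_id)
  then show ?thesis
    unfolding g ev_def split_def evz_def eval_mon_def by (auto intro!: continuous_intros)
qed

lemma evz_continuous: "continuous_on UNIV (\<lambda>z. evz N z \<alpha>)"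
  unfolding evz_def by (auto intro!: continuous_intros continuous_on_product_coordinates)

lemma compact_PiE_real:
  fixes Z :: "nat \<Rightarrow> real set"
  assumes "\<And>k. k \<in> {1..N} \<Longrightarrow> compact (Z k)"
  shows "compact (\<Pi>\<^sub>E k\<in>{1..N}. Z k)"
proof -
  have "(\<Pi>\<^sub>E k\<in>{1..N}. Z k) = PiE UNIV (\<lambda>k. if k \<in> {1..N} then Z k else {undefined})"
    by (auto simp: PiE_def Pi_def extensional_def split: if_splits)
  moreover have "compactin (product_topology (\<lambda>_. euclidean) UNIV) (PiE UNIV (\<lambda>k :: nat. if k \<in> {1..N} then Z k else {undefined}))"
    by (subst compactin_PiE) (use assms in auto)
  ultimately show ?thesis by (simp add: euclidean_product_topology)
qed

lemma integrable_continuous_compact: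
  fixes f :: "'a::topological_space \<Rightarrow> real"
  assumes "finite_measure M" "sets M = sets (restrict_space borel S)" "compact S" "continuous_on UNIV f"
  shows "integrable M f"
proof -
  have "compact (f ` S)" by (rule compact_continuous_image[OF continuous_on_subset[OF assms(4)] assms(3)]) simp
  then obtain K where K: "\<forall>y\<in>f ` S. norm y \<le> K" using compact_imp_bounded bounded_iff by blast
  show ?thesis
    by (rule finite_measure.integrable_const_bound[OF assms(1), of _ K])
       (use K space_restrict_borel[OF assms(2)] measurable_restrict_borel[OF assms(2) borel_measurable_continuous_onI[OF assms(4)]] in auto)
qed

text \<open>The quadratic form is the integral of \<open>ell (f x) \<theta>\<close> times a square.
  Choosing \<open>f\<close> on one kind of exponent only covers the marginals as well.\<close>

lemma psd_localizing_integral: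
  fixes f :: "'x \<Rightarrow> 'e::comm_monoid_add \<Rightarrow> real"
  assumes int: "\<And>\<gamma>. integrable M (\<lambda>x. f x \<gamma>)" and mult: "\<And>x \<beta> \<gamma>. f x (\<beta> + \<gamma>) = f x \<beta> * f x \<gamma>"
    and pos: "\<And>x. x \<in> space M \<Longrightarrow> 0 \<le> ell (f x) \<theta>" and y: "\<And>\<gamma>. y \<gamma> = (LINT x|M. f x \<gamma>)"
  shows "psd_on I (localizing_matrix \<theta> y)"
  unfolding psd_on_def
proof (intro conjI ballI allI)
  show "localizing_matrix \<theta> y \<beta> \<gamma> = localizing_matrix \<theta> y \<gamma> \<beta>" for \<beta> \<gamma>
    by (simp add: localizing_matrix_def add_ac)
  fix x :: "'e \<Rightarrow> real"
  have L: "localizing_matrix \<theta> y \<beta> \<gamma> = (LINT w|M. ell (f w) \<theta> * f w \<beta> * f w \<gamma>)"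
    and Li: "integrable M (\<lambda>w. ell (f w) \<theta> * f w \<beta> * f w \<gamma>)" for \<beta> \<gamma>
  proof -
    have i: "integrable M (\<lambda>w. f w (\<delta> + \<beta> + \<gamma>))" for \<delta> by (rule int)
    have e: "ell (\<lambda>\<delta>. f w (\<delta> + \<beta> + \<gamma>)) \<theta> = ell (f w) \<theta> * f w \<beta> * f w \<gamma>" for w
      by (simp add: ell_def mult sum_distrib_right mult.assoc)
    show "localizing_matrix \<theta> y \<beta> \<gamma> = (LINT w|M. ell (f w) \<theta> * f w \<beta> * f w \<gamma>)"
      unfolding localizing_matrix_ell y using ell_integral(1)[where f = "\<lambda>w \<delta>. f w (\<delta> + \<beta> + \<gamma>)" and P = \<theta>, OF i] by (simp only: e)
    show "integrable M (\<lambda>w. ell (f w) \<theta> * f w \<beta> * f w \<gamma>)"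
      using ell_integral(2)[where f = "\<lambda>w \<delta>. f w (\<delta> + \<beta> + \<gamma>)" and P = \<theta>, OF i] by (simp only: e)
  qed
  have "(\<Sum>\<beta>\<in>I. \<Sum>\<gamma>\<in>I. x \<beta> * localizing_matrix \<theta> y \<beta> \<gamma> * x \<gamma>)
      = (LINT w|M. (\<Sum>\<beta>\<in>I. \<Sum>\<gamma>\<in>I. x \<beta> * (ell (f w) \<theta> * f w \<beta> * f w \<gamma>) * x \<gamma>))"
    using Li by (simp add: L)
  also have "\<dots> = (LINT w|M. ell (f w) \<theta> * (\<Sum>\<beta>\<in>I. x \<beta> * f w \<beta>)\<^sup>2)"
    by (rule Bochner_Integration.integral_cong[OF refl])
       (simp add: power2_eq_square sum_product sum_distrib_left mult_ac)
  also have "\<dots> \<ge> 0"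
    by (rule integral_nonneg_AE) (use pos in \<open>auto intro!: AE_I2\<close>)
  finally show "0 \<le> (\<Sum>\<beta>\<in>I. \<Sum>\<gamma>\<in>I. x \<beta> * localizing_matrix \<theta> y \<beta> \<gamma> * x \<gamma>)" .
qed

lemma ell_interval_poly:
  assumes "\<And>\<beta> \<gamma>. y (\<beta> + \<gamma>) = y \<beta> * y \<gamma>" "y 0 = 1"
  shows "ell y (interval_poly a b x) = (b - ell y x) * (ell y x - a)"
  by (simp add: interval_poly_def ell_multiplicative[OF assms(1)] ell_diff const_poly_def assms(2))

lemma eval_u_ell: "eval_u \<theta> u = ell (\<lambda>\<beta>. eval_mon \<beta> u) \<theta>"
  by (simp add: eval_u_def ell_def)

lemma eval_tu_ell: "eval_tu h t u = ell (\<lambda>(p, \<beta>). t ^ p * eval_mon \<beta> u) h"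
  unfolding eval_tu_def ell_def by (rule sum.cong) (auto simp: mult_ac)

text \<open>The witnesses are the moments of \<open>\<mu>\<close> and \<open>\<nu>\<close>; as this
  works for every order, the linear program bounds every relaxation from above.\<close>

lemma lp_feasible_imp_sdp_feasible:
  fixes b :: "nat \<Rightarrow> real^'m::finite \<Rightarrow> real"
  assumes lp: "(\<mu>, \<nu>) \<in> lp_feasible N lam b U Z ZT T \<zeta>"
    and b: "\<And>k. linear (b k)" and U: "compact U" "U = basic_semialgebraic s w"
    and Z: "\<And>k. k \<in> {1..N} \<Longrightarrow> Z k = {zlo k..zhi k}" "\<And>k. k \<in> {1..N} \<Longrightarrow> ZT k = {zTlo k..zThi k}"
    and monC1: "\<And>p e. zmon N p e \<in> C1_functions N"
  shows "\<exists>(y, yT)\<in>sdp_feasible N r lam b s w zlo zhi zTlo zThi T \<zeta>.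
    ell (\<lambda>(p, \<beta>). y (p, 0, \<beta>)) h = (LINT (t, z, u)|\<mu>. eval_tu h t u)"
proof -
  have fin: "finite_measure \<mu>" "finite_measure \<nu>"
    and sets: "sets \<mu> = sets (restrict_space borel ({0..T} \<times> (\<Pi>\<^sub>E k\<in>{1..N}. Z k) \<times> U))"
      "sets \<nu> = sets (restrict_space borel (\<Pi>\<^sub>E k\<in>{1..N}. ZT k))"
    and eq: "\<And>g. g \<in> C1_functions N \<Longrightarrow> (LINT z|\<nu>. g (T, z)) - g (0, restrict \<zeta> {1..N}) = (LINT x|\<mu>. liouville N lam b g x)"
    using lp by (auto simp: lp_feasible_def)
  have cp: "compact ({0..T} \<times> (\<Pi>\<^sub>E k\<in>{1..N}. Z k) \<times> U)" "compact (\<Pi>\<^sub>E k\<in>{1..N}. ZT k)"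
    by (intro compact_Times compact_PiE_real compact_Icc U; simp only: Z compact_Icc)+
  have sp: "space \<mu> = {0..T} \<times> (\<Pi>\<^sub>E k\<in>{1..N}. Z k) \<times> U" "space \<nu> = (\<Pi>\<^sub>E k\<in>{1..N}. ZT k)"
    by (rule space_restrict_borel[OF sets(1)], rule space_restrict_borel[OF sets(2)])
  define y where "y \<gamma> = (LINT x|\<mu>. ev N x \<gamma>)" for \<gamma>
  define yT where "yT \<alpha> = (LINT z|\<nu>. evz N z \<alpha>)" for \<alpha>
  have int: "integrable \<mu> (\<lambda>x. ev N x \<gamma>)" for \<gamma>
    by (rule integrable_continuous_compact[OF fin(1) sets(1) cp(1) ev_continuous])
  have intT: "integrable \<nu> (\<lambda>z. evz N z \<alpha>)" for \<alpha>
    by (rule integrable_continuous_compact[OF fin(2) sets(2) cp(2) evz_continuous])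
  have one: "0 \<le> ell f 1" if "f 0 = 1" for f :: "'e::zero \<Rightarrow> real"
    using that by (simp add: single_one[symmetric] del: single_one)
  have ev0: "ev N x 0 = 1" for x :: "real \<times> (nat \<Rightarrow> real) \<times> (real^'m)"
    by (cases x) (simp add: ev_def zero_prod_def)
  have "(y, yT) \<in> sdp_feasible N r lam b s w zlo zhi zTlo zThi T \<zeta>"
    unfolding sdp_feasible_def mem_Collect_eq prod.case
  proof (intro conjI ballI allI impI)
    show "psd_on (tzuexps N r) (moment_matrix y)"
      unfolding moment_matrix_localizing
      by (rule psd_localizing_integral[OF int ev_add _ y_def]) (simp add: single_one[symmetric] ev0 del: single_one)
    show "psd_on (zexps N r) (moment_matrix yT)"
      unfolding moment_matrix_localizing
      by (rule psd_localizing_integral[OF intT evz_add _ yT_def]) (simp add: single_one[symmetric] del: single_one)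
    show "psd_on {..r - 1} (localizing_matrix (single 1 1 * (const_poly T - single 1 1)) (marginal_t y))"
    proof (rule psd_localizing_integral[where M = \<mu> and f = "\<lambda>x p. ev N x (p, 0, 0)"])
      show "ev N x (p + q, 0, 0) = ev N x (p, 0, 0) * ev N x (q, 0, 0)" for x :: "real \<times> (nat \<Rightarrow> real) \<times> (real^'m)" and p q
        by (cases x) (simp add: ev_def power_add)
      then have m: "ell (\<lambda>p. ev N x (p, 0, 0)) (P * Q) = ell (\<lambda>p. ev N x (p, 0, 0)) P * ell (\<lambda>p. ev N x (p, 0, 0)) Q"
        for x :: "real \<times> (nat \<Rightarrow> real) \<times> (real^'m)" and P Q by (rule ell_multiplicative)
      fix x assume x: "x \<in> space \<mu>"
      obtain t z u where xt: "x = (t, z, u)" by (cases x)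
      then show "0 \<le> ell (\<lambda>p. ev N x (p, 0, 0)) (single 1 1 * (const_poly T - single 1 1))"
        using x unfolding m by (simp add: ell_diff const_poly_def sp ev_def)
    qed (auto simp: marginal_t_def y_def int)
    show "psd_on {..r - 1} (localizing_matrix (interval_poly (zlo i) (zhi i) (single 1 1)) (marginal_z i y))"
      if i: "i \<in> {1..N}" for i
    proof (rule psd_localizing_integral[where M = \<mu> and f = "\<lambda>x k. ev N x (0, single i k, 0)"])
      show m: "ev N x (0, single i (p + q), 0) = ev N x (0, single i p, 0) * ev N x (0, single i q, 0)"
        for x :: "real \<times> (nat \<Rightarrow> real) \<times> (real^'m)" and p q
        by (cases x) (simp add: ev_def evz_single[OF i] power_add)
      fix x assume x: "x \<in> space \<mu>"
      obtain t z u where xt: "x = (t, z, u)" by (cases x)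
      have zP: "z \<in> (\<Pi>\<^sub>E k\<in>{1..N}. Z k)" using x unfolding xt sp by blast
      have "z i \<in> {zlo i..zhi i}" using PiE_mem[OF zP i] unfolding Z(1)[OF i] .
      then show "0 \<le> ell (\<lambda>k. ev N x (0, single i k, 0)) (interval_poly (zlo i) (zhi i) (single 1 1))"
        by (subst ell_interval_poly[OF m]) (simp_all add: xt ev_def evz_single[OF i])
    qed (auto simp: marginal_z_def y_def int)
    show "psd_on (uexps (r - half_deg (w j))) (localizing_matrix (w j) (marginal_u y))" if j: "j \<in> {1..s}" for j
    proof (rule psd_localizing_integral[where M = \<mu> and f = "\<lambda>x \<beta>. ev N x (0, 0, \<beta>)"])
      show "ev N x (0, 0, p + q) = ev N x (0, 0, p) * ev N x (0, 0, q)" for x :: "real \<times> (nat \<Rightarrow> real) \<times> (real^'m)" and p q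
        by (cases x) (simp add: ev_def eval_mon_add)
      fix x assume x: "x \<in> space \<mu>"
      obtain t z u where xt: "x = (t, z, u)" by (cases x)
      have "0 \<le> eval_u (w j) u" using x xt U(2) j by (auto simp: sp basic_semialgebraic_def)
      then show "0 \<le> ell (\<lambda>\<beta>. ev N x (0, 0, \<beta>)) (w j)" by (simp add: xt ev_def eval_u_ell)
    qed (auto simp: marginal_u_def y_def int)
    show "psd_on (zexps N (r - 1)) (localizing_matrix (interval_poly (zTlo i) (zThi i) (single (single i 1) 1)) yT)"
      if i: "i \<in> {1..N}" for i
    proof (rule psd_localizing_integral[OF intT evz_add _ yT_def])
      fix z assume "z \<in> space \<nu>"
      then have zP: "z \<in> (\<Pi>\<^sub>E k\<in>{1..N}. ZT k)" unfolding sp .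
      have "z i \<in> {zTlo i..zThi i}" using PiE_mem[OF zP i] unfolding Z(2)[OF i] .
      then show "0 \<le> ell (evz N z) (interval_poly (zTlo i) (zThi i) (single (single i 1) 1))"
        by (subst ell_interval_poly[OF evz_add]) (simp_all add: evz_single[OF i])
    qed
    fix p and \<alpha> :: zexp
    assume "keys \<alpha> \<subseteq> {1..N} \<and> p + total_deg \<alpha> \<le> r"
    have "ell y (poly_liouville N lam b (single (p, \<alpha>, 0) 1)) = (LINT x|\<mu>. liouville N lam b (zmon N p (lookup \<alpha>)) x)"
      unfolding y_def[abs_def] ell_integral(1)[OF int]
      by (rule Bochner_Integration.integral_cong[OF refl]) (auto simp: ell_poly_liouville[OF b])
    also have "\<dots> = (LINT z|\<nu>. T ^ p * evz N z \<alpha>) - 0 ^ p * (\<Prod>k=1..N. \<zeta> k ^ lookup \<alpha> k)"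
      using eq[OF monC1, of p "lookup \<alpha>"] by (simp add: zmon_def evz_def)
    also have "(LINT z|\<nu>. T ^ p * evz N z \<alpha>) = T ^ p * yT \<alpha>" by (simp add: yT_def)
    finally show "ell yT (single \<alpha> (T ^ p)) - ell y (poly_liouville N lam b (single (p, \<alpha>, 0) 1)) =
        0 ^ p * (\<Prod>k=1..N. \<zeta> k ^ lookup \<alpha> k)" by simp
  qed
  moreover have "ell (\<lambda>(p, \<beta>). y (p, 0, \<beta>)) h = (LINT (t, z, u)|\<mu>. eval_tu h t u)"
  proof -
    have "ell (\<lambda>(p, \<beta>). y (p, 0, \<beta>)) h = ell (\<lambda>\<gamma>. LINT x|\<mu>. (case \<gamma> of (p, \<beta>) \<Rightarrow> ev N x (p, 0, \<beta>))) h"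
      by (rule ell_cong) (auto simp: y_def)
    also have "\<dots> = (LINT x|\<mu>. ell (\<lambda>(p, \<beta>). ev N x (p, 0, \<beta>)) h)"
      by (rule ell_integral(1)) (auto simp: int split_def)
    also have "\<dots> = (LINT (t, z, u)|\<mu>. eval_tu h t u)"
      by (rule Bochner_Integration.integral_cong[OF refl]) (auto simp: eval_tu_ell ev_def)
    finally show ?thesis .
  qed
  ultimately show ?thesis by blast
qed

lemma zmon_C1: "zmon N p e \<in> C1_functions N"
proof -
  let ?S = "(UNIV :: real set) \<times> ({1..N} \<rightarrow>\<^sub>E (UNIV :: real set))"
  have c: "continuous_on ?S (zmon N p e)" for p e
    unfolding zmon_def split_def
    by (intro continuous_intros continuous_on_product_then_coordinatewise)
  have dte: "dt (zmon N p e) = (\<lambda>x. real p * zmon N (p - 1) e x)" by (rule ext) (auto simp: dt_zmon)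
  have dze: "dz k (zmon N p e) = (\<lambda>x. real (e k) * zmon N p (e(k := e k - 1)) x)" if "k \<in> {1..N}" for k
  proof
    fix x show "dz k (zmon N p e) x = real (e k) * zmon N p (e(k := e k - 1)) x"
      using dz_zmon[OF that, of p e "fst x" "snd x"] by (simp only: prod.collapse)
  qed
  show ?thesis
    unfolding C1_functions_def mem_Collect_eq
  proof (intro conjI allI ballI)
    show "continuous_on ?S (zmon N p e)" by (rule c)
    show "continuous_on ?S (dt (zmon N p e))" unfolding dte by (intro continuous_on_mult continuous_on_const c)
    show "continuous_on ?S (dz k (zmon N p e))" if "k \<in> {1..N}" for k
      unfolding dze[OF that] by (intro continuous_on_mult continuous_on_const c)
    show "(\<lambda>s. zmon N p e (s, z)) differentiable (at t)" for t z
      unfolding zmon_def prod.case by (auto intro!: derivative_intros)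
    show "(\<lambda>x. zmon N p e (t, z(k := x))) differentiable (at (z k))" if "k \<in> {1..N}" for t z k
      unfolding zmon_upd[OF that] by (auto intro!: derivative_intros)
  qed
qed

section \<open>Limits of moment sequences\<close>

lemma nonneg_quadratic:
  fixes a b c :: real
  assumes "0 \<le> a" "\<And>s. 0 \<le> s\<^sup>2 * a + 2 * s * b + c"
  shows "b\<^sup>2 \<le> a * c"
proof (cases "a = 0")
  case True
  have "b = 0"
  proof (rule ccontr)
    assume "b \<noteq> 0"
    with assms(2)[of "- (c + 1) / (2 * b)"] True show False by (simp add: field_simps)
  qed
  then show ?thesis using True by simp
next
  case False
  then have "a > 0" using assms(1) by simp
  with assms(2)[of "- b / a"] show ?thesis by (simp add: field_simps power2_eq_square)
qed

text \<open>Positivity is demanded only for polynomials supported on the two exponents, because a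
  moment matrix of finite order sees finitely many of them.\<close>

lemma moment_cauchy_schwarz:
  fixes y :: "'e::comm_monoid_add \<Rightarrow> real"
  assumes P: "\<And>p. keys p \<subseteq> {\<beta>, \<gamma>} \<Longrightarrow> 0 \<le> ell y (p * p)"
  shows "(y (\<beta> + \<gamma>))\<^sup>2 \<le> y (\<beta> + \<beta>) * y (\<gamma> + \<gamma>)"
proof (rule nonneg_quadratic)
  show "0 \<le> y (\<beta> + \<beta>)" using P[of "single \<beta> 1"] by (simp add: mult_single)
  fix s :: real
  let ?p = "single \<beta> s + single \<gamma> (1::real)"
  have "keys ?p \<subseteq> {\<beta>, \<gamma>}"
    using keys_add[of "single \<beta> s" "single \<gamma> (1::real)"] by (auto split: if_splits)
  then have "0 \<le> ell y (?p * ?p)" by (rule P)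
  also have "?p * ?p = single (\<beta> + \<beta>) (s * s) + (single (\<beta> + \<gamma>) s + (single (\<beta> + \<gamma>) s + single (\<gamma> + \<gamma>) 1))"
    by (simp only: distrib_left distrib_right mult_single mult_1 mult_1_right add.commute[of \<gamma> \<beta>] add.assoc)
  also have "ell y \<dots> = s\<^sup>2 * y (\<beta> + \<beta>) + 2 * s * y (\<beta> + \<gamma>) + y (\<gamma> + \<gamma>)"
    by (simp only: ell_add ell_single) (simp add: power2_eq_square)
  finally show "0 \<le> s\<^sup>2 * y (\<beta> + \<beta>) + 2 * s * y (\<beta> + \<gamma>) + y (\<gamma> + \<gamma>)" .
qed

section \<open>Boundedness, convergence and representation of moment sequences\<close>

definition mscale :: "nat \<Rightarrow> 'e::comm_monoid_add \<Rightarrow> 'e" where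
  "mscale n e = (\<Sum>l<n. e)"

lemma mscale_simps: "mscale 0 e = 0" "mscale (Suc n) e = e + mscale n e"
  by (simp_all add: mscale_def add.commute)

lemma mscale_add: "mscale (m + n) e = mscale m e + mscale n e"
  by (induction m) (simp_all add: mscale_simps add.assoc)

lemma single_power: "single (e :: 'e::comm_monoid_add) (1::real) ^ n = single (mscale n e) 1"
  by (induction n) (simp_all add: mscale_simps mult_single)

lemma single_prod: "(\<Prod>i\<in>I. single (f i :: 'e::comm_monoid_add) (1::real)) = single (\<Sum>i\<in>I. f i) 1"
  by (induction I rule: infinite_finite_induct) (simp_all add: mult_single)

text \<open>The submonoid of exponents generated by \<open>e i\<close> for \<open>i\<close> in
  \<open>I\<close>, that is, the monomials in finitely many chosen variables. It separates the
  entries governed by the constraints from the other exponents of the type, which knows infinitely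
  many states.\<close>

definition combos :: "('i \<Rightarrow> 'e::comm_monoid_add) \<Rightarrow> 'i set \<Rightarrow> 'e set" where
  "combos e I = range (\<lambda>a. \<Sum>i\<in>I. mscale (a i) (e i))"

lemma combosI: "(\<Sum>i\<in>I. mscale (a i) (e i)) \<in> combos e I"
  by (auto simp: combos_def)

text \<open>Variables are added one at a time. Cauchy-Schwarz bounds the moment at
  \<open>\<beta> + \<gamma>\<close> by a pure even power, controlled by growth, and by the doubled
  old monomial, controlled by induction. Bounds are eventual because a given monomial enters the
  moment matrix only from some order on.\<close>

lemma eventually_bounded_moments:
  fixes y :: "nat \<Rightarrow> 'e::comm_monoid_add \<Rightarrow> real"
  assumes I: "finite I"
    and psd: "\<And>F. finite F \<Longrightarrow> F \<subseteq> combos e I \<Longrightarrow>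
      \<forall>\<^sub>F r in sequentially. \<forall>p. keys p \<subseteq> F \<longrightarrow> 0 \<le> ell (y r) (p * p)"
    and zero: "\<forall>\<^sub>F r in sequentially. y r 0 = m"
    and growth: "\<And>i k. i \<in> I \<Longrightarrow> \<forall>\<^sub>F r in sequentially. y r (mscale (2 * k) (e i)) \<le> K * R ^ (2 * k)"
    and \<gamma>: "\<gamma> \<in> combos e I"
  shows "\<exists>B. \<forall>\<^sub>F r in sequentially. \<bar>y r \<gamma>\<bar> \<le> B"
proof -
  have "\<exists>B. \<forall>\<^sub>F r in sequentially. \<bar>y r (\<Sum>i\<in>J. mscale (a i) (e i))\<bar> \<le> B" if "J \<subseteq> I" for J a
    using finite_subset[OF that I] that
  proof (induction J arbitrary: a rule: finite_induct)
    case empty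
    show ?case by (rule exI[of _ "\<bar>m\<bar>"]) (use zero in \<open>auto elim: eventually_mono\<close>)
  next
    case (insert j J)
    let ?\<beta> = "mscale (a j) (e j)" and ?\<gamma> = "\<Sum>i\<in>J. mscale (a i) (e i)"
    \<comment> \<open>The induction hypothesis is needed for doubled exponents, which is why
      \<open>a\<close> is kept arbitrary.\<close>
    have dbl: "?\<gamma> + ?\<gamma> = (\<Sum>i\<in>J. mscale (a i + a i) (e i))" by (simp add: mscale_add sum.distrib)
    obtain B where B: "\<forall>\<^sub>F r in sequentially. \<bar>y r (?\<gamma> + ?\<gamma>)\<bar> \<le> B"
      unfolding dbl using insert.IH[of "\<lambda>i. a i + a i"] insert.prems by auto
    have in1: "?\<gamma> \<in> combos e I"
    proof -
      have "?\<gamma> = (\<Sum>i\<in>I. mscale (if i \<in> J then a i else 0) (e i))"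
        using insert.prems by (intro sum.mono_neutral_cong_left I) (auto simp: mscale_simps)
      then show ?thesis by (simp only: combosI)
    qed
    have in2: "?\<beta> \<in> combos e I"
    proof -
      have "(\<Sum>i\<in>{j}. mscale (a i) (e i)) = (\<Sum>i\<in>I. mscale (if i = j then a i else 0) (e i))"
        using insert.prems by (intro sum.mono_neutral_cong_left I) (auto simp: mscale_simps)
      then have "?\<beta> = (\<Sum>i\<in>I. mscale (if i = j then a i else 0) (e i))" by simp
      then show ?thesis by (simp only: combosI)
    qed
    have j: "j \<in> I" using insert.prems by auto
    define G where "G = \<bar>K * R ^ (2 * a j)\<bar>"
    have P0: "\<forall>\<^sub>F r in sequentially. \<forall>p. keys p \<subseteq> {?\<beta>, ?\<gamma>} \<longrightarrow> 0 \<le> ell (y r) (p * p)"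
      by (rule psd) (use in1 in2 in auto)
    have "\<forall>\<^sub>F r in sequentially. \<bar>y r (?\<beta> + ?\<gamma>)\<bar> \<le> sqrt (G * B)"
      using P0 growth[OF j, of "a j"] B
    proof eventually_elim
      case prems: (elim r)
      have P: "0 \<le> ell (y r) (p * p)" if "keys p \<subseteq> {?\<beta>, ?\<gamma>}" for p
        using prems(1) that by blast
      have pos: "0 \<le> y r (?\<beta> + ?\<beta>)"
        using P[of "single ?\<beta> 1"] by (simp add: mult_single)
      have "?\<beta> + ?\<beta> = mscale (2 * a j) (e j)" by (simp only: mult_2 mscale_add)
      then have g: "y r (?\<beta> + ?\<beta>) \<le> G" using prems(2) by (simp add: G_def)
      have "(y r (?\<beta> + ?\<gamma>))\<^sup>2 \<le> y r (?\<beta> + ?\<beta>) * y r (?\<gamma> + ?\<gamma>)"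
        by (rule moment_cauchy_schwarz[OF P])
      also have "\<dots> \<le> y r (?\<beta> + ?\<beta>) * \<bar>y r (?\<gamma> + ?\<gamma>)\<bar>" by (rule mult_left_mono[OF abs_ge_self pos])
      also have "\<dots> \<le> G * B" using g prems(3) pos by (intro mult_mono) auto
      finally have "sqrt ((y r (?\<beta> + ?\<gamma>))\<^sup>2) \<le> sqrt (G * B)" by (rule real_sqrt_le_mono)
      then show ?case by simp
    qed
    then show ?case using insert.hyps by (auto intro: exI[of _ "sqrt (G * B)"])
  qed
  then show ?thesis using \<gamma> unfolding combos_def by auto
qed

text \<open>An eventual bound is a bound after enlarging it for finitely many terms. Dividing each
  coordinate by its own bound gives the common bound 1 under which the diagonal argument is carried
  out.\<close>

lemma convergent_moment_subsequence:
  fixes y :: "nat \<Rightarrow> 'e \<Rightarrow> real"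
  assumes "countable E" "\<And>\<gamma>. \<gamma> \<in> E \<Longrightarrow> \<exists>B. \<forall>\<^sub>F r in sequentially. \<bar>y r \<gamma>\<bar> \<le> B"
  obtains \<sigma> y' where "strict_mono (\<sigma> :: nat \<Rightarrow> nat)" "\<And>\<gamma>. \<gamma> \<in> E \<Longrightarrow> (\<lambda>r. y (\<sigma> r) \<gamma>) \<longlonglongrightarrow> y' \<gamma>"
proof -
  have "\<exists>K>0. \<forall>r. \<bar>y r \<gamma>\<bar> \<le> K" if "\<gamma> \<in> E" for \<gamma>
  proof -
    from assms(2)[OF that] obtain B where "\<forall>\<^sub>F r in sequentially. norm (y r \<gamma>) \<le> B" by auto
    then have "Bseq (\<lambda>r. y r \<gamma>)" by (rule BfunI)
    then show ?thesis by (auto elim!: BseqE)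
  qed
  then have "\<forall>\<gamma>. \<exists>K. \<gamma> \<in> E \<longrightarrow> K > 0 \<and> (\<forall>r. \<bar>y r \<gamma>\<bar> \<le> K)" by blast
  from choice[OF this] obtain K where K: "\<And>\<gamma>. \<gamma> \<in> E \<Longrightarrow> K \<gamma> > 0" "\<And>\<gamma> r. \<gamma> \<in> E \<Longrightarrow> \<bar>y r \<gamma>\<bar> \<le> K \<gamma>"
    by blast
  define f where "f r \<gamma> = y r \<gamma> / K \<gamma>" for r \<gamma>
  have "norm (f r \<gamma>) \<le> 1" if "\<gamma> \<in> E" for r \<gamma> using K[OF that] by (simp add: f_def abs_divide)
  then obtain \<sigma> where \<sigma>: "strict_mono (\<sigma> :: nat \<Rightarrow> nat)" "\<And>\<gamma>. \<gamma> \<in> E \<Longrightarrow> \<exists>l. (\<lambda>n. f (\<sigma> n) \<gamma>) \<longlonglongrightarrow> l"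
  proof (rule function_convergent_subsequence[OF assms(1), of f 1])
    fix k assume "strict_mono (k :: nat \<Rightarrow> nat)" "\<And>x. x \<in> E \<Longrightarrow> \<exists>l. (\<lambda>n. f (k n) x) \<longlonglongrightarrow> l"
    then show thesis by (rule that)
  qed
  have "\<forall>\<gamma>. \<exists>l. \<gamma> \<in> E \<longrightarrow> (\<lambda>n. f (\<sigma> n) \<gamma>) \<longlonglongrightarrow> l" using \<sigma>(2) by blast
  from choice[OF this] obtain l where l: "\<And>\<gamma>. \<gamma> \<in> E \<Longrightarrow> (\<lambda>n. f (\<sigma> n) \<gamma>) \<longlonglongrightarrow> l \<gamma>" by blast
  have "(\<lambda>r. y (\<sigma> r) \<gamma>) \<longlonglongrightarrow> K \<gamma> * l \<gamma>" if "\<gamma> \<in> E" for \<gamma>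
  proof -
    have "(\<lambda>n. K \<gamma> * f (\<sigma> n) \<gamma>) \<longlonglongrightarrow> K \<gamma> * l \<gamma>" by (intro tendsto_intros l that)
    moreover have "K \<gamma> * f (\<sigma> n) \<gamma> = y (\<sigma> n) \<gamma>" for n using K(1)[OF that] by (simp add: f_def)
    ultimately show ?thesis by simp
  qed
  then show ?thesis using that[OF \<sigma>(1), of "\<lambda>\<gamma>. K \<gamma> * l \<gamma>"] by blast
qed

text \<open>Outside \<open>combos\<close> the sequence is replaced by zero. By the face condition a
  product lies in \<open>combos\<close> only if both factors do, so positivity survives this
  extension and the theory of functionals on all polynomials applies; division by \<open>m\<close>
  normalises the mass.\<close>

lemma moment_representation:
  fixes y :: "'e::comm_monoid_add \<Rightarrow> real"
  assumes I: "finite I" and face: "\<And>\<beta> \<gamma>. \<beta> + \<gamma> \<in> combos e I \<Longrightarrow> \<beta> \<in> combos e I \<and> \<gamma> \<in> combos e I"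
    and psd: "\<And>p. keys p \<subseteq> combos e I \<Longrightarrow> 0 \<le> ell y (p * p)"
    and growth: "\<And>i k. i \<in> I \<Longrightarrow> y (mscale (2 * k) (e i)) \<le> K * R ^ (2 * k)"
    and R: "0 < R" and y0: "y 0 = m" "0 < m"
  shows "\<exists>\<rho> X. real_distribution \<rho> \<and> (\<forall>i. continuous_on UNIV (X i)) \<and> (\<forall>i s. \<bar>X i s\<bar> \<le> R) \<and>
    (\<forall>a. y (\<Sum>i\<in>I. mscale (a i) (e i)) = m * (LINT s|\<rho>. (\<Prod>i\<in>I. X i s ^ a i)))"
proof -
  define y' where "y' \<gamma> = (if \<gamma> \<in> combos e I then y \<gamma> / m else 0)" for \<gamma>
  have pos: "0 \<le> ell y' (p * p)" for p
  proof -
    \<comment> \<open>The part of \<open>p\<close> inside \<open>combos\<close>; the remaining terms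
      contribute nothing to the quadratic form.\<close>
    define q where "q = (\<Sum>k\<in>keys p \<inter> combos e I. single k (lookup p k))"
    have lq: "lookup q k = (if k \<in> combos e I then lookup p k else 0)" for k
      by (auto simp: q_def lookup_sum lookup_single when_def in_keys_iff sum.If_cases)
    then have kq: "keys q = keys p \<inter> combos e I"
      by (auto simp: in_keys_iff split: if_splits)
    have z: "y' (\<beta> + \<gamma>) = 0" if "\<beta> \<notin> combos e I \<or> \<gamma> \<notin> combos e I" for \<beta> \<gamma>
    proof -
      have "\<beta> + \<gamma> \<notin> combos e I" using face[of \<beta> \<gamma>] that by blast
      then show ?thesis by (simp add: y'_def)
    qed
    have "ell y' (p * p) = (\<Sum>\<beta>\<in>keys p. \<Sum>\<gamma>\<in>keys p. lookup p \<beta> * lookup p \<gamma> * y' (\<beta> + \<gamma>))"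
      by (rule ell_mult)
    also have "\<dots> = (\<Sum>\<beta>\<in>keys q. \<Sum>\<gamma>\<in>keys p. lookup p \<beta> * lookup p \<gamma> * y' (\<beta> + \<gamma>))"
      by (rule sum.mono_neutral_right) (auto simp: kq z)
    also have "\<dots> = (\<Sum>\<beta>\<in>keys q. \<Sum>\<gamma>\<in>keys q. lookup p \<beta> * lookup p \<gamma> * y' (\<beta> + \<gamma>))"
      by (rule sum.cong[OF refl], rule sum.mono_neutral_right) (auto simp: kq z)
    also have "\<dots> = (\<Sum>\<beta>\<in>keys q. \<Sum>\<gamma>\<in>keys q. lookup q \<beta> * lookup q \<gamma> * y' (\<beta> + \<gamma>))"
      by (intro sum.cong refl) (auto simp: lq kq)
    also have "\<dots> = ell y' (q * q)" by (rule ell_mult[symmetric])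
    also have "\<dots> = ell y (q * q) / m"
    proof -
      have add: "\<beta> + \<gamma> \<in> combos e I" if b: "\<beta> \<in> combos e I" and c: "\<gamma> \<in> combos e I" for \<beta> \<gamma>
      proof -
        from b obtain a1 where a1: "\<beta> = (\<Sum>i\<in>I. mscale (a1 i) (e i))" by (auto simp: combos_def)
        from c obtain a2 where a2: "\<gamma> = (\<Sum>i\<in>I. mscale (a2 i) (e i))" by (auto simp: combos_def)
        have "\<beta> + \<gamma> = (\<Sum>i\<in>I. mscale (a1 i + a2 i) (e i))" by (simp add: a1 a2 mscale_add sum.distrib)
        then show ?thesis by (simp only: combosI)
      qed
      have "keys (q * q) \<subseteq> combos e I"
        using keys_mult[of q q] add kq by blast
      then have "ell y' (q * q) = ell (\<lambda>\<gamma>. y \<gamma> / m) (q * q)" by (intro ell_cong) (auto simp: y'_def)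
      then show ?thesis by (simp add: ell_def sum_divide_distrib)
    qed
    also have "\<dots> \<ge> 0" using psd[of q] kq y0 by simp
    finally show ?thesis .
  qed
  interpret positive_functional "ell y'" by (rule positive_functional_ell[OF pos])
  have in0: "0 \<in> combos e I" using combosI[of "\<lambda>_. 0" e I] by (simp add: mscale_simps)
  have y'_le: "y' \<gamma> \<le> c / m" if "y \<gamma> \<le> c" "\<gamma> \<in> combos e I" for \<gamma> c
    using that y0 by (simp add: y'_def divide_right_mono)
  have in1: "mscale n (e i) \<in> combos e I" if i: "i \<in> I" for n i
  proof -
    have "(\<Sum>i'\<in>I. mscale (if i' = i then n else 0) (e i')) = (\<Sum>i'\<in>I. if i' = i then mscale n (e i) else 0)"
      by (rule sum.cong) (auto simp: mscale_simps)
    also have "\<dots> = mscale n (e i)" using i I by simp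
    finally show ?thesis by (metis combosI)
  qed
  have cone: "const_poly (R\<^sup>2) - single (e i) 1 * single (e i) 1 \<in> cone" if i: "i \<in> I" for i
  proof (rule growth_imp_cone[OF R, where K = "K / m"])
    show "ell y' (single (e i) 1 ^ (2 * k)) \<le> K / m * R ^ (2 * k)" for k
      using y'_le[OF growth[OF i] in1[OF i], of k] by (simp add: single_power)
  qed
  have L1: "ell y' 1 = 1" using y0 in0 by (simp add: single_one[symmetric] y'_def del: single_one)
  show ?thesis
  proof (rule bounded_moment[OF I R cone L1])
    fix \<rho> X
    assume H: "real_distribution \<rho>" "\<And>i. continuous_on UNIV (X i)" "\<And>i s. \<bar>X i s\<bar> \<le> R"
      and X: "\<And>j. ell y' (\<Prod>i\<in>I. single (e i) 1 ^ j i) = (LINT s|\<rho>. (\<Prod>i\<in>I. X i s ^ j i))"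
    have "y (\<Sum>i\<in>I. mscale (a i) (e i)) = m * (LINT s|\<rho>. (\<Prod>i\<in>I. X i s ^ a i))" for a
    proof -
      have "y (\<Sum>i\<in>I. mscale (a i) (e i)) / m = (LINT s|\<rho>. (\<Prod>i\<in>I. X i s ^ a i))"
        using X[of a] combosI[of a e I] by (simp add: single_power single_prod y'_def)
      then show ?thesis using y0 by (simp add: field_simps)
    qed
    then show ?thesis using H by blast
  qed
qed

text \<open>On \<open>\<Theta> \<le> -\<delta>\<close> the weight \<open>(1 - \<Theta> / c)\<^sup>2\<^sup>k\<close> grows with \<open>k\<close> while it stays below \<open>1\<close> where \<open>\<Theta> \<ge> 0\<close>.\<close>

lemma nonneg_from_localizing:
  fixes \<Theta> :: "'x \<Rightarrow> real"
  assumes M: "finite_measure M" and meas: "\<Theta> \<in> borel_measurable M" and bd: "\<And>x. x \<in> space M \<Longrightarrow> \<bar>\<Theta> x\<bar> \<le> c" and c: "0 < c"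
    and loc: "\<And>k. 0 \<le> (LINT x|M. \<Theta> x * (c - \<Theta> x) ^ (2 * k))"
  shows "AE x in M. 0 \<le> \<Theta> x"
proof -
  interpret finite_measure M by (rule M)
  have small: "measure M {x \<in> space M. \<Theta> x \<le> - \<delta>} = 0" if \<delta>: "0 < \<delta>" for \<delta>
  proof (rule ccontr)
    let ?A = "{x \<in> space M. \<Theta> x \<le> - \<delta>}"
    have A: "?A \<in> sets M" using meas by measurable
    assume "measure M ?A \<noteq> 0"
    then have mA: "0 < measure M ?A" by (simp add: zero_less_measure_iff)
    have bound: "measure M ?A * (\<delta> * (1 + real (2 * k) * (\<delta> / c))) \<le> c * measure M (space M)" for k
    proof -
      let ?g = "\<lambda>x. \<Theta> x * (1 - \<Theta> x / c) ^ (2 * k)"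
      let ?K = "\<delta> * (1 + real (2 * k) * (\<delta> / c))"
      have pw: "?g x \<le> c - ?K * indicator ?A x" if x: "x \<in> space M" for x
      proof (cases "\<Theta> x \<ge> 0")
        case True
        then have "0 \<le> 1 - \<Theta> x / c" "1 - \<Theta> x / c \<le> 1" using bd[OF x] c by (auto simp: field_simps)
        then have "(1 - \<Theta> x / c) ^ (2 * k) \<le> 1" by (intro power_le_one)
        then have "?g x \<le> \<Theta> x * 1" using True by (intro mult_left_mono)
        also have "\<dots> \<le> c" using bd[OF x] by simp
        finally show ?thesis using True \<delta> by (simp add: indicator_def)
      next
        case False
        have g0: "?g x \<le> 0" using False by (intro mult_nonpos_nonneg) auto
        show ?thesis
        proof (cases "x \<in> ?A")
          case True
          then have t: "\<Theta> x \<le> - \<delta>" by simp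
          have "1 + real (2 * k) * (\<delta> / c) \<le> (1 + \<delta> / c) ^ (2 * k)"
            by (rule Bernoulli_inequality) (use \<delta> c in \<open>simp add: field_simps\<close>)
          also have "\<dots> \<le> (1 - \<Theta> x / c) ^ (2 * k)"
          proof (rule power_mono)
            have "\<delta> / c \<le> (- \<Theta> x) / c" using t c by (intro divide_right_mono) auto
            then show "1 + \<delta> / c \<le> 1 - \<Theta> x / c" by simp
            show "0 \<le> 1 + \<delta> / c" using \<delta> c by simp
          qed
          finally have "\<delta> * (1 + real (2 * k) * (\<delta> / c)) \<le> (- \<Theta> x) * (1 - \<Theta> x / c) ^ (2 * k)"
            using t \<delta> c by (intro mult_mono) auto
          moreover have i1: "indicator ?A x = (1 :: real)" using True by (rule indicator_simps(1))
          ultimately show ?thesis unfolding i1 using c by linarith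
        next
          case False
          then have i0: "indicator ?A x = (0 :: real)" by (rule indicator_simps(2))
          show ?thesis unfolding i0 using g0 c by linarith
        qed
      qed
      have gint: "integrable M ?g"
      proof (rule integrable_const_bound[of _ "c * 2 ^ (2 * k)"])
        have "norm (?g x) \<le> c * 2 ^ (2 * k)" if x: "x \<in> space M" for x
        proof -
          have "\<bar>1 - \<Theta> x / c\<bar> \<le> 2" using bd[OF x] c by (auto simp: abs_le_iff field_simps)
          then have "\<bar>1 - \<Theta> x / c\<bar> ^ (2 * k) \<le> 2 ^ (2 * k)" by (intro power_mono) auto
          then show ?thesis unfolding norm_mult norm_power using bd[OF x] c by (intro mult_mono) auto
        qed
        then show "AE x in M. norm (?g x) \<le> c * 2 ^ (2 * k)" by (rule AE_I2)
        show "?g \<in> borel_measurable M" using meas by measurable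
      qed
      have ind: "integrable M (indicator ?A :: 'x \<Rightarrow> real)"
        by (rule integrable_real_indicator[OF A]) (simp add: less_top[symmetric])
      have kint: "integrable M (\<lambda>x. c - ?K * indicator ?A x)"
        by (rule Bochner_Integration.integrable_diff[OF integrable_const integrable_mult_right[OF ind]])
      have e: "1 - \<Theta> x / c = (c - \<Theta> x) / c" for x using c by (simp add: diff_divide_distrib)
      have "(LINT x|M. ?g x) = (LINT x|M. \<Theta> x * (c - \<Theta> x) ^ (2 * k) / c ^ (2 * k))"
        by (simp only: e power_divide times_divide_eq_right)
      then have "0 \<le> (LINT x|M. ?g x)" using loc[of k] c by simp
      also have "\<dots> \<le> (LINT x|M. c - ?K * indicator ?A x)"
        by (rule integral_mono[OF gint kint pw])
      also have "\<dots> = c * measure M (space M) - ?K * measure M ?A"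
        using A by (subst Bochner_Integration.integral_diff[OF integrable_const integrable_mult_right[OF ind]]) simp
      finally show ?thesis by (simp only: mult.commute)
    qed
    \<comment> \<open>The lower bound in \<open>bound\<close> grows with slope \<open>d\<close> in
      \<open>k\<close>, whereas its upper bound is a fixed multiple of the total mass.\<close>
    define d where "d = measure M ?A * \<delta> * (2 * \<delta> / c)"
    have d: "0 < d" using mA \<delta> c by (simp add: d_def)
    obtain k where k: "real k * d > c * measure M (space M)" using reals_Archimedean3[OF d] by blast
    have "real k * d \<le> measure M ?A * (\<delta> * (1 + real (2 * k) * (\<delta> / c)))"
      using mA \<delta> by (simp add: d_def algebra_simps)
    then show False using bound[of k] k by linarith
  qed
  have "AE x in M. \<not> \<Theta> x \<le> - (1 / real (Suc n))" for n
  proof -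
    have A: "{x \<in> space M. \<Theta> x \<le> - (1 / real (Suc n))} \<in> sets M" using meas by measurable
    have "emeasure M {x \<in> space M. \<Theta> x \<le> - (1 / real (Suc n))} = 0"
      using small[of "1 / real (Suc n)"] by (simp add: emeasure_eq_measure)
    then show ?thesis using A by (intro AE_I[of _ _ "{x \<in> space M. \<Theta> x \<le> - (1 / real (Suc n))}"]) auto
  qed
  then have "AE x in M. \<forall>n. \<not> \<Theta> x \<le> - (1 / real (Suc n))" by (simp add: AE_all_countable)
  then show ?thesis
  proof eventually_elim
    case (elim x)
    show ?case
    proof (rule ccontr)
      assume "\<not> 0 \<le> \<Theta> x"
      then obtain n where "inverse (real (Suc n)) < - \<Theta> x" using reals_Archimedean[of "- \<Theta> x"] by auto
      then have "\<Theta> x \<le> - (1 / real (Suc n))" by (simp add: inverse_eq_divide)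
      then show False using elim by blast
    qed
  qed
qed

section \<open>Exponents in time, states and controls\<close>

lemma mscale_Pair: "mscale n (x, y) = (mscale n x, mscale n y)"
  by (induction n) (simp_all add: mscale_simps zero_prod_def)

lemma mscale_nat: "mscale n (1 :: nat) = n"
  by (simp add: mscale_def)

lemma mscale_zero: "mscale n 0 = 0"
  by (simp add: mscale_def)

lemma mscale_single: "mscale n (single k (1 :: nat)) = single k n"
  by (induction n) (simp_all add: mscale_simps single_add[symmetric])

text \<open>\<open>Inl 0\<close> is time, \<open>Inl k\<close> the \<open>k\<close>-th state and
  \<open>Inr j\<close> the \<open>j\<close>-th control, so one finite index set feeds the general
  moment theorem.\<close>

definition var :: "nat + 'm \<Rightarrow> 'm tzuexp" where
  "var i = (case i of Inl k \<Rightarrow> (if k = 0 then (1, 0, 0) else (0, single k 1, 0))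
     | Inr j \<Rightarrow> (0, 0, single j 1))"

definition vars :: "nat \<Rightarrow> (nat + 'm::finite) set" where
  "vars N = Inl ` {0..N} \<union> Inr ` UNIV"

lemma finite_vars: "finite (vars N)" by (simp add: vars_def)

lemma sum_vars: "(\<Sum>i\<in>vars N. f i) = f (Inl 0) + ((\<Sum>k\<in>{1..N}. f (Inl k)) + (\<Sum>j\<in>UNIV. f (Inr j)))"
proof -
  have "(\<Sum>i\<in>vars N. f i) = (\<Sum>i\<in>Inl ` {0..N}. f i) + (\<Sum>i\<in>Inr ` UNIV. f i)"
    unfolding vars_def by (rule sum.union_disjoint) auto
  also have "(\<Sum>i\<in>Inl ` {0..N}. f i) = (\<Sum>k\<in>{0..N}. f (Inl k))" by (simp add: sum.reindex)
  also have "{0..N} = insert 0 {1..N}" by auto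
  also have "(\<Sum>i\<in>Inr ` UNIV. f i) = (\<Sum>j\<in>UNIV. f (Inr j))" by (simp add: sum.reindex)
  finally show ?thesis by (simp add: add.assoc)
qed

lemma prod_vars: "(\<Prod>i\<in>vars N. f i) = f (Inl 0) * ((\<Prod>k\<in>{1..N}. f (Inl k)) * (\<Prod>j\<in>UNIV. f (Inr j)))"
proof -
  have "(\<Prod>i\<in>vars N. f i) = (\<Prod>i\<in>Inl ` {0..N}. f i) * (\<Prod>i\<in>Inr ` UNIV. f i)"
    unfolding vars_def by (rule prod.union_disjoint) auto
  also have "(\<Prod>i\<in>Inl ` {0..N}. f i) = (\<Prod>k\<in>{0..N}. f (Inl k))" by (simp add: prod.reindex)
  also have "{0..N} = insert 0 {1..N}" by auto
  also have "(\<Prod>i\<in>Inr ` UNIV. f i) = (\<Prod>j\<in>UNIV. f (Inr j))" by (simp add: prod.reindex)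
  finally show ?thesis by (simp add: mult.assoc)
qed

lemma combo_var:
  "(\<Sum>i\<in>vars N. mscale (a i) (var i)) =
    (a (Inl 0), (\<Sum>k\<in>{1..N}. single k (a (Inl k))), (\<Sum>j\<in>UNIV. single j (a (Inr j))))"
proof -
  have "(\<Sum>k\<in>{1..N}. mscale (a (Inl k)) (var (Inl k) :: 'a tzuexp)) = (\<Sum>k\<in>{1..N}. (0, single k (a (Inl k)), 0))"
    by (rule sum.cong[OF refl]) (simp add: var_def mscale_Pair mscale_zero mscale_single[simplified])
  also have "\<dots> = (0, (\<Sum>k\<in>{1..N}. single k (a (Inl k))), 0)"
    by (auto intro!: prod_eqI simp: fst_sum snd_sum)
  finally have 1: "(\<Sum>k\<in>{1..N}. mscale (a (Inl k)) (var (Inl k) :: 'a tzuexp)) = \<dots>" .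
  have "(\<Sum>j\<in>UNIV. mscale (a (Inr j)) (var (Inr j) :: 'a tzuexp)) = (\<Sum>j\<in>UNIV. (0, 0, single j (a (Inr j))))"
    by (rule sum.cong[OF refl]) (simp add: var_def mscale_Pair mscale_zero mscale_single[simplified])
  also have "\<dots> = (0, 0, (\<Sum>j\<in>UNIV. single j (a (Inr j))))"
    by (auto intro!: prod_eqI simp: fst_sum snd_sum)
  finally have 2: "(\<Sum>j\<in>UNIV. mscale (a (Inr j)) (var (Inr j) :: 'a tzuexp)) = \<dots>" .
  have 0: "mscale (a (Inl 0)) (var (Inl 0) :: 'a tzuexp) = (a (Inl 0), 0, 0)"
    by (simp add: var_def mscale_Pair mscale_zero mscale_nat[simplified])
  show ?thesis unfolding sum_vars 0 1 2 by simp
qed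

lemma lookup_sum_single: "finite K \<Longrightarrow> lookup (\<Sum>k\<in>K. single k (f k)) i = (if i \<in> K then f i else (0::nat))"
  by (auto simp: lookup_sum lookup_single when_def sum.If_cases)

text \<open>Exponents of arbitrary degree in which no state beyond \<open>N\<close> occurs: the
  entries of \<open>y\<close> that some relaxation of dimension \<open>N\<close> constrains.\<close>

definition texps :: "nat \<Rightarrow> 'm tzuexp set" where
  "texps N = {\<gamma>. keys (fst (snd \<gamma>)) \<subseteq> {1..N}}"

definition powers :: "'m tzuexp \<Rightarrow> nat + 'm \<Rightarrow> nat" where
  "powers \<gamma> i = (case i of Inl k \<Rightarrow> (if k = 0 then fst \<gamma> else lookup (fst (snd \<gamma>)) k)
     | Inr j \<Rightarrow> lookup (snd (snd \<gamma>)) j)"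

lemma texps_combo:
  assumes "\<gamma> \<in> texps N"
  shows "\<gamma> = (\<Sum>i\<in>vars N. mscale (powers \<gamma> i) (var i))"
proof -
  have out: "lookup (fst (snd \<gamma>)) i = 0" if "i \<notin> {1..N}" for i
    using assms that by (auto simp: texps_def in_keys_iff)
  have "fst (snd \<gamma>) = (\<Sum>k\<in>{1..N}. single k (powers \<gamma> (Inl k)))"
  proof (rule poly_mapping_eqI)
    fix i
    show "lookup (fst (snd \<gamma>)) i = lookup (\<Sum>k\<in>{1..N}. single k (powers \<gamma> (Inl k))) i"
    proof (cases "i \<in> {1..N}")
      case True
      then have "i \<noteq> 0" by auto
      then show ?thesis unfolding lookup_sum_single[OF finite_atLeastAtMost] using True by (simp add: powers_def)
    next
      case False
      then show ?thesis unfolding lookup_sum_single[OF finite_atLeastAtMost] using out[OF False] by (simp only: if_False)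
    qed
  qed
  moreover have "snd (snd \<gamma>) = (\<Sum>j\<in>UNIV. single j (powers \<gamma> (Inr j)))"
    by (rule poly_mapping_eqI) (simp add: lookup_sum_single powers_def)
  moreover have "fst \<gamma> = powers \<gamma> (Inl 0)" by (simp add: powers_def)
  ultimately show ?thesis unfolding combo_var by (metis prod.collapse)
qed

lemma combos_var: "combos (var :: _ \<Rightarrow> ('m::finite) tzuexp) (vars N) = texps N"
proof
  show "combos (var :: _ \<Rightarrow> 'm tzuexp) (vars N) \<subseteq> texps N"
  proof
    fix \<gamma> :: "'m tzuexp" assume "\<gamma> \<in> combos var (vars N)"
    then obtain a where "\<gamma> = (\<Sum>i\<in>vars N. mscale (a i) (var i))" by (auto simp: combos_def)
    then show "\<gamma> \<in> texps N"
      unfolding combo_var by (auto simp: texps_def in_keys_iff lookup_sum_single split: if_splits)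
  qed
  show "texps N \<subseteq> combos (var :: _ \<Rightarrow> 'm tzuexp) (vars N)"
  proof
    fix \<gamma> :: "'m tzuexp" assume "\<gamma> \<in> texps N"
    from texps_combo[OF this] show "\<gamma> \<in> combos var (vars N)" by (rule ssubst) (rule combosI)
  qed
qed

lemma keys_add_nat: "keys (\<alpha> + \<beta> :: 'v \<Rightarrow>\<^sub>0 nat) = keys \<alpha> \<union> keys \<beta>"
  by (auto simp: in_keys_iff lookup_add)

lemma texps_add: "\<beta> + \<gamma> \<in> texps N \<longleftrightarrow> \<beta> \<in> texps N \<and> \<gamma> \<in> texps N"
  by (simp add: texps_def keys_add_nat)

lemma combo_zvar:
  "(\<Sum>k\<in>{1..N}. mscale (a k) (single k (1::nat))) = (\<Sum>k\<in>{1..N}. single k (a k))"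
  by (simp only: mscale_single)

definition zexps_all :: "nat \<Rightarrow> zexp set" where
  "zexps_all N = {\<alpha>. keys \<alpha> \<subseteq> {1..N}}"

lemma zexps_all_combo:
  assumes "\<alpha> \<in> zexps_all N"
  shows "\<alpha> = (\<Sum>k\<in>{1..N}. mscale (lookup \<alpha> k) (single k (1::nat)))"
  unfolding combo_zvar
proof (rule poly_mapping_eqI)
  show "lookup \<alpha> i = lookup (\<Sum>k\<in>{1..N}. single k (lookup \<alpha> k)) i" for i
    unfolding lookup_sum_single[OF finite_atLeastAtMost] using assms by (auto simp: zexps_all_def in_keys_iff)
qed

lemma combos_zvar: "combos (\<lambda>k. single k (1::nat)) {1..N} = zexps_all N"
proof
  show "combos (\<lambda>k. single k (1::nat)) {1..N} \<subseteq> zexps_all N"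
  proof
    fix \<alpha> :: zexp assume "\<alpha> \<in> combos (\<lambda>k. single k (1::nat)) {1..N}"
    then obtain a where "\<alpha> = (\<Sum>k\<in>{1..N}. mscale (a k) (single k (1::nat)))" by (auto simp: combos_def)
    then show "\<alpha> \<in> zexps_all N"
      unfolding combo_zvar by (auto simp: zexps_all_def in_keys_iff lookup_sum_single split: if_splits)
  qed
  show "zexps_all N \<subseteq> combos (\<lambda>k. single k (1::nat)) {1..N}"
  proof
    fix \<alpha> assume "\<alpha> \<in> zexps_all N"
    from zexps_all_combo[OF this] show "\<alpha> \<in> combos (\<lambda>k. single k (1::nat)) {1..N}"
      by (rule ssubst) (rule combosI)
  qed
qed

lemma zexps_all_add: "\<beta> + \<gamma> \<in> zexps_all N \<longleftrightarrow> \<beta> \<in> zexps_all N \<and> \<gamma> \<in> zexps_all N"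
  by (simp add: zexps_all_def keys_add_nat)

lemma eventually_subset_directed:
  assumes "finite F" "\<And>x. x \<in> F \<Longrightarrow> \<exists>r0. \<forall>r\<ge>r0. x \<in> E (r :: nat)"
  shows "\<forall>\<^sub>F r in sequentially. F \<subseteq> E r"
proof -
  have "\<forall>x\<in>F. \<forall>\<^sub>F r in sequentially. x \<in> E r"
    using assms(2) by (auto simp: eventually_sequentially)
  then have "\<forall>\<^sub>F r in sequentially. \<forall>x\<in>F. x \<in> E r" by (simp add: eventually_ball_finite_distrib assms(1))
  then show ?thesis by (auto elim: eventually_mono)
qed

lemma eventually_tzuexps:
  fixes F :: "('m::finite) tzuexp set"
  assumes "finite F" "F \<subseteq> texps N"
  shows "\<forall>\<^sub>F r in sequentially. F \<subseteq> tzuexps N r"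
proof (rule eventually_subset_directed[OF assms(1)])
  fix \<gamma> assume "\<gamma> \<in> F"
  obtain p \<alpha> \<beta> where g: "\<gamma> = (p, \<alpha>, \<beta>)" by (cases \<gamma>)
  have "\<gamma> \<in> texps N" using \<open>\<gamma> \<in> F\<close> assms(2) by blast
  then have "keys \<alpha> \<subseteq> {1..N}" by (simp only: texps_def g mem_Collect_eq fst_conv snd_conv)
  then show "\<exists>r0. \<forall>r\<ge>r0. \<gamma> \<in> tzuexps N r"
    by (intro exI[of _ "p + total_deg \<alpha> + total_deg \<beta>"]) (auto simp: g tzuexps_def)
qed

lemma eventually_zexps:
  assumes "finite F" "F \<subseteq> zexps_all N"
  shows "\<forall>\<^sub>F r in sequentially. F \<subseteq> zexps N (r - d)"
proof (rule eventually_subset_directed[OF assms(1)])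
  fix \<alpha> assume "\<alpha> \<in> F"
  then show "\<exists>r0. \<forall>r\<ge>r0. \<alpha> \<in> zexps N (r - d)"
    using assms(2) by (intro exI[of _ "total_deg \<alpha> + d"]) (auto simp: zexps_all_def zexps_def)
qed

lemma eventually_uexps:
  assumes "finite F"
  shows "\<forall>\<^sub>F r in sequentially. F \<subseteq> uexps (r - d)"
proof (rule eventually_subset_directed[OF assms])
  fix \<beta> assume "\<beta> \<in> F"
  then show "\<exists>r0. \<forall>r\<ge>r0. \<beta> \<in> uexps (r - d)"
    by (intro exI[of _ "total_deg \<beta> + d"]) (auto simp: uexps_def)
qed

lemma eventually_atMost:
  assumes "finite F"
  shows "\<forall>\<^sub>F r in sequentially. F \<subseteq> {..r - d :: nat}"
proof (rule eventually_subset_directed[OF assms])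
  fix k assume "k \<in> F"
  then show "\<exists>r0. \<forall>r\<ge>r0. k \<in> {..r - d}" by (intro exI[of _ "k + d"]) auto
qed

lemma ell_interval_expand:
  "ell f (interval_poly a b (single e 1)) = (a + b) * f e - f (e + e) - a * b * f 0"
  by (simp only: interval_poly_def const_poly_def left_diff_distrib right_diff_distrib mult_single ell_diff ell_single)
     (simp add: algebra_simps)

text \<open>\<open>a\<^sup>2 + b\<^sup>2 - x\<^sup>2 = 2 (b - x) (x - a) + (x - a - b)\<^sup>2\<close>\<close>

lemma interval_growth:
  fixes y :: "'e::comm_monoid_add \<Rightarrow> real"
  assumes sq: "\<And>p. keys p \<subseteq> {e + g, g} \<Longrightarrow> 0 \<le> ell y (p * p)"
    and loc: "0 \<le> (a + b) * y (e + (g + g)) - y ((e + e) + (g + g)) - a * b * y (g + g)"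
  shows "y ((e + e) + (g + g)) \<le> (a\<^sup>2 + b\<^sup>2) * y (g + g)"
proof -
  let ?c = "- (a + b)"
  let ?p = "single (e + g) 1 + single g ?c"
  have "keys ?p \<subseteq> {e + g, g}"
    using keys_add[of "single (e + g) (1::real)" "single g ?c"] by (auto split: if_splits)
  then have "0 \<le> ell y (?p * ?p)" by (rule sq)
  also have "?p * ?p = single ((e + e) + (g + g)) 1 + (single (e + (g + g)) ?c + (single (e + (g + g)) ?c + single (g + g) (?c * ?c)))"
    by (simp only: distrib_left distrib_right mult_single mult_1 mult_1_right) (simp add: add_ac)
  also have "ell y \<dots> = y ((e + e) + (g + g)) - 2 * (a + b) * y (e + (g + g)) + (a + b)\<^sup>2 * y (g + g)"
    by (simp only: ell_add ell_single) (simp add: power2_eq_square algebra_simps)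
  finally show ?thesis using loc by (simp add: power2_eq_square algebra_simps)
qed

lemma ell_tendsto:
  assumes "\<And>\<gamma>. \<gamma> \<in> keys P \<Longrightarrow> (\<lambda>r. y r \<gamma>) \<longlonglongrightarrow> y' \<gamma>"
  shows "(\<lambda>r. ell (y r) P) \<longlonglongrightarrow> ell y' P"
  unfolding ell_def by (intro tendsto_intros assms)

lemma keys_mult_subset:
  assumes "\<And>\<beta> \<gamma>. \<beta> \<in> E \<Longrightarrow> \<gamma> \<in> E \<Longrightarrow> \<beta> + \<gamma> \<in> E"
    and "keys P \<subseteq> E" "keys Q \<subseteq> E"
  shows "keys (P * Q :: 'e::comm_monoid_add rpoly) \<subseteq> E"
  using keys_mult[of P Q] assms by blast

lemma keys_diff_subset:
  "keys P \<subseteq> E \<Longrightarrow> keys Q \<subseteq> E \<Longrightarrow> keys (P - Q :: 'e rpoly) \<subseteq> E"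
  using keys_diff[of P Q] by blast

text \<open>\<open>f x\<close> evaluates monomials at the point with parameter \<open>x\<close>.
  Testing with the squares of \<open>(c - \<theta>) ^ k\<close> produces the weights of
  \<open>nonneg_from_localizing\<close>; \<open>c\<close> dominates the values of
  \<open>\<theta>\<close> through the bounds \<open>K\<close>.\<close>

lemma support_from_localizing:
  fixes f :: "'x \<Rightarrow> 'e::comm_monoid_add \<Rightarrow> real"
  assumes M: "finite_measure M" and meas: "\<And>\<gamma>. (\<lambda>x. f x \<gamma>) \<in> borel_measurable M"
    and bd: "\<And>x \<gamma>. \<bar>f x \<gamma>\<bar> \<le> K \<gamma>"
    and mult: "\<And>x \<beta> \<gamma>. f x (\<beta> + \<gamma>) = f x \<beta> * f x \<gamma>" and one: "\<And>x. f x 0 = 1"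
    and E: "0 \<in> E" "\<And>\<beta> \<gamma>. \<beta> \<in> E \<Longrightarrow> \<gamma> \<in> E \<Longrightarrow> \<beta> + \<gamma> \<in> E" "keys \<theta> \<subseteq> E"
    and Y: "\<And>\<gamma>. \<gamma> \<in> E \<Longrightarrow> Y \<gamma> = (LINT x|M. f x \<gamma>)"
    and loc: "\<And>q. keys q \<subseteq> E \<Longrightarrow> 0 \<le> ell Y (\<theta> * (q * q))"
  shows "AE x in M. 0 \<le> ell (f x) \<theta>"
proof -
  interpret finite_measure M by (rule M)
  define c where "c = 1 + (\<Sum>\<gamma>\<in>keys \<theta>. \<bar>lookup \<theta> \<gamma>\<bar> * K \<gamma>)"
  have K: "0 \<le> K \<gamma>" for \<gamma> using bd[of undefined \<gamma>] by linarith
  have c: "0 < c" unfolding c_def by (intro add_pos_nonneg sum_nonneg) (auto simp: K)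
  have int: "integrable M (\<lambda>x. f x \<gamma>)" for \<gamma>
    by (rule integrable_const_bound[of _ "K \<gamma>"]) (use bd meas in auto)
  show ?thesis
  proof (rule nonneg_from_localizing[OF M _ _ c])
    show "(\<lambda>x. ell (f x) \<theta>) \<in> borel_measurable M"
      by (rule borel_measurable_integrable[OF ell_integral(2)[where f = f, OF int]])
    show "\<bar>ell (f x) \<theta>\<bar> \<le> c" for x
    proof -
      have "\<bar>ell (f x) \<theta>\<bar> \<le> (\<Sum>\<gamma>\<in>keys \<theta>. \<bar>lookup \<theta> \<gamma>\<bar> * K \<gamma>)"
        unfolding ell_def
      proof (rule order_trans[OF sum_abs sum_mono])
        fix \<gamma> assume "\<gamma> \<in> keys \<theta>"
        show "\<bar>lookup \<theta> \<gamma> * f x \<gamma>\<bar> \<le> \<bar>lookup \<theta> \<gamma>\<bar> * K \<gamma>"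
          unfolding abs_mult by (rule mult_left_mono[OF bd]) simp
      qed
      then show ?thesis by (simp add: c_def)
    qed
    fix k
    let ?q = "(const_poly c - \<theta>) ^ k"
    have "keys (const_poly c - \<theta>) \<subseteq> E"
      by (rule keys_diff_subset) (use E in \<open>auto simp: const_poly_def\<close>)
    then have kq: "keys ?q \<subseteq> E"
    proof (induction k)
      case (Suc k)
      show ?case unfolding power_Suc by (rule keys_mult_subset[OF E(2) Suc(2) Suc(1)[OF Suc(2)]])
    qed (use E(1) in simp)
    have pw: "ell (f x) (P ^ n) = ell (f x) P ^ n" for x P n
      by (induction n) (simp_all add: ell_multiplicative[OF mult] one single_one[symmetric] del: single_one)
    have "ell (f x) (\<theta> * (?q * ?q)) = ell (f x) \<theta> * (c - ell (f x) \<theta>) ^ (2 * k)" for x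
      by (simp only: ell_multiplicative[OF mult] pw ell_diff const_poly_def ell_single one mult_2 power_add mult_1_right)
    moreover have "ell Y (\<theta> * (?q * ?q)) = ell (\<lambda>\<gamma>. LINT x|M. f x \<gamma>) (\<theta> * (?q * ?q))"
      unfolding ell_def
    proof (rule sum.cong[OF refl])
      fix \<gamma> assume "\<gamma> \<in> keys (\<theta> * (?q * ?q))"
      moreover have "keys (\<theta> * (?q * ?q)) \<subseteq> E"
        by (rule keys_mult_subset[OF E(2) E(3) keys_mult_subset[OF E(2) kq kq]])
      ultimately have "\<gamma> \<in> E" by (rule rev_subsetD)
      from Y[OF this] show "lookup (\<theta> * (?q * ?q)) \<gamma> * Y \<gamma> = lookup (\<theta> * (?q * ?q)) \<gamma> * (LINT x|M. f x \<gamma>)"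
        by (simp only:)
    qed
    moreover have "ell (\<lambda>\<gamma>. LINT x|M. f x \<gamma>) (\<theta> * (?q * ?q)) = (LINT x|M. ell (f x) (\<theta> * (?q * ?q)))"
      by (rule ell_integral(1)[OF int])
    ultimately show "0 \<le> (LINT x|M. ell (f x) \<theta> * (c - ell (f x) \<theta>) ^ (2 * k))"
      using loc[OF kq] by simp
  qed
qed

text \<open>Exceptional parameters are redirected to a fixed point of \<open>S\<close>, which exists
  because \<open>M\<close> is not the zero measure. The image measure then lives on \<open>S\<close>
  itself, with the same integrals.\<close>

lemma push_to_compact:
  fixes pt :: "real \<Rightarrow> 'x::t2_space"
  assumes M: "finite_measure M" "sets M = sets borel" "emeasure M (space M) \<noteq> 0"
    and pt: "continuous_on UNIV pt" and S: "compact S" and AE: "AE s in M. pt s \<in> S"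
  shows "\<exists>\<mu>. finite_measure \<mu> \<and> sets \<mu> = sets (restrict_space borel S) \<and>
    (\<forall>g :: 'x \<Rightarrow> real. continuous_on UNIV g \<longrightarrow> (LINT x|\<mu>. g x) = (LINT s|M. g (pt s)))"
proof -
  interpret finite_measure M by (rule M)
  have "S \<noteq> {}"
  proof
    assume "S = {}"
    then have "AE s in M. False" using AE by simp
    then have "ae_filter M = bot" by (simp add: eventually_False)
    then show False using M(3) by (simp add: ae_filter_eq_bot_iff)
  qed
  then obtain a where a: "a \<in> S" by blast
  define pt' where "pt' s = (if pt s \<in> S then pt s else a)" for s
  have ptm: "pt \<in> M \<rightarrow>\<^sub>M borel"
    using borel_measurable_continuous_onI[OF pt] M(2) by (simp cong: measurable_cong_sets)
  have Sb: "S \<in> sets borel" using compact_imp_closed[OF S] by simp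
  have "pt' \<in> M \<rightarrow>\<^sub>M borel" unfolding pt'_def
    by (rule measurable_If[OF ptm]) (use measurable_sets_Collect[OF ptm, of "\<lambda>x. x \<in> S"] Sb in \<open>auto simp: pred_def\<close>)
  then have m: "pt' \<in> M \<rightarrow>\<^sub>M restrict_space borel S"
    by (rule measurable_restrict_space2[rotated]) (auto simp: pt'_def a)
  show ?thesis
  proof (intro exI conjI allI impI)
    show "finite_measure (distr M (restrict_space borel S) pt')" by (rule finite_measure_distr[OF m])
    show "sets (distr M (restrict_space borel S) pt') = sets (restrict_space borel S)" by simp
    fix g :: "'x \<Rightarrow> real" assume g: "continuous_on UNIV g"
    have gb: "g \<in> borel_measurable borel" by (rule borel_measurable_continuous_onI[OF g])
    have "(LINT x|distr M (restrict_space borel S) pt'. g x) = (LINT s|M. g (pt' s))"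
      by (rule integral_distr[OF m measurable_restrict_space1[OF gb]])
    also have "\<dots> = (LINT s|M. g (pt s))"
    proof (rule integral_cong_AE)
      show "(\<lambda>s. g (pt' s)) \<in> borel_measurable M" by (rule measurable_compose[OF m measurable_restrict_space1[OF gb]])
      show "(\<lambda>s. g (pt s)) \<in> borel_measurable M" by (rule measurable_compose[OF ptm gb])
      show "AE s in M. g (pt' s) = g (pt s)" using AE by eventually_elim (simp add: pt'_def)
    qed
    finally show "(LINT x|distr M (restrict_space borel S) pt'. g x) = (LINT s|M. g (pt s))" .
  qed
qed

text \<open>No state beyond \<open>N\<close> is created by the operator, so the equations involve
  only moments that are known to converge.\<close>

lemma texps_poly_liouville:
  fixes b :: "nat \<Rightarrow> real^'m::finite \<Rightarrow> real"
  assumes \<alpha>: "keys \<alpha> \<subseteq> {1..N}"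
  shows "keys (poly_liouville N lam b (single (p, \<alpha>, 0) 1)) \<subseteq> texps N"
proof -
  have add: "keys (P + Q) \<subseteq> texps N" if "keys P \<subseteq> texps N" "keys Q \<subseteq> texps N"
    for P Q :: "'m tzuexp rpoly" using keys_add[of P Q] that by blast
  have mult: "keys (P * Q) \<subseteq> texps N" if "keys P \<subseteq> texps N" "keys Q \<subseteq> texps N"
    for P Q :: "'m tzuexp rpoly" using keys_mult[of P Q] that texps_add by blast
  have sum': "keys (\<Sum>i\<in>UNIV. P i) \<subseteq> texps N" if "\<And>i. keys (P i) \<subseteq> texps N"
    for P :: "'m \<Rightarrow> 'm tzuexp rpoly"
  proof -
    have "keys (\<Sum>i\<in>K. P i) \<subseteq> texps N" for K
    proof (induction K rule: infinite_finite_induct)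
      case (insert x K)
      show ?case unfolding sum.insert[OF insert(1,2)] by (rule add[OF that insert(3)])
    qed simp_all
    then show ?thesis .
  qed
  have sum'': "keys (\<Sum>i\<in>K. P i) \<subseteq> texps N" if "\<And>i. i \<in> K \<Longrightarrow> keys (P i) \<subseteq> texps N"
    for K :: "nat set" and P :: "nat \<Rightarrow> 'm tzuexp rpoly"
    using that
  proof (induction K rule: infinite_finite_induct)
    case (insert x K)
    show ?case unfolding sum.insert[OF insert(1,2)] by (rule add[OF insert(4) insert(3)]) (use insert(4) in auto)
  qed simp_all
  have single: "keys (single \<gamma> c) \<subseteq> texps N" if "\<gamma> \<in> texps N" for \<gamma> :: "'m tzuexp" and c :: real
    using that by simp
  have sub: "keys (\<alpha> - single k 1) \<subseteq> {1..N}" for k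
  proof
    fix i assume "i \<in> keys (\<alpha> - single k 1)"
    then have "i \<in> keys \<alpha>" by (simp add: in_keys_iff lookup_minus)
    then show "i \<in> {1..N}" using \<alpha> by blast
  qed
  have dt: "poly_dt (single (p, \<alpha>, 0) 1) = single (p - 1, \<alpha>, 0 :: 'm uexp) (real p)"
    by (simp add: poly_dt_def)
  have dz: "poly_dz k (single (p, \<alpha>, 0) 1) = single (p, \<alpha> - single k 1, 0 :: 'm uexp) (real (lookup \<alpha> k))" for k
    by (simp add: poly_dz_def)
  show ?thesis
    unfolding poly_liouville_def dt dz poly_rhs_def
  proof (intro add single sum'' mult sum')
    show "(p - 1, \<alpha>, 0) \<in> texps N" using \<alpha> by (simp add: texps_def)
    show "(p, \<alpha> - single k 1, 0) \<in> texps N" for k using sub[of k] by (simp add: texps_def)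
    show "(0, single k 1, 0) \<in> texps N" if "k \<in> {1..N}" for k using that by (simp add: texps_def)
    show "(0, 0, single i 1) \<in> texps N" for i by (simp add: texps_def)
  qed
qed

lemma countable_texps: "countable (texps N :: ('m::finite) tzuexp set)"
proof -
  have "texps N \<subseteq> (\<Union>r. tzuexps N r :: 'm tzuexp set)"
  proof
    fix \<gamma> :: "'m tzuexp" assume g: "\<gamma> \<in> texps N"
    obtain p \<alpha> \<beta> where "\<gamma> = (p, \<alpha>, \<beta>)" by (cases \<gamma>)
    with g have "\<gamma> \<in> tzuexps N (p + total_deg \<alpha> + total_deg \<beta>)"
      unfolding texps_def tzuexps_def by simp
    then show "\<gamma> \<in> (\<Union>r. tzuexps N r)" by (rule UN_I[OF UNIV_I])
  qed
  moreover have "countable (\<Union>r. tzuexps N r :: 'm tzuexp set)"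
    by (rule countable_UN[OF _ countable_finite[OF finite_tzuexps]]) simp
  ultimately show ?thesis by (rule countable_subset)
qed

lemma countable_zexps_all: "countable (zexps_all N)"
proof -
  have "zexps_all N \<subseteq> (\<Union>r. zexps N r)"
  proof
    fix \<alpha> assume "\<alpha> \<in> zexps_all N"
    then have "\<alpha> \<in> zexps N (total_deg \<alpha>)" unfolding zexps_all_def zexps_def by simp
    then show "\<alpha> \<in> (\<Union>r. zexps N r)" by (rule UN_I[OF UNIV_I])
  qed
  moreover have "countable (\<Union>r. zexps N r)"
    by (rule countable_UN[OF _ countable_finite[OF finite_zexps]]) simp
  ultimately show ?thesis by (rule countable_subset)
qed

section \<open>Sequences of feasible points of all orders\<close>

locale sdp_sequence =
  fixes N :: nat and lam :: "nat \<Rightarrow> real" and b :: "nat \<Rightarrow> real^'m::finite \<Rightarrow> real" and s :: nat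
    and w :: "nat \<Rightarrow> 'm uexp rpoly" and zlo zhi zTlo zThi :: "nat \<Rightarrow> real" and T :: real and \<zeta> :: "nat \<Rightarrow> real"
    and y :: "nat \<Rightarrow> 'm tzuexp \<Rightarrow> real" and yT :: "nat \<Rightarrow> zexp \<Rightarrow> real"
  assumes feas: "\<And>r. (y r, yT r) \<in> sdp_feasible N r lam b s w zlo zhi zTlo zThi T \<zeta>"
    and T: "0 < T" and ball: "\<exists>j\<in>{1..s}. \<exists>M. w j = ball_poly M"
begin

lemmas F = feas[unfolded sdp_feasible_def mem_Collect_eq prod.case]

lemma eq: "keys \<alpha> \<subseteq> {1..N} \<Longrightarrow> p + total_deg \<alpha> \<le> r \<Longrightarrow>
    T ^ p * yT r \<alpha> - ell (y r) (poly_liouville N lam b (single (p, \<alpha>, 0) 1)) =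
    0 ^ p * (\<Prod>k=1..N. \<zeta> k ^ lookup \<alpha> k)"
  using F[of r] unfolding ell_single by blast

lemma psd:
  assumes "finite K" "K \<subseteq> texps N"
  shows "\<forall>\<^sub>F r in sequentially. \<forall>p. keys p \<subseteq> K \<longrightarrow> 0 \<le> ell (y r) (p * p)"
  using eventually_tzuexps[OF assms]
proof eventually_elim
  case (elim r)
  show ?case
  proof (intro allI impI)
    fix p :: "'m tzuexp rpoly" assume "keys p \<subseteq> K"
    then have k: "keys p \<subseteq> tzuexps N r" using elim by blast
    have "psd_on (tzuexps N r) (localizing_matrix 1 (y r))"
      using F[of r] unfolding moment_matrix_localizing by blast
    from localizing_nonneg[OF this finite_tzuexps k] show "0 \<le> ell (y r) (p * p)" by simp
  qed
qed

lemma psdT: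
  assumes "finite K" "K \<subseteq> zexps_all N"
  shows "\<forall>\<^sub>F r in sequentially. \<forall>p. keys p \<subseteq> K \<longrightarrow> 0 \<le> ell (yT r) (p * p)"
  using eventually_zexps[OF assms, of 0]
proof eventually_elim
  case (elim r)
  show ?case
  proof (intro allI impI)
    fix p :: "zexp rpoly" assume "keys p \<subseteq> K"
    then have k: "keys p \<subseteq> zexps N r" using elim by auto
    have "psd_on (zexps N r) (localizing_matrix 1 (yT r))"
      using F[of r] unfolding moment_matrix_localizing by blast
    from localizing_nonneg[OF this finite_zexps k] show "0 \<le> ell (yT r) (p * p)" by simp
  qed
qed

text \<open>The test monomial \<open>1\<close>, and below it \<open>t\<close>, fix the masses of the
  two sequences; the second needs order at least 1.\<close>

lemma yT_zero: "yT r 0 = 1"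
  using eq[of 0 0 r] by (simp add: total_deg_def poly_liouville_def poly_dt_def poly_dz_def)

lemma y_zero: "1 \<le> r \<Longrightarrow> y r 0 = T"
  using eq[of 0 1 r] by (simp add: total_deg_def poly_liouville_def poly_dt_def poly_dz_def yT_zero zero_prod_def)

text \<open>Eventual in \<open>r\<close>, because the degree of \<open>q\<close> has to fit into the
  localizing matrix. The same holds for the other constraints below.\<close>

lemma loc_t: "\<forall>\<^sub>F r in sequentially. 0 \<le> ell (marginal_t (y r)) (interval_poly 0 T (single 1 1) * (q * q))"
  using eventually_atMost[OF finite_keys[of q], of 1]
proof eventually_elim
  case (elim r)
  have e: "single 1 1 * (const_poly T - single 1 1) = interval_poly 0 T (single (1::nat) 1)"
    by (simp add: interval_poly_def const_poly_def mult.commute)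
  have "psd_on {..r - 1} (localizing_matrix (interval_poly 0 T (single 1 1)) (marginal_t (y r)))"
    unfolding e[symmetric] using F[of r] by blast
  from localizing_nonneg[OF this _ elim] show ?case by simp
qed

lemma loc_z:
  assumes i: "i \<in> {1..N}"
  shows "\<forall>\<^sub>F r in sequentially. 0 \<le> ell (marginal_z i (y r)) (interval_poly (zlo i) (zhi i) (single 1 1) * (q * q))"
  using eventually_atMost[OF finite_keys[of q], of 1]
proof eventually_elim
  case (elim r)
  have "psd_on {..r - 1} (localizing_matrix (interval_poly (zlo i) (zhi i) (single 1 1)) (marginal_z i (y r)))"
    using F[of r] i by blast
  from localizing_nonneg[OF this _ elim] show ?case by simp
qed

lemma loc_u:
  assumes j: "j \<in> {1..s}"
  shows "\<forall>\<^sub>F r in sequentially. 0 \<le> ell (marginal_u (y r)) (w j * (q * q))"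
  using eventually_uexps[OF finite_keys[of q], of "half_deg (w j)"]
proof eventually_elim
  case (elim r)
  have "psd_on (uexps (r - half_deg (w j))) (localizing_matrix (w j) (marginal_u (y r)))"
    using F[of r] j by blast
  from localizing_nonneg[OF this finite_uexps elim] show ?case .
qed

lemma loc_T:
  assumes i: "i \<in> {1..N}" and q: "keys q \<subseteq> zexps_all N"
  shows "\<forall>\<^sub>F r in sequentially. 0 \<le> ell (yT r) (interval_poly (zTlo i) (zThi i) (single (single i 1) 1) * (q * q))"
  using eventually_zexps[OF finite_keys q, of 1]
proof eventually_elim
  case (elim r)
  have "psd_on (zexps N (r - 1)) (localizing_matrix (interval_poly (zTlo i) (zThi i) (single (single i 1) 1)) (yT r))"
    using F[of r] i by blast
  from localizing_nonneg[OF this finite_zexps elim] show ?case .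
qed

definition M0 :: int where "M0 = (SOME M. \<exists>j\<in>{1..s}. w j = ball_poly M)"

lemma M0: "\<exists>j\<in>{1..s}. w j = ball_poly M0"
  unfolding M0_def by (rule someI_ex) (use ball in blast)

text \<open>One radius for all variables: it dominates \<open>\<bar>a\<bar> + \<bar>b\<bar>\<close>
  for every interval \<open>[a, b]\<close> involved, and as it is at least 1 and at least
  \<open>M0\<close>, its square dominates the constant of the ball constraint.\<close>

definition R :: real where
  "R = 1 + T + \<bar>real_of_int M0\<bar> + (\<Sum>k\<in>{1..N}. \<bar>zlo k\<bar> + \<bar>zhi k\<bar> + \<bar>zTlo k\<bar> + \<bar>zThi k\<bar>)"

lemma sum_le_R: "k \<in> {1..N} \<Longrightarrow> \<bar>zlo k\<bar> + \<bar>zhi k\<bar> + \<bar>zTlo k\<bar> + \<bar>zThi k\<bar> \<le> R"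
proof -
  assume k: "k \<in> {1..N}"
  have "\<bar>zlo k\<bar> + \<bar>zhi k\<bar> + \<bar>zTlo k\<bar> + \<bar>zThi k\<bar> \<le> (\<Sum>k\<in>{1..N}. \<bar>zlo k\<bar> + \<bar>zhi k\<bar> + \<bar>zTlo k\<bar> + \<bar>zThi k\<bar>)"
    by (rule member_le_sum[OF k]) auto
  then show ?thesis using T by (simp add: R_def)
qed

lemma R_ge: "1 \<le> R" "T \<le> R" "\<bar>real_of_int M0\<bar> \<le> R"
proof -
  have "0 \<le> (\<Sum>k\<in>{1..N}. \<bar>zlo k\<bar> + \<bar>zhi k\<bar> + \<bar>zTlo k\<bar> + \<bar>zThi k\<bar>)" by (intro sum_nonneg) auto
  then show "1 \<le> R" "T \<le> R" "\<bar>real_of_int M0\<bar> \<le> R" using T by (auto simp: R_def)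
qed

lemma squares_le: "\<bar>x\<bar> + \<bar>z\<bar> \<le> R \<Longrightarrow> x\<^sup>2 + z\<^sup>2 \<le> R\<^sup>2"
proof -
  assume a: "\<bar>x\<bar> + \<bar>z\<bar> \<le> R"
  have "x\<^sup>2 + z\<^sup>2 \<le> (\<bar>x\<bar> + \<bar>z\<bar>)\<^sup>2" by (simp add: power2_sum)
  also have "\<dots> \<le> R\<^sup>2" using a by (intro power_mono) auto
  finally show ?thesis .
qed

text \<open>For a fixed \<open>k\<close> finitely many steps are combined, each costing a factor
  \<open>R\<^sup>2\<close>, so the conjunction of the eventual statements is again eventual.\<close>

lemma growth_from_step:
  fixes Y :: "nat \<Rightarrow> 'e::comm_monoid_add \<Rightarrow> real"
  assumes zero: "\<forall>\<^sub>F r in sequentially. Y r 0 = m"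
    and step: "\<And>k. \<forall>\<^sub>F r in sequentially. Y r ((e + e) + (mscale k e + mscale k e)) \<le> R\<^sup>2 * Y r (mscale k e + mscale k e)"
  shows "\<forall>\<^sub>F r in sequentially. Y r (mscale (2 * k) e) \<le> m * R ^ (2 * k)"
proof (induction k)
  case 0
  show ?case using zero by (auto simp: mscale_simps elim: eventually_mono)
next
  case (Suc k)
  show ?case using Suc step[of k]
  proof eventually_elim
    case (elim r)
    have e: "mscale k e + mscale k e = mscale (2 * k) e" by (simp only: mult_2 mscale_add)
    have e': "(e + e) + mscale (2 * k) e = mscale (2 * Suc k) e" by (simp add: mscale_simps add.assoc)
    have "Y r (mscale (2 * Suc k) e) \<le> R\<^sup>2 * Y r (mscale (2 * k) e)" using elim(2) unfolding e e' .
    also have "\<dots> \<le> R\<^sup>2 * (m * R ^ (2 * k))" using elim(1) by (intro mult_left_mono) auto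
    finally show ?case by (simp add: power2_eq_square mult_ac)
  qed
qed

text \<open>The hypothesis \<open>loc\<close> is the localizing constraint tested with the single
  monomial \<open>g\<close>; a square built from \<open>e + g\<close> and \<open>g\<close> removes
  its linear term, and \<open>R\<close> absorbs the endpoints.\<close>

lemma interval_step:
  fixes Y :: "nat \<Rightarrow> 'e::comm_monoid_add \<Rightarrow> real"
  assumes psd: "\<forall>\<^sub>F r in sequentially. \<forall>p. keys p \<subseteq> {e + g, g} \<longrightarrow> 0 \<le> ell (Y r) (p * p)"
    and loc: "\<forall>\<^sub>F r in sequentially. 0 \<le> (l + h) * Y r (e + (g + g)) - Y r ((e + e) + (g + g)) - l * h * Y r (g + g)"
    and lh: "\<bar>l\<bar> + \<bar>h\<bar> \<le> R"
  shows "\<forall>\<^sub>F r in sequentially. Y r ((e + e) + (g + g)) \<le> R\<^sup>2 * Y r (g + g)"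
  using psd loc
proof eventually_elim
  case (elim r)
  have P: "0 \<le> ell (Y r) (p * p)" if "keys p \<subseteq> {e + g, g}" for p using elim(1) that by blast
  have "Y r ((e + e) + (g + g)) \<le> (l\<^sup>2 + h\<^sup>2) * Y r (g + g)" by (rule interval_growth[OF P elim(2)])
  also have "\<dots> \<le> R\<^sup>2 * Y r (g + g)"
    using squares_le[OF lh] P[of "single g 1"] by (intro mult_right_mono) (simp_all add: mult_single)
  finally show ?case .
qed

lemma ell_interval_square:
  fixes e :: "'e::comm_monoid_add"
  shows "ell f (interval_poly a c (single e 1) * (single g 1 * single g 1)) =
    (a + c) * f (e + (g + g)) - f ((e + e) + (g + g)) - a * c * f (g + g)"
proof -
  have "ell f (interval_poly a c (single e 1) * single (g + g) 1) = ell (\<lambda>\<gamma>. f (\<gamma> + (g + g))) (interval_poly a c (single e 1))"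
    by (subst mult.commute) (simp add: ell_mono_times add.commute)
  then show ?thesis by (simp add: mult_single ell_interval_expand)
qed

text \<open>Time and states use their interval constraints. For a control the ball constraint bounds
  the sum over all controls of second moments, in which the required one is a summand and the others
  are nonnegative.\<close>

lemma growth:
  assumes i: "i \<in> vars N"
  shows "\<forall>\<^sub>F r in sequentially. y r (mscale (2 * k) (var i)) \<le> T * R ^ (2 * k)"
proof (rule growth_from_step)
  show "\<forall>\<^sub>F r in sequentially. y r 0 = T" using eventually_ge_at_top[of 1] by eventually_elim (rule y_zero)
  fix k
  let ?e = "var i" and ?g = "mscale k (var i)"
  have e: "?e \<in> texps N"
    using i by (cases i) (auto simp: vars_def var_def texps_def)
  have "mscale k ?e \<in> texps N" for k
    using e by (induction k) (auto simp: mscale_simps texps_add, simp add: texps_def)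
  then have g: "?g \<in> texps N" .
  have psd2: "\<forall>\<^sub>F r in sequentially. \<forall>p. keys p \<subseteq> {?e + ?g, ?g} \<longrightarrow> 0 \<le> ell (y r) (p * p)"
    by (rule psd) (use e g in \<open>auto simp: texps_add\<close>)
  consider "i = Inl 0" | l where "i = Inl l" "l \<in> {1..N}" | j where "i = Inr j"
    using i by (fastforce simp: vars_def)
  then show "\<forall>\<^sub>F r in sequentially. y r ((?e + ?e) + (?g + ?g)) \<le> R\<^sup>2 * y r (?g + ?g)"
  proof cases
    case 1
    have v: "?e = (1, 0, 0)" "?g = (k, 0, 0)" by (simp_all add: 1 var_def mscale_Pair mscale_zero mscale_nat[simplified])
    note v = v(1) v(2)[unfolded v(1) One_nat_def]
    show ?thesis
    proof (rule interval_step[OF psd2])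
      show "\<bar>0\<bar> + \<bar>T\<bar> \<le> R" using R_ge T by simp
      show "\<forall>\<^sub>F r in sequentially. 0 \<le> (0 + T) * y r (?e + (?g + ?g)) - y r ((?e + ?e) + (?g + ?g)) - 0 * T * y r (?g + ?g)"
        using loc_t[of "single k 1"]
      proof eventually_elim
        case (elim r)
        then show ?case unfolding ell_interval_square by (simp add: v marginal_t_def)
      qed
    qed
  next
    case 2
    have v: "?e = (0, single l 1, 0)" "?g = (0, single l k, 0)"
      using 2 by (simp_all add: var_def mscale_Pair mscale_zero mscale_single[simplified])
    note v = v(1) v(2)[unfolded v(1) One_nat_def]
    show ?thesis
    proof (rule interval_step[OF psd2])
      show "\<bar>zlo l\<bar> + \<bar>zhi l\<bar> \<le> R" using sum_le_R[OF 2(2)] by simp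
      show "\<forall>\<^sub>F r in sequentially. 0 \<le> (zlo l + zhi l) * y r (?e + (?g + ?g)) - y r ((?e + ?e) + (?g + ?g)) - zlo l * zhi l * y r (?g + ?g)"
        using loc_z[OF 2(2), of "single k 1"]
      proof eventually_elim
        case (elim r)
        then show ?case unfolding ell_interval_square by (simp add: v marginal_z_def single_add[symmetric])
      qed
    qed
  next
    case 3
    have v: "?e = (0, 0, single j 1)" "?g = (0, 0, single j k)"
      using 3 by (simp_all add: var_def mscale_Pair mscale_zero mscale_single[simplified])
    note v = v(1) v(2)[unfolded v(1) One_nat_def]
    obtain j0 where j0: "j0 \<in> {1..s}" "w j0 = ball_poly M0" using M0 by blast
    let ?q = "single (single j k) 1"
    \<comment> \<open>The exponent of the product of control \<open>i\<close> with the
      \<open>k\<close>-th power of control \<open>j\<close>; the moments at the doubled exponents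
      are diagonal entries, hence eventually nonnegative.\<close>
    define sq where "sq i = (0 :: nat, 0 :: zexp, single i 1 + single j k)" for i :: 'm
    have psd3: "\<forall>\<^sub>F r in sequentially. \<forall>p. keys p \<subseteq> range sq \<union> {?g} \<longrightarrow> 0 \<le> ell (y r) (p * p)"
      by (rule psd) (auto simp: sq_def texps_def v)
    show ?thesis
      using loc_u[OF j0(1), of ?q] psd3
    proof eventually_elim
      case (elim r)
      have P: "0 \<le> y r (sq i + sq i)" for i
        using elim(2)[rule_format, of "single (sq i) 1"] by (simp add: mult_single)
      have P0: "0 \<le> y r (?g + ?g)"
        using elim(2)[rule_format, of "single ?g 1"] by (simp add: mult_single)
      have dbl: "single i 2 = single i 1 + single i (1::nat)" for i :: 'm
        by (simp add: single_add[symmetric] numeral_2_eq_2)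
      have sqd: "(0, 0, single i 2 + (single j k + single j k)) = sq i + sq i" for i
        unfolding dbl by (simp add: sq_def add_ac)
      have "?q * ?q = single (single j k + single j k) (1::real)" by (simp add: mult_single)
      then have "ell (marginal_u (y r)) (w j0 * (?q * ?q)) = ell (\<lambda>\<gamma>. marginal_u (y r) (\<gamma> + (single j k + single j k))) (ball_poly M0)"
        by (subst mult.commute) (simp add: ell_mono_times add.commute j0)
      also have "\<dots> = real_of_int M0 * y r (?g + ?g) - (\<Sum>i\<in>UNIV. y r (sq i + sq i))"
        by (simp only: ball_poly_def const_poly_def ell_diff ell_sum ell_single mult_1 marginal_u_def v sqd add_0)
          (simp add: zero_prod_def v)
      finally have "(\<Sum>i\<in>UNIV. y r (sq i + sq i)) \<le> real_of_int M0 * y r (?g + ?g)" using elim(1) by simp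
      moreover have "y r (sq j + sq j) \<le> (\<Sum>i\<in>UNIV. y r (sq i + sq i))" by (rule member_le_sum) (auto simp: P)
      moreover have "sq j + sq j = (?e + ?e) + (?g + ?g)" by (simp add: sq_def v add_ac)
      moreover have "real_of_int M0 * y r (?g + ?g) \<le> R\<^sup>2 * y r (?g + ?g)"
      proof (rule mult_right_mono[OF _ P0])
        have "real_of_int M0 \<le> R" using R_ge(3) by linarith
        also have "R \<le> R\<^sup>2" using R_ge(1) by (simp add: power2_eq_square)
        finally show "real_of_int M0 \<le> R\<^sup>2" .
      qed
      ultimately show ?case by simp
    qed
  qed
qed

lemma growthT:
  assumes i: "i \<in> {1..N}"
  shows "\<forall>\<^sub>F r in sequentially. yT r (mscale (2 * k) (single i 1)) \<le> 1 * R ^ (2 * k)"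
proof (rule growth_from_step)
  show "\<forall>\<^sub>F r in sequentially. yT r 0 = 1" by (simp add: yT_zero)
  fix k
  let ?e = "single i (1::nat)"
  let ?g = "mscale k ?e"
  have e: "?e \<in> zexps_all N" using i by (simp add: zexps_all_def)
  have "mscale k ?e \<in> zexps_all N" for k
    using e by (induction k) (auto simp: mscale_simps zexps_all_add, simp add: zexps_all_def)
  then have g: "?g \<in> zexps_all N" .
  have psd2: "\<forall>\<^sub>F r in sequentially. \<forall>p. keys p \<subseteq> {?e + ?g, ?g} \<longrightarrow> 0 \<le> ell (yT r) (p * p)"
    by (rule psdT) (use e g in \<open>auto simp only: zexps_all_add finite_insert finite.emptyI\<close>)
  show "\<forall>\<^sub>F r in sequentially. yT r ((?e + ?e) + (?g + ?g)) \<le> R\<^sup>2 * yT r (?g + ?g)"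
  proof (rule interval_step[OF psd2])
    show "\<bar>zTlo i\<bar> + \<bar>zThi i\<bar> \<le> R" using sum_le_R[OF i] by simp
    show "\<forall>\<^sub>F r in sequentially. 0 \<le> (zTlo i + zThi i) * yT r (?e + (?g + ?g)) - yT r ((?e + ?e) + (?g + ?g)) - zTlo i * zThi i * yT r (?g + ?g)"
      using loc_T[OF i, of "single ?g 1"] g unfolding ell_interval_square by simp
  qed
qed

end

lemma keys_interval_poly:
  assumes "\<And>\<beta> \<gamma>. \<beta> \<in> E \<Longrightarrow> \<gamma> \<in> E \<Longrightarrow> \<beta> + \<gamma> \<in> E" "0 \<in> E" "keys x \<subseteq> E"
  shows "keys (interval_poly a b x) \<subseteq> E"
  unfolding interval_poly_def const_poly_def
  by (rule keys_mult_subset[OF assms(1)], assumption, assumption; rule keys_diff_subset) (use assms in auto)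

lemma in_interval_iff: "a \<le> b \<Longrightarrow> 0 \<le> (b - x) * (x - a) \<Longrightarrow> x \<in> {a..b}" for a b x :: real
  by (auto simp: zero_le_mult_iff)

context sdp_sequence
begin

lemma y_bounded: "\<gamma> \<in> texps N \<Longrightarrow> \<exists>B. \<forall>\<^sub>F r in sequentially. \<bar>y r \<gamma>\<bar> \<le> B"
  unfolding combos_var[symmetric]
  by (rule eventually_bounded_moments[OF finite_vars, where m = T and K = T and R = R])
     (auto simp: combos_var intro: psd growth eventually_mono[OF eventually_ge_at_top[of 1]] y_zero)

lemma yT_bounded:
  assumes "\<gamma> \<in> zexps_all N"
  shows "\<exists>B. \<forall>\<^sub>F r in sequentially. \<bar>yT r \<gamma>\<bar> \<le> B"
proof (rule eventually_bounded_moments[OF finite_atLeastAtMost])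
  show "\<forall>\<^sub>F r in sequentially. \<forall>p. keys p \<subseteq> F \<longrightarrow> 0 \<le> ell (yT r) (p * p)"
    if "finite F" "F \<subseteq> combos (\<lambda>k. single k (1::nat)) {1..N}" for F
    using psdT that unfolding combos_zvar by blast
  show "\<forall>\<^sub>F r in sequentially. yT r 0 = 1" by (simp add: yT_zero)
  show "\<gamma> \<in> combos (\<lambda>k. single k (1::nat)) {1..N}" using assms unfolding combos_zvar .
qed (rule growthT)

text \<open>What survives the limit: all constraints without restriction on the order, the growth of
  even moments, and a bound \<open>c\<close> on the objective.\<close>

definition limit_pair :: "(nat \<times> 'm uexp) rpoly \<Rightarrow> real \<Rightarrow> ('m tzuexp \<Rightarrow> real) \<Rightarrow> (zexp \<Rightarrow> real) \<Rightarrow> bool" where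
  "limit_pair h c y' yT' \<longleftrightarrow> (\<forall>p. keys p \<subseteq> texps N \<longrightarrow> 0 \<le> ell y' (p * p)) \<and>
    (\<forall>p. keys p \<subseteq> zexps_all N \<longrightarrow> 0 \<le> ell yT' (p * p)) \<and>
    y' 0 = T \<and> yT' 0 = 1 \<and>
    (\<forall>i\<in>vars N. \<forall>k. y' (mscale (2 * k) (var i)) \<le> T * R ^ (2 * k)) \<and>
    (\<forall>i\<in>{1..N}. \<forall>k. yT' (mscale (2 * k) (single i 1)) \<le> 1 * R ^ (2 * k)) \<and>
    (\<forall>q. 0 \<le> ell (marginal_t y') (interval_poly 0 T (single 1 1) * (q * q))) \<and>
    (\<forall>i\<in>{1..N}. \<forall>q. 0 \<le> ell (marginal_z i y') (interval_poly (zlo i) (zhi i) (single 1 1) * (q * q))) \<and>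
    (\<forall>j\<in>{1..s}. \<forall>q. 0 \<le> ell (marginal_u y') (w j * (q * q))) \<and>
    (\<forall>i\<in>{1..N}. \<forall>q. keys q \<subseteq> zexps_all N \<longrightarrow>
      0 \<le> ell yT' (interval_poly (zTlo i) (zThi i) (single (single i 1) 1) * (q * q))) \<and>
    (\<forall>p \<alpha>. keys \<alpha> \<subseteq> {1..N} \<longrightarrow>
      T ^ p * yT' \<alpha> - ell y' (poly_liouville N lam b (single (p, \<alpha>, 0) 1)) =
      0 ^ p * (\<Prod>k=1..N. \<zeta> k ^ lookup \<alpha> k)) \<and>
    ell (\<lambda>(p, \<beta>). y' (p, 0, \<beta>)) h \<le> c"

lemma limit_moments:
  assumes obj: "\<And>r. ell (\<lambda>(p, \<beta>). y r (p, 0, \<beta>)) h \<le> c"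
  shows "\<exists>y' yT'. limit_pair h c y' yT'"
proof -
  \<comment> \<open>Both sequences are indexed by one countable set, so a single subsequence serves
    them together.\<close>
  define E where "E = (Inl ` texps N \<union> Inr ` zexps_all N :: ('m tzuexp + zexp) set)"
  have "countable E" by (simp add: E_def countable_texps countable_zexps_all)
  moreover have "\<exists>B. \<forall>\<^sub>F r in sequentially. \<bar>case_sum (y r) (yT r) \<gamma>\<bar> \<le> B" if "\<gamma> \<in> E" for \<gamma>
    using that y_bounded yT_bounded by (auto simp: E_def)
  ultimately obtain \<sigma> f where \<sigma>: "strict_mono (\<sigma> :: nat \<Rightarrow> nat)"
    and f: "\<And>\<gamma>. \<gamma> \<in> E \<Longrightarrow> (\<lambda>r. case_sum (y (\<sigma> r)) (yT (\<sigma> r)) \<gamma>) \<longlonglongrightarrow> f \<gamma>"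
    by (rule convergent_moment_subsequence[of E "\<lambda>r. case_sum (y r) (yT r)"]) auto
  define y' where "y' \<gamma> = f (Inl \<gamma>)" for \<gamma>
  define yT' where "yT' \<gamma> = f (Inr \<gamma>)" for \<gamma>
  have Y: "(\<lambda>r. y (\<sigma> r) \<gamma>) \<longlonglongrightarrow> y' \<gamma>" if "\<gamma> \<in> texps N" for \<gamma>
    using f[of "Inl \<gamma>"] that by (simp add: E_def y'_def)
  have YT: "(\<lambda>r. yT (\<sigma> r) \<gamma>) \<longlonglongrightarrow> yT' \<gamma>" if "\<gamma> \<in> zexps_all N" for \<gamma>
    using f[of "Inr \<gamma>"] that by (simp add: E_def yT'_def)
  have ev: "\<forall>\<^sub>F r in sequentially. P (\<sigma> r)" if "\<forall>\<^sub>F r in sequentially. P r" for P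
    using filterlim_subseq[OF \<sigma>] that by (auto simp: filterlim_iff)
  have low: "0 \<le> x" if "a \<longlonglongrightarrow> x" "\<forall>\<^sub>F r in sequentially. 0 \<le> a r" for a and x :: real
    by (rule tendsto_lowerbound[OF that]) simp
  have up: "x \<le> d" if "a \<longlonglongrightarrow> x" "\<forall>\<^sub>F r in sequentially. a r \<le> d" for a and x d :: real
    by (rule tendsto_upperbound[OF that]) simp
  have t0: "(0 :: 'm tzuexp) \<in> texps N" by (simp add: texps_def)
  have z0: "0 \<in> zexps_all N" by (simp add: zexps_all_def)
  have tadd: "\<beta> + \<gamma> \<in> texps N" if "\<beta> \<in> texps N" "\<gamma> \<in> texps N" for \<beta> \<gamma> :: "'m tzuexp" using that by (simp add: texps_add)
  have zadd: "\<beta> + \<gamma> \<in> zexps_all N" if "\<beta> \<in> zexps_all N" "\<gamma> \<in> zexps_all N" for \<beta> \<gamma> using that by (simp add: zexps_all_add)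
  have 1: "0 \<le> ell y' (p * p)" if p: "keys p \<subseteq> texps N" for p
  proof (rule low)
    show "(\<lambda>r. ell (y (\<sigma> r)) (p * p)) \<longlonglongrightarrow> ell y' (p * p)"
      by (rule ell_tendsto, rule Y, erule subsetD[OF keys_mult_subset[OF tadd p p], rotated -1])
    show "\<forall>\<^sub>F r in sequentially. 0 \<le> ell (y (\<sigma> r)) (p * p)"
      by (rule ev[OF eventually_mono[OF psd[OF finite_keys p]]]) simp
  qed
  have 2: "0 \<le> ell yT' (p * p)" if p: "keys p \<subseteq> zexps_all N" for p
  proof (rule low)
    show "(\<lambda>r. ell (yT (\<sigma> r)) (p * p)) \<longlonglongrightarrow> ell yT' (p * p)"
      by (rule ell_tendsto, rule YT, erule subsetD[OF keys_mult_subset[OF zadd p p], rotated -1])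
    show "\<forall>\<^sub>F r in sequentially. 0 \<le> ell (yT (\<sigma> r)) (p * p)"
      by (rule ev[OF eventually_mono[OF psdT[OF finite_keys p]]]) simp
  qed
  have 3: "y' 0 = T"
  proof (rule LIMSEQ_unique[OF Y[OF t0]])
    show "(\<lambda>r. y (\<sigma> r) 0) \<longlonglongrightarrow> T"
      by (rule tendsto_eventually, rule ev, rule eventually_mono[OF eventually_ge_at_top[of 1]], rule y_zero)
  qed
  have 4: "yT' 0 = 1" using LIMSEQ_unique[OF YT[OF z0]] by (simp add: yT_zero)
  have 5: "y' (mscale (2 * k) (var i)) \<le> T * R ^ (2 * k)" if "i \<in> vars N" for i k
  proof (rule up[OF Y ev[OF growth[OF that]]])
    have "var i \<in> (texps N :: 'm tzuexp set)" using that by (cases i) (auto simp: vars_def var_def texps_def)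
    then have "mscale n (var i) \<in> (texps N :: 'm tzuexp set)" for n
      by (induction n) (auto simp: mscale_simps texps_add t0)
    then show "mscale (2 * k) (var i) \<in> (texps N :: 'm tzuexp set)" .
  qed
  have 6: "yT' (mscale (2 * k) (single i 1)) \<le> 1 * R ^ (2 * k)" if "i \<in> {1..N}" for i k
    by (rule up[OF YT ev[OF growthT[OF that]]]) (use that in \<open>simp only: mscale_single, simp add: zexps_all_def\<close>)
  have 7: "0 \<le> ell (marginal_t y') (interval_poly 0 T (single 1 1) * (q * q))" for q
    by (rule low[OF ell_tendsto ev[OF loc_t]]) (simp add: marginal_t_def Y texps_def)
  have 8: "0 \<le> ell (marginal_z i y') (interval_poly (zlo i) (zhi i) (single 1 1) * (q * q))" if "i \<in> {1..N}" for i q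
    by (rule low[OF ell_tendsto ev[OF loc_z[OF that]]]) (unfold marginal_z_def, rule Y, use that in \<open>auto simp: texps_def\<close>)
  have 9: "0 \<le> ell (marginal_u y') (w j * (q * q))" if "j \<in> {1..s}" for j q
    by (rule low[OF ell_tendsto ev[OF loc_u[OF that]]]) (simp add: marginal_u_def Y texps_def)
  have 10: "0 \<le> ell yT' (interval_poly (zTlo i) (zThi i) (single (single i 1) 1) * (q * q))"
    if i: "i \<in> {1..N}" and q: "keys q \<subseteq> zexps_all N" for i q
  proof (rule low[OF ell_tendsto ev[OF loc_T[OF i q]]])
    have "keys (single (single i (1::nat)) (1::real)) \<subseteq> zexps_all N"
      using i by (simp add: zexps_all_def)
    from keys_mult_subset[OF zadd keys_interval_poly[OF zadd z0 this] keys_mult_subset[OF zadd q q]]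
    show "(\<lambda>r. yT (\<sigma> r) \<gamma>) \<longlonglongrightarrow> yT' \<gamma>" if "\<gamma> \<in> keys (interval_poly (zTlo i) (zThi i) (single (single i 1) 1) * (q * q))" for \<gamma>
      by (intro YT) (use that in blast)
  qed
  have 11: "T ^ p * yT' \<alpha> - ell y' (poly_liouville N lam b (single (p, \<alpha>, 0) 1)) =
      0 ^ p * (\<Prod>k=1..N. \<zeta> k ^ lookup \<alpha> k)" if \<alpha>: "keys \<alpha> \<subseteq> {1..N}" for p \<alpha>
  proof (rule LIMSEQ_unique)
    have "\<alpha> \<in> zexps_all N" using \<alpha> by (simp add: zexps_all_def)
    then show "(\<lambda>r. T ^ p * yT (\<sigma> r) \<alpha> - ell (y (\<sigma> r)) (poly_liouville N lam b (single (p, \<alpha>, 0) 1)))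
      \<longlonglongrightarrow> T ^ p * yT' \<alpha> - ell y' (poly_liouville N lam b (single (p, \<alpha>, 0) 1))"
      using texps_poly_liouville[OF \<alpha>, of lam b p] by (intro tendsto_intros YT ell_tendsto Y) auto
    show "(\<lambda>r. T ^ p * yT (\<sigma> r) \<alpha> - ell (y (\<sigma> r)) (poly_liouville N lam b (single (p, \<alpha>, 0) 1)))
      \<longlonglongrightarrow> 0 ^ p * (\<Prod>k=1..N. \<zeta> k ^ lookup \<alpha> k)"
      by (rule tendsto_eventually, rule ev, rule eventually_mono[OF eventually_ge_at_top[of "p + total_deg \<alpha>"]], rule eq[OF \<alpha>])
  qed
  have 12: "ell (\<lambda>(p, \<beta>). y' (p, 0, \<beta>)) h \<le> c"
  proof (rule up)
    show "(\<lambda>r. ell (\<lambda>(p, \<beta>). y (\<sigma> r) (p, 0, \<beta>)) h) \<longlonglongrightarrow> ell (\<lambda>(p, \<beta>). y' (p, 0, \<beta>)) h"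
      by (rule ell_tendsto) (auto intro!: Y simp: texps_def split: prod.split)
    show "\<forall>\<^sub>F r in sequentially. ell (\<lambda>(p, \<beta>). y (\<sigma> r) (p, 0, \<beta>)) h \<le> c" using obj by simp
  qed
  show ?thesis
    by (rule exI[of _ y'], rule exI[of _ yT'], unfold limit_pair_def) (intro conjI allI ballI impI 1 2 3 4 5 6 7 8 9 10 11 12; assumption)
qed

text \<open>The limit sequences are represented on the line by continuous coordinate functions.
  Every marginal constraint confines its own coordinates almost surely, and since the state set is a
  product, these finitely many facts place the joint point in it.\<close>

lemma limit_in_lp:
  assumes obj: "\<And>r. ell (\<lambda>(p, \<beta>). y r (p, 0, \<beta>)) h \<le> c"
    and b: "\<And>k. linear (b k)" and U: "compact U" "U = basic_semialgebraic s w"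
    and Z: "\<And>k. k \<in> {1..N} \<Longrightarrow> zlo k \<le> zhi k \<and> Z k = {zlo k..zhi k}"
    and ZT: "\<And>k. k \<in> {1..N} \<Longrightarrow> zTlo k \<le> zThi k \<and> ZT k = {zTlo k..zThi k}"
  shows "\<exists>(\<mu>, \<nu>)\<in>lp_feasible N lam b U Z ZT T \<zeta>. (LINT (t, z, u)|\<mu>. eval_tu h t u) \<le> c"
proof -
  from limit_moments[of h c, OF obj] obtain y' yT' where "limit_pair h c y' yT'" by blast
  note L = this[unfolded limit_pair_def]
  have psd: "\<And>p. keys p \<subseteq> texps N \<Longrightarrow> 0 \<le> ell y' (p * p)"
    and psdT: "\<And>p. keys p \<subseteq> zexps_all N \<Longrightarrow> 0 \<le> ell yT' (p * p)"
    and y0: "y' 0 = T" "yT' 0 = 1"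
    and growth: "\<And>i k. i \<in> vars N \<Longrightarrow> y' (mscale (2 * k) (var i)) \<le> T * R ^ (2 * k)"
    and growthT: "\<And>i k. i \<in> {1..N} \<Longrightarrow> yT' (mscale (2 * k) (single i 1)) \<le> 1 * R ^ (2 * k)"
    and loc_t: "\<And>q. 0 \<le> ell (marginal_t y') (interval_poly 0 T (single 1 1) * (q * q))"
    and loc_z: "\<And>i q. i \<in> {1..N} \<Longrightarrow> 0 \<le> ell (marginal_z i y') (interval_poly (zlo i) (zhi i) (single 1 1) * (q * q))"
    and loc_u: "\<And>j q. j \<in> {1..s} \<Longrightarrow> 0 \<le> ell (marginal_u y') (w j * (q * q))"
    and loc_T: "\<And>i q. i \<in> {1..N} \<Longrightarrow> keys q \<subseteq> zexps_all N \<Longrightarrow>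
      0 \<le> ell yT' (interval_poly (zTlo i) (zThi i) (single (single i 1) 1) * (q * q))"
    and eq: "\<And>p \<alpha>. keys \<alpha> \<subseteq> {1..N} \<Longrightarrow>
      T ^ p * yT' \<alpha> - ell y' (poly_liouville N lam b (single (p, \<alpha>, 0) 1)) =
      0 ^ p * (\<Prod>k=1..N. \<zeta> k ^ lookup \<alpha> k)"
    and obj': "ell (\<lambda>(p, \<beta>). y' (p, 0, \<beta>)) h \<le> c"
    using L by blast+
  have R0: "0 < R" using R_ge(1) by linarith
  have "\<exists>\<rho> X. real_distribution \<rho> \<and> (\<forall>i. continuous_on UNIV (X i)) \<and> (\<forall>i s. \<bar>X i s\<bar> \<le> R) \<and>
    (\<forall>a. y' (\<Sum>i\<in>vars N. mscale (a i) (var i)) = T * (LINT s|\<rho>. (\<Prod>i\<in>vars N. X i s ^ a i)))"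
    by (rule moment_representation[OF finite_vars _ _ growth R0 y0(1) T]) (auto simp: combos_var texps_add psd)
  then obtain \<rho> X where \<rho>: "real_distribution \<rho>" and X: "\<And>i. continuous_on UNIV (X i)" "\<And>i s. \<bar>X i s\<bar> \<le> R"
    and rep: "\<And>a. y' (\<Sum>i\<in>vars N. mscale (a i) (var i)) = T * (LINT s|\<rho>. (\<Prod>i\<in>vars N. X i s ^ a i))" by blast
  have "\<exists>\<rho> X. real_distribution \<rho> \<and> (\<forall>i. continuous_on UNIV (X i)) \<and> (\<forall>i s. \<bar>X i s\<bar> \<le> R) \<and>
    (\<forall>a. yT' (\<Sum>i\<in>{1..N}. mscale (a i) (single i 1)) = 1 * (LINT s|\<rho>. (\<Prod>i\<in>{1..N}. X i s ^ a i)))"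
    by (rule moment_representation[OF finite_atLeastAtMost _ _ growthT R0 y0(2)]) (auto simp only: combos_zvar zexps_all_add psdT zero_less_one)
  then obtain \<rho>T XT where \<rho>T: "real_distribution \<rho>T" and XT: "\<And>i. continuous_on UNIV (XT i)" "\<And>i s. \<bar>XT i s\<bar> \<le> R"
    and repT: "\<And>a. yT' (\<Sum>i\<in>{1..N}. mscale (a i) (single i 1)) = 1 * (LINT s|\<rho>T. (\<Prod>i\<in>{1..N}. XT i s ^ a i))" by blast
  interpret \<rho>: real_distribution \<rho> by (rule \<rho>)
  interpret \<rho>T: real_distribution \<rho>T by (rule \<rho>T)
  have pow: "\<bar>x ^ n\<bar> \<le> R ^ n" if "\<bar>x\<bar> \<le> R" for x n unfolding power_abs using that by (intro power_mono) auto
  have prodb: "\<bar>\<Prod>i\<in>I. f i ^ a i\<bar> \<le> (\<Prod>i\<in>I. R ^ a i)" if "\<And>i. \<bar>f i\<bar> \<le> R" for f :: "'i \<Rightarrow> real" and a I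
    unfolding abs_prod using that pow by (intro prod_mono) auto
  \<comment> \<open>The representing law is a probability; here the mass \<open>y' 0 = T\<close> is
    restored.\<close>
  define M where "M = density \<rho> (\<lambda>_. ennreal T)"
  have sM: "sets M = sets borel" "space M = UNIV" by (simp_all add: M_def)
  have M: "finite_measure M" "emeasure M (space M) \<noteq> 0"
  proof -
    have "emeasure M (space M) = ennreal T" using \<rho>.emeasure_space_1 by (simp add: M_def emeasure_density_const del: \<rho>.emeasure_space_1)
    then show "finite_measure M" "emeasure M (space M) \<noteq> 0" using T by (auto intro: finite_measureI)
  qed
  have bm: "f \<in> borel_measurable M" "f \<in> borel_measurable \<rho>" "f \<in> borel_measurable \<rho>T" if "continuous_on UNIV f" for f :: "real \<Rightarrow> real"
    using borel_measurable_continuous_onI[OF that] sM by (simp_all cong: measurable_cong_sets)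
  have iM: "(LINT s|M. f s) = T * (LINT s|\<rho>. f s)" if "continuous_on UNIV f" for f :: "real \<Rightarrow> real"
    unfolding M_def using T bm(2)[OF that] by (subst integral_density) auto
  define pt where "pt s = (X (Inl 0) s, (\<lambda>k\<in>{1..N}. X (Inl k) s), (\<chi> j. X (Inr j) s))" for s
  define ptT where "ptT s = (\<lambda>k\<in>{1..N}. XT k s)" for s
  have zc: "continuous_on UNIV (\<lambda>s. \<lambda>k\<in>{1..N}. f k s)" if "\<And>k. continuous_on UNIV (f k)" for f :: "nat \<Rightarrow> real \<Rightarrow> real"
  proof (rule continuous_on_coordinatewise_then_product)
    show "continuous_on UNIV (\<lambda>s. (\<lambda>k\<in>{1..N}. f k s) i)" for i
      by (cases "i \<in> {1..N}") (simp_all only: restrict_apply if_True if_False that continuous_on_const)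
  qed
  have ptc: "continuous_on UNIV pt" unfolding pt_def
    by (intro continuous_on_Pair zc continuous_on_vec_lambda X)
  have ptTc: "continuous_on UNIV ptT" unfolding ptT_def by (rule zc[OF XT(1)])
  have ev_pt: "ev N (pt s) \<gamma> = (\<Prod>i\<in>vars N. X i s ^ powers \<gamma> i)" for s \<gamma>
  proof -
    obtain p \<alpha> \<beta> where g: "\<gamma> = (p, \<alpha>, \<beta>)" by (cases \<gamma>)
    have "evz N (\<lambda>k\<in>{1..N}. X (Inl k) s) \<alpha> = (\<Prod>k\<in>{1..N}. X (Inl k) s ^ powers \<gamma> (Inl k))"
      unfolding evz_def by (rule prod.cong) (auto simp: powers_def g)
    then show ?thesis unfolding prod_vars by (simp add: pt_def ev_def g powers_def eval_mon_def)
  qed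
  have cev: "continuous_on UNIV (\<lambda>s. ev N (pt s) \<gamma>)" for \<gamma>
    by (rule continuous_on_compose2[OF ev_continuous ptc]) simp
  have Y: "y' \<gamma> = (LINT s|M. ev N (pt s) \<gamma>)" if "\<gamma> \<in> texps N" for \<gamma>
  proof -
    have "y' \<gamma> = y' (\<Sum>i\<in>vars N. mscale (powers \<gamma> i) (var i))" by (rule arg_cong[OF texps_combo[OF that]])
    also have "\<dots> = T * (LINT s|\<rho>. ev N (pt s) \<gamma>)" unfolding rep ev_pt ..
    finally show ?thesis unfolding iM[OF cev] .
  qed
  have evb: "\<bar>ev N (pt s) \<gamma>\<bar> \<le> (\<Prod>i\<in>vars N. R ^ powers \<gamma> i)" for s \<gamma>
    unfolding ev_pt by (rule prodb[OF X(2)])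
  have evz_ptT: "evz N (ptT s) \<alpha> = (\<Prod>k\<in>{1..N}. XT k s ^ lookup \<alpha> k)" for s \<alpha>
    unfolding evz_def ptT_def by (rule prod.cong) auto
  have cevz: "continuous_on UNIV (\<lambda>s. evz N (ptT s) \<alpha>)" for \<alpha>
    by (rule continuous_on_compose2[OF evz_continuous ptTc]) simp
  have YT: "yT' \<alpha> = (LINT s|\<rho>T. evz N (ptT s) \<alpha>)" if "\<alpha> \<in> zexps_all N" for \<alpha>
    unfolding evz_ptT using repT[of "lookup \<alpha>", unfolded zexps_all_combo[OF that, symmetric]]
    by (simp only: mult_1)
  have evzb: "\<bar>evz N (ptT s) \<alpha>\<bar> \<le> (\<Prod>k\<in>{1..N}. R ^ lookup \<alpha> k)" for s \<alpha>
    unfolding evz_ptT by (rule prodb[OF XT(2)])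
  \<comment> \<open>A marginal only involves powers of its own variable, so all exponents are
    admissible and \<open>E\<close> is everything.\<close>
  have st: "AE s in M. X (Inl 0) s \<in> {0..T}"
  proof -
    have "AE s in M. 0 \<le> ell (\<lambda>p. X (Inl 0) s ^ p) (interval_poly 0 T (single 1 1))"
    proof (rule support_from_localizing[OF M(1), where E = UNIV and Y = "marginal_t y'"])
      show "marginal_t y' p = (LINT s|M. X (Inl 0) s ^ p)" for p
        unfolding marginal_t_def by (subst Y) (auto simp: texps_def ev_def pt_def)
    qed (auto simp: power_add X intro!: pow bm continuous_intros loc_t[simplified])
    then show ?thesis
      by eventually_elim (rule in_interval_iff, use T in \<open>auto simp: ell_interval_poly power_add\<close>)
  qed
  have sz: "AE s in M. X (Inl i) s \<in> {zlo i..zhi i}" if i: "i \<in> {1..N}" for i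
  proof -
    have "AE s in M. 0 \<le> ell (\<lambda>p. X (Inl i) s ^ p) (interval_poly (zlo i) (zhi i) (single 1 1))"
    proof (rule support_from_localizing[OF M(1), where E = UNIV and Y = "marginal_z i y'"])
      show "marginal_z i y' p = (LINT s|M. X (Inl i) s ^ p)" for p
      proof -
        have "(0, single i p, 0) \<in> (texps N :: 'm tzuexp set)" using i by (auto simp: texps_def)
        moreover have "evz N (\<lambda>k\<in>{1..N}. X (Inl k) s) (single i p) = X (Inl i) s ^ p" for s
          using evz_single[OF i, of _ p] i by simp
        ultimately show ?thesis unfolding marginal_z_def by (subst Y) (auto simp: ev_def pt_def)
      qed
    qed (auto simp: power_add X intro!: pow bm continuous_intros loc_z[OF i, simplified])
    then show ?thesis
      by eventually_elim (rule in_interval_iff, use Z[OF i] in \<open>auto simp: ell_interval_poly power_add\<close>)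
  qed
  have su: "AE s in M. 0 \<le> eval_u (w j) (\<chi> j. X (Inr j) s)" if j: "j \<in> {1..s}" for j
    unfolding eval_u_ell
  proof (rule support_from_localizing[OF M(1), where E = UNIV and Y = "marginal_u y'"])
    have e: "eval_mon \<beta> (\<chi> j. X (Inr j) s) = ev N (pt s) (0, 0, \<beta>)" for \<beta> s by (simp add: ev_def pt_def)
    show "marginal_u y' \<beta> = (LINT s|M. eval_mon \<beta> (\<chi> j. X (Inr j) s))" for \<beta>
      unfolding marginal_u_def e by (rule Y) (simp add: texps_def)
    show "\<bar>eval_mon \<beta> (\<chi> j. X (Inr j) s)\<bar> \<le> (\<Prod>i\<in>vars N. R ^ powers (0, 0, \<beta>) i)" for \<beta> s
      unfolding e by (rule evb)
    show "(\<lambda>s. eval_mon \<beta> (\<chi> j. X (Inr j) s)) \<in> borel_measurable M" for \<beta> unfolding e by (rule bm(1)[OF cev])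
  qed (auto simp: eval_mon_add intro!: loc_u[OF j])
  \<comment> \<open>The terminal constraints act on the joint sequence, so here the admissible
    exponents are those without states beyond \<open>N\<close>.\<close>
  have szT: "AE s in \<rho>T. XT i s \<in> {zTlo i..zThi i}" if i: "i \<in> {1..N}" for i
  proof -
    have "AE s in \<rho>T. 0 \<le> ell (evz N (ptT s)) (interval_poly (zTlo i) (zThi i) (single (single i 1) 1))"
    proof (rule support_from_localizing[OF \<rho>T.finite_measure_axioms bm(3)[OF cevz] evzb evz_add evz_0, where E = "zexps_all N" and Y = yT'])
      show z: "0 \<in> zexps_all N" by (simp add: zexps_all_def)
      show a: "\<beta> + \<gamma> \<in> zexps_all N" if "\<beta> \<in> zexps_all N" "\<gamma> \<in> zexps_all N" for \<beta> \<gamma> using that by (simp add: zexps_all_add)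
      have "keys (single (single i (1::nat)) (1::real)) \<subseteq> zexps_all N"
        using i by (simp add: zexps_all_def)
      from keys_interval_poly[OF a z this] show "keys (interval_poly (zTlo i) (zThi i) (single (single i 1) 1)) \<subseteq> zexps_all N" by blast
    qed (rule YT, assumption, rule loc_T[OF i], assumption)
    moreover have "ell (evz N (ptT s)) (interval_poly (zTlo i) (zThi i) (single (single i 1) 1)) = (zThi i - XT i s) * (XT i s - zTlo i)" for s
      unfolding ell_interval_poly[OF evz_add evz_0] ell_single evz_single[OF i] using i by (simp add: ptT_def)
    ultimately show ?thesis
      by (auto elim!: eventually_mono intro: in_interval_iff[OF conjunct1[OF ZT[OF i]]] simp del: atLeastAtMost_iff)
  qed
  have sz': "AE s in M. \<forall>k\<in>{1..N}. X (Inl k) s \<in> {zlo k..zhi k}"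
    by (rule AE_finite_allI[OF finite_atLeastAtMost sz])
  have su': "AE s' in M. \<forall>j\<in>{1..s}. 0 \<le> eval_u (w j) (\<chi> j. X (Inr j) s')"
    by (rule AE_finite_allI[OF finite_atLeastAtMost su])
  have szT': "AE s in \<rho>T. \<forall>k\<in>{1..N}. XT k s \<in> {zTlo k..zThi k}"
    by (rule AE_finite_allI[OF finite_atLeastAtMost szT])
  let ?S = "{0..T} \<times> (\<Pi>\<^sub>E k\<in>{1..N}. Z k) \<times> U" and ?ST = "\<Pi>\<^sub>E k\<in>{1..N}. ZT k"
  have AE: "AE s in M. pt s \<in> ?S"
    using st sz' su'
  proof eventually_elim
    case (elim s)
    have "(\<lambda>k\<in>{1..N}. X (Inl k) s) \<in> (\<Pi>\<^sub>E k\<in>{1..N}. Z k)" by (rule restrict_PiE_iff[THEN iffD2]) (use elim(2) Z in blast)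
    moreover have "(\<chi> j. X (Inr j) s) \<in> U" using elim(3) by (simp add: U(2) basic_semialgebraic_def)
    ultimately show ?case using elim(1) by (simp only: pt_def mem_Times_iff fst_conv snd_conv)
  qed
  have AET: "AE s in \<rho>T. ptT s \<in> ?ST"  using szT'
  proof eventually_elim
    case (elim s)
    show ?case unfolding ptT_def by (rule restrict_PiE_iff[THEN iffD2]) (use elim ZT in blast)
  qed
  have cS: "compact ?S" by (intro compact_Times compact_PiE_real U(1)) (use Z in auto)
  have cST: "compact ?ST" by (intro compact_PiE_real) (use ZT in auto)
  obtain \<mu> where \<mu>: "finite_measure \<mu>" "sets \<mu> = sets (restrict_space borel ?S)"
    and i\<mu>: "\<And>g :: _ \<Rightarrow> real. continuous_on UNIV g \<Longrightarrow> (LINT x|\<mu>. g x) = (LINT s|M. g (pt s))"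
    using push_to_compact[OF M(1) sM(1) M(2) ptc cS AE] by blast
  have "emeasure \<rho>T (space \<rho>T) \<noteq> 0" using \<rho>T.emeasure_space_1 by simp
  then obtain \<nu> where \<nu>: "finite_measure \<nu>" "sets \<nu> = sets (restrict_space borel ?ST)"
    and i\<nu>: "\<And>g :: _ \<Rightarrow> real. continuous_on UNIV g \<Longrightarrow> (LINT x|\<nu>. g x) = (LINT s|\<rho>T. g (ptT s))"
    using push_to_compact[OF \<rho>T.finite_measure_axioms \<rho>T.events_eq_borel _ ptTc cST AET] by blast
  have int: "integrable M (\<lambda>s. ev N (pt s) \<gamma>)" for \<gamma>
    by (rule finite_measure.integrable_const_bound[OF M(1), of _ "\<Prod>i\<in>vars N. R ^ powers \<gamma> i"]) (use evb bm(1)[OF cev] in auto)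
  have ellY: "ell y' P = (LINT x|\<mu>. ell (ev N x) P)" if "keys P \<subseteq> texps N" for P
  proof -
    have "(LINT x|\<mu>. ell (ev N x) P) = (LINT s|M. ell (ev N (pt s)) P)"
      unfolding ell_def by (rule i\<mu>) (intro continuous_intros ev_continuous)
    also have "\<dots> = ell (\<lambda>\<gamma>. LINT s|M. ev N (pt s) \<gamma>) P" by (rule ell_integral(1)[OF int, symmetric])
    also have "\<dots> = ell y' P" unfolding ell_def by (rule sum.cong) (use Y that in auto)
    finally show ?thesis by simp
  qed
  have bc: "continuous_on UNIV (b k)" for k using b by (simp add: linear_continuous_on linear_conv_bounded_linear)
  have "(\<mu>, \<nu>) \<in> lp_feasible N lam b U Z ZT T \<zeta>"
  proof (rule lp_feasibleI[OF \<mu>(1) \<nu>(1) \<mu>(2) \<nu>(2) U(1) bc])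
    show "0 \<le> T" using T by simp
    show "bounded (Z k) \<and> bounded (ZT k)" if "k \<in> {1..N}" for k using Z[OF that] ZT[OF that] by simp
    fix p e
    \<comment> \<open>The exponent function cut down to \<open>1..N\<close>, the only indices that
      \<open>zmon\<close> reads.\<close>
    define \<alpha> where "\<alpha> = (\<Sum>k\<in>{1..N}. single k (e k :: nat))"
    have l: "lookup \<alpha> k = (if k \<in> {1..N} then e k else 0)" for k
      unfolding \<alpha>_def by (rule lookup_sum_single[OF finite_atLeastAtMost])
    have k\<alpha>: "keys \<alpha> \<subseteq> {1..N}" unfolding subset_iff in_keys_iff l by simp
    have z: "zmon N p e = zmon N p (lookup \<alpha>)"
      unfolding zmon_def by (intro ext, clarify, intro arg_cong2[where f = times] refl prod.cong) (simp only: l if_True)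
    let ?P = "poly_liouville N lam b (single (p, \<alpha>, 0) 1)"
    have 1: "(LINT z|\<nu>. zmon N p e (T, z)) = T ^ p * yT' \<alpha>"
    proof -
      have "(LINT z|\<nu>. zmon N p e (T, z)) = (LINT z|\<nu>. T ^ p * evz N z \<alpha>)" unfolding z unfolding zmon_def evz_def by simp
      also have "\<dots> = T ^ p * (LINT z|\<nu>. evz N z \<alpha>)" by simp
      also have "(LINT z|\<nu>. evz N z \<alpha>) = yT' \<alpha>"
        unfolding i\<nu>[OF evz_continuous] by (rule YT[symmetric]) (simp only: zexps_all_def mem_Collect_eq k\<alpha>)
      finally show ?thesis .
    qed
    have 2: "zmon N p e (0, restrict \<zeta> {1..N}) = 0 ^ p * (\<Prod>k=1..N. \<zeta> k ^ lookup \<alpha> k)"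
      unfolding z unfolding zmon_def prod.case by (intro arg_cong2[where f = times] refl prod.cong) (simp only: restrict_apply if_True)
    have "(LINT x|\<mu>. liouville N lam b (zmon N p e) x) = (LINT x|\<mu>. ell (ev N x) ?P)"
    proof (rule Bochner_Integration.integral_cong[OF refl])
      fix x :: "real \<times> (nat \<Rightarrow> real) \<times> (real^'m)"
      obtain t zz u where x: "x = (t, zz, u)" by (cases x)
      show "liouville N lam b (zmon N p e) x = ell (ev N x) ?P" unfolding x ell_poly_liouville[OF b] z ..
    qed
    also have "\<dots> = ell y' ?P" by (rule ellY[OF texps_poly_liouville[OF k\<alpha>], symmetric])
    finally show "(LINT z|\<nu>. zmon N p e (T, z)) - zmon N p e (0, restrict \<zeta> {1..N}) = (LINT x|\<mu>. liouville N lam b (zmon N p e) x)"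
      unfolding 1 2 using eq[OF k\<alpha>, of p] by simp
  qed
  moreover have "(LINT (t, z, u)|\<mu>. eval_tu h t u) = ell (\<lambda>(p, \<beta>). y' (p, 0, \<beta>)) h"
  proof -
    have 1: "(\<lambda>(t, z, u). eval_tu h t u) = (\<lambda>x. ell (\<lambda>(p, \<beta>). ev N x (p, 0, \<beta>)) h)"
      by (auto simp: eval_tu_ell ev_def)
    have "(LINT x|\<mu>. ell (\<lambda>(p, \<beta>). ev N x (p, 0, \<beta>)) h) = (LINT s|M. ell (\<lambda>(p, \<beta>). ev N (pt s) (p, 0, \<beta>)) h)"
      unfolding ell_def split_def by (rule i\<mu>) (intro continuous_intros ev_continuous)
    also have "\<dots> = ell (\<lambda>\<gamma>. LINT s|M. (\<lambda>(p, \<beta>). ev N (pt s) (p, 0, \<beta>)) \<gamma>) h"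
      by (rule ell_integral(1)[symmetric]) (use int in \<open>auto simp: split_def\<close>)
    also have "\<dots> = ell (\<lambda>(p, \<beta>). y' (p, 0, \<beta>)) h"
      unfolding ell_def by (rule sum.cong) (auto simp: Y texps_def)
    finally show ?thesis unfolding 1 .
  qed
  ultimately show ?thesis using obj' by (intro bexI[of _ "(\<mu>, \<nu>)"]) auto
qed

end

section \<open>From measures to controls\<close>

text \<open>After normalisation to probabilities, equal integrals of cosines and sines mean equal
  characteristic functions.\<close>

lemma real_measure_eqI:
  fixes M1 M2 :: "real measure"
  assumes fin: "finite_measure M1" "finite_measure M2" and sets: "sets M1 = sets borel" "sets M2 = sets borel"
    and eq: "\<And>\<psi> :: real \<Rightarrow> real. continuous_on UNIV \<psi> \<Longrightarrow> (LINT x|M1. \<psi> x) = (LINT x|M2. \<psi> x)"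
    and pos: "0 < measure M1 (space M1)"
  shows "M1 = M2"
proof -
  define c where "c = 1 / measure M1 (space M1)"
  have c: "0 < c" using pos by (simp add: c_def)
  have tot: "measure M1 (space M1) = measure M2 (space M2)" using eq[of "\<lambda>_. 1"] by simp
  have rd: "real_distribution (density M (\<lambda>_. ennreal c))"
    if "finite_measure M" "sets M = sets borel" "measure M (space M) = measure M1 (space M1)" for M :: "real measure"
  proof (intro real_distribution.intro real_distribution_axioms.intro prob_spaceI)
    show "emeasure (density M (\<lambda>_. ennreal c)) (space (density M (\<lambda>_. ennreal c))) = 1"
      using that(3) c pos finite_measure.emeasure_eq_measure[OF that(1)]
      by (simp add: emeasure_density_const ennreal_mult'[symmetric]) (simp add: c_def)
    show "sets (density M (\<lambda>_. ennreal c)) = sets borel" using that(2) by simp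
  qed
  interpret D1: real_distribution "density M1 (\<lambda>_. ennreal c)" by (rule rd[OF fin(1) sets(1) refl])
  interpret D2: real_distribution "density M2 (\<lambda>_. ennreal c)" by (rule rd[OF fin(2) sets(2) tot[symmetric]])
  have int: "(LINT x|density M1 (\<lambda>_. ennreal c). \<psi> x) = (LINT x|density M2 (\<lambda>_. ennreal c). \<psi> x)"
    if "continuous_on UNIV \<psi>" for \<psi> :: "real \<Rightarrow> real"
  proof -
    have "\<psi> \<in> borel_measurable M1" "\<psi> \<in> borel_measurable M2"
      using borel_measurable_continuous_onI[OF that] sets by (simp_all cong: measurable_cong_sets)
    then show ?thesis using eq[OF that] c by (simp add: integral_density)
  qed
  have "density M1 (\<lambda>_. ennreal c) = density M2 (\<lambda>_. ennreal c)"
  proof (rule Levy_uniqueness[OF D1.real_distribution_axioms D2.real_distribution_axioms], rule ext)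
    fix a
    show "char (density M1 (\<lambda>_. ennreal c)) a = char (density M2 (\<lambda>_. ennreal c)) a"
    proof (rule complex_eqI)
      have re: "Re (iexp (a * x)) = cos (a * x)" and im: "Im (iexp (a * x)) = sin (a * x)" for x
        by (simp_all add: exp_Euler cos_of_real sin_of_real flip: of_real_mult)
      have m: "(\<lambda>x. complex_of_real (a * x)) \<in> borel_measurable D" if "sets D = sets borel" for D :: "real measure"
        unfolding measurable_cong_sets[OF that refl] by measurable
      have i1: "integrable (density M1 (\<lambda>_. ennreal c)) (\<lambda>x. iexp (a * x))" by (rule D1.integrable_iexp[OF m]) (simp_all add: sets)
      have i2: "integrable (density M2 (\<lambda>_. ennreal c)) (\<lambda>x. iexp (a * x))" by (rule D2.integrable_iexp[OF m]) (simp_all add: sets)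
      have "continuous_on UNIV (\<lambda>x. cos (a * x))" "continuous_on UNIV (\<lambda>x. sin (a * x))" by (intro continuous_intros)+
      then show "Re (char (density M1 (\<lambda>_. ennreal c)) a) = Re (char (density M2 (\<lambda>_. ennreal c)) a)"
        "Im (char (density M1 (\<lambda>_. ennreal c)) a) = Im (char (density M2 (\<lambda>_. ennreal c)) a)"
        unfolding char_def using integral_Re[OF i1] integral_Re[OF i2] integral_Im[OF i1] integral_Im[OF i2] int
        unfolding re im by metis+
    qed
  qed
  then have d: "emeasure (density M1 (\<lambda>_. ennreal c)) A = emeasure (density M2 (\<lambda>_. ennreal c)) A" for A by simp
  show ?thesis
  proof (rule measure_eqI)
    fix A assume "A \<in> sets M1"
    then have "ennreal c * emeasure M1 A = ennreal c * emeasure M2 A"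
      using d[of A] sets by (simp add: emeasure_density_const)
    then show "emeasure M1 A = emeasure M2 A" using c by (simp add: ennreal_mult_cancel_left)
  qed (simp add: sets)
qed

section \<open>The time marginal and conditional means given time\<close>

lemma antiderivative_UNIV:
  fixes \<psi> :: "real \<Rightarrow> real"
  assumes "continuous_on UNIV \<psi>"
  obtains G where "\<And>t. (G has_real_derivative \<psi> t) (at t)"
proof -
  have "\<exists>F. \<forall>x. -\<infinity> < ereal x \<longrightarrow> ereal x < \<infinity> \<longrightarrow> (F has_vector_derivative \<psi> x) (at x)"
    by (rule einterval_antiderivative) (use assms in \<open>auto simp: continuous_on_eq_continuous_at\<close>)
  then show thesis using that by (auto simp: has_real_derivative_iff_has_vector_derivative)
qed

lemma C1_time:
  assumes d: "\<And>t. (\<kappa> has_real_derivative \<kappa>' t) (at t)" and c: "continuous_on UNIV \<kappa>'"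
  shows "(\<lambda>(t, z). \<kappa> t) \<in> C1_functions N" "liouville N lam b (\<lambda>(t, z). \<kappa> t) = (\<lambda>x. \<kappa>' (fst x))"
proof -
  have k: "continuous_on UNIV \<kappa>" using d by (meson DERIV_continuous continuous_at_imp_continuous_on)
  have dt: "dt (\<lambda>(t, z). \<kappa> t) = (\<lambda>x. \<kappa>' (fst x))" using d by (auto simp: dt_def DERIV_imp_deriv)
  have dz: "dz k (\<lambda>(t, z). \<kappa> t) = (\<lambda>x. 0)" for k by (auto simp: dz_def)
  have c1: "continuous_on S (\<lambda>x. \<kappa> (fst x))" "continuous_on S (\<lambda>x. \<kappa>' (fst x))" for S :: "(real \<times> (nat \<Rightarrow> real)) set"
    by (auto intro!: continuous_on_compose2[OF k] continuous_on_compose2[OF c] continuous_intros)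
  show "(\<lambda>(t, z). \<kappa> t) \<in> C1_functions N"
    unfolding C1_functions_def mem_Collect_eq dt dz
  proof (intro conjI allI ballI)
    show "continuous_on (UNIV \<times> ({1..N} \<rightarrow>\<^sub>E UNIV)) (\<lambda>(t, z :: nat \<Rightarrow> real). \<kappa> t)" unfolding split_def by (rule c1)
    show "continuous_on (UNIV \<times> ({1..N} \<rightarrow>\<^sub>E UNIV)) (\<lambda>x :: real \<times> (nat \<Rightarrow> real). \<kappa>' (fst x))" by (rule c1)
    show "(\<lambda>s. case (s, z) of (t, z) \<Rightarrow> \<kappa> t) differentiable at t" for t and z :: "nat \<Rightarrow> real"
      using d by (auto simp: real_differentiable_def)
  qed simp_all
  show "liouville N lam b (\<lambda>(t, z). \<kappa> t) = (\<lambda>x. \<kappa>' (fst x))"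
    unfolding liouville_def dt dz by (auto simp: split_def)
qed

text \<open>Test functions linear in one state: they turn the Liouville equation into a weak linear
  equation for the mean of that mode.\<close>

lemma C1_time_coordinate:
  assumes d: "\<And>t. (\<kappa> has_real_derivative \<kappa>' t) (at t)" and c: "continuous_on UNIV \<kappa>'" and k: "k \<in> {1..N}"
  shows "(\<lambda>(t, z). \<kappa> t * z k) \<in> C1_functions N"
    "liouville N lam b (\<lambda>(t, z). \<kappa> t * z k) =
      (\<lambda>x. \<kappa>' (fst x) * fst (snd x) k + (lam k * fst (snd x) k + b k (snd (snd x))) * \<kappa> (fst x))"
proof -
  have kc: "continuous_on UNIV \<kappa>" using d by (meson DERIV_continuous continuous_at_imp_continuous_on)
  have ddt: "((\<lambda>s. \<kappa> s * y) has_real_derivative \<kappa>' t * y) (at t)" for t y by (rule DERIV_cmult_right[OF d])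
  have dt: "dt (\<lambda>(t, z). \<kappa> t * z k) = (\<lambda>x. \<kappa>' (fst x) * snd x k)" using ddt by (auto simp: dt_def DERIV_imp_deriv)
  have ddz: "((\<lambda>x. \<kappa> t * (z(j := x)) k) has_real_derivative (if j = k then \<kappa> t else 0)) (at y)" for t z j y
    by (auto intro!: derivative_eq_intros)
  have dz: "dz j (\<lambda>(t, z). \<kappa> t * z k) = (\<lambda>x :: real \<times> (nat \<Rightarrow> real). if j = k then \<kappa> (fst x) else 0)" for j
    unfolding dz_def split_def fst_conv snd_conv DERIV_imp_deriv[OF ddz] by auto
  have pc: "continuous_on S (\<lambda>x. snd x k)" for S :: "(real \<times> (nat \<Rightarrow> real)) set"
    by (rule continuous_on_product_then_coordinatewise) (intro continuous_intros)
  have c1: "continuous_on S (\<lambda>x. \<kappa> (fst x))" "continuous_on S (\<lambda>x. \<kappa>' (fst x))" for S :: "(real \<times> (nat \<Rightarrow> real)) set"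
    by (auto intro!: continuous_on_compose2[OF kc] continuous_on_compose2[OF c] continuous_intros)
  show "(\<lambda>(t, z). \<kappa> t * z k) \<in> C1_functions N"
    unfolding C1_functions_def mem_Collect_eq dt dz
  proof (intro conjI allI ballI)
    show "continuous_on (UNIV \<times> ({1..N} \<rightarrow>\<^sub>E UNIV)) (\<lambda>(t, z). \<kappa> t * z k)"
      unfolding split_def by (intro continuous_intros c1 pc)
    show "continuous_on (UNIV \<times> ({1..N} \<rightarrow>\<^sub>E UNIV)) (\<lambda>x. \<kappa>' (fst x) * snd x k)" by (intro continuous_intros c1 pc)
    show "continuous_on (UNIV \<times> ({1..N} \<rightarrow>\<^sub>E UNIV)) (\<lambda>x :: real \<times> (nat \<Rightarrow> real). if j = k then \<kappa> (fst x) else 0)" for j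
      by (cases "j = k") (simp_all add: c1)
    show "(\<lambda>s. case (s, z) of (t, z) \<Rightarrow> \<kappa> t * z k) differentiable at t" for t and z :: "nat \<Rightarrow> real"
      using ddt[of "z k" t] by (auto simp: real_differentiable_def)
    show "(\<lambda>x. case (t, z(j := x)) of (t, z) \<Rightarrow> \<kappa> t * z k) differentiable at (z j)" for t j and z :: "nat \<Rightarrow> real"
      using ddz[of t z j "z j"] unfolding prod.case real_differentiable_def by blast
  qed
  have "(\<Sum>j=1..N. modal_rhs lam b j (z j) u * (if j = k then \<kappa> t else 0)) = modal_rhs lam b k (z k) u * \<kappa> t" for z :: "nat \<Rightarrow> real" and u t
  proof -
    have "(\<Sum>j=1..N. modal_rhs lam b j (z j) u * (if j = k then \<kappa> t else 0)) = (\<Sum>j=1..N. if j = k then modal_rhs lam b j (z j) u * \<kappa> t else 0)"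
      by (rule sum.cong) auto
    also have "\<dots> = modal_rhs lam b k (z k) u * \<kappa> t" by (subst sum.delta) (use k in auto)
    finally show ?thesis .
  qed
  then show "liouville N lam b (\<lambda>(t, z). \<kappa> t * z k) =
      (\<lambda>x. \<kappa>' (fst x) * fst (snd x) k + (lam k * fst (snd x) k + b k (snd (snd x))) * \<kappa> (fst x))"
    unfolding liouville_def dt dz by (auto simp: split_def modal_rhs_def)
qed

locale lp_solution =
  fixes N :: nat and lam :: "nat \<Rightarrow> real" and b :: "nat \<Rightarrow> real^'m::finite \<Rightarrow> real" and U :: "(real^'m) set"
    and Z ZT :: "nat \<Rightarrow> real set" and T :: real and \<zeta> :: "nat \<Rightarrow> real"
    and \<mu> :: "(real \<times> (nat \<Rightarrow> real) \<times> (real^'m)) measure" and \<nu> :: "(nat \<Rightarrow> real) measure"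
  assumes feas: "(\<mu>, \<nu>) \<in> lp_feasible N lam b U Z ZT T \<zeta>" and T: "0 < T" and U: "compact U"
    and Z: "\<And>k. k \<in> {1..N} \<Longrightarrow> compact (Z k) \<and> compact (ZT k)" and b: "\<And>k. linear (b k)"
begin

abbreviation "states \<equiv> {0..T} \<times> (\<Pi>\<^sub>E k\<in>{1..N}. Z k) \<times> U"

lemma fin: "finite_measure \<mu>" "finite_measure \<nu>"
  and sets: "sets \<mu> = sets (restrict_space borel states)" "sets \<nu> = sets (restrict_space borel (\<Pi>\<^sub>E k\<in>{1..N}. ZT k))"
  and test: "g \<in> C1_functions N \<Longrightarrow> (LINT z|\<nu>. g (T, z)) - g (0, restrict \<zeta> {1..N}) = (LINT x|\<mu>. liouville N lam b g x)"
  using feas by (simp_all add: lp_feasible_def)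

lemma space: "space \<mu> = states" "space \<nu> = (\<Pi>\<^sub>E k\<in>{1..N}. ZT k)"
  by (rule space_restrict_borel[OF sets(1)], rule space_restrict_borel[OF sets(2)])

lemma compact_states: "compact states" "compact (\<Pi>\<^sub>E k\<in>{1..N}. ZT k)"
  by (intro compact_Times compact_PiE_real U compact_Icc conjunct1[OF Z] conjunct2[OF Z]; assumption)+

lemma integrable_mu: "continuous_on UNIV (f :: _ \<Rightarrow> real) \<Longrightarrow> integrable \<mu> f"
  by (rule integrable_continuous_compact[OF fin(1) sets(1) compact_states(1)])

lemma meas_mu: "f \<in> borel_measurable borel \<Longrightarrow> f \<in> borel_measurable \<mu>"
  by (rule measurable_restrict_borel[OF sets(1)])

lemma fst_meas: "fst \<in> borel_measurable \<mu>"
  by (rule measurable_restrict_borel[OF sets(1)]) (intro borel_measurable_continuous_onI continuous_intros)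

lemma continuous_bounded:
  assumes "continuous_on UNIV (\<phi> :: _ \<Rightarrow> real)"
  obtains K where "0 \<le> K" "\<And>x. x \<in> states \<Longrightarrow> \<bar>\<phi> x\<bar> \<le> K"
proof -
  have "bounded (\<phi> ` states)"
    by (rule compact_imp_bounded, rule compact_continuous_image[OF continuous_on_subset[OF assms] compact_states(1)]) simp
  then obtain K where "\<forall>y\<in>\<phi> ` states. norm y \<le> K" by (auto simp: bounded_iff)
  then show thesis using that[of "\<bar>K\<bar>"] by (force simp: real_norm_def)
qed

lemma time_test:
  assumes d: "\<And>t. (\<kappa> has_real_derivative \<kappa>' t) (at t)" and c: "continuous_on UNIV \<kappa>'"
  shows "\<kappa> T * measure \<nu> (space \<nu>) - \<kappa> 0 = (LINT x|\<mu>. \<kappa>' (fst x))"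
  using test[OF C1_time(1)[OF d c]] unfolding C1_time(2)[OF d c] by (simp add: mult.commute)

lemma nu_total: "measure \<nu> (space \<nu>) = 1"
  using time_test[of "\<lambda>_. 1" "\<lambda>_. 0"] by simp

text \<open>An antiderivative of \<open>\<psi>\<close> is a test function of time alone, and
  \<open>\<nu>\<close> has mass 1; the Liouville equation then returns the ordinary
  integral.\<close>

lemma time_integral:
  fixes \<psi> :: "real \<Rightarrow> real"
  assumes \<psi>: "continuous_on UNIV \<psi>"
  shows "(LINT x|\<mu>. \<psi> (fst x)) = integral {0..T} \<psi>"
proof -
  obtain G where G: "\<And>t. (G has_real_derivative \<psi> t) (at t)" using antiderivative_UNIV[OF \<psi>] by blast
  have "(\<psi> has_integral (G T - G 0)) {0..T}"
    by (rule fundamental_theorem_of_calculus) (use T G in \<open>auto simp: has_real_derivative_iff_has_vector_derivative[symmetric] intro: has_field_derivative_at_within\<close>)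
  then show ?thesis using time_test[OF G \<psi>] by (simp add: nu_total integral_unique)
qed

lemma mu_fst: "distr \<mu> borel fst = density lborel (indicator {0..T})"
proof (rule real_measure_eqI)
  interpret finite_measure \<mu> by (rule fin)
  show f: "finite_measure (distr \<mu> borel fst)" by (rule finite_measure_distr[OF fst_meas])
  show "finite_measure (density lborel (indicator {0..T}))"
    by (rule finite_measureI) (simp add: emeasure_density nn_integral_indicator emeasure_lborel_Icc_eq)
  have eq: "(LINT x|distr \<mu> borel fst. \<psi> x) = integral {0..T} \<psi>" if "continuous_on UNIV \<psi>" for \<psi> :: "real \<Rightarrow> real"
    using time_integral[OF that] by (subst integral_distr[OF fst_meas borel_measurable_continuous_onI[OF that]])
  show "(LINT x|distr \<mu> borel fst. \<psi> x) = (LINT x|density lborel (indicator {0..T}). \<psi> x)"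
    if \<psi>: "continuous_on UNIV \<psi>" for \<psi> :: "real \<Rightarrow> real"
  proof -
    have "(LINT x|density lborel (indicator {0..T}). \<psi> x) = (LINT x|density lborel (\<lambda>x. ennreal (indicator {0..T} x)). \<psi> x)"
      by (simp add: ennreal_indicator)
    also have "\<dots> = (LINT x|lborel. indicator {0..T} x *\<^sub>R \<psi> x)"
      by (rule integral_density) (use borel_measurable_continuous_onI[OF \<psi>] in auto)
    also have "\<dots> = integral {0..T} \<psi>"
      using set_borel_integral_eq_integral(2)[OF borel_integrable_atLeastAtMost'[OF continuous_on_subset[OF \<psi> subset_UNIV], of 0 T]]
      by (simp add: set_lebesgue_integral_def)
    finally show ?thesis unfolding eq[OF \<psi>] ..
  qed
  have "measure (distr \<mu> borel fst) (space (distr \<mu> borel fst)) = T"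
    using eq[of "\<lambda>_. 1"] T by simp
  then show "0 < measure (distr \<mu> borel fst) (space (distr \<mu> borel fst))" using T by simp
qed simp_all

lemma integral_lborel_fst:
  assumes "w \<in> borel_measurable borel"
  shows "(LINT x|\<mu>. w (fst x)) = (LINT t|lborel. indicator {0..T} t * (w t :: real))"
proof -
  have "(LINT x|\<mu>. w (fst x)) = (LINT t|density lborel (\<lambda>t. ennreal (indicator {0..T} t)). w t)"
    using mu_fst by (simp add: integral_distr[OF fst_meas assms, symmetric] ennreal_indicator)
  also have "\<dots> = (LINT t|lborel. indicator {0..T} t *\<^sub>R w t)" by (rule integral_density) (use assms in auto)
  finally show ?thesis by simp
qed

text \<open>\<open>v\<close> is the conditional mean of \<open>\<phi>\<close> given time, obtained
  as a Radon-Nikodym density: by \<open>mu_fst\<close> a null set of times carries no mass of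
  \<open>\<mu>\<close>, nor of its multiple by \<open>\<phi>\<close>.\<close>

lemma time_density_nonneg:
  assumes \<phi>: "continuous_on UNIV \<phi>" and nonneg: "\<And>x. x \<in> states \<Longrightarrow> 0 \<le> \<phi> x"
  shows "\<exists>v. integrable lborel v \<and> (\<forall>w\<in>borel_measurable borel. (LINT t|lborel. v t * w t) = (LINT x|\<mu>. \<phi> x * (w (fst x) :: real)))"
proof -
  have \<phi>m: "\<phi> \<in> borel_measurable \<mu>" by (rule meas_mu[OF borel_measurable_continuous_onI[OF \<phi>]])
  let ?D = "density \<mu> (\<lambda>x. ennreal (\<phi> x))" and ?N = "distr (density \<mu> (\<lambda>x. ennreal (\<phi> x))) borel fst"
  have fD: "fst \<in> borel_measurable ?D" using fst_meas by simp
  have "absolutely_continuous lborel ?N"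
    unfolding absolutely_continuous_def
  proof
    fix A :: "real set" assume A: "A \<in> null_sets lborel"
    then have Ab: "A \<in> sets borel" by auto
    have "emeasure \<mu> (fst -` A \<inter> space \<mu>) = emeasure (density lborel (indicator {0..T})) A"
      unfolding mu_fst[symmetric] by (rule emeasure_distr[OF fst_meas Ab, symmetric])
    also have "\<dots> = 0" using absolutely_continuousI_density[of "indicator {0..T}" lborel] A
      by (auto simp: absolutely_continuous_def)
    finally have "fst -` A \<inter> space \<mu> \<in> null_sets \<mu>" using measurable_sets[OF fst_meas Ab] by auto
    then have "fst -` A \<inter> space \<mu> \<in> null_sets ?D"
      using absolutely_continuousI_density[of "\<lambda>x. ennreal (\<phi> x)" \<mu>] \<phi>m by (auto simp: absolutely_continuous_def)
    then have "emeasure ?D (fst -` A \<inter> space ?D) = 0" by (simp add: null_setsD1)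
    then show "A \<in> null_sets ?N" using Ab unfolding emeasure_distr[OF fD Ab, symmetric] by (intro null_setsI) simp_all
  qed
  then obtain f where f: "f \<in> borel_measurable lborel" "density lborel f = ?N"
    using sigma_finite_measure.Radon_Nikodym[OF sigma_finite_lborel, of ?N] by auto
  have "(\<integral>\<^sup>+ t. f t \<partial>lborel) = emeasure ?N UNIV" unfolding f(2)[symmetric] using f(1) by (simp add: emeasure_density)
  also have "\<dots> = (\<integral>\<^sup>+ x. ennreal (\<phi> x) \<partial>\<mu>)" using emeasure_distr[OF fD, of UNIV] \<phi>m by (simp add: emeasure_density nn_integral_indicator cong: nn_integral_cong)
  also have "\<dots> < \<infinity>" using integrable_mu[OF \<phi>] nonneg
    by (subst nn_integral_eq_integral) (auto simp: space intro!: AE_I2)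
  finally have finf: "(\<integral>\<^sup>+ t. f t \<partial>lborel) < \<infinity>" .
  then have ae: "AE t in lborel. f t \<noteq> \<infinity>" using nn_integral_noteq_infinite[OF f(1)] by auto
  define v where "v t = enn2real (f t)" for t
  have vm: "v \<in> borel_measurable lborel" unfolding v_def using f(1) by measurable
  have fv: "AE t in lborel. f t = ennreal (v t)" using ae by eventually_elim (simp add: v_def less_top[symmetric])
  have dv: "density lborel (\<lambda>t. ennreal (v t)) = ?N"
    unfolding f(2)[symmetric] by (rule density_cong) (use fv f(1) vm in auto)
  have "(\<integral>\<^sup>+ t. ennreal (v t) \<partial>lborel) < \<infinity>" using finf nn_integral_cong_AE[OF fv] by simp
  then have "integrable lborel v" by (intro integrableI_nonneg vm) (auto simp: v_def)
  moreover have "(LINT t|lborel. v t * w t) = (LINT x|\<mu>. \<phi> x * w (fst x))" if w: "w \<in> borel_measurable borel" for w :: "real \<Rightarrow> real"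
  proof -
    have "(LINT t|lborel. v t * w t) = (LINT t|density lborel (\<lambda>t. ennreal (v t)). w t)"
      by (subst integral_density) (use w vm in \<open>auto simp: v_def\<close>)
    also have "\<dots> = (LINT x|?D. w (fst x))" unfolding dv by (rule integral_distr[OF fD w])
    also have "\<dots> = (LINT x|\<mu>. \<phi> x *\<^sub>R w (fst x))"
      by (rule integral_density) (use \<phi>m measurable_compose[OF fst_meas w] nonneg in \<open>auto simp: space intro!: AE_I2\<close>)
    finally show ?thesis by simp
  qed
  ultimately show ?thesis by blast
qed

lemma integrable_weight:
  fixes w :: "real \<Rightarrow> real"
  assumes \<phi>: "continuous_on UNIV \<phi>" and w: "w \<in> borel_measurable borel" "\<And>t. \<bar>w t\<bar> \<le> C"
  shows "integrable \<mu> (\<lambda>x. \<phi> x * w (fst x))"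
proof (rule Bochner_Integration.integrable_bound)
  show "integrable \<mu> (\<lambda>x. \<phi> x * C)" using integrable_mu[OF \<phi>] by simp
  show "(\<lambda>x. \<phi> x * w (fst x)) \<in> borel_measurable \<mu>"
    using borel_measurable_integrable[OF integrable_mu[OF \<phi>]] measurable_compose[OF fst_meas w(1)] by simp
  show "AE x in \<mu>. norm (\<phi> x * w (fst x)) \<le> norm (\<phi> x * C)"
  proof (rule AE_I2)
    fix x :: "real \<times> (nat \<Rightarrow> real) \<times> (real^'m)"
    have "\<bar>w (fst x)\<bar> \<le> \<bar>C\<bar>" using w(2)[of "fst x"] by linarith
    then show "norm (\<phi> x * w (fst x)) \<le> norm (\<phi> x * C)" unfolding real_norm_def abs_mult by (rule mult_left_mono) simp
  qed
qed

text \<open>A signed integrand is made nonnegative by adding a bound \<open>K\<close> valid on the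
  state set, and the density of the constant is subtracted again; bounded weights keep both parts
  integrable.\<close>

lemma time_density:
  assumes \<phi>: "continuous_on UNIV \<phi>"
  obtains v where "integrable lborel v"
    "\<And>w C. w \<in> borel_measurable borel \<Longrightarrow> (\<And>t. \<bar>w t\<bar> \<le> C) \<Longrightarrow> (LINT t|lborel. v t * w t) = (LINT x|\<mu>. \<phi> x * (w (fst x) :: real))"
proof -
  obtain K where K: "0 \<le> K" "\<And>x. x \<in> states \<Longrightarrow> \<bar>\<phi> x\<bar> \<le> K" using continuous_bounded[OF \<phi>] by blast
  have c1: "continuous_on UNIV (\<lambda>x. \<phi> x + K)" by (intro continuous_intros \<phi>)
  have n1: "0 \<le> \<phi> x + K" if "x \<in> states" for x using K(2)[OF that] by linarith
  obtain v1 where v1: "integrable lborel v1" "\<And>w :: real \<Rightarrow> real. w \<in> borel_measurable borel \<Longrightarrow> (LINT t|lborel. v1 t * w t) = (LINT x|\<mu>. (\<phi> x + K) * w (fst x))"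
    using time_density_nonneg[OF c1 n1] by blast
  obtain v2 where v2: "integrable lborel v2" "\<And>w :: real \<Rightarrow> real. w \<in> borel_measurable borel \<Longrightarrow> (LINT t|lborel. v2 t * w t) = (LINT x|\<mu>. K * w (fst x))"
    using time_density_nonneg[of "\<lambda>_. K"] K(1) by auto
  show thesis
  proof (rule that)
    show "integrable lborel (\<lambda>t. v1 t - v2 t)" by (intro Bochner_Integration.integrable_diff v1 v2)
    fix w :: "real \<Rightarrow> real" and C assume w: "w \<in> borel_measurable borel" "\<And>t. \<bar>w t\<bar> \<le> C"
    have i: "integrable lborel (\<lambda>t. v t * w t)" if "integrable lborel v" for v
    proof (rule Bochner_Integration.integrable_bound)
      show "integrable lborel (\<lambda>t. v t * C)" using that by simp
      show "(\<lambda>t. v t * w t) \<in> borel_measurable lborel" using borel_measurable_integrable[OF that] w(1) by simp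
      show "AE t in lborel. norm (v t * w t) \<le> norm (v t * C)"
      proof (rule AE_I2)
        fix t
        have "\<bar>w t\<bar> \<le> \<bar>C\<bar>" using w(2)[of t] by linarith
        then show "norm (v t * w t) \<le> norm (v t * C)" unfolding real_norm_def abs_mult by (rule mult_left_mono) simp
      qed
    qed
    have wf: "(\<lambda>x. w (fst x)) \<in> borel_measurable \<mu>" by (rule measurable_compose[OF fst_meas w(1)])
    have iw: "integrable \<mu> (\<lambda>x. w (fst x))"
      by (rule finite_measure.integrable_const_bound[OF fin(1), of _ C]) (use w(2) wf in auto)
    have j: "integrable \<mu> (\<lambda>x. \<phi> x * w (fst x))" by (rule integrable_weight[OF \<phi> w])
    have "(LINT t|lborel. (v1 t - v2 t) * w t) = (LINT t|lborel. v1 t * w t) - (LINT t|lborel. v2 t * w t)"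
      using i[OF v1(1)] i[OF v2(1)] by (simp add: left_diff_distrib)
    also have "\<dots> = (LINT x|\<mu>. \<phi> x * w (fst x))"
      unfolding v1(2)[OF w(1)] v2(2)[OF w(1)] distrib_right using j iw by simp
    finally show "(LINT t|lborel. (v1 t - v2 t) * w t) = (LINT x|\<mu>. \<phi> x * w (fst x))" .
  qed
qed

end

section \<open>Fibres of the input map and the epigraph of the fibre cost\<close>

lemma closed_fibre_epigraph:
  fixes B :: "real^'m::finite \<Rightarrow> 'h::real_normed_vector" and f :: "real^'m \<Rightarrow> real"
  assumes U: "compact U" and B: "bounded_linear B" and f: "continuous_on UNIV f"
  shows "closed {q. \<exists>u\<in>U. B u = B (fst q) \<and> f u \<le> snd q}" (is "closed ?E")
  unfolding closed_sequential_limits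
proof (intro allI impI)
  fix q l assume q: "(\<forall>n. q n \<in> ?E) \<and> q \<longlonglongrightarrow> l"
  then have "\<forall>n. \<exists>u. u \<in> U \<and> B u = B (fst (q n)) \<and> f u \<le> snd (q n)" by blast
  from choice[OF this] obtain u where u: "\<And>n. u n \<in> U" "\<And>n. B (u n) = B (fst (q n))" "\<And>n. f (u n) \<le> snd (q n)" by blast
  obtain v r where v: "v \<in> U" "strict_mono r" "(u \<circ> r) \<longlonglongrightarrow> v"
    using U u(1) unfolding compact_def by metis
  have qr: "(q \<circ> r) \<longlonglongrightarrow> l" using q v(2) by (intro LIMSEQ_subseq_LIMSEQ) auto
  have Bc: "isCont B x" for x using linear_continuous_at[OF B] .
  have "(\<lambda>n. B (u (r n))) \<longlonglongrightarrow> B v" using isCont_tendsto_compose[OF Bc v(3)] by (simp add: o_def)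
  moreover have "(\<lambda>n. B (fst (q (r n)))) \<longlonglongrightarrow> B (fst l)" using isCont_tendsto_compose[OF Bc tendsto_fst[OF qr]] by (simp add: o_def)
  ultimately have "B v = B (fst l)" unfolding u(2) by (rule LIMSEQ_unique)
  moreover have "f v \<le> snd l"
  proof (rule LIMSEQ_le)
    have "isCont f v" using f by (simp add: continuous_on_eq_continuous_at)
    from isCont_tendsto_compose[OF this v(3)] show "(\<lambda>n. f (u (r n))) \<longlonglongrightarrow> f v" by (simp add: o_def)
    show "(\<lambda>n. snd (q (r n))) \<longlonglongrightarrow> snd l" using tendsto_snd[OF qr] by (simp add: o_def)
  qed (use u(3) in auto)
  ultimately show "l \<in> ?E" using v(1) by blast
qed

text \<open>The set is the epigraph of the fibre cost pulled back by \<open>B\<close> and the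
  translation \<open>a\<close>. Its first component need not lie in \<open>U\<close>, so averages of
  controls may be tested for membership. Convexity of the infimum passes to this set because the
  infimum over a nonempty compact fibre is attained.\<close>

lemma convex_fibre_epigraph:
  fixes B :: "real^'m::finite \<Rightarrow> 'h::real_normed_vector" and f :: "real^'m \<Rightarrow> real"
  assumes U: "compact U" and B: "bounded_linear B" and f: "continuous_on UNIV f"
    and conv: "ereal_convex (\<lambda>v. INF u\<in>{u \<in> U. v = a + B u}. ereal (f u))"
  shows "convex {q. \<exists>u\<in>U. B u = B (fst q) \<and> f u \<le> snd q}" (is "convex ?E")
  unfolding convex_alt
proof (intro ballI allI impI)
  fix x y and \<theta> :: real assume xy: "x \<in> ?E" "y \<in> ?E" and \<theta>: "0 \<le> \<theta> \<and> \<theta> \<le> 1"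
  interpret B: bounded_linear B by (rule B)
  define g where "g v = (INF u\<in>{u \<in> U. v = a + B u}. ereal (f u))" for v
  have gle: "g (a + B (fst q)) \<le> ereal (snd q)" if q: "q \<in> ?E" for q
  proof -
    obtain u where u: "u \<in> U" "B u = B (fst q)" "f u \<le> snd q" using q by blast
    show ?thesis unfolding g_def by (rule INF_lower2[of u]) (use u in auto)
  qed
  show "(1 - \<theta>) *\<^sub>R x + \<theta> *\<^sub>R y \<in> ?E"
  proof (cases "\<theta> = 0 \<or> \<theta> = 1")
    case True
    then show ?thesis using xy by auto
  next
    case False
    then have \<theta>': "0 < \<theta>" "\<theta> < 1" using \<theta> by auto
    let ?q = "(1 - \<theta>) *\<^sub>R x + \<theta> *\<^sub>R y"
    have "g (a + B (fst ?q)) = g ((1 - \<theta>) *\<^sub>R (a + B (fst x)) + \<theta> *\<^sub>R (a + B (fst y)))"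
      by (simp add: B.add B.diff B.scaleR algebra_simps)
    also have "\<dots> \<le> ereal (1 - \<theta>) * g (a + B (fst x)) + ereal \<theta> * g (a + B (fst y))"
      using conv \<theta>' unfolding ereal_convex_def g_def by blast
    also have "\<dots> \<le> ereal (1 - \<theta>) * ereal (snd x) + ereal \<theta> * ereal (snd y)"
      by (intro add_mono ereal_mult_left_mono gle xy) (use \<theta>' in auto)
    also have "\<dots> = ereal (snd ?q)" by simp
    finally have le: "g (a + B (fst ?q)) \<le> ereal (snd ?q)" .
    \<comment> \<open>A finite infimum shows that the fibre is nonempty; its minimiser is a control
      that witnesses membership.\<close>
    define F where "F = {u \<in> U. a + B (fst ?q) = a + B u}"
    have "F \<noteq> {}"
    proof
      assume "F = {}"
      then have "g (a + B (fst ?q)) = \<infinity>" unfolding g_def F_def[symmetric] by (simp add: top_ereal_def)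
      then show False using le by simp
    qed
    moreover have "compact F"
    proof -
      have "F = U \<inter> {u. B u = B (fst ?q)}" unfolding F_def by auto
      moreover have "closed {u. B u = B (fst ?q)}"
        by (intro closed_Collect_eq linear_continuous_on[OF B] continuous_on_const)
      ultimately show ?thesis using U by (simp only: compact_Int_closed)
    qed
    moreover have "continuous_on F f" by (rule continuous_on_subset[OF f]) simp
    ultimately obtain u where u: "u \<in> F" "\<And>v. v \<in> F \<Longrightarrow> f u \<le> f v" using continuous_attains_inf[of F f] by blast
    have "ereal (f u) \<le> g (a + B (fst ?q))" unfolding g_def F_def[symmetric] by (rule INF_greatest) (simp add: u(2))
    with le have "f u \<le> snd ?q" by (metis ereal_less_eq(3) order_trans)
    moreover have "u \<in> U" "B u = B (fst ?q)" using u(1) by (auto simp: F_def)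
    ultimately show ?thesis by blast
  qed
qed

text \<open>Jensen's inequality in set form: a hyperplane strictly separating the average from
  \<open>E\<close> is contradicted by integrating its inequality against
  \<open>\<omega>\<close>.\<close>

lemma average_in_closed_convex:
  fixes P :: "'m::finite \<Rightarrow> 'x \<Rightarrow> real" and E :: "((real^'m) \<times> real) set"
  assumes E: "closed E" "convex E" and \<omega>: "integrable M \<omega>" "\<And>x. x \<in> space M \<Longrightarrow> 0 \<le> \<omega> x" "(LINT x|M. \<omega> x) = 1"
    and int: "\<And>i. integrable M (\<lambda>x. P i x * \<omega> x)" "integrable M (\<lambda>x. Q x * \<omega> x)"
    and mem: "\<And>x. x \<in> space M \<Longrightarrow> \<omega> x \<noteq> 0 \<Longrightarrow> ((\<chi> i. P i x), Q x) \<in> E"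
  shows "((\<chi> i. LINT x|M. P i x * \<omega> x), (LINT x|M. Q x * \<omega> x)) \<in> E" (is "?q \<in> E")
proof (rule ccontr)
  assume "?q \<notin> E"
  from separating_hyperplane_closed_point[OF E(2,1) this] obtain a c where a: "a \<bullet> ?q < c" "\<And>x. x \<in> E \<Longrightarrow> c < a \<bullet> x" by blast
  let ?f = "\<lambda>x. (\<Sum>i\<in>UNIV. fst a $ i * (P i x * \<omega> x)) + snd a * (Q x * \<omega> x)"
  have "c = (LINT x|M. c * \<omega> x)" using \<omega>(3) by simp
  also have "\<dots> \<le> (LINT x|M. ?f x)"
  proof (rule integral_mono)
    show "integrable M (\<lambda>x. c * \<omega> x)" using \<omega>(1) by simp
    show "integrable M ?f" using int by simp
    fix x assume x: "x \<in> space M"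
    have "?f x = \<omega> x * (a \<bullet> ((\<chi> i. P i x), Q x))"
      by (simp add: inner_prod_def inner_vec_def sum_distrib_left algebra_simps)
    moreover have "\<omega> x * c \<le> \<omega> x * (a \<bullet> ((\<chi> i. P i x), Q x))"
      using mem[OF x] a(2) \<omega>(2)[OF x] by (cases "\<omega> x = 0") (auto intro: mult_left_mono less_imp_le)
    ultimately show "c * \<omega> x \<le> ?f x" by (simp add: mult.commute)
  qed
  also have "\<dots> = a \<bullet> ?q" using int by (simp add: inner_prod_def inner_vec_def)
  finally show False using a(1) by simp
qed

context lp_solution
begin

text \<open>Averages of controls and cost over \<open>[t, t + 1/n]\<close> lie in the closed convex
  set belonging to time \<open>t\<close>, up to a small error in the cost. Lebesgue differentiation
  identifies their limit as the conditional means at \<open>t\<close>.\<close>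

lemma time_slices:
  fixes B :: "real^'m \<Rightarrow> 'h::real_normed_vector"
  assumes B: "bounded_linear B" and conv: "\<And>t. t \<in> {0..T} \<Longrightarrow> ereal_convex (fibre_cost A B U h t z)"
    and v: "\<And>i. integrable lborel (v i)"
      "\<And>i w C. w \<in> borel_measurable borel \<Longrightarrow> (\<And>t. \<bar>w t\<bar> \<le> C) \<Longrightarrow> (LINT t|lborel. v i t * w t) = (LINT x|\<mu>. snd (snd x) $ i * (w (fst x) :: real))"
    and \<eta>: "integrable lborel \<eta>"
      "\<And>w C. w \<in> borel_measurable borel \<Longrightarrow> (\<And>t. \<bar>w t\<bar> \<le> C) \<Longrightarrow> (LINT t|lborel. \<eta> t * w t) = (LINT x|\<mu>. eval_tu h (fst x) (snd (snd x)) * (w (fst x) :: real))"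
  obtains Nl where "negligible Nl" "\<And>t. t \<in> {0..T} - Nl \<Longrightarrow> \<exists>u\<in>U. B u = B (\<chi> i. v i t) \<and> eval_tu h t u \<le> \<eta> t"
proof -
  have si: "set_integrable lborel {a..b} f" if "integrable lborel f" for f :: "real \<Rightarrow> real" and a b
    unfolding set_integrable_def by (rule integrable_mult_indicator[OF _ that]) simp
  have io: "f integrable_on {a..b}" if "integrable lborel f" for f :: "real \<Rightarrow> real" and a b
    by (rule set_borel_integral_eq_integral(1)[OF si[OF that]])
  have "\<exists>N. negligible N \<and> (\<forall>x. x \<notin> N \<longrightarrow> (\<lambda>n. integral {x..x + 1 / real (Suc n)} (v i) * real (Suc n)) \<longlonglongrightarrow> v i x)" for i
    by (rule lebesgue_differentiation_sequence[OF io[OF v(1)], of i]) blast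
  then have "\<forall>i. \<exists>N. negligible N \<and> (\<forall>x. x \<notin> N \<longrightarrow> (\<lambda>n. integral {x..x + 1 / real (Suc n)} (v i) * real (Suc n)) \<longlonglongrightarrow> v i x)" ..
  from choice[OF this] obtain Ni where Ni: "\<And>i. negligible (Ni i)"
    "\<And>i x. x \<notin> Ni i \<Longrightarrow> (\<lambda>n. integral {x..x + 1 / real (Suc n)} (v i) * real (Suc n)) \<longlonglongrightarrow> v i x" by blast
  obtain Ne where Ne: "negligible Ne"
    "\<And>x. x \<notin> Ne \<Longrightarrow> (\<lambda>n. integral {x..x + 1 / real (Suc n)} \<eta> * real (Suc n)) \<longlonglongrightarrow> \<eta> x"
    by (rule lebesgue_differentiation_sequence[OF io[OF \<eta>(1)]]) blast
  \<comment> \<open>\<open>T\<close> is excluded so that short slices to the right of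
    \<open>t\<close> stay inside \<open>[0, T]\<close>.\<close>
  define Nl where "Nl = (\<Union>i. Ni i) \<union> Ne \<union> {T}"
  have "negligible Nl" unfolding Nl_def by (intro negligible_Un negligible_Union) (auto intro: Ni Ne)
  moreover have "\<exists>u\<in>U. B u = B (\<chi> i. v i t) \<and> eval_tu h t u \<le> \<eta> t" if t: "t \<in> {0..T} - Nl" for t
  proof -
    have t0: "0 \<le> t" "t < T" using t by (auto simp: Nl_def)
    have hc: "continuous_on S (\<lambda>u. eval_tu h t u)" for S
    proof -
      have "continuous_on S (\<lambda>u :: real^'m. (t, u))" by (intro continuous_intros)
      from continuous_on_compose2[OF eval_tu_continuous this, of h] show ?thesis by simp
    qed
    let ?E = "{q. \<exists>u\<in>U. B u = B (fst q) \<and> eval_tu h t u \<le> snd q}"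
    have Ec: "closed ?E" by (rule closed_fibre_epigraph[OF U B hc])
    have Ev: "convex ?E" by (rule convex_fibre_epigraph[OF U B hc]) (use conv[of t] t in \<open>simp add: fibre_cost_def[abs_def]\<close>)
    \<comment> \<open>Normalised indicator of a slice; since time is Lebesgue distributed under
      \<open>\<mu>\<close>, its integral is 1 as soon as the slice fits into
      \<open>[0, T]\<close>.\<close>
    define w where "w n s = real (Suc n) * indicator {t..t + 1 / real (Suc n)} s" for n s
    have wm: "w n \<in> borel_measurable borel" for n unfolding w_def by measurable
    have wb: "\<bar>w n s\<bar> \<le> real (Suc n)" for n s by (simp add: w_def indicator_def)
    have wi: "(LINT s|lborel. f s * w n s) = integral {t..t + 1 / real (Suc n)} f * real (Suc n)" if "integrable lborel f" for f n
    proof -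
      have "(LINT s|lborel. f s * w n s) = real (Suc n) * (LINT s:{t..t + 1 / real (Suc n)}|lborel. f s)"
        unfolding w_def set_lebesgue_integral_def
        by (subst integral_mult_right_zero[symmetric]) (rule Bochner_Integration.integral_cong, auto simp: indicator_def)
      then show ?thesis using set_borel_integral_eq_integral(2)[OF si[OF that]] by simp
    qed
    define q where "q n = ((\<chi> i. LINT x|\<mu>. snd (snd x) $ i * w n (fst x)), (LINT x|\<mu>. eval_tu h (fst x) (snd (snd x)) * w n (fst x)))" for n
    have "(\<lambda>n. (LINT x|\<mu>. snd (snd x) $ i * w n (fst x))) \<longlonglongrightarrow> v i t" for i
      using Ni(2)[of t i] t unfolding v(2)[OF wm wb, symmetric] wi[OF v(1)] by (auto simp: Nl_def)
    moreover have "(\<lambda>n. (LINT x|\<mu>. eval_tu h (fst x) (snd (snd x)) * w n (fst x))) \<longlonglongrightarrow> \<eta> t"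
      using Ne(2)[of t] t unfolding \<eta>(2)[OF wm wb, symmetric] wi[OF \<eta>(1)] by (auto simp: Nl_def)
    ultimately have qlim: "q \<longlonglongrightarrow> ((\<chi> i. v i t), \<eta> t)" unfolding q_def by (intro tendsto_Pair vec_tendstoI) auto
    have hcc: "continuous_on UNIV (\<lambda>x :: real \<times> (nat \<Rightarrow> real) \<times> (real^'m). eval_tu h (fst x) (snd (snd x)))"
    proof -
      have "continuous_on UNIV (\<lambda>x :: real \<times> (nat \<Rightarrow> real) \<times> (real^'m). (fst x, snd (snd x)))" by (intro continuous_intros)
      from continuous_on_compose2[OF eval_tu_continuous this, of h] show ?thesis by simp
    qed
    \<comment> \<open>Inside the slice the cost is taken at other times than \<open>t\<close>; by
      uniform continuity \<open>\<epsilon>\<close> absorbs the difference, and closedness removes it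
      afterwards.\<close>
    have eps: "((\<chi> i. v i t), \<eta> t + \<epsilon>) \<in> ?E" if \<epsilon>: "0 < \<epsilon>" for \<epsilon>
    proof -
      have "uniformly_continuous_on ({0..T} \<times> U) (\<lambda>x. eval_tu h (fst x) (snd x))"
        by (rule compact_uniformly_continuous[OF continuous_on_subset[OF eval_tu_continuous]]) (auto intro: compact_Times U)
      then obtain d where d: "0 < d" "\<And>x x'. x \<in> {0..T} \<times> U \<Longrightarrow> x' \<in> {0..T} \<times> U \<Longrightarrow> dist x' x < d \<Longrightarrow>
          dist (eval_tu h (fst x') (snd x')) (eval_tu h (fst x) (snd x)) < \<epsilon>"
        using \<epsilon> unfolding uniformly_continuous_on_def by metis
      have sm: "\<forall>\<^sub>F n in sequentially. 1 / real (Suc n) < min d (T - t)"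
        using LIMSEQ_inverse_real_of_nat d(1) t0 by (intro order_tendstoD(2)) (auto simp: inverse_eq_divide)
      have "\<forall>\<^sub>F n in sequentially. q n + (0, \<epsilon>) \<in> ?E" using sm
      proof eventually_elim
        case (elim n)
        have w1: "(LINT x|\<mu>. w n (fst x)) = 1"
        proof -
          have "(LINT x|\<mu>. w n (fst x)) = (LINT s|lborel. real (Suc n) * indicator {t..t + 1 / real (Suc n)} s)"
            unfolding integral_lborel_fst[OF wm]
            by (rule Bochner_Integration.integral_cong) (use elim t0 in \<open>auto simp: w_def indicator_def\<close>)
          also have "\<dots> = 1" by (simp add: measure_lborel_Icc)
          finally show ?thesis .
        qed
        have iw: "integrable \<mu> (\<lambda>x. w n (fst x))" using integrable_weight[OF continuous_on_const[of _ 1] wm wb] by simp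
        have hi: "integrable \<mu> (\<lambda>x. eval_tu h (fst x) (snd (snd x)) * w n (fst x))" by (rule integrable_weight[OF hcc wm wb])
        have "((\<chi> i. LINT x|\<mu>. snd (snd x) $ i * w n (fst x)), (LINT x|\<mu>. (eval_tu h (fst x) (snd (snd x)) + \<epsilon>) * w n (fst x))) \<in> ?E"
        proof (rule average_in_closed_convex[OF Ec Ev iw])
          show "0 \<le> w n (fst x)" for x :: "real \<times> (nat \<Rightarrow> real) \<times> (real^'m)" by (simp add: w_def)
          show "integrable \<mu> (\<lambda>x. snd (snd x) $ i * w n (fst x))" for i by (rule integrable_weight[OF _ wm wb]) (intro continuous_intros)
          show "integrable \<mu> (\<lambda>x. (eval_tu h (fst x) (snd (snd x)) + \<epsilon>) * w n (fst x))" unfolding distrib_right using hi iw by simp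
          fix x assume x: "x \<in> space \<mu>" "w n (fst x) \<noteq> 0"
          have xs: "fst x \<in> {0..T}" "snd (snd x) \<in> U" using x(1) unfolding space by auto
          have "\<bar>t - fst x\<bar> < d" using x(2) elim by (auto simp: w_def indicator_def split: if_splits)
          then have "dist (t, snd (snd x)) (fst x, snd (snd x)) < d" by (simp add: dist_Pair_Pair dist_real_def)
          from d(2)[OF _ _ this] xs t0 have "\<bar>eval_tu h t (snd (snd x)) - eval_tu h (fst x) (snd (snd x))\<bar> < \<epsilon>" by (auto simp: dist_real_def)
          then show "((\<chi> i. snd (snd x) $ i), eval_tu h (fst x) (snd (snd x)) + \<epsilon>) \<in> ?E"
            using xs(2) by (intro CollectI bexI[of _ "snd (snd x)"]) auto
        qed (rule w1)
        then show ?case unfolding distrib_right using hi iw w1 by (simp add: q_def)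
      qed
      moreover have "(\<lambda>n. q n + (0, \<epsilon>)) \<longlonglongrightarrow> ((\<chi> i. v i t), \<eta> t) + (0, \<epsilon>)" by (intro tendsto_intros qlim)
      ultimately have "((\<chi> i. v i t), \<eta> t) + (0, \<epsilon>) \<in> ?E" by (intro Lim_in_closed_set[OF Ec]) auto
      then show ?thesis by simp
    qed
    have "((\<chi> i. v i t), \<eta> t) \<in> ?E"
    proof (rule Lim_in_closed_set[OF Ec])
      show "\<forall>\<^sub>F n in sequentially. ((\<chi> i. v i t), \<eta> t + 1 / real (Suc n)) \<in> ?E" by (intro always_eventually allI eps) simp
      have "(\<lambda>n. ((\<chi> i. v i t), \<eta> t + 1 / real (Suc n))) \<longlonglongrightarrow> ((\<chi> i. v i t), \<eta> t + 0)"
        using LIMSEQ_inverse_real_of_nat by (intro tendsto_intros) (simp add: inverse_eq_divide)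
      then show "(\<lambda>n. ((\<chi> i. v i t), \<eta> t + 1 / real (Suc n))) \<longlonglongrightarrow> ((\<chi> i. v i t), \<eta> t)" by simp
    qed simp
    then show ?thesis by simp
  qed
  ultimately show thesis by (rule that)
qed

end

section \<open>Measurable choice of a control\<close>

text \<open>The smallest zero is measurable: \<open>{\<tau> \<le> a}\<close> is described by countably many conditions on \<open>W\<close>.\<close>

lemma measurable_minimal_zero:
  fixes W :: "real \<Rightarrow> 't \<Rightarrow> real"
  assumes c: "\<And>t. continuous_on {0..1} (\<lambda>s. W s t)" and m: "\<And>s. W s \<in> borel_measurable M" and n: "\<And>s t. 0 \<le> W s t"
  obtains \<tau> where "\<tau> \<in> borel_measurable M" "\<And>t. 0 \<le> \<tau> t \<and> \<tau> t \<le> 1" "\<And>t s. 0 \<le> s \<Longrightarrow> s \<le> 1 \<Longrightarrow> W s t = 0 \<Longrightarrow> W (\<tau> t) t = 0"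
proof -
  define S where "S t = {s\<in>{0..1}. W s t = 0}" for t
  \<comment> \<open>The inserted 1 is a default for an empty set of zeros; it does not influence the
    events \<open>\<tau> t \<le> a\<close> with \<open>a < 1\<close>.\<close>
  define \<tau> where "\<tau> t = Inf (insert 1 (S t))" for t
  have "closed (S t)" for t unfolding S_def by (rule continuous_closed_preimage_constant[OF c]) simp
  then have cl: "closed (insert 1 (S t))" for t by (rule closed_insert)
  have bb: "bdd_below (insert 1 (S t))" for t by (rule bdd_belowI[of _ 0]) (auto simp: S_def)
  have \<tau>: "\<tau> t \<in> insert 1 (S t)" for t unfolding \<tau>_def by (rule closed_contains_Inf[OF _ bb cl]) simp
  have lower: "\<tau> t \<le> s" if "s \<in> insert 1 (S t)" for t s unfolding \<tau>_def by (rule cInf_lower[OF that bb])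
  have range: "0 \<le> \<tau> t \<and> \<tau> t \<le> 1" for t using \<tau>[of t] by (auto simp: S_def)
  have zero: "W (\<tau> t) t = 0" if "0 \<le> s" "s \<le> 1" "W s t = 0" for s t
  proof -
    have s: "s \<in> S t" using that by (simp add: S_def)
    show ?thesis
    proof (cases "\<tau> t \<in> S t")
      case False
      then have "\<tau> t = 1" using \<tau>[of t] by blast
      then have "s = \<tau> t" using lower[of s t] s that(2) by auto
      then show ?thesis using that(3) by simp
    qed (simp add: S_def)
  qed
  define Q where "Q = \<rat> \<inter> {0..1::real}"
  have Q: "countable Q" unfolding Q_def by (intro countable_Int1 countable_rat)
  \<comment> \<open>The points \<open>a * q\<close> are dense in \<open>[0, a]\<close> and include
    the endpoint \<open>a\<close>. By compactness, values of \<open>W\<close> at them below every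
    \<open>1 / Suc n\<close> force a zero in \<open>[0, a]\<close>.\<close>
  have iff: "\<tau> t \<le> a \<longleftrightarrow> (\<forall>n. \<exists>q\<in>Q. W (a * q) t < 1 / real (Suc n))" if a: "0 \<le> a" "a < 1" for a t
  proof
    assume le: "\<tau> t \<le> a"
    then have "\<tau> t \<in> S t" using \<tau>[of t] a by auto
    then have s: "0 \<le> \<tau> t" "\<tau> t \<le> 1" "W (\<tau> t) t = 0" by (auto simp: S_def)
    show "\<forall>n. \<exists>q\<in>Q. W (a * q) t < 1 / real (Suc n)"
    proof
      fix n
      have "0 < 1 / real (Suc n)" by simp
      then obtain d where d: "0 < d" "\<And>x. x \<in> {0..1} \<Longrightarrow> dist x (\<tau> t) < d \<Longrightarrow> dist (W x t) (W (\<tau> t) t) < 1 / real (Suc n)"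
        using c[of t] s unfolding continuous_on_iff by (meson atLeastAtMost_iff)
      have "\<exists>q\<in>Q. \<bar>a * q - \<tau> t\<bar> < d"
      proof (cases "\<tau> t = a")
        case True
        then show ?thesis using d(1) by (intro bexI[of _ 1]) (auto simp: Q_def)
      next
        case False
        then have lt: "\<tau> t < a" "0 < a" using le s by auto
        then have "\<tau> t / a < min 1 (\<tau> t / a + d)" using d(1) by simp
        then obtain q where q: "q \<in> \<rat>" "\<tau> t / a < q" "q < min 1 (\<tau> t / a + d)" using Rats_dense_in_real by blast
        have "0 \<le> \<tau> t / a" using s lt by simp
        then have "q \<in> Q" using q by (auto simp: Q_def)
        moreover have "\<tau> t < a * q" using q(2) lt(2) by (simp add: pos_divide_less_eq mult.commute)
        moreover have "a * (q - \<tau> t / a) \<le> 1 * (q - \<tau> t / a)" using a q(2) by (intro mult_right_mono) auto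
        then have "a * q - \<tau> t < d" using q(3) lt(2) by (simp add: right_diff_distrib)
        ultimately show ?thesis by (intro bexI[of _ q]) auto
      qed
      then obtain q where q: "q \<in> Q" "\<bar>a * q - \<tau> t\<bar> < d" by blast
      have "a * q \<in> {0..1}" using q(1) a mult_le_one[of a q] by (auto simp: Q_def)
      from d(2)[OF this] q s(3) n[of "a * q" t] show "\<exists>q\<in>Q. W (a * q) t < 1 / real (Suc n)"
        by (intro bexI[of _ q]) (auto simp: dist_real_def)
    qed
  next
    assume r: "\<forall>n. \<exists>q\<in>Q. W (a * q) t < 1 / real (Suc n)"
    have "continuous_on {0..a} (\<lambda>s. W s t)" by (rule continuous_on_subset[OF c]) (use a in auto)
    then obtain s where s: "s \<in> {0..a}" "\<And>s'. s' \<in> {0..a} \<Longrightarrow> W s t \<le> W s' t"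
      using continuous_attains_inf[of "{0..a}" "\<lambda>s. W s t"] a by auto
    have lt: "W s t < 1 / real (Suc n)" for n
    proof -
      obtain q where q: "q \<in> Q" "W (a * q) t < 1 / real (Suc n)" using r by blast
      have "a * q \<in> {0..a}" using q(1) a mult_left_le[of q a] by (auto simp: Q_def)
      from s(2)[OF this] q(2) show ?thesis by linarith
    qed
    have "W s t \<le> 0"
    proof (rule field_le_epsilon)
      fix e :: real assume "0 < e"
      then obtain k where "inverse (real (Suc k)) < e" using reals_Archimedean by blast
      then show "W s t \<le> 0 + e" using lt[of k] by (simp add: inverse_eq_divide)
    qed
    then have "W s t = 0" using n[of s t] by simp
    then have "s \<in> insert 1 (S t)" using s(1) a by (auto simp: S_def)
    from lower[OF this] s(1) show "\<tau> t \<le> a" by simp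
  qed
  have "\<tau> \<in> borel_measurable M"
  proof (rule borel_measurableI_le)
    fix a :: real
    consider "a < 0" | "1 \<le> a" | "0 \<le> a" "a < 1" by linarith
    then show "{t \<in> space M. \<tau> t \<le> a} \<in> sets M"
    proof cases
      case 1
      have "\<not> \<tau> t \<le> a" for t using range[of t] 1 by linarith
      then show ?thesis by simp
    next
      case 2
      then have "{t \<in> space M. \<tau> t \<le> a} = space M" using range by (auto intro: order_trans)
      then show ?thesis by simp
    next
      case 3
      have "{t \<in> space M. \<exists>q\<in>Q. W (a * q) t < 1 / real (Suc n)} = (\<Union>q\<in>Q. {t \<in> space M. W (a * q) t < 1 / real (Suc n)})" for n by auto
      moreover have "(\<Union>q\<in>Q. {t \<in> space M. W (a * q) t < 1 / real (Suc n)}) \<in> sets M" for n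
        by (rule sets.countable_UN''[OF Q borel_measurable_less[OF m borel_measurable_const]])
      ultimately show ?thesis unfolding iff[OF 3] by (intro sets.sets_Collect_countable_All) simp
    qed
  qed
  then show thesis using that range zero by blast
qed

text \<open>A scalar parameter for all controls in a cube, so that choosing a vector measurably
  reduces to choosing a smallest zero in \<open>[0, 1]\<close>.\<close>

lemma box_parametrisation:
  assumes K: "0 < K"
  obtains P :: "real \<Rightarrow> real^'m::finite" where "continuous_on UNIV P"
    "\<And>u. (\<And>i. \<bar>u $ i\<bar> \<le> K) \<Longrightarrow> \<exists>s. 0 \<le> s \<and> s \<le> 1 \<and> P s = u"
proof -
  obtain e where e: "bij_betw e (UNIV :: 'm set) {0..<CARD('m)}" using ex_bij_betw_finite_nat[of "UNIV :: 'm set"] by auto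
  define P where "P s = (\<chi> i :: 'm. 2 * K * space_filling CARD('m) (e i) s - K)" for s
  show thesis
  proof (rule that[of P])
    show "continuous_on UNIV P" unfolding P_def
      by (intro continuous_on_vec_lambda continuous_intros continuous_space_filling)
    fix u :: "real^'m" assume u: "\<And>i. \<bar>u $ i\<bar> \<le> K"
    define q where "q j = (u $ (inv_into UNIV e j) + K) / (2 * K)" for j
    have "0 \<le> q j \<and> q j \<le> 1" for j
      using u[of "inv_into UNIV e j"] K by (simp add: q_def abs_le_iff divide_simps)
    then obtain s where s: "0 \<le> s" "s \<le> 1" "\<And>j. j < CARD('m) \<Longrightarrow> space_filling CARD('m) j s = q j"
      by (rule space_filling_surj[of "CARD('m)" q]) blast
    have "P s = u"
    proof (subst vec_eq_iff, rule allI)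
      fix i
      have "e i < CARD('m)" using e by (auto simp: bij_betw_def)
      moreover have "inv_into UNIV e (e i) = i" by (rule inv_into_f_f) (use e in \<open>auto simp: bij_betw_def\<close>)
      ultimately show "P s $ i = u $ i" using K by (simp add: P_def s(3) q_def)
    qed
    then show "\<exists>s. 0 \<le> s \<and> s \<le> 1 \<and> P s = u" using s by blast
  qed
qed

lemma lborel_interval_eq_lebesgue_on:
  fixes f :: "real \<Rightarrow> real"
  assumes "f \<in> borel_measurable borel"
  shows "(LINT t|lborel. indicator {0..T} t * f t) = (LINT t|lebesgue_on {0..T}. f t)"
proof -
  have "(LINT t|lebesgue_on {0..T}. f t) = (LINT t|lebesgue. indicator {0..T} t *\<^sub>R f t)"
    by (rule integral_restrict_space) simp
  also have "\<dots> = (LINT t|lborel. indicator {0..T} t *\<^sub>R f t)" by (rule integral_completion) (use assms in simp)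
  finally show ?thesis by simp
qed

lemma measurable_lebesgue_on_borel: "f \<in> borel_measurable borel \<Longrightarrow> f \<in> borel_measurable (lebesgue_on S)"
  by (intro measurable_restrict_space1 measurable_completion) simp

text \<open>Test with the negative part of \<open>y\<close>, extended by constants beyond
  \<open>[0, T]\<close>: the integral is then minus that of its square, which must vanish.\<close>

lemma nonneg_from_weighted_integrals:
  fixes y :: "real \<Rightarrow> real"
  assumes T: "0 < T" and y: "continuous_on {0..T} y"
    and int: "\<And>\<theta>. continuous_on UNIV \<theta> \<Longrightarrow> (\<And>t. 0 \<le> \<theta> t) \<Longrightarrow> 0 \<le> integral {0..T} (\<lambda>t. \<theta> t * y t)"
    and t: "t \<in> {0..T}"
  shows "0 \<le> y t"
proof -
  define \<theta> where "\<theta> t = max 0 (- y (max 0 (min T t)))" for t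
  have c: "continuous_on UNIV \<theta>" unfolding \<theta>_def
    by (intro continuous_intros continuous_on_compose2[OF y]) (use T in auto)
  have e: "\<theta> t * y t = - (\<theta> t)\<^sup>2" if "t \<in> {0..T}" for t
    using that by (auto simp: \<theta>_def power2_eq_square max_def)
  have cs: "continuous_on {0..T} (\<lambda>t. (\<theta> t)\<^sup>2)" by (intro continuous_intros continuous_on_subset[OF c]) simp
  have "0 \<le> integral {0..T} (\<lambda>t. \<theta> t * y t)" by (rule int[OF c]) (simp add: \<theta>_def)
  also have "\<dots> = integral {0..T} (\<lambda>t. - (\<theta> t)\<^sup>2)" by (rule Henstock_Kurzweil_Integration.integral_cong) (rule e)
  finally have "integral {0..T} (\<lambda>t. (\<theta> t)\<^sup>2) \<le> 0" by simp
  moreover have "0 \<le> integral {0..T} (\<lambda>t. (\<theta> t)\<^sup>2)" by (rule Henstock_Kurzweil_Integration.integral_nonneg[OF integrable_continuous_real[OF cs]]) simp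
  ultimately have "integral {0..T} (\<lambda>t. (\<theta> t)\<^sup>2) = 0" by simp
  then have "(\<theta> t)\<^sup>2 = 0" using integral_eq_0_iff[OF cs T] t by simp
  then have "max 0 (- y t) = 0" using t by (simp add: \<theta>_def)
  then show ?thesis by (simp add: max_def split: if_splits)
qed

section \<open>Reconstruction of an admissible control from a feasible pair\<close>

context lp_solution
begin

lemma U_nonempty: "U \<noteq> {}"
proof
  assume "U = {}"
  then have "space \<mu> = {}" by (simp add: space)
  then have "measure \<mu> (space \<mu>) = 0" by simp
  then show False using time_integral[of "\<lambda>_. 1"] T by simp
qed

text \<open>Membership in \<open>U\<close>, the prescribed value of \<open>B\<close> and the cost
  bound are combined into one nonnegative function \<open>W\<close> of the curve parameter; since
  \<open>U\<close> is closed, its zeros are exactly the parameters of suitable controls, and the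
  smallest one is measurable in time.\<close>

lemma measurable_selection:
  fixes B :: "real^'m \<Rightarrow> 'h::real_normed_vector"
  assumes B: "bounded_linear B" and v: "\<And>i. v i \<in> borel_measurable borel" and \<eta>: "\<eta> \<in> borel_measurable borel" and Nl: "negligible Nl"
    and ex: "\<And>t. t \<in> {0..T} - Nl \<Longrightarrow> \<exists>u\<in>U. B u = B (\<chi> i. v i t) \<and> eval_tu h t u \<le> \<eta> t"
  obtains u where "u \<in> controls T U" "\<And>t. t \<in> {0..T} - Nl \<Longrightarrow> B (u t) = B (\<chi> i. v i t) \<and> eval_tu h t (u t) \<le> \<eta> t"
proof -
  obtain u0 where u0: "u0 \<in> U" using U_nonempty by blast
  obtain K where K: "0 < K" "\<And>u. u \<in> U \<Longrightarrow> norm u \<le> K" using compact_imp_bounded[OF U] by (auto simp: bounded_pos)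
  obtain P :: "real \<Rightarrow> real^'m" where P: "continuous_on UNIV P"
    "\<And>u. (\<And>i. \<bar>u $ i\<bar> \<le> K) \<Longrightarrow> \<exists>s. 0 \<le> s \<and> s \<le> 1 \<and> P s = u" using box_parametrisation[OF K(1)] by blast
  have Pc: "continuous_on S P" for S by (rule continuous_on_subset[OF P(1)]) simp
  define W where "W s t = max 0 (eval_tu h t (P s) - \<eta> t) + infdist (P s) U + norm (B (P s) - B (\<chi> i. v i t))" for s t
  have hs: "continuous_on S (\<lambda>s. eval_tu h t (P s))" for S t
  proof -
    have "continuous_on S (\<lambda>s. (t, P s))" by (intro continuous_intros Pc)
    from continuous_on_compose2[OF eval_tu_continuous this, of h] show ?thesis by simp
  qed
  have ht: "(\<lambda>t. eval_tu h t p) \<in> borel_measurable borel" for p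
  proof -
    have "continuous_on UNIV (\<lambda>t :: real. (t, p))" by (intro continuous_intros)
    from continuous_on_compose2[OF eval_tu_continuous this, of h] show ?thesis
      by (intro borel_measurable_continuous_onI) simp
  qed
  have vm: "(\<lambda>t. \<chi> i. v i t) \<in> borel_measurable borel"
    by (subst borel_measurable_euclidean_space) (auto simp: Basis_vec_def inner_axis v)
  have Bv: "(\<lambda>t. norm (B p - B (\<chi> i. v i t))) \<in> borel_measurable borel" for p
    by (rule measurable_compose[OF vm borel_measurable_continuous_onI])
       (intro continuous_intros linear_continuous_on[OF B])
  obtain \<tau> where \<tau>: "\<tau> \<in> borel_measurable borel" "\<And>t. 0 \<le> \<tau> t \<and> \<tau> t \<le> 1"
    and \<tau>0: "\<And>t s. 0 \<le> s \<Longrightarrow> s \<le> 1 \<Longrightarrow> W s t = 0 \<Longrightarrow> W (\<tau> t) t = 0"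
  proof (rule measurable_minimal_zero[of W borel])
    show "continuous_on {0..1} (\<lambda>s. W s t)" for t
      unfolding W_def by (intro continuous_intros hs Pc continuous_on_compose2[OF linear_continuous_on[OF B] Pc] continuous_on_infdist) auto
    show "W s \<in> borel_measurable borel" for s unfolding W_def using ht \<eta> Bv by (intro borel_measurable_add borel_measurable_max borel_measurable_diff) auto
    show "0 \<le> W s t" for s t by (simp add: W_def infdist_nonneg)
  qed blast
  \<comment> \<open>On the null set, where a zero is not guaranteed, a fixed point of
    \<open>U\<close> keeps the control in \<open>U\<close> at every time.\<close>
  define u where "u t = (if t \<in> Nl then u0 else P (\<tau> t))" for t
  have good: "P (\<tau> t) \<in> U \<and> B (P (\<tau> t)) = B (\<chi> i. v i t) \<and> eval_tu h t (P (\<tau> t)) \<le> \<eta> t" if t: "t \<in> {0..T} - Nl" for t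
  proof -
    obtain p where p: "p \<in> U" "B p = B (\<chi> i. v i t)" "eval_tu h t p \<le> \<eta> t" using ex[OF t] by blast
    have "\<bar>p $ i\<bar> \<le> K" for i using component_le_norm_cart[of p i] K(2)[OF p(1)] by linarith
    then obtain s where s: "0 \<le> s" "s \<le> 1" "P s = p" using P(2) by blast
    have "W s t = 0" using p by (simp add: W_def s)
    from \<tau>0[OF s(1,2) this] have "max 0 (eval_tu h t (P (\<tau> t)) - \<eta> t) + infdist (P (\<tau> t)) U + norm (B (P (\<tau> t)) - B (\<chi> i. v i t)) = 0"
      by (simp add: W_def)
    moreover have "0 \<le> max 0 (eval_tu h t (P (\<tau> t)) - \<eta> t)" "0 \<le> infdist (P (\<tau> t)) U" "0 \<le> norm (B (P (\<tau> t)) - B (\<chi> i. v i t))"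
      by (simp_all add: infdist_nonneg)
    ultimately have "max 0 (eval_tu h t (P (\<tau> t)) - \<eta> t) = 0" "infdist (P (\<tau> t)) U = 0" "norm (B (P (\<tau> t)) - B (\<chi> i. v i t)) = 0"
      by linarith+
    then show ?thesis using in_closed_iff_infdist_zero[OF compact_imp_closed[OF U] U_nonempty] by (auto simp: max_def split: if_splits)
  qed
  have uU: "u t \<in> U" if "t \<in> {0..T}" for t using good[of t] u0 that by (auto simp: u_def)
  have "u \<in> borel_measurable lebesgue" unfolding u_def
  proof (rule measurable_If)
    have "(\<lambda>t. P (\<tau> t)) \<in> borel_measurable borel" by (rule measurable_compose[OF \<tau>(1) borel_measurable_continuous_onI[OF P(1)]])
    then show "(\<lambda>t. P (\<tau> t)) \<in> borel_measurable lebesgue" by (intro measurable_completion) simp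
    have "Nl \<in> sets lebesgue" using Nl by (rule negligible_imp_sets)
    then show "{t \<in> space lebesgue. t \<in> Nl} \<in> sets lebesgue" by simp
  qed simp
  then have "u \<in> borel_measurable (lebesgue_on {0..T})" by (rule measurable_restrict_space1)
  moreover have "bounded (u ` {0..T})" by (rule bounded_subset[OF compact_imp_bounded[OF U]]) (use uU in auto)
  ultimately have "u \<in> controls T U" using uU by (auto simp: controls_def)
  then show thesis by (rule that) (use good in \<open>simp add: u_def\<close>)
qed

text \<open>The mean control at time \<open>t\<close> is replaced by a control in \<open>U\<close>
  with the same value of \<open>B\<close> and cost at most the mean cost. Since \<open>b k\<close>
  factors through \<open>B\<close>, the modes are driven as by the means; a weak comparison then
  identifies them with the mean states, which inherit the interval constraints.\<close>

lemma control_from_measure: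
  fixes B :: "real^'m \<Rightarrow> 'h::real_normed_vector"
  assumes B: "bounded_linear B" and conv: "\<And>t. t \<in> {0..T} \<Longrightarrow> ereal_convex (fibre_cost A B U h t z)"
    and bB: "\<And>k u v. B u = B v \<Longrightarrow> b k u = b k v"
    and Z': "\<And>k. k \<in> {1..N} \<Longrightarrow> Z k = {zlo k..zhi k} \<and> ZT k = {zTlo k..zThi k}"
  shows "\<exists>u\<in>modal_controls N lam b U Z ZT T \<zeta>. cost T h u \<le> (LINT (t, z, u)|\<mu>. eval_tu h t u)"
proof -
  let ?L = "lebesgue_on {0..T}"
  have hcc: "continuous_on UNIV (\<lambda>x :: real \<times> (nat \<Rightarrow> real) \<times> (real^'m). eval_tu h (fst x) (snd (snd x)))"
  proof -
    have "continuous_on UNIV (\<lambda>x :: real \<times> (nat \<Rightarrow> real) \<times> (real^'m). (fst x, snd (snd x)))" by (intro continuous_intros)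
    from continuous_on_compose2[OF eval_tu_continuous this, of h] show ?thesis by simp
  qed
  \<comment> \<open>\<open>v i\<close> is the conditional mean of control \<open>i\<close> given
    time; \<open>\<eta>\<close> below is that of the cost.\<close>
  have "\<exists>v. integrable lborel v \<and> (\<forall>w C. w \<in> borel_measurable borel \<longrightarrow> (\<forall>t. \<bar>w t\<bar> \<le> C) \<longrightarrow> (LINT t|lborel. v t * w t) = (LINT x|\<mu>. snd (snd x) $ i * (w (fst x) :: real)))" for i
    by (rule time_density[of "\<lambda>x. snd (snd x) $ i"], intro continuous_intros) blast
  then have "\<forall>i. \<exists>v. integrable lborel v \<and> (\<forall>w C. w \<in> borel_measurable borel \<longrightarrow> (\<forall>t. \<bar>w t\<bar> \<le> C) \<longrightarrow> (LINT t|lborel. v t * w t) = (LINT x|\<mu>. snd (snd x) $ i * (w (fst x) :: real)))" ..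
  from choice[OF this] obtain v where v: "\<And>i. integrable lborel (v i)"
      "\<And>i w C. w \<in> borel_measurable borel \<Longrightarrow> (\<And>t. \<bar>w t\<bar> \<le> C) \<Longrightarrow> (LINT t|lborel. v i t * w t) = (LINT x|\<mu>. snd (snd x) $ i * (w (fst x) :: real))"
    by blast
  obtain \<eta> where \<eta>: "integrable lborel \<eta>"
      "\<And>w C. w \<in> borel_measurable borel \<Longrightarrow> (\<And>t. \<bar>w t\<bar> \<le> C) \<Longrightarrow> (LINT t|lborel. \<eta> t * w t) = (LINT x|\<mu>. eval_tu h (fst x) (snd (snd x)) * (w (fst x) :: real))"
    by (rule time_density[OF hcc]) blast
  have vm: "v i \<in> borel_measurable borel" for i using borel_measurable_integrable[OF v(1)] by simp
  have \<eta>m: "\<eta> \<in> borel_measurable borel" using borel_measurable_integrable[OF \<eta>(1)] by simp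
  obtain Nl where Nl: "negligible Nl" "\<And>t. t \<in> {0..T} - Nl \<Longrightarrow> \<exists>u\<in>U. B u = B (\<chi> i. v i t) \<and> eval_tu h t u \<le> \<eta> t"
    by (rule time_slices[OF B conv v \<eta>]) blast+
  obtain u where u: "u \<in> controls T U" and uN: "\<And>t. t \<in> {0..T} - Nl \<Longrightarrow> B (u t) = B (\<chi> i. v i t) \<and> eval_tu h t (u t) \<le> \<eta> t"
    by (rule measurable_selection[OF B vm \<eta>m Nl]) blast+
  have um: "u \<in> borel_measurable ?L" and uU: "\<And>t. t \<in> {0..T} \<Longrightarrow> u t \<in> U" using u by (auto simp: controls_def)
  have AEI: "AE t in ?L. Q t" if "\<And>t. t \<in> {0..T} - Nl \<Longrightarrow> Q t" for Q by (rule AE_lebesgue_on_negligible[OF Nl(1) _ that]) simp_all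
  have bc: "continuous_on S (b k)" for S k using b by (simp add: linear_continuous_on linear_conv_bounded_linear)
  have "\<exists>K. \<forall>p\<in>U. \<bar>b k p\<bar> \<le> K" for k
    using compact_imp_bounded[OF compact_continuous_image[OF bc U]] by (force simp: bounded_iff)
  then obtain K where K: "\<And>k p. p \<in> U \<Longrightarrow> \<bar>b k p\<bar> \<le> K k" by metis
  have bum: "(\<lambda>t. b k (u t)) \<in> borel_measurable ?L" for k by (rule measurable_compose[OF um borel_measurable_continuous_onI[OF bc]])
  have bub: "\<bar>b k (u t)\<bar> \<le> K k" if "0 \<le> t" "t \<le> T" for t k using K uU that by simp
  define zz where "zz t k = exp (lam k * t) * (\<zeta> k + (LINT s|lebesgue_on {0..t}. exp (- lam k * s) * b k (u s)))" for t k
  have zz: "abs_continuous_on 0 T (\<lambda>t. zz t k)" "zz 0 k = \<zeta> k"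
    "AE t in ?L. ((\<lambda>t. zz t k) has_real_derivative lam k * zz t k + b k (u t)) (at t within {0..T})" for k
    using duhamel[where l = "lam k" and \<zeta> = "\<zeta> k", OF less_imp_le[OF T] bum bub] by (simp_all add: zz_def)
  have zzc: "continuous_on {0..T} (\<lambda>t. zz t k)" for k by (rule abs_continuous_imp_continuous[OF zz(1)])
  have coord: "continuous_on UNIV (\<lambda>x :: real \<times> (nat \<Rightarrow> real) \<times> (real^'m). fst (snd x) k)" for k
    by (rule continuous_on_product_then_coordinatewise) (intro continuous_intros)
  have bcoord: "continuous_on UNIV (\<lambda>x :: real \<times> (nat \<Rightarrow> real) \<times> (real^'m). b k (snd (snd x)))" for k
    by (rule continuous_on_compose2[OF bc]) (auto intro!: continuous_intros)
  \<comment> \<open>The means and the chosen control have the same effect on mode \<open>k\<close>,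
    by linearity of \<open>b k\<close> and because they have the same value of \<open>B\<close> at
    almost every time.\<close>
  have drive: "(LINT x|\<mu>. b k (snd (snd x)) * \<kappa> (fst x)) = (LINT t|?L. b k (u t) * \<kappa> t)"
    if \<kappa>: "continuous_on UNIV \<kappa>" for \<kappa> k
  proof -
    have "bounded (\<kappa> ` {0..T})" by (rule compact_imp_bounded[OF compact_continuous_image[OF continuous_on_subset[OF \<kappa>]]]) auto
    then obtain C where C: "\<And>t. t \<in> {0..T} \<Longrightarrow> \<bar>\<kappa> t\<bar> \<le> C" by (force simp: bounded_iff)
    have C0: "0 \<le> C" using C[of 0] T by (auto intro: order_trans[OF abs_ge_zero])
    \<comment> \<open>Weights have to be bounded on the whole line, while \<open>\<kappa>\<close> is
      bounded only on \<open>[0, T]\<close>; \<open>\<mu>\<close> carries no other times.\<close>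
    define w where "w t = indicator {0..T} t * \<kappa> t" for t
    have km: "\<kappa> \<in> borel_measurable borel" by (rule borel_measurable_continuous_onI[OF \<kappa>])
    have wm: "w \<in> borel_measurable borel" unfolding w_def using km by measurable
    have wb: "\<bar>w t\<bar> \<le> C" for t using C[of t] C0 by (simp add: w_def indicator_def)
    have lin: "b k p = (\<Sum>i\<in>UNIV. b k (axis i 1) * p $ i)" for p
    proof -
      interpret linear "b k" by (rule b)
      have "b k p = b k (\<Sum>i\<in>UNIV. p $ i *\<^sub>R axis i 1)" by (simp add: basis_expansion[of p, unfolded scalar_mult_eq_scaleR])
      then show ?thesis by (simp add: sum scale mult.commute)
    qed
    have iv: "integrable lborel (\<lambda>t. v i t * w t)" for i
    proof (rule Bochner_Integration.integrable_bound)
      show "integrable lborel (\<lambda>t. v i t * C)" using v(1) by simp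
      show "(\<lambda>t. v i t * w t) \<in> borel_measurable lborel" using vm wm by simp
      show "AE t in lborel. norm (v i t * w t) \<le> norm (v i t * C)"
        using wb C0 by (intro AE_I2) (simp add: abs_mult mult_left_mono)
    qed
    have im: "integrable \<mu> (\<lambda>x. snd (snd x) $ i * w (fst x))" for i by (rule integrable_weight[OF _ wm wb]) (intro continuous_intros)
    have "(LINT x|\<mu>. b k (snd (snd x)) * \<kappa> (fst x)) = (LINT x|\<mu>. (\<Sum>i\<in>UNIV. b k (axis i 1) * (snd (snd x) $ i * w (fst x))))"
      by (rule Bochner_Integration.integral_cong)
         (auto simp: space w_def lin[of "snd (snd _)"] sum_distrib_right mult.assoc)
    also have "\<dots> = (\<Sum>i\<in>UNIV. b k (axis i 1) * (LINT t|lborel. v i t * w t))" using im by (simp add: v(2)[OF wm wb])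
    also have "\<dots> = (LINT t|lborel. (\<Sum>i\<in>UNIV. b k (axis i 1) * (v i t * w t)))" using iv by simp
    also have "\<dots> = (LINT t|lborel. indicator {0..T} t * (b k (\<chi> i. v i t) * \<kappa> t))"
      by (rule Bochner_Integration.integral_cong) (auto simp: w_def lin[of "vec_lambda _"] sum_distrib_right sum_distrib_left mult_ac)
    also have "\<dots> = (LINT t|?L. b k (\<chi> i. v i t) * \<kappa> t)"
      by (rule lborel_interval_eq_lebesgue_on) (unfold lin[of "vec_lambda _"], use vm km in simp)
    also have "\<dots> = (LINT t|?L. b k (u t) * \<kappa> t)"
    proof (rule integral_cong_AE)
      show "(\<lambda>t. b k (\<chi> i. v i t) * \<kappa> t) \<in> borel_measurable ?L"
        by (rule measurable_lebesgue_on_borel) (unfold lin[of "vec_lambda _"], use vm km in simp)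
      show "(\<lambda>t. b k (u t) * \<kappa> t) \<in> borel_measurable ?L" using bum measurable_lebesgue_on_borel[OF km] by simp
      show "AE t in ?L. b k (\<chi> i. v i t) * \<kappa> t = b k (u t) * \<kappa> t"
        by (rule AEI) (use uN bB in metis)
    qed
    finally show ?thesis .
  qed
  \<comment> \<open>The product rule for \<open>\<kappa> t * zz t k\<close> is compared with the
    Liouville equation for the test function with value \<open>\<kappa> t * z k\<close>. The driving
    terms cancel, and \<open>\<theta> = \<kappa>' + lam k * \<kappa>\<close> is all that
    remains.\<close>
  have key: "\<kappa> T * ((LINT y|\<nu>. y k) - zz T k) = (LINT x|\<mu>. \<theta> (fst x) * fst (snd x) k) - integral {0..T} (\<lambda>t. \<theta> t * zz t k)"
    if k: "k \<in> {1..N}" and d: "\<And>t. (\<kappa> has_real_derivative (\<theta> t - lam k * \<kappa> t)) (at t)" and c: "continuous_on UNIV \<theta>" for k \<kappa> \<theta>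
  proof -
    have kc: "continuous_on UNIV \<kappa>" using d by (meson DERIV_continuous continuous_at_imp_continuous_on)
    have c': "continuous_on UNIV (\<lambda>t. \<theta> t - lam k * \<kappa> t)" by (intro continuous_intros c kc)
    have "(LINT y|\<nu>. \<kappa> T * y k) - \<kappa> 0 * \<zeta> k = (LINT x|\<mu>. (\<theta> (fst x) - lam k * \<kappa> (fst x)) * fst (snd x) k + (lam k * fst (snd x) k + b k (snd (snd x))) * \<kappa> (fst x))"
      using test[OF C1_time_coordinate(1)[OF d c' k]] k unfolding C1_time_coordinate(2)[OF d c' k] by simp
    also have "\<dots> = (LINT x|\<mu>. \<theta> (fst x) * fst (snd x) k + b k (snd (snd x)) * \<kappa> (fst x))"
      by (rule Bochner_Integration.integral_cong) (simp_all add: algebra_simps)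
    also have "\<dots> = (LINT x|\<mu>. \<theta> (fst x) * fst (snd x) k) + (LINT x|\<mu>. b k (snd (snd x)) * \<kappa> (fst x))"
    proof (rule Bochner_Integration.integral_add)
      have f: "continuous_on UNIV (\<lambda>x :: real \<times> (nat \<Rightarrow> real) \<times> (real^'m). g (fst x))" if "continuous_on UNIV g" for g :: "real \<Rightarrow> real"
        by (rule continuous_on_compose2[OF that]) (auto intro!: continuous_intros)
      show "integrable \<mu> (\<lambda>x. \<theta> (fst x) * fst (snd x) k)" by (intro integrable_mu continuous_on_mult f c coord)
      show "integrable \<mu> (\<lambda>x. b k (snd (snd x)) * \<kappa> (fst x))" by (intro integrable_mu continuous_on_mult f kc bcoord)
    qed
    finally have 1: "\<kappa> T * (LINT y|\<nu>. y k) - \<kappa> 0 * \<zeta> k = (LINT x|\<mu>. \<theta> (fst x) * fst (snd x) k) + (LINT t|?L. b k (u t) * \<kappa> t)"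
      unfolding drive[OF kc] by simp
    have "bounded ((\<lambda>t. \<theta> t - lam k * \<kappa> t) ` {0..T})" by (rule compact_imp_bounded[OF compact_continuous_image[OF continuous_on_subset[OF c']]]) auto
    then obtain C where C: "\<And>t. t \<in> {0..T} \<Longrightarrow> \<bar>\<theta> t - lam k * \<kappa> t\<bar> \<le> C" by (force simp: bounded_iff)
    have "abs_continuous_on 0 T \<kappa>"
    proof (rule abs_continuous_lipschitz)
      fix x y assume xy: "0 \<le> x" "x \<le> y" "y \<le> T"
      show "\<bar>\<kappa> y - \<kappa> x\<bar> \<le> C * (y - x)"
      proof (cases "x = y")
        case False
        then have "x < y" using xy by simp
        from MVT2[OF this, of \<kappa> "\<lambda>t. \<theta> t - lam k * \<kappa> t"] d obtain \<xi> where "x < \<xi>" "\<xi> < y" "\<kappa> y - \<kappa> x = (y - x) * (\<theta> \<xi> - lam k * \<kappa> \<xi>)" by blast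
        then show ?thesis using C[of \<xi>] xy by (simp add: abs_mult mult.commute mult_left_mono)
      qed simp
    qed
    then have ac: "abs_continuous_on 0 T (\<lambda>t. \<kappa> t * zz t k)" by (rule abs_continuous_mult[OF _ zz(1)])
    have "((\<lambda>t. \<theta> t * zz t k + b k (u t) * \<kappa> t) has_integral (\<kappa> T * zz T k - \<kappa> 0 * zz 0 k)) {0..T}"
    proof (rule fundamental_theorem_abs_continuous[OF less_imp_le[OF T] ac])
      show "AE t in ?L. ((\<lambda>t. \<kappa> t * zz t k) has_real_derivative \<theta> t * zz t k + b k (u t) * \<kappa> t) (at t within {0..T})"
        using zz(3)[of k]
      proof eventually_elim
        case (elim t)
        from DERIV_mult[OF has_field_derivative_at_within[OF d[of t]] elim] show ?case by (simp add: algebra_simps)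
      qed
    qed
    then have 2: "integral {0..T} (\<lambda>t. \<theta> t * zz t k + b k (u t) * \<kappa> t) = \<kappa> T * zz T k - \<kappa> 0 * \<zeta> k"
      by (simp add: integral_unique zz(2))
    have i1: "(\<lambda>t. \<theta> t * zz t k) integrable_on {0..T}"
      by (intro integrable_continuous_real continuous_on_mult zzc continuous_on_subset[OF c]) simp
    have "bounded (\<kappa> ` {0..T})" by (rule compact_imp_bounded[OF compact_continuous_image[OF continuous_on_subset[OF kc]]]) auto
    then obtain C' where C': "\<And>t. t \<in> {0..T} \<Longrightarrow> \<bar>\<kappa> t\<bar> \<le> C'" by (force simp: bounded_iff)
    have i2: "integrable ?L (\<lambda>t. b k (u t) * \<kappa> t)"
    proof (rule integrable_lebesgue_on_bounded)
      show "(\<lambda>t. b k (u t) * \<kappa> t) \<in> borel_measurable ?L"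
        using bum measurable_lebesgue_on_borel[OF borel_measurable_continuous_onI[OF kc]] by simp
      show "norm (b k (u t) * \<kappa> t) \<le> K k * C'" if t: "0 \<le> t" "t \<le> T" for t
        unfolding real_norm_def abs_mult using bub[OF t] C'[of t] t
        by (intro mult_mono) (auto intro: order_trans[OF abs_ge_zero])
    qed
    have "(LINT t|?L. b k (u t) * \<kappa> t) = integral {0..T} (\<lambda>t. b k (u t) * \<kappa> t)" using integral_eq_lebesgue_on(2)[OF i2] by simp
    then show ?thesis using 1 2 Henstock_Kurzweil_Integration.integral_add[OF i1 integral_eq_lebesgue_on(1)[OF i2]]
      by (simp add: right_diff_distrib)
  qed
  \<comment> \<open>With \<open>\<kappa> t = exp (- lam k * t)\<close> the weight
    \<open>\<theta>\<close> vanishes, and the factor in front is not zero.\<close>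
  have terminal: "zz T k = (LINT y|\<nu>. y k)" if k: "k \<in> {1..N}" for k
  proof -
    have "exp (- lam k * T) * ((LINT y|\<nu>. y k) - zz T k) = (LINT x|\<mu>. 0 * fst (snd x) k) - integral {0..T} (\<lambda>t. 0 * zz t k)"
      by (rule key[OF k]) (auto intro!: derivative_eq_intros)
    then show ?thesis by simp
  qed
  \<comment> \<open>For a prescribed \<open>\<theta>\<close> the equation for
    \<open>\<kappa>\<close> is solved by variation of constants; the terminal contribution is zero
    by the previous step.\<close>
  have weak: "(LINT x|\<mu>. \<theta> (fst x) * fst (snd x) k) = integral {0..T} (\<lambda>t. \<theta> t * zz t k)"
    if k: "k \<in> {1..N}" and c: "continuous_on UNIV \<theta>" for k and \<theta> :: "real \<Rightarrow> real"
  proof -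
    have "continuous_on UNIV (\<lambda>t. exp (lam k * t) * \<theta> t)" by (intro continuous_intros c)
    then obtain G where G: "\<And>t. (G has_real_derivative exp (lam k * t) * \<theta> t) (at t)" using antiderivative_UNIV by blast
    have "exp (- lam k * T) * G T * ((LINT y|\<nu>. y k) - zz T k) = (LINT x|\<mu>. \<theta> (fst x) * fst (snd x) k) - integral {0..T} (\<lambda>t. \<theta> t * zz t k)"
    proof (rule key[OF k _ c])
      fix t
      have "((\<lambda>t. exp (- lam k * t)) has_real_derivative - lam k * exp (- lam k * t)) (at t)" by (auto intro!: derivative_eq_intros)
      from DERIV_mult[OF this G[of t]]
      show "((\<lambda>t. exp (- lam k * t) * G t) has_real_derivative \<theta> t - lam k * (exp (- lam k * t) * G t)) (at t)"
        by (simp add: algebra_simps flip: exp_add mult_exp_exp)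
    qed
    then show ?thesis using terminal[OF k] by simp
  qed
  have nui: "integrable \<nu> (\<lambda>y. y k)" for k
    by (rule integrable_continuous_compact[OF fin(2) sets(2) compact_states(2)]) (rule continuous_on_product_coordinates)
  have zT: "zz T k \<in> ZT k" if k: "k \<in> {1..N}" for k
  proof -
    interpret \<nu>: finite_measure \<nu> by (rule fin)
    have b: "y k \<in> {zTlo k..zThi k}" if "y \<in> space \<nu>" for y
    proof -
      have "y k \<in> ZT k" using that k unfolding space by (rule PiE_mem)
      then show ?thesis using Z'[OF k] by blast
    qed
    have "(LINT y|\<nu>. zTlo k) \<le> (LINT y|\<nu>. y k)" by (rule integral_mono) (use nui b in auto)
    moreover have "(LINT y|\<nu>. y k) \<le> (LINT y|\<nu>. zThi k)" by (rule integral_mono) (use nui b in auto)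
    ultimately have "zz T k \<in> {zTlo k..zThi k}" unfolding terminal[OF k] by (simp add: nu_total)
    then show ?thesis using Z'[OF k] by blast
  qed
  have zZ: "zz t k \<in> Z k" if k: "k \<in> {1..N}" and t: "t \<in> {0..T}" for k t
  proof -
    have b: "fst (snd x) k \<in> {zlo k..zhi k}" if "x \<in> space \<mu>" for x
    proof -
      have "fst (snd x) \<in> (\<Pi>\<^sub>E k\<in>{1..N}. Z k)" using that unfolding space by (simp only: mem_Times_iff)
      then have "fst (snd x) k \<in> Z k" by (rule PiE_mem[OF _ k])
      then show ?thesis using Z'[OF k] by blast
    qed
    have f: "continuous_on UNIV (\<lambda>x :: real \<times> (nat \<Rightarrow> real) \<times> (real^'m). g (fst x))" if "continuous_on UNIV g" for g :: "real \<Rightarrow> real"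
      by (rule continuous_on_compose2[OF that]) (auto intro!: continuous_intros)
    \<comment> \<open>One affine formula serves both ends of the interval, with
      \<open>(a, c)\<close> equal to \<open>(1, - zlo k)\<close> and to
      \<open>(-1, zhi k)\<close>.\<close>
    have w: "integral {0..T} (\<lambda>t. \<theta> t * (a * zz t k + c)) = (LINT x|\<mu>. \<theta> (fst x) * (a * fst (snd x) k + c))"
      if \<theta>: "continuous_on UNIV \<theta>" for \<theta> a c
    proof -
      have ci: "continuous_on {0..T} \<theta>" by (rule continuous_on_subset[OF \<theta>]) simp
      have i: "(\<lambda>t. \<theta> t * zz t k) integrable_on {0..T}" "\<theta> integrable_on {0..T}"
        by (intro integrable_continuous_real continuous_on_mult zzc ci)+
      have "integral {0..T} (\<lambda>t. \<theta> t * (a * zz t k + c)) = integral {0..T} (\<lambda>t. a * (\<theta> t * zz t k) + c * \<theta> t)"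
        by (rule Henstock_Kurzweil_Integration.integral_cong) (simp add: algebra_simps)
      also have "\<dots> = a * integral {0..T} (\<lambda>t. \<theta> t * zz t k) + c * integral {0..T} \<theta>"
        using i by (subst Henstock_Kurzweil_Integration.integral_add) (auto intro: integrable_on_mult_right)
      also have "\<dots> = a * (LINT x|\<mu>. \<theta> (fst x) * fst (snd x) k) + c * (LINT x|\<mu>. \<theta> (fst x))"
        unfolding weak[OF k \<theta>] time_integral[OF \<theta>] ..
      also have "\<dots> = (LINT x|\<mu>. a * (\<theta> (fst x) * fst (snd x) k) + c * \<theta> (fst x))"
        using integrable_mu[OF continuous_on_mult[OF f[OF \<theta>] coord]] integrable_mu[OF f[OF \<theta>]] by simp
      also have "\<dots> = (LINT x|\<mu>. \<theta> (fst x) * (a * fst (snd x) k + c))"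
        by (rule Bochner_Integration.integral_cong) (simp_all add: algebra_simps)
      finally show ?thesis .
    qed
    have "0 \<le> 1 * zz t k + - zlo k"
    proof (rule nonneg_from_weighted_integrals[OF T _ _ t])
      show "0 \<le> integral {0..T} (\<lambda>t. \<theta> t * (1 * zz t k + - zlo k))" if "continuous_on UNIV \<theta>" "\<And>t. 0 \<le> \<theta> t" for \<theta>
        unfolding w[OF that(1)] by (rule Bochner_Integration.integral_nonneg) (use b that(2) in auto)
    qed (intro continuous_intros zzc)
    moreover have "0 \<le> (-1) * zz t k + zhi k"
    proof (rule nonneg_from_weighted_integrals[OF T _ _ t])
      show "0 \<le> integral {0..T} (\<lambda>t. \<theta> t * ((-1) * zz t k + zhi k))" if "continuous_on UNIV \<theta>" "\<And>t. 0 \<le> \<theta> t" for \<theta>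
        unfolding w[OF that(1)] by (rule Bochner_Integration.integral_nonneg) (use b that(2) in auto)
    qed (intro continuous_intros zzc)
    ultimately show ?thesis using Z'[OF k] by simp
  qed
  have "modal_solution N lam b T \<zeta> u zz" unfolding modal_solution_def modal_rhs_def using zz by blast
  moreover have "AE t in ?L. \<forall>k\<in>{1..N}. zz t k \<in> Z k" by (rule AEI) (use zZ in blast)
  ultimately have mc: "u \<in> modal_controls N lam b U Z ZT T \<zeta>" using u zT unfolding modal_controls_def by blast
  have "cost T h u \<le> (LINT t|?L. \<eta> t)"
    unfolding cost_def
  proof (rule integral_mono_AE)
    have "(\<lambda>t. (t, u t)) \<in> borel_measurable ?L" by (rule borel_measurable_Pair[OF measurable_lebesgue_on_borel um]) simp
    from measurable_compose[OF this borel_measurable_continuous_onI[OF eval_tu_continuous]]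
    have hm: "(\<lambda>t. eval_tu h t (u t)) \<in> borel_measurable ?L" by simp
    have "bounded ((\<lambda>x. eval_tu h (fst x) (snd x)) ` ({0..T} \<times> U))"
      by (rule compact_imp_bounded[OF compact_continuous_image[OF continuous_on_subset[OF eval_tu_continuous]]]) (auto intro: compact_Times U)
    then obtain C where C: "\<And>x. x \<in> {0..T} \<times> U \<Longrightarrow> \<bar>eval_tu h (fst x) (snd x)\<bar> \<le> C" by (force simp: bounded_iff)
    show "integrable ?L (\<lambda>t. eval_tu h t (u t))"
      by (rule integrable_lebesgue_on_bounded[OF hm, of C]) (use C[of "(_, u _)"] uU in auto)
    have "integrable lebesgue \<eta>" using \<eta>(1) \<eta>m by (simp add: integrable_completion)
    from integrable_mult_indicator[OF _ this, of "{0..T}"]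
    show "integrable ?L \<eta>" by (subst integrable_restrict_space) simp_all
    show "AE t in ?L. eval_tu h t (u t) \<le> \<eta> t" by (rule AEI) (use uN in blast)
  qed
  \<comment> \<open>The indicator is a bounded weight, so the defining property of
    \<open>\<eta>\<close> turns the time integral back into an integral over
    \<open>\<mu>\<close>.\<close>
  also have "\<dots> = (LINT t|lborel. \<eta> t * indicator {0..T} t)"
    using lborel_interval_eq_lebesgue_on[OF \<eta>m, of T] by (simp add: mult.commute)
  also have "\<dots> = (LINT x|\<mu>. eval_tu h (fst x) (snd (snd x)) * indicator {0..T} (fst x))"
    by (rule \<eta>(2)[of _ 1]) (auto simp: indicator_def)
  also have "\<dots> = (LINT x|\<mu>. eval_tu h (fst x) (snd (snd x)))"
    by (rule Bochner_Integration.integral_cong) (auto simp: space)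
  finally show ?thesis using mc by (intro bexI[of _ u]) (simp_all add: split_def)
qed

end

section \<open>Comparison of the values\<close>

text \<open>Monotone values converge to their supremum, which the linear program bounds from above.
  A gap would contain a real \<open>c\<close>; every order then has a feasible point of value at
  most \<open>c\<close>, and a limit of these is feasible for the linear program. Choosing
  \<open>c\<close> real also handles infinite values.\<close>

lemma sdp_value_tendsto_lp_value:
  fixes b :: "nat \<Rightarrow> real^'m::finite \<Rightarrow> real"
  assumes b: "\<And>k. linear (b k)" and U: "compact U" "U = basic_semialgebraic s w"
    and ball: "\<exists>j\<in>{1..s}. \<exists>M. w j = ball_poly M" and T: "0 < T"
    and Z: "\<And>k. k \<in> {1..N} \<Longrightarrow> zlo k \<le> zhi k \<and> Z k = {zlo k..zhi k}"
    and ZT: "\<And>k. k \<in> {1..N} \<Longrightarrow> zTlo k \<le> zThi k \<and> ZT k = {zTlo k..zThi k}"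
  shows "(\<lambda>r. sdp_value N r lam b s w zlo zhi zTlo zThi T \<zeta> h) \<longlonglongrightarrow> lp_value N lam b U Z ZT T \<zeta> h"
proof -
  let ?S = "\<lambda>r. sdp_value N r lam b s w zlo zhi zTlo zThi T \<zeta> h" and ?L = "lp_value N lam b U Z ZT T \<zeta> h"
  have "incseq ?S" by (rule incseq_SucI, rule sdp_value_mono) simp
  then have lim: "?S \<longlonglongrightarrow> (SUP r. ?S r)" by (rule LIMSEQ_SUP)
  have le: "?S r \<le> ?L" for r
    unfolding lp_value_def
  proof (rule INF_greatest)
    fix p assume p: "p \<in> lp_feasible N lam b U Z ZT T \<zeta>"
    obtain \<mu> \<nu> where p': "p = (\<mu>, \<nu>)" by (cases p)
    obtain y yT where y: "(y, yT) \<in> sdp_feasible N r lam b s w zlo zhi zTlo zThi T \<zeta>"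
      "ell (\<lambda>(p, \<beta>). y (p, 0, \<beta>)) h = (LINT (t, z, u)|\<mu>. eval_tu h t u)"
      using lp_feasible_imp_sdp_feasible[OF p[unfolded p'] b U conjunct2[OF Z] conjunct2[OF ZT] zmon_C1, of r h] by blast
    show "?S r \<le> (case p of (\<mu>, \<nu>) \<Rightarrow> ereal (LINT (t, z, u)|\<mu>. eval_tu h t u))"
      unfolding sdp_value_def by (rule INF_lower2[OF y(1)]) (simp add: p' y(2))
  qed
  have "(SUP r. ?S r) = ?L"
  proof (rule antisym)
    show "(SUP r. ?S r) \<le> ?L" by (rule SUP_least) (rule le)
    show "?L \<le> (SUP r. ?S r)"
    proof (rule ccontr)
      assume "\<not> ?L \<le> (SUP r. ?S r)"
      then obtain c where c: "(SUP r. ?S r) < ereal c" "ereal c < ?L"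
        using ereal_dense2 unfolding not_le by blast
      have "\<exists>p. p \<in> sdp_feasible N r lam b s w zlo zhi zTlo zThi T \<zeta> \<and> ell (\<lambda>(q, \<beta>). fst p (q, 0, \<beta>)) h \<le> c" for r
      proof -
        have "?S r < ereal c" using c(1) by (rule le_less_trans[OF SUP_upper[OF UNIV_I]])
        then obtain p where "p \<in> sdp_feasible N r lam b s w zlo zhi zTlo zThi T \<zeta>"
          "(case p of (y, yT) \<Rightarrow> ereal (ell (\<lambda>(p, \<beta>). y (p, 0, \<beta>)) h)) < ereal c"
          unfolding sdp_value_def INF_less_iff by blast
        then show ?thesis by (intro exI[of _ p]) (auto simp: split_beta)
      qed
      then obtain p where p: "\<And>r. p r \<in> sdp_feasible N r lam b s w zlo zhi zTlo zThi T \<zeta>"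
        "\<And>r. ell (\<lambda>(q, \<beta>). fst (p r) (q, 0, \<beta>)) h \<le> c" by metis
      interpret sdp_sequence N lam b s w zlo zhi zTlo zThi T \<zeta> "\<lambda>r. fst (p r)" "\<lambda>r. snd (p r)"
        by unfold_locales (use p(1) T ball in simp_all)
      obtain \<mu> \<nu> where mn: "(\<mu>, \<nu>) \<in> lp_feasible N lam b U Z ZT T \<zeta>" "(LINT (t, z, u)|\<mu>. eval_tu h t u) \<le> c"
        using limit_in_lp[OF p(2) b U Z ZT] by blast
      have "?L \<le> ereal c" unfolding lp_value_def by (rule INF_lower2[OF mn(1)]) (simp add: mn(2))
      with c(2) show False by simp
    qed
  qed
  with lim show ?thesis by simp
qed

text \<open>One inequality comes from occupation measures, the other from the control built from a
  feasible pair. The fixed \<open>z\<close> enters the fibre cost through the translation by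
  \<open>A z\<close>.\<close>

lemma lp_value_eq_modal_value:
  fixes b :: "nat \<Rightarrow> real^'m::finite \<Rightarrow> real" and B :: "real^'m \<Rightarrow> 'h::real_normed_vector"
  assumes b: "\<And>k. linear (b k)" and U: "compact U" and T: "0 < T"
    and Z: "\<And>k. k \<in> {1..N} \<Longrightarrow> zlo k \<le> zhi k \<and> Z k = {zlo k..zhi k}"
    and ZT: "\<And>k. k \<in> {1..N} \<Longrightarrow> zTlo k \<le> zThi k \<and> ZT k = {zTlo k..zThi k}"
    and B: "bounded_linear B" and conv: "\<And>t. t \<in> {0..T} \<Longrightarrow> ereal_convex (fibre_cost A B U h t z)"
    and bB: "\<And>k u v. B u = B v \<Longrightarrow> b k u = b k v"
  shows "lp_value N lam b U Z ZT T \<zeta> h = modal_value N lam b U Z ZT T \<zeta> h"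
proof (rule antisym)
  have bc: "continuous_on UNIV (b k)" for k using b by (simp add: linear_continuous_on linear_conv_bounded_linear)
  show "lp_value N lam b U Z ZT T \<zeta> h \<le> modal_value N lam b U Z ZT T \<zeta> h"
    unfolding modal_value_def
  proof (rule INF_greatest)
    fix u assume u: "u \<in> modal_controls N lam b U Z ZT T \<zeta>"
    obtain \<mu> \<nu> where mn: "(\<mu>, \<nu>) \<in> lp_feasible N lam b U Z ZT T \<zeta>" "(LINT (t, z, u)|\<mu>. eval_tu h t u) = cost T h u"
      using occupation_measure[OF u U bc T, of zlo zhi h] Z ZT by auto
    show "lp_value N lam b U Z ZT T \<zeta> h \<le> ereal (cost T h u)"
      unfolding lp_value_def by (rule INF_lower2[OF mn(1)]) (simp add: mn(2))
  qed
  show "modal_value N lam b U Z ZT T \<zeta> h \<le> lp_value N lam b U Z ZT T \<zeta> h"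
    unfolding lp_value_def
  proof (rule INF_greatest)
    fix p assume p: "p \<in> lp_feasible N lam b U Z ZT T \<zeta>"
    obtain \<mu> \<nu> where p': "p = (\<mu>, \<nu>)" by (cases p)
    have ZZ: "Z k = {zlo k..zhi k} \<and> ZT k = {zTlo k..zThi k}" if "k \<in> {1..N}" for k using Z ZT that by blast
    interpret lp_solution N lam b U Z ZT T \<zeta> \<mu> \<nu>
      by (rule lp_solution.intro) (use p p' T U b Z ZT in auto)
    obtain u where u: "u \<in> modal_controls N lam b U Z ZT T \<zeta>" "cost T h u \<le> (LINT (t, z, u)|\<mu>. eval_tu h t u)"
      using control_from_measure[OF B conv bB ZZ] by blast
    show "modal_value N lam b U Z ZT T \<zeta> h \<le> (case p of (\<mu>, \<nu>) \<Rightarrow> ereal (LINT (t, z, u)|\<mu>. eval_tu h t u))"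
      unfolding modal_value_def by (rule INF_lower2[OF u(1)]) (simp add: p' u(2))
  qed
qed

lemma linear_modal_input:
  assumes "bounded_linear B"
  shows "linear (modal_input \<Psi> B k)"
proof -
  interpret bounded_linear B by (rule assms)
  show ?thesis by (rule linearI) (simp_all add: modal_input_def add scaleR inner_add_left)
qed

theorem theorem4p2:
  fixes D X XT :: "'h::{real_inner, banach, second_countable_topology} set"
    and A :: "'h \<Rightarrow> 'h"
    and lam :: "nat \<Rightarrow> real"
    and \<Phi> \<Psi> :: "nat \<Rightarrow> 'h"
    and S :: "real \<Rightarrow> 'h \<Rightarrow> 'h"
    and B :: "real^'m::finite \<Rightarrow> 'h"
    and U :: "(real^'m) set"
    and T :: real
    and z0 :: 'h
    and h :: "(nat \<times> 'm uexp) rpoly"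
    and s :: nat
    and w :: "nat \<Rightarrow> 'm uexp rpoly"
    and zlo zhi zTlo zThi :: "nat \<Rightarrow> real"
  assumes "riesz_spectral D A lam \<Phi>"
    and "dual_eigenvectors D A \<Phi> \<Psi>"
    and "generates D A S"
    and "bounded_linear B"
    and "XT \<subseteq> X \<inter> D"
    and "T > 0"
    and "z0 \<in> X \<inter> D"
    and "compact U"
    and "U = basic_semialgebraic s w"
    and "\<exists>j\<in>{1..s}. \<exists>M. w j = ball_poly M"
    and "\<And>k. k \<ge> 1 \<Longrightarrow> zlo k \<le> zhi k \<and> modal_set \<Psi> X k = {zlo k..zhi k}"
    and "\<And>k. k \<ge> 1 \<Longrightarrow> zTlo k \<le> zThi k \<and> modal_set \<Psi> XT k = {zTlo k..zThi k}"
  shows "\<forall>N\<ge>1.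
    (let b = modal_input \<Psi> B;
         \<zeta> = coef \<Psi> z0;
         Z = modal_set \<Psi> X;
         ZT = modal_set \<Psi> XT;
         P_sdp = (\<lambda>r. sdp_value N r lam b s w zlo zhi zTlo zThi T \<zeta> h);
         P_lp = lp_value N lam b U Z ZT T \<zeta> h
     in (mono_on {r_min s w..} P_sdp \<and> P_sdp \<longlonglongrightarrow> P_lp) \<and>
        ((\<forall>t\<in>{0..T}. \<forall>z\<in>X \<inter> D.
            convex ((\<lambda>u. A z + B u) ` U) \<and> ereal_convex (fibre_cost A B U h t z)) \<longrightarrow>
         mono_on {r_min s w..} P_sdp \<and> P_sdp \<longlonglongrightarrow> P_lp \<and>
         P_lp = modal_value N lam b U Z ZT T \<zeta> h \<and>
         modal_value N lam b U Z ZT T \<zeta> h \<le> full_value S B U X XT T z0 h))"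
proof (intro allI impI)
  fix N :: nat assume "1 \<le> N"
  let ?b = "modal_input \<Psi> B" and ?\<zeta> = "coef \<Psi> z0" and ?Z = "modal_set \<Psi> X" and ?ZT = "modal_set \<Psi> XT"
  have b: "linear (?b k)" for k by (rule linear_modal_input[OF assms(4)])
  have Z: "zlo k \<le> zhi k \<and> ?Z k = {zlo k..zhi k}" if "k \<in> {1..N}" for k using assms(11)[of k] that by simp
  have ZT: "zTlo k \<le> zThi k \<and> ?ZT k = {zTlo k..zThi k}" if "k \<in> {1..N}" for k using assms(12)[of k] that by simp
  have mono: "mono_on {r_min s w..} (\<lambda>r. sdp_value N r lam ?b s w zlo zhi zTlo zThi T ?\<zeta> h)"
    by (rule mono_onI) (rule sdp_value_mono)
  have lim: "(\<lambda>r. sdp_value N r lam ?b s w zlo zhi zTlo zThi T ?\<zeta> h) \<longlonglongrightarrow> lp_value N lam ?b U ?Z ?ZT T ?\<zeta> h"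
    by (rule sdp_value_tendsto_lp_value[OF b assms(8,9,10,6) Z ZT])
  have eq: "lp_value N lam ?b U ?Z ?ZT T ?\<zeta> h = modal_value N lam ?b U ?Z ?ZT T ?\<zeta> h"
    if conv: "\<forall>t\<in>{0..T}. \<forall>z\<in>X \<inter> D. convex ((\<lambda>u. A z + B u) ` U) \<and> ereal_convex (fibre_cost A B U h t z)"
  proof (rule lp_value_eq_modal_value[OF b assms(8,6) Z ZT assms(4)])
    \<comment> \<open>The initial state belongs to \<open>X \<inter> D\<close> and serves as the
      state at which the convexity hypothesis is evaluated.\<close>
    show "ereal_convex (fibre_cost A B U h t z0)" if "t \<in> {0..T}" for t using conv that assms(7) by blast
    show "?b k u = ?b k v" if "B u = B v" for k u v using that by (simp add: modal_input_def)
  qed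
  interpret modal_semigroup D A lam \<Phi> \<Psi> S by unfold_locales (rule assms)+
  have full: "modal_value N lam ?b U ?Z ?ZT T ?\<zeta> h \<le> full_value S B U X XT T z0 h"
    unfolding modal_value_def full_value_def
    by (rule INF_superset_mono[OF full_controls_subset_modal_controls[OF assms(4,6)] order_refl])
  show "let b = ?b; \<zeta> = ?\<zeta>; Z = ?Z; ZT = ?ZT;
         P_sdp = (\<lambda>r. sdp_value N r lam b s w zlo zhi zTlo zThi T \<zeta> h);
         P_lp = lp_value N lam b U Z ZT T \<zeta> h
     in (mono_on {r_min s w..} P_sdp \<and> P_sdp \<longlonglongrightarrow> P_lp) \<and>
        ((\<forall>t\<in>{0..T}. \<forall>z\<in>X \<inter> D.
            convex ((\<lambda>u. A z + B u) ` U) \<and> ereal_convex (fibre_cost A B U h t z)) \<longrightarrow>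
         mono_on {r_min s w..} P_sdp \<and> P_sdp \<longlonglongrightarrow> P_lp \<and>
         P_lp = modal_value N lam b U Z ZT T \<zeta> h \<and>
         modal_value N lam b U Z ZT T \<zeta> h \<le> full_value S B U X XT T z0 h)"
    unfolding Let_def using mono lim eq full by blast
qed

end
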